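(* Let $0<\theta<1$ and $C>0$ be fixed. Assume that, for every $A>0$, $$\sum_{\substack{q\le N^{\theta}(\log N)^{C}\\ (N,q)=1}}\left|\sum_{\substack{n<N\\ n\equiv N \bmod q}}\Lambda(n)-\frac{N}{\varphi(q)}\right|\ll_{A}\frac{N}{(\log N)^{A}}$$ for every sufficiently large natural number $N$. Assume moreover that, for the same $\theta$, both for $g(n)=\mu(n)$ and for $g(n)=\mu(n)\log(n)$, for every $A>0$, $$\sum_{\substack{q\le N^{1-\theta}\\ (N,q)=1}}\left|\sum_{\substack{n<N\\ n\equiv N \bmod q}}\Lambda(n)g(N-n)-\frac{1}{\varphi(q)}\sum_{n<N}\Lambda(n)g(N-n)\right|\ll_{A}\frac{N}{(\log N)^{A}}$$ for every sufficiently large natural number $N$. Then $$R(N):=\sum_{n<N}\Lambda(n)\Lambda(N-n)\ \ge\ N\,\mathfrak S(N)\,(1-\mathcal A_N)+O_{A,\theta}\!\left(\frac{N}{(\log N)^{A}}\right).$$ Moreover, the assertions $R(N)\sim N\,\mathfrak S(N)$ and $\sum_{n<N}\Lambda(n)\mu(N-n)=o(N)$ are equivalent.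
   Context: $\Lambda$ is the von Mangoldt function, $\mu$ the M\"obius function, $\varphi$ Euler's totient; $p$ denotes primes; sums over $n$ and $q$ run over positive integers; $A>0$ is arbitrary. $$\mathfrak S(N):=\begin{cases}2\prod_{p\mid N,\,p>2}\left(1+\frac1{p-2}\right)\prod_{p>2}\left(1-\frac1{(p-1)^2}\right),& N\text{ even}\\ 0,& N\text{ odd}\end{cases}$$ is the singular series for the binary Goldbach conjecture, and $$\mathcal A_N:=\prod_{p\nmid N,\ p>2}\left(1-\frac1{p(p-1)}\right).$$ *)

theory Defs
  imports
    "HOL-Analysis.Analysis"
    "HOL-Library.Landau_Symbols"
    "HOL-Computational_Algebra.Squarefree"
    "HOL-Number_Theory.Number_Theory"
    "HOL-Number_Theory.Prime_Powers"
begin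

definition moebius_mu :: "nat \<Rightarrow> real" where
  "moebius_mu n = (if squarefree n then (-1) ^ card (prime_factors n) else 0)"

definition singular_series :: "nat \<Rightarrow> real" where
  "singular_series N =
    (if even N
     then 2 * (\<Prod>p | p \<in> prime_factors N \<and> p > 2. 1 + 1 / (real p - 2))
            * (\<Prod>p. if prime p \<and> p > 2 then 1 - 1 / (real p - 1)\<^sup>2 else 1)
     else 0)"

definition artin_product :: "nat \<Rightarrow> real" where
  "artin_product N =
    (\<Prod>p. if prime p \<and> \<not> p dvd N \<and> p > 2 then 1 - 1 / (real p * (real p - 1)) else 1)"

definition goldbach_sum :: "nat \<Rightarrow> real" where
  "goldbach_sum N = (\<Sum>n\<in>{1..<N}. mangoldt n * mangoldt (N - n))"

(* The singular series vanishes at odd N, so an asymptotic equivalence with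
   N * singular_series N is only meaningful as N tends to infinity through the even numbers. *)
definition even_at_top :: "nat filter" where
  "even_at_top = inf at_top (principal {N. even N})"

(* Both infinite products converge, so prodinf has its intended value. *)

lemma convergent_prod_if_quadratic:
  assumes "\<And>p. P p \<Longrightarrow> p > 2 \<and> 0 \<le> a p \<and> a p \<le> 1 / (real p - 1)\<^sup>2"
  shows "convergent_prod (\<lambda>p::nat. if P p then 1 - a p else (1::real))"
proof -
  have s: "summable (\<lambda>p. 4 * (1 / real p ^ 2))"
    using inverse_power_summable[of 2, where 'a = real]
    by (intro summable_mult) (simp add: field_simps)
  have le: "a p \<le> 4 * (1 / real p ^ 2)" if "P p" for p
  proof -
    from assms[OF that] have p: "real p \<ge> 3" and a: "a p \<le> 1 / (real p - 1)\<^sup>2"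
      by auto
    have "(real p / 2)\<^sup>2 \<le> (real p - 1)\<^sup>2"
      using p by (intro power_mono) auto
    then have "1 / (real p - 1)\<^sup>2 \<le> 1 / (real p / 2)\<^sup>2"
      using p by (intro divide_left_mono) auto
    also have "\<dots> = 4 * (1 / real p ^ 2)"
      by (simp add: power_divide)
    finally show ?thesis
      using a by linarith
  qed
  have "summable (\<lambda>p. norm ((if P p then 1 - a p else (1::real)) - 1))"
  proof (rule summable_comparison_test[OF _ s], intro exI allI impI)
    fix p :: nat
    show "norm (norm ((if P p then 1 - a p else (1::real)) - 1)) \<le> 4 * (1 / real p ^ 2)"
      using le[of p] assms[of p] by auto
  qed
  then have "abs_convergent_prod (\<lambda>p. if P p then 1 - a p else (1::real))"
    by (rule summable_imp_abs_convergent_prod)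
  then show ?thesis
    by (rule abs_convergent_prod_imp_convergent_prod)
qed

lemma convergent_prod_singular_series:
  "convergent_prod (\<lambda>p::nat. if prime p \<and> p > 2 then 1 - 1 / (real p - 1)\<^sup>2 else (1::real))"
  by (rule convergent_prod_if_quadratic) auto

lemma convergent_prod_artin_product:
  "convergent_prod (\<lambda>p::nat. if prime p \<and> \<not> p dvd N \<and> p > 2
                              then 1 - 1 / (real p * (real p - 1)) else (1::real))"
proof (rule convergent_prod_if_quadratic)
  fix p :: nat assume p: "prime p \<and> \<not> p dvd N \<and> p > 2"
  then have "(real p - 1)\<^sup>2 \<le> real p * (real p - 1)"
    by (auto simp: power2_eq_square intro!: mult_right_mono)
  with p show "p > 2 \<and> 0 \<le> 1 / (real p * (real p - 1)) \<and>
      1 / (real p * (real p - 1)) \<le> 1 / (real p - 1)\<^sup>2"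
    by (auto intro!: divide_left_mono)
qed

end

(*
  Taking q = p^2 for the least prime p not dividing N, a modulus of size O((log N)^4), in the second
  hypothesis shows that sum Lambda(n) g(N - n) itself is O(N / (log N)^A): the class n = N (mod p^2)
  forces N - n to be divisible by p^2, where g vanishes. Hence both sides of the claimed equivalences
  hold, and everything follows from R(N) ~ N S(N) for even N, together with artin_product N >= 3/8.

  For the asymptotic formula fix z, let P be the product of the primes up to z, and put y = P N^theta.
  For squarefree m > 1 coprime to P, the identity Lambda(m) = - sum_{d | m} mu(d) log d is split as
  type_I + type_II - overlap: type_I collects the divisors d <= y, type_II the complementary divisors
  e = m / d < N / y, and overlap the divisors counted twice. The second hypothesis makes the
  contribution of type_II negligible, and the first one evaluates that of type_I as
  N * prod_{p <= z} (1 - [p not dividing N] / (p - 1)) * sum_{d <= y} mu(d) log(y / d) / phi(d) over d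
  coprime to P N; the prime number theorem, itself a case of the first hypothesis, evaluates this sum.
  The overlap and the m that are not squarefree contribute at most a small multiple of N^2 / phi(N) as
  z grows: d is confined to a short interval and to integers without prime factors up to z, and beyond
  the level of distribution the Brun-Titchmarsh inequality is sufficient. Finally S(N) is comparable
  with N / phi(N).
*)
theory Submission
  imports Defs "HOL-Real_Asymp.Real_Asymp"
begin

section \<open>Multiplicative functions\<close>

text \<open>Sifting by the primes up to z serves three ends: totients of the remaining d are close
  to d, few integers near y survive, and square divisors k^2 > 1 of m have k > z. As z stays fixed
  while N grows, P acts as a constant. The factor P in y has a precise purpose: sifting multiplies
  each modulus by a divisor b of P. With e < N / y the product b * e stays within N^(1 - theta),
  where the second hypothesis has no room to spare, whereas b * d <= P^2 * N^theta is paid for by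
  (log N)^C in the first one. The obstacle is uniformity in N, because N / phi(N) is unbounded.
  Errors have to be small against N^2 / phi(N). Coprimality to N costs a factor prod (1 -
  p^(-1/2))^(-1) over the primes dividing N; it is only exp(O(sqrt(log N))), so a saving X^(-1/2)
  absorbs it. This is why the Moebius sums are stated with an error e + C * X^(-1/2) valid for all X
  > 0 and not just as limits. Parameters are fixed in the order I (the number of dyadic blocks of
  the overlap that are treated by the first hypothesis), then z, then N.\<close>

lemma squarefree_induct [consumes 1, case_names one prime_mult]:
  assumes "squarefree (n::nat)" "P 1"
    and "\<And>p m. prime p \<Longrightarrow> \<not> p dvd m \<Longrightarrow> squarefree m \<Longrightarrow> squarefree (p * m) \<Longrightarrow> p * m dvd n \<Longrightarrow> P m \<Longrightarrow> P (p * m)"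
  shows "P n"
proof -
  \<comment> \<open>Generalising to all divisors m of n keeps \<open>p * m dvd n\<close> available,
    so that assumptions on the primes of n can be used in the inductive step.\<close>
  have "squarefree m \<Longrightarrow> m dvd n \<Longrightarrow> P m" for m
  proof (induction m rule: less_induct)
    case (less m)
    show ?case
    proof (cases "m = 1")
      case True
      then show ?thesis using assms(2) by simp
    next
      case False
      obtain p where p: "prime p" "p dvd m" using prime_factor_nat[OF False] by blast
      then obtain k where k: "m = p * k" by blast
      have "m > 0" using less.prems(1) by (intro Nat.gr0I) auto
      have nd: "\<not> p dvd k"
      proof
        assume "p dvd k"
        then have "p\<^sup>2 dvd m" using k by (auto simp: power2_eq_square)
        then have "p dvd 1" using less.prems(1) by (rule squarefreeD[rotated])
        then show False using p by simp
      qed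
      have sf: "squarefree k" using less.prems(1) k squarefree_mono[of k m] by simp
      have "k < m" using k \<open>m > 0\<close> prime_gt_1_nat[OF p(1)] by simp
      moreover have "k dvd n" using k less.prems(2) by (auto elim: dvd_mult_right)
      ultimately have "P k" using less.IH sf by blast
      then show ?thesis using assms(3)[of p k] p nd sf k less.prems by auto
    qed
  qed
  then show ?thesis using assms(1) by simp
qed

section \<open>Divisor sums of the Moebius function\<close>

lemma moebius_mu_1 [simp]: "moebius_mu 1 = 1" "moebius_mu (Suc 0) = 1"
  by (simp_all add: moebius_mu_def)

lemma moebius_mu_0 [simp]: "moebius_mu 0 = 0"
  by (simp add: moebius_mu_def)

lemma moebius_mu_not_squarefree: "\<not> squarefree n \<Longrightarrow> moebius_mu n = 0"
  by (simp add: moebius_mu_def)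

lemma abs_moebius_mu_le: "\<bar>moebius_mu n\<bar> \<le> 1"
  by (simp add: moebius_mu_def power_abs)

lemma abs_moebius_mu_mult_le: "\<bar>moebius_mu n * x\<bar> \<le> \<bar>x\<bar>"
  using mult_right_mono[OF abs_moebius_mu_le[of n], of "\<bar>x\<bar>"] by (simp add: abs_mult)

lemma moebius_mu_square: "squarefree n \<Longrightarrow> moebius_mu n * moebius_mu n = 1"
  by (simp add: moebius_mu_def flip: power_mult_distrib)

lemma moebius_mu_mult:
  assumes "coprime a b"
  shows "moebius_mu (a * b) = moebius_mu a * moebius_mu b"
proof (cases "squarefree a \<and> squarefree b")
  case True
  then have sf: "squarefree (a * b)" using assms squarefree_mult_coprime by blast
  have "a \<noteq> 0" "b \<noteq> 0" using True by (auto intro!: Nat.gr0I)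
  then have "prime_factors (a * b) = prime_factors a \<union> prime_factors b"
    by (rule prime_factors_product)
  moreover have "prime_factors a \<inter> prime_factors b = {}"
    using assms by (metis coprime_common_divisor disjoint_iff in_prime_factors_iff not_prime_unit)
  ultimately have "card (prime_factors (a * b)) = card (prime_factors a) + card (prime_factors b)"
    by (simp add: card_Un_disjoint)
  then show ?thesis using True sf by (simp add: moebius_mu_def power_add)
next
  case False
  then have "\<not> squarefree (a * b)" by (auto dest: squarefree_multD)
  then show ?thesis using False by (auto simp: moebius_mu_def)
qed

lemma moebius_mu_prime: "prime p \<Longrightarrow> moebius_mu p = -1"
  by (simp add: moebius_mu_def squarefree_prime prime_factorization_prime)

lemma moebius_mu_prime_mult:
  "prime p \<Longrightarrow> \<not> p dvd n \<Longrightarrow> moebius_mu (p * n) = - moebius_mu n"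
  by (subst moebius_mu_mult) (auto simp: moebius_mu_prime prime_imp_coprime)

lemma dvd_div_gt0: "d dvd n \<Longrightarrow> n > 0 \<Longrightarrow> n div d > (0::nat)"
  by (auto simp: dvd_def)

text \<open>Pairs each d free of p with p * d, where mu changes sign; divisors divisible by p^2
  contribute nothing. Choosing p | n suitably yields both basic divisor sums below.\<close>

lemma sum_moebius_prime_split:
  fixes f :: "nat \<Rightarrow> real"
  assumes n: "n > 0" and p: "prime p" "p dvd n"
  shows "(\<Sum>d | d dvd n. moebius_mu d * f d)
       = (\<Sum>d | d dvd n \<and> \<not> p dvd d. moebius_mu d * (f d - f (p * d)))"
proof -
  have fin: "finite {d. d dvd n}" using n by simp
  let ?A = "{d. d dvd n \<and> \<not> p dvd d}"
  have A: "finite ?A" by (rule finite_subset[OF _ fin]) auto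
  have "(\<Sum>d | d dvd n. moebius_mu d * f d)
      = (\<Sum>d\<in>?A. moebius_mu d * f d) + (\<Sum>d | d dvd n \<and> p dvd d. moebius_mu d * f d)"
    using fin by (subst sum.union_disjoint[symmetric]) (auto intro!: sum.cong)
  also have "(\<Sum>d | d dvd n \<and> p dvd d. moebius_mu d * f d) = (\<Sum>d\<in>(*) p ` ?A. moebius_mu d * f d)"
  proof (rule sum.mono_neutral_right)
    show "finite {d. d dvd n \<and> p dvd d}" by (rule finite_subset[OF _ fin]) auto
    show "(*) p ` ?A \<subseteq> {d. d dvd n \<and> p dvd d}"
      using p by (auto intro!: divides_mult prime_imp_coprime)
    show "\<forall>i\<in>{d. d dvd n \<and> p dvd d} - (*) p ` ?A. moebius_mu i * f i = 0"
    proof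
      fix i assume i: "i \<in> {d. d dvd n \<and> p dvd d} - (*) p ` ?A"
      then obtain k where k: "i = p * k" by blast
      have "p dvd k" using i k by (auto elim: dvd_mult_right)
      then have "p\<^sup>2 dvd i" using k by (auto simp: power2_eq_square)
      then have "\<not> squarefree i" using p(1) not_squarefreeI[of p i] not_prime_unit by metis
      then show "moebius_mu i * f i = 0" by (simp add: moebius_mu_not_squarefree)
    qed
  qed
  also have "\<dots> = (\<Sum>d\<in>?A. moebius_mu (p * d) * f (p * d))"
    using p prime_gt_0_nat[of p] by (subst sum.reindex) (auto simp: inj_on_def)
  also have "\<dots> = (\<Sum>d\<in>?A. - moebius_mu d * f (p * d))"
    using p by (intro sum.cong) (auto simp: moebius_mu_prime_mult)
  finally show ?thesis by (simp add: sum.distrib[symmetric] algebra_simps)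
qed

lemma sum_moebius_mu_divisors:
  assumes "n > 0"
  shows "(\<Sum>d | d dvd n. moebius_mu d) = (if n = 1 then 1 else 0)"
proof (cases "n = 1")
  case False
  then obtain p where p: "prime p" "p dvd n" using prime_factor_nat by blast
  show ?thesis using sum_moebius_prime_split[OF assms p, of "\<lambda>_. 1"] False by simp
qed simp

text \<open>For a prime p | n the difference ln d - ln (p * d) is the constant -ln p. What remains
  is the plain Moebius sum over the divisors of the p-free part of n, which vanishes unless n is a
  power of p.\<close>

lemma sum_moebius_mu_ln:
  assumes "n > 0"
  shows "(\<Sum>d | d dvd n. moebius_mu d * ln (real d)) = - mangoldt n"
proof (cases "n = 1")
  case False
  then obtain p where p: "prime p" "p dvd n" using prime_factor_nat by blast
  have p0: "p > 0" using p prime_gt_0_nat by blast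
  obtain k m where km: "n = p ^ k * m" "\<not> p dvd m"
    using prime_power_canonical[OF p(1) assms] by (metis mult.commute)
  have m0: "m > 0" using km assms by (cases m) auto
  have k0: "k > 0" using km p by (cases k) auto
  have "(\<Sum>d | d dvd n. moebius_mu d * ln (real d))
      = (\<Sum>d | d dvd n \<and> \<not> p dvd d. moebius_mu d * (ln (real d) - ln (real (p * d))))"
    using sum_moebius_prime_split[OF assms p, of "\<lambda>d. ln (real d)"] by simp
  also have "\<dots> = (\<Sum>d | d dvd n \<and> \<not> p dvd d. moebius_mu d * (- ln p))"
    using assms p0 by (intro sum.cong) (auto simp: ln_mult dvd_pos_nat)
  also have "{d. d dvd n \<and> \<not> p dvd d} = {d. d dvd m}"
  proof (intro Set.set_eqI iffI; clarsimp)
    fix d assume "d dvd n" "\<not> p dvd d"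
    then show "d dvd m" using km p
      by (metis coprime_commute coprime_dvd_mult_right_iff coprime_power_right_iff prime_imp_coprime)
  next
    fix d assume "d dvd m"
    then show "d dvd n \<and> \<not> p dvd d" using km by (auto intro: dvd_trans)
  qed
  also have "(\<Sum>d | d dvd m. moebius_mu d * (- ln p)) = (\<Sum>d | d dvd m. moebius_mu d) * (- ln p)"
    by (simp add: sum_distrib_right sum_negf)
  also have "\<dots> = (if m = 1 then - ln p else 0)"
    using sum_moebius_mu_divisors[OF m0] by simp
  also have "\<dots> = - mangoldt n"
  proof (cases "m = 1")
    case True
    then show ?thesis using km p k0 by simp
  next
    case False
    then obtain q where q: "prime q" "q dvd m" using prime_factor_nat by blast
    have "\<not> primepow n"
    proof (rule not_primepowI[of p q])
      show "p dvd n" "q dvd n" using km k0 q p by auto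
      show "p \<noteq> q" using q km by auto
    qed (use p q in auto)
    then show ?thesis using False by (simp add: mangoldt_def)
  qed
  finally show ?thesis .
qed simp

lemma sum_divisors_pairs_swap:
  fixes F :: "nat \<Rightarrow> nat \<Rightarrow> real"
  assumes "n > 0"
  shows "(\<Sum>d | d dvd n. \<Sum>e | e dvd n div d. F d e) = (\<Sum>e | e dvd n. \<Sum>d | d dvd n div e. F d e)"
proof -
  have fin: "finite {d. d dvd n}" using assms by simp
  have f2: "finite {e. e dvd n div d}" if "d dvd n" for d
    using that assms by (simp add: dvd_div_gt0)
  have eq: "d dvd n \<and> e dvd n div d \<longleftrightarrow> d * e dvd n" for d e
    using assms by (metis dvd_mult_div_cancel dvd_mult_left dvd_times_left_cancel_iff dvd_0_left_iff less_irrefl)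
  have "(\<Sum>d | d dvd n. \<Sum>e | e dvd n div d. F d e)
      = (\<Sum>(d,e)\<in>(SIGMA d:{d. d dvd n}. {e. e dvd n div d}). F d e)"
    using fin f2 by (subst sum.Sigma) auto
  also have "\<dots> = (\<Sum>(e,d)\<in>(SIGMA e:{e. e dvd n}. {d. d dvd n div e}). F d e)"
  proof (rule sum.reindex_bij_witness[of _ "\<lambda>(e,d). (d,e)" "\<lambda>(d,e). (e,d)"]; clarsimp)
    fix a b assume "a dvd n" "b dvd n div a"
    then have "b * a dvd n" using eq[of a b] by (simp add: mult.commute)
    then show "b dvd n \<and> a dvd n div b" using eq[of b a] by simp
  next
    fix a b assume "a dvd n" "b dvd n div a"
    then have "b * a dvd n" using eq[of a b] by (simp add: mult.commute)
    then show "b dvd n \<and> a dvd n div b" using eq[of b a] by simp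
  qed
  also have "\<dots> = (\<Sum>e | e dvd n. \<Sum>d | d dvd n div e. F d e)"
    using fin f2 by (subst sum.Sigma) auto
  finally show ?thesis .
qed

text \<open>Dirichlet convolution of mu with the identity for Lambda, followed by the collapse of
  the inner Moebius sum. It is the link that transfers information on psi to the summatory function
  of mu.\<close>

lemma moebius_mu_times_ln:
  assumes n: "n > 0"
  shows "moebius_mu n * ln (real n) = - (\<Sum>d | d dvd n. moebius_mu d * mangoldt (n div d))"
proof -
  have "(\<Sum>d | d dvd n. moebius_mu d * mangoldt (n div d))
     = (\<Sum>d | d dvd n. moebius_mu d * (- (\<Sum>e | e dvd n div d. moebius_mu e * ln (real e))))"
    using n by (intro sum.cong refl) (auto simp: sum_moebius_mu_ln dvd_div_gt0)
  also have "\<dots> = - (\<Sum>d | d dvd n. \<Sum>e | e dvd n div d. moebius_mu d * (moebius_mu e * ln (real e)))"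
    by (simp add: sum_negf sum_distrib_left)
  also have "\<dots> = - (\<Sum>e | e dvd n. \<Sum>d | d dvd n div e. moebius_mu d * (moebius_mu e * ln (real e)))"
    using sum_divisors_pairs_swap[OF n] by simp
  also have "\<dots> = - (\<Sum>e | e dvd n. (\<Sum>d | d dvd n div e. moebius_mu d) * (moebius_mu e * ln (real e)))"
    by (simp add: sum_distrib_right)
  also have "\<dots> = - (\<Sum>e | e dvd n. if e = n then moebius_mu e * ln (real e) else 0)"
  proof (intro arg_cong[where f = uminus] sum.cong refl)
    fix e assume e: "e \<in> {e. e dvd n}"
    then have "n div e > 0" using n by (simp add: dvd_div_gt0)
    moreover have "n div e = 1 \<longleftrightarrow> e = n"
      using e n by (metis (full_types) div_self dvd_mult_div_cancel less_irrefl mem_Collect_eq mult.right_neutral)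
    ultimately show "(\<Sum>d | d dvd n div e. moebius_mu d) * (moebius_mu e * ln (real e))
        = (if e = n then moebius_mu e * ln (real e) else 0)"
      by (simp only: sum_moebius_mu_divisors) simp
  qed
  also have "\<dots> = - (moebius_mu n * ln (real n))"
    using n by (subst sum.delta) auto
  finally show ?thesis by simp
qed

text \<open>k^2 divides m exactly when k divides \<open>square_part m\<close>, so this is the plain
  Moebius sum over the divisors of \<open>square_part m\<close>.\<close>

lemma sum_moebius_mu_square_divisors:
  assumes "m > 0"
  shows "(\<Sum>k | k\<^sup>2 dvd m. moebius_mu k) = (if squarefree m then 1 else 0)"
proof -
  have "{k. k\<^sup>2 dvd m} = {k. k dvd square_part m}"
    by (auto simp: dvd_square_part_iff)
  moreover have "square_part m > 0" using assms square_part_0_iff[of m] by (auto intro!: Nat.gr0I)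
  moreover have "square_part m = 1 \<longleftrightarrow> squarefree m"
  proof
    assume "square_part m = 1"
    then show "squarefree m" by (metis squarefree_decompose squarefree_squarefree_part mult.right_neutral power_one)
  next
    assume "squarefree m"
    then show "square_part m = 1" using squarefreeD[OF _ square_part_square_dvd[of m]] by simp
  qed
  ultimately show ?thesis using sum_moebius_mu_divisors by simp
qed

section \<open>Totients and divisors of squarefree numbers\<close>

lemma totient_prime_mult:
  "prime p \<Longrightarrow> \<not> p dvd m \<Longrightarrow> real (totient (p * m)) = (real p - 1) * real (totient m)"
  using prime_ge_1_nat[of p]
  by (subst totient_mult_coprime) (simp_all add: prime_imp_coprime totient_prime of_nat_diff)

lemma squarefree_totient_ge_sqrt:
  assumes "squarefree (n::nat)"
  shows "2 * real (totient n) \<ge> sqrt (real n)"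
proof -
  \<comment> \<open>The inequality p - 1 >= sqrt p fails only at p = 2. Charging the factor 2 to
    even n alone makes the statement inductive.\<close>
  have "(if even n then 2 else 1) * real (totient n) \<ge> sqrt (real n)"
    using assms
  proof (induction n rule: squarefree_induct)
    case one
    then show ?case by simp
  next
    case (prime_mult p m)
    show ?case
    proof (cases "p = 2")
      case True
      then have "odd m" using prime_mult by auto
      then have IH: "real (totient m) \<ge> sqrt (real m)" using prime_mult by simp
      have t: "totient (p * m) = totient m" using True \<open>odd m\<close> by (simp add: totient_double)
      have "sqrt (real (p * m)) = sqrt 2 * sqrt (real m)" using True by (simp add: real_sqrt_mult)
      also have "\<dots> \<le> 2 * sqrt (real m)" by (intro mult_right_mono) (auto simp: real_le_lsqrt)
      finally show ?thesis using t IH True by simp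
    next
      case False
      then have p3: "p \<ge> 3" using prime_ge_2_nat[OF \<open>prime p\<close>] by simp
      have odd: "odd p" using False primes_dvd_imp_eq two_is_prime_nat \<open>prime p\<close> by blast
      have "real p \<le> (real p - 1)\<^sup>2"
      proof -
        have "real p * 3 \<le> real p * real p" using p3 by (intro mult_left_mono) auto
        then show ?thesis by (simp add: power2_eq_square algebra_simps)
      qed
      then have s: "sqrt (real p) \<le> real p - 1" using p3 by (intro real_le_lsqrt) auto
      have "sqrt (real (p * m)) = sqrt (real p) * sqrt (real m)" by (simp add: real_sqrt_mult)
      also have "\<dots> \<le> (real p - 1) * ((if even m then 2 else 1) * real (totient m))"
        using s p3 prime_mult by (intro mult_mono) auto
      also have "\<dots> = (if even (p * m) then 2 else 1) * real (totient (p * m))"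
        using odd prime_mult by (simp add: totient_prime_mult)
      finally show ?thesis .
    qed
  qed
  also have "\<dots> \<le> 2 * real (totient n)" by (intro mult_right_mono) auto
  finally show ?thesis .
qed

text \<open>Primewise this is (p - 1)^4 >= p^3, which fails at 2 and 3 and holds from 5 on.\<close>

lemma squarefree_totient_ge_powr:
  assumes "squarefree (n::nat)" and "\<And>p. prime p \<Longrightarrow> p dvd n \<Longrightarrow> p \<ge> 5"
  shows "real (totient n) \<ge> real n powr (3/4)"
  using assms(1)
proof (induction n rule: squarefree_induct)
  case one
  then show ?case by simp
next
  case (prime_mult p m)
  have p5: "real p \<ge> 5" using assms(2)[of p] prime_mult by (auto dest: dvd_mult_left)
  have "real p powr 3 \<le> (real p - 1) powr 4"
  proof -
    have "(real p - 1)^4 - real p ^3 = real p ^ 3 * (real p - 5) + 6 * real p ^2 - 4 * real p + 1"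
      by (simp add: power4_eq_xxxx power3_eq_cube power2_eq_square algebra_simps)
    moreover have "6 * real p ^2 \<ge> 4 * real p" 
    proof -
      have "6 * real p * 5 \<le> 6 * real p * real p" using p5 by (intro mult_left_mono) auto
      then show ?thesis using p5 by (simp add: power2_eq_square)
    qed
    moreover have "real p ^ 3 * (real p - 5) \<ge> 0" using p5 by simp
    ultimately have "real p ^ 3 \<le> (real p - 1)^4" by linarith
    then show ?thesis using p5 by (simp add: powr_numeral)
  qed
  then have "(real p powr 3) powr (1/4) \<le> ((real p - 1) powr 4) powr (1/4)"
    using p5 by (intro powr_mono2) auto
  then have "real p powr (3/4) \<le> real p - 1" using p5 by (simp only: powr_powr) simp
  then have "real (p * m) powr (3/4) \<le> (real p - 1) * real (totient m)"
    using prime_mult p5 by (auto simp: powr_mult intro!: mult_mono)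
  then show ?case using prime_mult by (simp add: totient_prime_mult)
qed

lemma divisors_prime_mult:
  assumes "prime p" "\<not> p dvd m" "(m::nat) > 0"
  shows "card {d. d dvd p * m} = 2 * card {d. d dvd m}"
proof -
  have eq: "{d. d dvd p * m} = {d. d dvd m} \<union> (*) p ` {d. d dvd m}"
  proof (rule Set.set_eqI, rule iffI)
    fix d assume d: "d \<in> {d. d dvd p * m}"
    show "d \<in> {d. d dvd m} \<union> (*) p ` {d. d dvd m}"
    proof (cases "p dvd d")
      case True
      then obtain k where "d = p * k" by blast
      then show ?thesis using d assms prime_gt_0_nat[of p] by auto
    next
      case False
      then have "coprime d p" using assms(1) prime_imp_coprime coprime_commute by blast
      then show ?thesis using d by (simp add: coprime_dvd_mult_right_iff)
    qed
  qed (auto intro: dvd_mult)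
  have "card {d. d dvd p * m} = card {d. d dvd m} + card ((*) p ` {d. d dvd m})"
    unfolding eq
  proof (rule card_Un_disjoint)
    show "{d. d dvd m} \<inter> (*) p ` {d. d dvd m} = {}"
      using assms(2) dvd_mult_left[of p _ m] by blast
  qed (use assms in simp_all)
  also have "card ((*) p ` {d. d dvd m}) = card {d. d dvd m}"
    using assms prime_gt_0_nat[of p] by (intro card_image) (auto simp: inj_on_def)
  finally show ?thesis by simp
qed

text \<open>Each prime contributes a factor 2, and 2 <= p^(1/8) from 256 = 2^8 on. This is the
  origin of the later condition \<open>z \<ge> 256\<close>.\<close>

lemma squarefree_card_divisors_le:
  assumes "squarefree (n::nat)" and "\<And>p. prime p \<Longrightarrow> p dvd n \<Longrightarrow> p \<ge> 256"
  shows "real (card {d. d dvd n}) \<le> real n powr (1/8)"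
  using assms(1)
proof (induction n rule: squarefree_induct)
  case one
  then show ?case by simp
next
  case (prime_mult p m)
  have p5: "real p \<ge> 256" using assms(2)[of p] prime_mult by (auto dest: dvd_mult_left)
  have "(256::real) powr (1/8) \<le> real p powr (1/8)" using p5 by (intro powr_mono2) auto
  moreover have "(256::real) powr (1/8) = (2 powr 8) powr (1/8)" by simp
  then have "(256::real) powr (1/8) = 2" by (simp only: powr_powr) simp
  ultimately have "2 \<le> real p powr (1/8)" by simp
  moreover have "m > 0" using prime_mult by (auto intro!: Nat.gr0I)
  ultimately show ?case using prime_mult
    by (auto simp: divisors_prime_mult powr_mult intro!: mult_mono)
qed

text \<open>Follows from n = sum of phi(j) over j | n, read with the complementary divisor, since
  phi(n / j) = phi(n) / phi(j) for squarefree n. It is the device by which sums of 1 / phi(d) are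
  reduced to sums of 1 / d throughout.\<close>

lemma squarefree_over_totient:
  assumes "squarefree (n::nat)"
  shows "real n / real (totient n) = (\<Sum>j | j dvd n. 1 / real (totient j))"
proof -
  have n: "n > 0" using assms by (auto intro!: Nat.gr0I)
  have "real n = (\<Sum>j | j dvd n. real (totient j))"
    by (metis of_nat_sum totient_divisor_sum)
  also have "\<dots> = (\<Sum>j | j dvd n. real (totient (n div j)))"
    using n by (intro sum.reindex_bij_witness[of _ "\<lambda>j. n div j" "\<lambda>j. n div j"])
      (auto simp: div_div_eq_right)
  also have "\<dots> = (\<Sum>j | j dvd n. real (totient n) / real (totient j))"
  proof (intro sum.cong refl)
    fix j assume "j \<in> {j. j dvd n}"
    then obtain k where k: "n = j * k" by auto
    have jk: "j > 0" "k > 0" using n k by auto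
    have "coprime j k"
    proof (rule coprimeI)
      fix x assume "x dvd j" "x dvd k"
      then have "x\<^sup>2 dvd n" using k by (auto simp: power2_eq_square intro: mult_dvd_mono)
      then show "x dvd 1" using assms by (rule squarefreeD[rotated])
    qed
    then show "real (totient (n div j)) = real (totient n) / real (totient j)"
      using k jk by (simp add: totient_mult_coprime)
  qed
  also have "\<dots> = real (totient n) * (\<Sum>j | j dvd n. 1 / real (totient j))"
    by (simp add: sum_distrib_left)
  finally show ?thesis using n by (simp add: field_simps)
qed

section \<open>Elementary sums\<close>

lemma finite_nat_real_le: "finite {d::nat. real d \<le> x}"
  by (rule finite_subset[of _ "{..nat \<lfloor>x\<rfloor>}"]) (auto simp: le_nat_floor)

lemma sum_inverse_le_ln:
  assumes "1 \<le> k" "k \<le> n"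
  shows "(\<Sum>d=k..n. 1 / real d) \<le> 1 + ln (real n / real k)"
  using assms(2)
proof (induction n rule: dec_induct)
  case base
  then show ?case using assms(1) by simp
next
  case (step n)
  have n: "n \<ge> 1" using step assms by simp
  have "ln (real n / real (Suc n)) \<le> real n / real (Suc n) - 1"
    using n by (intro ln_le_minus_one) simp
  then have "1 / real (Suc n) \<le> - ln (real n / real (Suc n))"
    by (simp add: field_simps)
  also have "\<dots> = ln (real (Suc n) / real k) - ln (real n / real k)"
    using n assms(1) by (simp add: ln_div)
  finally show ?case using step by simp
qed

lemma sum_inverse_upto_le: "(\<Sum>d=1..n. 1 / real d) \<le> 1 + ln (real n)" if "n \<ge> 1"
  using sum_inverse_le_ln[of 1 n] that by simp

lemma sum_inverse_window_le:
  fixes a b :: real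
  assumes "0 < a" "a \<le> b"
  shows "(\<Sum>d | 1 \<le> d \<and> a < real d \<and> real d \<le> b. 1 / real d) \<le> 1 + ln (b / a)"
proof (cases "{d. 1 \<le> d \<and> a < real d \<and> real d \<le> b} = {}")
  case True
  then show ?thesis using assms by (simp only: True) simp
next
  case False
  define k where "k = Min {d. 1 \<le> d \<and> a < real d \<and> real d \<le> b}"
  define n where "n = Max {d. 1 \<le> d \<and> a < real d \<and> real d \<le> b}"
  have fin: "finite {d. 1 \<le> d \<and> a < real d \<and> real d \<le> b}"
    by (rule finite_subset[OF _ finite_nat_real_le[of b]]) auto
  have k: "k \<in> {d. 1 \<le> d \<and> a < real d \<and> real d \<le> b}" unfolding k_def using False fin by (intro Min_in)
  have n: "n \<in> {d. 1 \<le> d \<and> a < real d \<and> real d \<le> b}" unfolding n_def using False fin by (intro Max_in)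
  have kn: "k \<le> n" unfolding k_def using fin n by (intro Min_le)
  have "{d. 1 \<le> d \<and> a < real d \<and> real d \<le> b} \<subseteq> {k..n}"
    using fin by (auto simp: k_def n_def)
  then have "(\<Sum>d | 1 \<le> d \<and> a < real d \<and> real d \<le> b. 1 / real d) \<le> (\<Sum>d=k..n. 1 / real d)"
    by (intro sum_mono2) auto
  also have "\<dots> \<le> 1 + ln (real n / real k)" using sum_inverse_le_ln kn k by simp
  also have "real n / real k \<le> b / a" using k n assms by (intro frac_le) auto
  then have "ln (real n / real k) \<le> ln (b / a)" using k n by (intro ln_mono) auto
  finally show ?thesis by simp
qed

lemma sum_inverse_real_le:
  fixes b :: real
  assumes "b \<ge> 1"
  shows "(\<Sum>d | 1 \<le> d \<and> real d \<le> b. 1 / real d) \<le> 1 + ln b"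
proof -
  have "{d. 1 \<le> d \<and> real d \<le> b} = {1..nat \<lfloor>b\<rfloor>}" using assms by (auto simp: le_nat_floor) linarith
  moreover have "nat \<lfloor>b\<rfloor> \<ge> 1" using assms by (simp add: le_nat_floor)
  ultimately have "(\<Sum>d | 1 \<le> d \<and> real d \<le> b. 1 / real d) \<le> 1 + ln (real (nat \<lfloor>b\<rfloor>))"
    using sum_inverse_upto_le by simp
  also have "ln (real (nat \<lfloor>b\<rfloor>)) \<le> ln b" using assms \<open>nat \<lfloor>b\<rfloor> \<ge> 1\<close> by (intro ln_mono) auto
  finally show ?thesis by simp
qed

lemma sum_inverse_sqrt_le: "(\<Sum>i=1..n. 1 / sqrt (real i)) \<le> 2 * sqrt (real n)"
proof (induction n)
  case (Suc n)
  let ?a = "sqrt (real n)" and ?b = "sqrt (real (Suc n))"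
  have b: "?b > 0" "?a \<le> ?b" by auto
  have "?b\<^sup>2 - ?a\<^sup>2 = 1" by simp
  then have "(?b - ?a) * (?b + ?a) = 1" by (simp add: power2_eq_square algebra_simps)
  moreover have "(?b - ?a) * (?b + ?a) \<le> (?b - ?a) * (2 * ?b)" using b by (intro mult_left_mono) auto
  ultimately have "1 \<le> (2 * ?b - 2 * ?a) * ?b" by (simp add: algebra_simps)
  then have "1 / ?b \<le> 2 * ?b - 2 * ?a" using b by (subst pos_divide_le_eq) auto
  then show ?case using Suc by simp
qed simp

text \<open>Comparison with the telescoping differences of 2 / sqrt k. Passing from z to its floor m
  costs another factor 2, because z <= 4 * m. The set A is arbitrary, as it will be cut out by
  coprimality conditions whose only effect used here is k > z.\<close>

lemma sum_powr_tail_le: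
  fixes z :: real
  assumes z: "z \<ge> 1" and A: "finite A" "\<And>k. k \<in> A \<Longrightarrow> real k > z"
  shows "(\<Sum>k\<in>A. real k powr (-3/2)) \<le> 4 / sqrt z"
proof -
  define m where "m = nat \<lfloor>z\<rfloor>"
  have m: "m \<ge> 1" "real m \<le> z" "z < real m + 1" using z by (auto simp: m_def le_nat_floor)
  have tel: "(\<Sum>k=m+1..n. real k powr (-3/2)) \<le> 2 / sqrt (real m) - 2 / sqrt (real n)" if "n \<ge> m" for n
    using that
  proof (induction n rule: dec_induct)
    case base
    then show ?case by simp
  next
    case (step n)
    let ?a = "sqrt (real n)" and ?b = "sqrt (real (Suc n))"
    have ab: "?a > 0" "?b > 0" "?a \<le> ?b" using step m by auto
    have ab2: "?a * ?b \<le> ?b * ?b" using ab by (intro mult_right_mono) auto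
    have p: "real (Suc n) powr (-3/2) = 1 / ?b ^ 3"
    proof -
      have "real (Suc n) powr (3/2) = (real (Suc n) powr (1/2)) powr 3" by (simp only: powr_powr) simp
      also have "\<dots> = ?b ^ 3" by (simp add: powr_half_sqrt powr_numeral)
      finally show ?thesis by (simp add: powr_minus_divide)
    qed
    have "?b\<^sup>2 - ?a\<^sup>2 = 1" by simp
    then have e: "(?b - ?a) * (?b + ?a) = 1" by (simp add: power2_eq_square algebra_simps)
    have "(?b - ?a) * (?b + ?a) \<le> (?b - ?a) * (2 * ?b)" using ab by (intro mult_left_mono) auto
    then have h: "1 \<le> 2 * (?b - ?a) * ?b" using e by (simp add: algebra_simps)
    have "1 / ?b ^ 3 \<le> (2 * (?b - ?a) * ?b) / ?b ^ 3" using h ab by (intro divide_right_mono) auto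
    also have "\<dots> = 2 * (?b - ?a) / (?b * ?b)"
    proof -
      have "c * b / b ^ 3 = c / (b * b)" if "b > 0" for b c :: real
        using that by (simp add: field_simps power3_eq_cube)
      then show ?thesis using ab(2) by blast
    qed
    also have "\<dots> \<le> 2 * (?b - ?a) / (?a * ?b)"
      using ab ab2 by (intro divide_left_mono) auto
    also have "\<dots> = 2 / ?a - 2 / ?b"
    proof -
      have "2 * (b - a) / (a * b) = 2 / a - 2 / b" if "a > 0" "b > 0" for a b :: real
        using that by (simp add: field_simps)
      then show ?thesis using ab by blast
    qed
    finally have "real (Suc n) powr (-3/2) \<le> 2 / ?a - 2 / ?b" using p by simp
    moreover have "(\<Sum>k=m+1..Suc n. real k powr (-3/2)) = (\<Sum>k=m+1..n. real k powr (-3/2)) + real (Suc n) powr (-3/2)"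
      using step by (subst sum.nat_ivl_Suc') auto
    ultimately show ?case using step by linarith
  qed
  define n where "n = max m (Max (insert 0 A))"
  have "A \<subseteq> {m+1..n}"
  proof
    fix k assume k: "k \<in> A"
    then have "real k > real m" using A m by fastforce
    moreover have "k \<le> n" using k A by (auto simp: n_def intro!: le_max_iff_disj[THEN iffD2] Max_ge)
    ultimately show "k \<in> {m+1..n}" by auto
  qed
  then have "(\<Sum>k\<in>A. real k powr (-3/2)) \<le> (\<Sum>k=m+1..n. real k powr (-3/2))"
    by (intro sum_mono2) auto
  also have "\<dots> \<le> 2 / sqrt (real m) - 2 / sqrt (real n)" by (rule tel) (simp add: n_def)
  also have "\<dots> \<le> 2 / sqrt (real m)" by simp
  also have "\<dots> \<le> 2 / (sqrt z / 2)"
  proof -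
    have "z \<le> 2 * 2 * real m" using m by linarith
    then have "sqrt z \<le> sqrt (2 * 2 * real m)" by simp
    also have "\<dots> = 2 * sqrt (real m)" by (simp only: real_sqrt_mult) simp
    finally show ?thesis using z m by (intro divide_left_mono) auto
  qed
  finally show ?thesis by simp
qed

lemma ln_le_powr: "ln x \<le> x powr a / a" if "a > 0" "x > 0" for x a :: real
proof -
  have "ln (x powr a) \<le> x powr a - 1" using that by (intro ln_le_minus_one) simp
  then show ?thesis using that by (simp add: ln_powr field_simps)
qed

text \<open>Writing n = b * s^2 with b squarefree bounds the harmonic sum by the squarefree one
  times sum 1 / s^2 <= 2. It feeds both the sieve mass and the Mertens-type bound for
  primorials.\<close>

lemma sum_squarefree_inverse_ge:
  fixes R :: nat
  assumes "R \<ge> 1"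
  shows "(\<Sum>b | b \<in> {1..R} \<and> squarefree b. 1 / real b) \<ge> ln (real R + 1) / 2"
proof -
  let ?B = "{b. b \<in> {1..R} \<and> squarefree b}"
  have "ln (real R + 1) \<le> (\<Sum>n=1..R. 1 / real n)"
    using ln_le_harm[of R] by (simp add: harm_def inverse_eq_divide)
  also have "\<dots> = (\<Sum>n=1..R. (\<lambda>(b,s). 1 / real b * (1 / real s ^ 2)) (squarefree_part n, square_part n))"
  proof (intro sum.cong refl)
    fix n :: nat
    have "real n = real (squarefree_part n * square_part n ^ 2)"
      using squarefree_decompose[of n] by simp
    then show "1 / real n = (\<lambda>(b,s). 1 / real b * (1 / real s ^ 2)) (squarefree_part n, square_part n)"
      by simp
  qed
  also have "\<dots> = (\<Sum>(b,s)\<in>(\<lambda>n. (squarefree_part n, square_part n)) ` {1..R}. 1 / real b * (1 / real s ^ 2))"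
  proof -
    have "inj_on (\<lambda>n. (squarefree_part n, square_part n)) {1..R}"
    proof (rule inj_onI)
      fix a b :: nat
      assume "(squarefree_part a, square_part a) = (squarefree_part b, square_part b)"
      then show "a = b" using squarefree_decompose[of a] squarefree_decompose[of b] by simp
    qed
    then show ?thesis by (simp add: sum.reindex)
  qed
  also have "\<dots> \<le> (\<Sum>(b,s)\<in>?B \<times> {1..R}. 1 / real b * (1 / real s ^ 2))"
  proof (rule sum_mono2)
    show "(\<lambda>n. (squarefree_part n, square_part n)) ` {1..R} \<subseteq> ?B \<times> {1..R}"
    proof (rule image_subsetI)
      fix n assume n: "n \<in> {1..R}"
      have 1: "squarefree_part n dvd n" by (metis squarefree_decompose dvd_triv_left)
      have 2: "square_part n dvd n"
        using square_part_square_dvd[of n] by (metis dvd_mult_left power2_eq_square)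
      have "squarefree_part n > 0" "square_part n > 0"
        using n 1 2 by (auto intro!: Nat.gr0I)
      then show "(squarefree_part n, square_part n) \<in> ?B \<times> {1..R}"
        using n dvd_imp_le[OF 1] dvd_imp_le[OF 2] by auto
    qed
  qed auto
  also have "\<dots> = (\<Sum>b\<in>?B. 1 / real b) * (\<Sum>s=1..R. 1 / real s ^ 2)"
    by (subst sum_product) (simp add: sum.cartesian_product)
  also have "\<dots> \<le> (\<Sum>b\<in>?B. 1 / real b) * 2"
  proof (rule mult_left_mono)
    have "(\<Sum>s=1..R. 1 / real s ^ 2) \<le> 2 - 1 / real R"
      using assms
    proof (induction R rule: dec_induct)
      case (step n)
      have "1 / real (Suc n) ^ 2 \<le> 1 / (real n * real (Suc n))"
        using step by (intro divide_left_mono) (auto simp: power2_eq_square)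
      also have "\<dots> = 1 / real n - 1 / real (Suc n)" using step by (simp add: field_simps)
      finally show ?case using step by simp
    qed simp
    then show "(\<Sum>s=1..R. 1 / real s ^ 2) \<le> 2" by (rule order_trans) simp
  qed (auto intro!: sum_nonneg)
  finally show ?thesis by simp
qed

section \<open>Prime powers\<close>

text \<open>A prime power up to x is determined by its base and an exponent at most log2 x. The set
  of bases is left free to cover the various exceptional prime powers met later.\<close>

lemma card_primepow_le:
  fixes x :: real
  assumes B: "finite B" and x: "x \<ge> 1"
  shows "real (card {n. real n \<le> x \<and> primepow n \<and> aprimedivisor n \<in> B}) \<le> real (card B) * log 2 x"
proof -
  let ?K = "nat \<lfloor>log 2 x\<rfloor>"
  have "{n. real n \<le> x \<and> primepow n \<and> aprimedivisor n \<in> B} \<subseteq> (\<lambda>(p,k). p ^ k) ` (B \<times> {1..?K})"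
  proof clarify
    fix n assume n: "real n \<le> x" "primepow n" "aprimedivisor n \<in> B"
    then obtain p k where pk: "prime p" "k > 0" "n = p ^ k" by (auto simp: primepow_def)
    have p: "aprimedivisor n = p" using pk by (simp add: aprimedivisor_prime_power)
    have "2 ^ k \<le> p ^ k" using prime_ge_2_nat[OF pk(1)] by (rule power_mono) simp
    then have "real (2 ^ k) \<le> real (p ^ k)" by (rule of_nat_mono)
    then have "2 ^ k \<le> x" using n pk by (metis of_nat_numeral of_nat_power order_trans)
    then have "real k \<le> log 2 x" using x by (subst le_log_iff) (auto simp: powr_realpow)
    then have "k \<le> ?K" by (simp add: le_nat_floor)
    then have "(p, k) \<in> B \<times> {1..?K}" using n p pk by auto
    then show "n \<in> (\<lambda>(p,k). p ^ k) ` (B \<times> {1..?K})" using pk by force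
  qed
  then have "card {n. real n \<le> x \<and> primepow n \<and> aprimedivisor n \<in> B} \<le> card ((\<lambda>(p,k). p ^ k) ` (B \<times> {1..?K}))"
    using B by (intro card_mono) auto
  also have "\<dots> \<le> card (B \<times> {1..?K})" using B by (intro card_image_le) auto
  also have "\<dots> = card B * ?K" by (simp add: card_cartesian_product)
  finally have "real (card {n. real n \<le> x \<and> primepow n \<and> aprimedivisor n \<in> B}) \<le> real (card B) * real ?K"
    by (metis of_nat_le_iff of_nat_mult)
  also have "\<dots> \<le> real (card B) * log 2 x"
    using x by (intro mult_left_mono) auto
  finally show ?thesis .
qed

lemma card_prime_factors_le:
  assumes "n > 0"
  shows "real (card (prime_factors n)) \<le> log 2 (real n)"
proof -
  have "(2::nat) ^ card (prime_factors n) = (\<Prod>p\<in>prime_factors n. 2)" by simp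
  also have "\<dots> \<le> (\<Prod>p\<in>prime_factors n. p)"
    by (intro prod_mono) (auto simp: in_prime_factors_iff prime_ge_2_nat)
  also have "\<dots> \<le> (\<Prod>p\<in>prime_factors n. p ^ multiplicity p n)"
  proof (intro prod_mono conjI)
    fix p assume p: "p \<in> prime_factors n"
    then have "multiplicity p n \<ge> 1" by (simp add: prime_factors_multiplicity)
    moreover have "p \<ge> 1" using p by (auto simp: in_prime_factors_iff prime_ge_1_nat)
    ultimately show "p \<le> p ^ multiplicity p n" using self_le_power[of p "multiplicity p n"] by simp
  qed simp
  also have "\<dots> = n" using assms by (intro prime_factorization_nat [symmetric]) simp
  finally have "(2::real) ^ card (prime_factors n) \<le> real n"
    by (metis of_nat_le_iff of_nat_numeral of_nat_power)
  then show ?thesis using assms by (subst le_log_iff) (auto simp: powr_realpow)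
qed

section \<open>Consequences of the prime number theorem for the Moebius function\<close>

lemma sum_divisors_upto:
  fixes f g :: "nat \<Rightarrow> real"
  shows "(\<Sum>n=1..x. \<Sum>d | d dvd n. f d * g (n div d)) = (\<Sum>d=1..x. f d * (\<Sum>k=1..x div d. g k))"
proof -
  have fin: "finite {d. d dvd n}" if "n \<in> {1..x}" for n using that by simp
  have "(\<Sum>n=1..x. \<Sum>d | d dvd n. f d * g (n div d))
      = (\<Sum>(n,d)\<in>(SIGMA n:{1..x}. {d. d dvd n}). f d * g (n div d))"
    using fin by (subst sum.Sigma) auto
  also have "\<dots> = (\<Sum>(d,k)\<in>(SIGMA d:{1..x}. {1..x div d}). f d * g k)"
  proof (rule sum.reindex_bij_witness[of _ "\<lambda>(d,k). (d * k, d)" "\<lambda>(n,d). (d, n div d)"])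
    fix a assume "a \<in> (SIGMA n:{1..x}. {d. d dvd n})"
    then obtain n d where a: "a = (n, d)" "n \<ge> 1" "n \<le> x" "d dvd n" by auto
    then show "(\<lambda>(d,k). (d * k, d)) ((\<lambda>(n,d). (d, n div d)) a) = a" by simp
    show "(\<lambda>(n,d). (d, n div d)) a \<in> (SIGMA d:{1..x}. {1..x div d})"
      using a dvd_imp_le[of d n] dvd_pos_nat[of n d] dvd_div_gt0[of d n] by (auto simp: div_le_mono Suc_le_eq)
    show "(case (\<lambda>(n,d). (d, n div d)) a of (d, k) \<Rightarrow> f d * g k) = (case a of (n, d) \<Rightarrow> f d * g (n div d))"
      using a by simp
  next
    fix b assume "b \<in> (SIGMA d:{1..x}. {1..x div d})"
    then obtain d k where b: "b = (d, k)" "d \<ge> 1" "d \<le> x" "k \<ge> 1" "k \<le> x div d" by auto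
    then show "(\<lambda>(n,d). (d, n div d)) ((\<lambda>(d,k). (d * k, d)) b) = b" by simp
    show "(\<lambda>(d,k). (d * k, d)) b \<in> (SIGMA n:{1..x}. {d. d dvd n})"
      using b by (auto simp: less_eq_div_iff_mult_less_eq mult.commute Suc_le_eq)
  qed
  also have "\<dots> = (\<Sum>d=1..x. \<Sum>k=1..x div d. f d * g k)"
    by (subst sum.Sigma) auto
  finally show ?thesis by (simp add: sum_distrib_left)
qed

lemma real_nat_div_diff: "d > 0 \<Longrightarrow> \<bar>real (x div d) - real x / real d\<bar> \<le> 1"
proof -
  assume d: "d > 0"
  have "real x = real (x div d) * real d + real (x mod d)"
    by (metis div_mult_mod_eq of_nat_add of_nat_mult)
  moreover have "real (x mod d) \<le> real d" using d by simp
  ultimately show ?thesis using d by (simp add: abs_if field_simps)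
qed

lemma sum_moebius_mu_div: "x \<ge> 1 \<Longrightarrow> (\<Sum>n=1..x. moebius_mu n * real (x div n)) = 1"
proof -
  assume x: "x \<ge> 1"
  have "(\<Sum>n=1..x. moebius_mu n * real (x div n)) = (\<Sum>d=1..x. moebius_mu d * (\<Sum>k=1..x div d. 1))"
    by simp
  also have "\<dots> = (\<Sum>n=1..x. \<Sum>d | d dvd n. moebius_mu d * 1)"
    by (rule sum_divisors_upto[symmetric])
  also have "\<dots> = (\<Sum>n=1..x. if n = 1 then 1 else 0)"
    using sum_moebius_mu_divisors by (intro sum.cong) auto
  also have "\<dots> = 1" using x by simp
  finally show ?thesis .
qed

text \<open>In the exact identity sum mu(n) * floor(x / n) = 1, replacing each floor by x / n costs
  at most 1 per term, hence at most x in total.\<close>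

lemma abs_sum_moebius_mu_over_le: "\<bar>\<Sum>n=1..x. moebius_mu n / real n\<bar> \<le> 2"
proof (cases "x \<ge> 1")
  case True
  have "real x * (\<Sum>n=1..x. moebius_mu n / real n) - 1
      = (\<Sum>n=1..x. moebius_mu n * (real x / real n - real (x div n)))"
    using sum_moebius_mu_div[OF True] by (simp add: right_diff_distrib sum_subtractf sum_distrib_left mult.commute)
  also have "\<bar>\<dots>\<bar> \<le> (\<Sum>n=1..x. 1)"
  proof (rule order_trans[OF sum_abs sum_mono])
    fix n assume "n \<in> {1..x}"
    then show "\<bar>moebius_mu n * (real x / real n - real (x div n))\<bar> \<le> 1"
      using order_trans[OF abs_moebius_mu_mult_le real_nat_div_diff[of n x, unfolded abs_minus_commute[of "real (x div n)"]]] by simp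
  qed
  finally have "\<bar>real x * (\<Sum>n=1..x. moebius_mu n / real n) - 1\<bar> \<le> real x" by simp
  then have "\<bar>real x * (\<Sum>n=1..x. moebius_mu n / real n)\<bar> \<le> real x * 2" using True by linarith
  then show ?thesis using True by (simp add: abs_mult)
qed simp

lemma sum_moebius_mu_ln_upto:
  "(\<Sum>n=1..x. moebius_mu n * ln (real n)) = - (\<Sum>d=1..x. moebius_mu d * (\<Sum>k=1..x div d. mangoldt k))"
proof -
  have "(\<Sum>n=1..x. moebius_mu n * ln (real n))
      = - (\<Sum>n=1..x. \<Sum>d | d dvd n. moebius_mu d * mangoldt (n div d))"
    by (simp add: moebius_mu_times_ln sum_negf)
  then show ?thesis using sum_divisors_upto[of moebius_mu mangoldt x] by simp
qed

lemma sum_ln_div_le: "(\<Sum>n=1..x. ln (real x / real n)) \<le> 4 * real x"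
proof (cases "x \<ge> 1")
  case True
  have "(\<Sum>n=1..x. ln (real x / real n)) \<le> (\<Sum>n=1..x. 2 * sqrt (real x) * (1 / sqrt (real n)))"
  proof (rule sum_mono)
    fix n assume "n \<in> {1..x}"
    then have "ln (real x / real n) \<le> (real x / real n) powr (1/2) / (1/2)"
      by (intro ln_le_powr) auto
    then show "ln (real x / real n) \<le> 2 * sqrt (real x) * (1 / sqrt (real n))"
      by (simp add: powr_half_sqrt real_sqrt_divide mult.commute)
  qed
  also have "\<dots> = 2 * sqrt (real x) * (\<Sum>n=1..x. 1 / sqrt (real n))"
    by (simp add: sum_distrib_left)
  also have "\<dots> \<le> 2 * sqrt (real x) * (2 * sqrt (real x))"
    using sum_inverse_sqrt_le by (intro mult_left_mono) auto
  finally show ?thesis by simp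
qed simp

section \<open>From psi(x) ~ x to M(x) = o(x)\<close>

text \<open>Write M(x) * ln x = sum mu(n) ln(x / n) + sum mu(n) ln n. The first sum is O(x). The
  second is -sum mu(d) psi(x / d); its main part is x * sum mu(d) / d = O(x), and the error of psi
  contributes e * x * ln x + O(x). Dividing by x * ln x leaves an arbitrarily small e.\<close>

lemma moebius_mu_mean_zero:
  assumes psi: "(\<lambda>n. (\<Sum>k=1..n. mangoldt k) / real n) \<longlonglongrightarrow> (1::real)"
  shows "(\<lambda>n. (\<Sum>k=1..n. moebius_mu k) / real n) \<longlonglongrightarrow> 0"
proof -
  define psi where "psi n = (\<Sum>k=1..n. mangoldt k :: real)" for n
  \<comment> \<open>The constant C swallows the finitely many small n, so that the bound can be
    applied to every x div d, including the many small ones.\<close>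
  have appr: "\<exists>C\<ge>0. \<forall>n. \<bar>psi n - real n\<bar> \<le> e * real n + C" if e: "e > 0" for e
  proof -
    have "\<forall>\<^sub>F n in sequentially. \<bar>psi n / real n - 1\<bar> < e"
      using tendstoD[OF psi e] by (simp add: dist_real_def psi_def)
    then obtain n0 where n0: "\<And>n. n \<ge> n0 \<Longrightarrow> \<bar>psi n / real n - 1\<bar> < e"
      by (auto simp: eventually_at_top_linorder)
    define C where "C = (\<Sum>n\<le>n0. \<bar>psi n - real n\<bar>)"
    have "\<bar>psi n - real n\<bar> \<le> e * real n + C" for n
    proof (cases "n \<le> n0")
      case True
      then have "\<bar>psi n - real n\<bar> \<le> C" unfolding C_def by (intro member_le_sum) auto
      then show ?thesis using e by (intro order_trans[OF _ le_add_same_cancel2[THEN iffD2]]) auto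
    next
      case False
      then have "psi n - real n = real n * (psi n / real n - 1)" by (simp add: right_diff_distrib)
      then have "\<bar>psi n - real n\<bar> = real n * \<bar>psi n / real n - 1\<bar>"
        by (simp only: abs_mult abs_of_nat)
      also have "\<dots> \<le> real n * e" using n0[of n] False by (intro mult_left_mono) auto
      moreover have "C \<ge> 0" unfolding C_def by (auto intro: sum_nonneg)
      ultimately show ?thesis by (simp add: mult.commute)
    qed
    moreover have "C \<ge> 0" unfolding C_def by (auto intro: sum_nonneg)
    ultimately show ?thesis by blast
  qed
  have main: "\<exists>C\<ge>0. \<forall>x\<ge>1. \<bar>\<Sum>k=1..x. moebius_mu k\<bar> * ln (real x) \<le> e * real x * ln (real x) + C * real x"
    if e: "e > 0" for e
  proof -
    from appr[OF e] obtain C where C: "C \<ge> 0" "\<And>n. \<bar>psi n - real n\<bar> \<le> e * real n + C" by blast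
    have "\<bar>\<Sum>k=1..x. moebius_mu k\<bar> * ln (real x) \<le> e * real x * ln (real x) + (C + 7 + 2 * e) * real x"
      if x: "x \<ge> 1" for x
    proof -
      have "(\<Sum>k=1..x. moebius_mu k) * ln (real x)
          = (\<Sum>n=1..x. moebius_mu n * ln (real x / real n)) + (\<Sum>n=1..x. moebius_mu n * ln (real n))"
        unfolding sum_distrib_right sum.distrib[symmetric] using x
        by (intro sum.cong) (auto simp: ln_div algebra_simps)
      also have "(\<Sum>n=1..x. moebius_mu n * ln (real n)) = - (\<Sum>d=1..x. moebius_mu d * psi (x div d))"
        unfolding psi_def by (rule sum_moebius_mu_ln_upto)
      also have "(\<Sum>d=1..x. moebius_mu d * psi (x div d))
          = real x * (\<Sum>d=1..x. moebius_mu d / real d) + (\<Sum>d=1..x. moebius_mu d * (psi (x div d) - real x / real d))"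
        by (simp add: sum_distrib_left sum.distrib[symmetric] algebra_simps)
      finally have eq: "(\<Sum>k=1..x. moebius_mu k) * ln (real x) = (\<Sum>n=1..x. moebius_mu n * ln (real x / real n))
         - real x * (\<Sum>d=1..x. moebius_mu d / real d) - (\<Sum>d=1..x. moebius_mu d * (psi (x div d) - real x / real d))"
        by simp
      have b1: "\<bar>\<Sum>n=1..x. moebius_mu n * ln (real x / real n)\<bar> \<le> 4 * real x"
      proof -
        have "\<bar>\<Sum>n=1..x. moebius_mu n * ln (real x / real n)\<bar> \<le> (\<Sum>n=1..x. ln (real x / real n))"
        proof (rule order_trans[OF sum_abs sum_mono])
          fix n assume "n \<in> {1..x}"
          then have "ln (real x / real n) \<ge> 0" by (intro ln_ge_zero) auto
          then show "\<bar>moebius_mu n * ln (real x / real n)\<bar> \<le> ln (real x / real n)"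
            using abs_moebius_mu_mult_le[of n "ln (real x / real n)"] by simp
        qed
        then show ?thesis using sum_ln_div_le[of x] by simp
      qed
      have b2: "\<bar>real x * (\<Sum>d=1..x. moebius_mu d / real d)\<bar> \<le> 2 * real x"
        using mult_left_mono[OF abs_sum_moebius_mu_over_le[of x], of "real x"] by (simp add: abs_mult mult.commute)
      have b3: "\<bar>\<Sum>d=1..x. moebius_mu d * (psi (x div d) - real x / real d)\<bar>
          \<le> e * real x * ln (real x) + (C + 1 + 2 * e) * real x"
      proof -
        have "\<bar>\<Sum>d=1..x. moebius_mu d * (psi (x div d) - real x / real d)\<bar>
            \<le> (\<Sum>d=1..x. e * real x * (1 / real d) + (C + 1 + e))"
        proof (rule order_trans[OF sum_abs sum_mono])
          fix d assume d: "d \<in> {1..x}"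
          have 1: "\<bar>real (x div d) - real x / real d\<bar> \<le> 1" using d by (intro real_nat_div_diff) auto
          then have "real (x div d) \<le> real x / real d + 1" by linarith
          then have "e * real (x div d) \<le> e * (real x / real d + 1)" using e by (intro mult_left_mono) auto
          then have "\<bar>psi (x div d) - real x / real d\<bar> \<le> e * (real x / real d + 1) + C + 1"
            using C(2)[of "x div d"] 1 by linarith
          then have "\<bar>moebius_mu d * (psi (x div d) - real x / real d)\<bar> \<le> e * (real x / real d + 1) + C + 1"
            using order_trans[OF abs_moebius_mu_mult_le] by blast
          then show "\<bar>moebius_mu d * (psi (x div d) - real x / real d)\<bar> \<le> e * real x * (1 / real d) + (C + 1 + e)"
            by (simp add: algebra_simps)
        qed
        also have "\<dots> = e * real x * (\<Sum>d=1..x. 1 / real d) + (C + 1 + e) * real x"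
          by (simp add: sum.distrib sum_distrib_left)
        also have "\<dots> \<le> e * real x * (1 + ln (real x)) + (C + 1 + e) * real x"
          using sum_inverse_upto_le[OF x] e C(1) by (intro add_mono mult_left_mono) auto
        finally show ?thesis by (simp add: algebra_simps)
      qed
      have "\<bar>\<Sum>k=1..x. moebius_mu k\<bar> * ln (real x) = \<bar>(\<Sum>k=1..x. moebius_mu k) * ln (real x)\<bar>"
        using x by (simp add: abs_mult)
      then show ?thesis using eq b1 b2 b3 by (simp add: algebra_simps)
    qed
    then show ?thesis using C e by (intro exI[of _ "C + 7 + 2 * e"]) auto
  qed
  show ?thesis
  proof (rule tendstoI)
    fix e :: real assume e: "e > 0"
    from main[of "e/2"] e obtain C where C: "C \<ge> 0"
      "\<And>x. x \<ge> 1 \<Longrightarrow> \<bar>\<Sum>k=1..x. moebius_mu k\<bar> * ln (real x) \<le> e/2 * real x * ln (real x) + C * real x"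
      by (auto)
    have "\<forall>\<^sub>F x in sequentially. ln (real x) > 2 * C / e + 1" by real_asymp
    then show "\<forall>\<^sub>F x in sequentially. dist ((\<Sum>k = 1..x. moebius_mu k) / real x) 0 < e"
      using eventually_gt_at_top[of 1]
    proof eventually_elim
      case (elim x)
      have l: "ln (real x) > 0" using elim by simp
      have "C < e / 2 * ln (real x)" using elim e by (simp add: field_simps)
      then have "C * real x < e / 2 * ln (real x) * real x" using elim by simp
      then have "\<bar>\<Sum>k=1..x. moebius_mu k\<bar> * ln (real x) < e * real x * ln (real x)"
      proof -
        have "e / 2 * real x * ln (real x) + e / 2 * ln (real x) * real x = e * real x * ln (real x)"
          by (simp add: algebra_simps)
        moreover have "x \<ge> 1" using elim by simp
        ultimately show ?thesis using C(2)[of x] \<open>C * real x < _\<close> by linarith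
      qed
      then have "\<bar>\<Sum>k=1..x. moebius_mu k\<bar> < e * real x"
        by (rule mult_right_less_imp_less) (use l in simp)
      then show ?case using elim by (simp add: dist_real_def field_simps)
    qed
  qed
qed

text \<open>Axer's argument: on each range where \<open>\<lfloor>X / n\<rfloor>\<close> is constant, the weight varies boundedly.\<close>

lemma abs_sum_moebius_weighted_le:
  fixes f :: "nat \<Rightarrow> real"
  assumes ab: "a < b" and M: "\<And>i. i \<le> b \<Longrightarrow> \<bar>\<Sum>k=1..i. moebius_mu k\<bar> \<le> E"
  shows "\<bar>\<Sum>n=a+1..b. moebius_mu n * f n\<bar> \<le> E * (\<bar>f b\<bar> + \<bar>f (a+1)\<bar> + (\<Sum>n=a+1..<b. \<bar>f (n+1) - f n\<bar>))"
proof -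
  define M where "M i = (\<Sum>k=1..i. moebius_mu k)" for i
  have E: "E \<ge> 0" using M[of 0] by simp
  have "(\<Sum>n=a+1..b. moebius_mu n * f n) = M b * f b - M a * f (a+1) - (\<Sum>n=a+1..<b. M n * (f (n+1) - f n))"
  proof -
    have "Suc a \<le> b" using ab by simp
    then show ?thesis
    proof (induction b rule: dec_induct)
      case base
      then show ?case by (simp add: M_def algebra_simps)
    next
      case (step n)
      then show ?case by (simp add: M_def algebra_simps)
    qed
  qed
  also have "\<bar>\<dots>\<bar> \<le> \<bar>M b * f b\<bar> + \<bar>M a * f (a+1)\<bar> + \<bar>\<Sum>n=a+1..<b. M n * (f (n+1) - f n)\<bar>"
    by linarith
  also have "\<dots> \<le> E * \<bar>f b\<bar> + E * \<bar>f (a+1)\<bar> + (\<Sum>n=a+1..<b. E * \<bar>f (n+1) - f n\<bar>)"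
    unfolding abs_mult using M ab
    by (intro add_mono mult_right_mono order_trans[OF sum_abs sum_mono]) (auto simp: M_def abs_mult intro!: mult_right_mono)
  also have "\<dots> = E * (\<bar>f b\<bar> + \<bar>f (a+1)\<bar> + (\<Sum>n=a+1..<b. \<bar>f (n+1) - f n\<bar>))"
    by (simp add: sum_distrib_left distrib_left)
  finally show ?thesis .
qed

text \<open>For n <= X / K the trivial bound B is enough. The remaining n fall into fewer than K
  intervals on which floor(X / n) is constant; there X / n varies by less than 1, the weight has
  total variation at most B, and partial summation against M(n) = o(X) applies. The Lipschitz
  condition is asked for only between consecutive integers, so \<open>\<rho>\<close> may jump at
  integers.\<close>

lemma axer_moebius:
  fixes \<rho> :: "real \<Rightarrow> real"
  assumes M: "(\<lambda>n. (\<Sum>k=1..n. moebius_mu k) / real n) \<longlonglongrightarrow> 0"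
    and B: "\<And>t. t \<ge> 1 \<Longrightarrow> \<bar>\<rho> t\<bar> \<le> B"
    and lip: "\<And>k s t. k \<ge> 1 \<Longrightarrow> real k \<le> s \<Longrightarrow> s \<le> t \<Longrightarrow> t < real k + 1 \<Longrightarrow> \<bar>\<rho> s - \<rho> t\<bar> \<le> B * (t - s)"
    and e: "e > 0"
  shows "\<exists>X0\<ge>1. \<forall>X\<ge>X0. \<bar>\<Sum>n | 1 \<le> n \<and> real n \<le> X. moebius_mu n * \<rho> (X / real n)\<bar> \<le> e * X"
proof -
  have B0: "B \<ge> 0" using B[of 1] by simp
  \<comment> \<open>Makes the trivial bound B * X / K on the range n <= X / K at most e / 2 *
    X.\<close>
  define K where "K = nat \<lceil>2 * B / e\<rceil> + 1"
  have K: "K \<ge> 1" "B / real K \<le> e / 2"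
  proof -
    have "2 * B / e \<le> real K" unfolding K_def by linarith
    then show "B / real K \<le> e / 2" using e by (simp add: K_def field_simps)
  qed (simp add: K_def)
  \<comment> \<open>Chosen so that fewer than K intervals, each costing 3 * B * d * X, cost at most
    e / 2 * X together.\<close>
  define d where "d = e / (6 * (B + 1) * real K)"
  have d: "d > 0" using e K B0 by (simp add: d_def)
  have "\<forall>\<^sub>F n in sequentially. \<bar>(\<Sum>k=1..n. moebius_mu k) / real n\<bar> < d"
    using tendstoD[OF M d] by (simp add: dist_real_def)
  then obtain n0 where n0: "\<And>n. n \<ge> n0 \<Longrightarrow> \<bar>(\<Sum>k=1..n. moebius_mu k) / real n\<bar> < d"
    by (auto simp: eventually_at_top_linorder)
  \<comment> \<open>For i < n0 only the trivial bound i <= n0 is available; X >= n0 / d makes it at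
    most d * X.\<close>
  define X0 where "X0 = max 1 (real n0 / d)"
  have "\<bar>\<Sum>n | 1 \<le> n \<and> real n \<le> X. moebius_mu n * \<rho> (X / real n)\<bar> \<le> e * X" if X: "X \<ge> X0" for X
  proof -
    have X1: "X \<ge> 1" using X by (simp add: X0_def)
    have Mb: "\<bar>\<Sum>k=1..i. moebius_mu k\<bar> \<le> d * X" if i: "real i \<le> X" for i
    proof (cases "i \<ge> n0 \<and> i > 0")
      case True
      then have "\<bar>\<Sum>k=1..i. moebius_mu k\<bar> < d * real i" using n0[of i] by (simp add: field_simps)
      also have "\<dots> \<le> d * X" using i d by (intro mult_left_mono) auto
      finally show ?thesis by simp
    next
      case False
      have "\<bar>\<Sum>k=1..i. moebius_mu k\<bar> \<le> (\<Sum>k=1..i. 1)"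
        by (rule order_trans[OF sum_abs sum_mono]) (rule abs_moebius_mu_le)
      also have "\<dots> \<le> real n0" using False by auto
      also have "\<dots> \<le> d * X" using X d by (simp add: X0_def field_simps)
      finally show ?thesis .
    qed
    define S where "S = {n. 1 \<le> n \<and> real n \<le> X}"
    have finS: "finite S" unfolding S_def by (rule finite_subset[OF _ finite_nat_real_le[of X]]) auto
    define S1 where "S1 = {n\<in>S. real K \<le> X / real n}"
    define T where "T k = {n\<in>S. real k \<le> X / real n \<and> X / real n < real k + 1}" for k :: nat
    have U: "S = S1 \<union> (\<Union>k\<in>{1..<K}. T k)"
    proof
      show "S \<subseteq> S1 \<union> (\<Union>k\<in>{1..<K}. T k)"
      proof
        fix n assume n: "n \<in> S"
        show "n \<in> S1 \<union> (\<Union>k\<in>{1..<K}. T k)"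
        proof (cases "n \<in> S1")
          case False
          define k where "k = nat \<lfloor>X / real n\<rfloor>"
          have q: "1 \<le> X / real n" using n by (simp add: S_def)
          have k: "real k \<le> X / real n" "X / real n < real k + 1" "k \<ge> 1"
            using q by (auto simp: k_def le_nat_floor)
          have "X / real n < real K" using False n by (simp add: S1_def)
          then have "k < K" using k by linarith
          then show ?thesis using k n by (auto simp: T_def)
        qed simp
      qed
    qed (auto simp: S1_def T_def)
    have disj: "S1 \<inter> (\<Union>k\<in>{1..<K}. T k) = {}"
    proof -
      have False if "n \<in> S1" "n \<in> T k" "k < K" for n k
      proof -
        have "real k + 1 \<le> real K" using that by simp
        then show False using that unfolding S1_def T_def by fastforce
      qed
      then show ?thesis by auto
    qed
    have disj2: "T k \<inter> T l = {}" if "k \<noteq> l" for k l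
    proof -
      have False if "n \<in> T k" "n \<in> T l" "k < l" for n k l
      proof -
        have "real k + 1 \<le> real l" using that by simp
        then show False using that unfolding T_def by fastforce
      qed
      then show ?thesis using \<open>k \<noteq> l\<close> by (metis disjoint_iff nat_neq_iff)
    qed
    have fin: "finite S1" "\<And>k. finite (T k)" using finS by (auto simp: S1_def T_def)
    have split: "(\<Sum>n\<in>S. moebius_mu n * \<rho> (X / real n)) = (\<Sum>n\<in>S1. moebius_mu n * \<rho> (X / real n))
        + (\<Sum>k=1..<K. \<Sum>n\<in>T k. moebius_mu n * \<rho> (X / real n))"
      unfolding U using fin disj disj2 by (subst sum.union_disjoint) (auto simp: sum.UNION_disjoint)
    have p1: "\<bar>\<Sum>n\<in>S1. moebius_mu n * \<rho> (X / real n)\<bar> \<le> e / 2 * X"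
    proof -
      have "\<bar>\<Sum>n\<in>S1. moebius_mu n * \<rho> (X / real n)\<bar> \<le> (\<Sum>n\<in>S1. B)"
      proof (rule order_trans[OF sum_abs sum_mono])
        fix n assume "n \<in> S1"
        then have "X / real n \<ge> 1" by (simp add: S1_def S_def)
        then show "\<bar>moebius_mu n * \<rho> (X / real n)\<bar> \<le> B"
          using order_trans[OF abs_moebius_mu_mult_le B] by simp
      qed
      also have "\<dots> = real (card S1) * B" by simp
      also have "\<dots> \<le> (X / real K) * B"
      proof (intro mult_right_mono B0)
        have "S1 \<subseteq> {1..nat \<lfloor>X / real K\<rfloor>}"
        proof
          fix n assume n: "n \<in> S1"
          then have "n \<ge> 1" "real K \<le> X / real n" by (auto simp: S1_def S_def)
          then have "real n \<le> X / real K" using K(1) by (simp add: field_simps)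
          then show "n \<in> {1..nat \<lfloor>X / real K\<rfloor>}" using n by (auto simp: S1_def S_def le_nat_floor)
        qed
        then have "card S1 \<le> nat \<lfloor>X / real K\<rfloor>" using card_mono[of "{1..nat \<lfloor>X / real K\<rfloor>}" S1] by simp
        also have "real (nat \<lfloor>X / real K\<rfloor>) \<le> X / real K" using X1 by simp
        finally show "real (card S1) \<le> X / real K" by simp
      qed
      also have "\<dots> = B / real K * X" by simp
      also have "\<dots> \<le> e / 2 * X" using K X1 by (intro mult_right_mono) auto
      finally show ?thesis .
    qed
    have p2: "\<bar>\<Sum>n\<in>T k. moebius_mu n * \<rho> (X / real n)\<bar> \<le> d * X * (3 * B)" if k: "k \<ge> 1" for k
    proof -
      define a where "a = nat \<lfloor>X / (real k + 1)\<rfloor>"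
      define b where "b = nat \<lfloor>X / real k\<rfloor>"
      have Teq: "T k = {a+1..b}"
      proof (rule Set.set_eqI)
        fix n
        have "n \<in> {a+1..b} \<longleftrightarrow> n \<ge> 1 \<and> X / (real k + 1) < real n \<and> real n \<le> X / real k"
        proof -
          have "a < n \<longleftrightarrow> X / (real k + 1) < real n" 
          proof -
            have "X / (real k + 1) \<ge> 0" using X1 by simp
            then show ?thesis unfolding a_def by linarith
          qed
          moreover have "n \<le> b \<longleftrightarrow> real n \<le> X / real k"
          proof -
            have "X / real k \<ge> 0" using X1 by simp
            then show ?thesis unfolding b_def by linarith
          qed
          ultimately show ?thesis by auto
        qed
        also have "\<dots> \<longleftrightarrow> n \<in> T k"
        proof (cases "n \<ge> 1")
          case True
          have "X / real k \<le> X" using k X1 by (simp add: field_simps)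
          then have "real n \<le> X / real k \<Longrightarrow> real n \<le> X" by linarith
          moreover have "real n \<le> X / real k \<longleftrightarrow> real k \<le> X / real n" using True k by (simp add: field_simps)
          moreover have "X / (real k + 1) < real n \<longleftrightarrow> X / real n < real k + 1" using True k by (simp add: field_simps)
          ultimately show ?thesis using True by (auto simp: T_def S_def)
        qed (auto simp: T_def S_def)
        finally show "n \<in> T k \<longleftrightarrow> n \<in> {a+1..b}" by simp
      qed
      show ?thesis
      proof (cases "a < b")
        case True
        define f where "f n = \<rho> (X / real n)" for n :: nat
        have r: "real k \<le> X / real n" "X / real n < real k + 1" "n \<ge> 1" if "n \<in> {a+1..b}" for n
          using that unfolding Teq[symmetric] by (auto simp: T_def S_def)
        have fb: "\<bar>f n\<bar> \<le> B" if "n \<in> {a+1..b}" for n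
          unfolding f_def using r[OF that] k by (intro B) linarith
        have "(\<Sum>n=a+1..<b. \<bar>f (n+1) - f n\<bar>) \<le> (\<Sum>n=a+1..<b. B * (X / real n - X / real (n+1)))"
        proof (rule sum_mono)
          fix n assume n: "n \<in> {a+1..<b}"
          then have "X / real (n+1) \<le> X / real n" using X1 by (intro divide_left_mono) auto
          then show "\<bar>f (n+1) - f n\<bar> \<le> B * (X / real n - X / real (n+1))"
            unfolding f_def using r[of n] r[of "n+1"] n k by (intro lip[of k]) auto
        qed
        also have "\<dots> = B * (X / real (a+1) - X / real b)"
        proof -
          have "(\<Sum>n=a+1..<b. X / real n - X / real (n+1)) = X / real (a+1) - X / real b"
            using True sum_Suc_diff'[of "a+1" b "\<lambda>n. - (X / real n)"] by simp
          then show ?thesis by (simp add: sum_distrib_left[symmetric])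
        qed
        also have "\<dots> \<le> B * 1"
          using r[of "a+1"] r[of b] True B0 by (intro mult_left_mono) auto
        finally have v: "(\<Sum>n=a+1..<b. \<bar>f (n+1) - f n\<bar>) \<le> B" by simp
        have dX: "d * X \<ge> 0" using d X1 by simp
        have "b \<in> T k" unfolding Teq using True by simp
        then have bX: "real b \<le> X" by (simp add: T_def S_def)
        have "\<bar>\<Sum>n=a+1..b. moebius_mu n * f n\<bar> \<le> (d * X) * (\<bar>f b\<bar> + \<bar>f (a+1)\<bar> + (\<Sum>n=a+1..<b. \<bar>f (n+1) - f n\<bar>))"
          using True bX by (intro abs_sum_moebius_weighted_le Mb) auto
        also have "\<dots> \<le> (d * X) * (B + B + B)"
          using fb[of b] fb[of "a+1"] True v dX by (intro mult_left_mono add_mono) auto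
        finally show ?thesis unfolding Teq f_def by simp
      next
        case False
        then have "T k = {}" unfolding Teq by simp
        then show ?thesis using d X1 B0 by simp
      qed
    qed
    have "\<bar>\<Sum>k=1..<K. \<Sum>n\<in>T k. moebius_mu n * \<rho> (X / real n)\<bar> \<le> (\<Sum>k=1..<K. d * X * (3 * B))"
      by (rule order_trans[OF sum_abs sum_mono]) (use p2 in auto)
    also have "\<dots> \<le> real K * (d * X * (3 * (B + 1)))"
      using d X1 B0 by (simp add: mult_mono)
    also have "\<dots> = d * (6 * (B + 1) * real K) * X / 2" by (simp add: algebra_simps)
    also have "d * (6 * (B + 1) * real K) = e" using K B0 by (simp add: d_def)
    finally show ?thesis using p1 split unfolding S_def by linarith
  qed
  moreover have "X0 \<ge> 1" by (simp add: X0_def)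
  ultimately show ?thesis by blast
qed

section \<open>Weighted sums of the Moebius function over integers free of given primes\<close>

text \<open>T is the set of forbidden primes. Putting the weight at X / d makes the sum at X over
  multiples of p equal, up to a factor, to the same kind of sum at X / p, which is what the
  recursion below exploits. The weights that occur are 1 and ln.\<close>

definition mu_sum :: "nat set \<Rightarrow> (real \<Rightarrow> real) \<Rightarrow> real \<Rightarrow> real" where
  "mu_sum T g X = (\<Sum>d | 1 \<le> d \<and> real d \<le> X \<and> (\<forall>p\<in>T. \<not> p dvd d). moebius_mu d / real d * g (X / real d))"

lemma finite_mu_sum_range: "finite {d::nat. 1 \<le> d \<and> real d \<le> X \<and> P d}"
  by (rule finite_subset[OF _ finite_nat_real_le[of X]]) auto

lemma mu_sum_less_1: "X < 1 \<Longrightarrow> mu_sum T g X = 0"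
proof -
  assume "X < 1"
  then have e: "{d. 1 \<le> d \<and> real d \<le> X \<and> (\<forall>p\<in>T. \<not> p dvd d)} = {}" by auto
  show ?thesis unfolding mu_sum_def e by simp
qed

text \<open>Among the d allowed by T, those divisible by p are p * k with k again free of p, up to
  terms with mu = 0, and mu(p * k) = -mu(k). The equation refers back to the enlarged set, but at
  the smaller argument X / p.\<close>

lemma mu_sum_insert:
  assumes T: "\<And>q. q \<in> T \<Longrightarrow> prime q" and p: "prime p" "p \<notin> T"
  shows "mu_sum (insert p T) g X = mu_sum T g X + mu_sum (insert p T) g (X / real p) / real p"
proof -
  have p0: "p > 0" using p prime_gt_0_nat by blast
  let ?S = "{d. 1 \<le> d \<and> real d \<le> X \<and> (\<forall>q\<in>T. \<not> q dvd d)}"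
  let ?S1 = "{d. 1 \<le> d \<and> real d \<le> X \<and> (\<forall>q\<in>insert p T. \<not> q dvd d)}"
  let ?S2 = "{d. 1 \<le> d \<and> real d \<le> X / real p \<and> (\<forall>q\<in>insert p T. \<not> q dvd d)}"
  let ?f = "\<lambda>d. moebius_mu d / real d * g (X / real d)"
  have nd: "q \<in> T \<Longrightarrow> q dvd p * d \<longleftrightarrow> q dvd d" for q d
    using T[of q] p by (metis dvd_mult prime_dvd_mult_iff primes_dvd_imp_eq)
  have fin: "finite ?S" by (rule finite_mu_sum_range)
  have "mu_sum T g X = (\<Sum>d\<in>?S1. ?f d) + (\<Sum>d\<in>?S - ?S1. ?f d)"
    unfolding mu_sum_def by (subst add.commute, rule sum.subset_diff) (use fin in auto)
  also have "(\<Sum>d\<in>?S - ?S1. ?f d) = (\<Sum>d\<in>(*) p ` ?S2. ?f d)"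
  proof (rule sum.mono_neutral_right)
    show "(*) p ` ?S2 \<subseteq> ?S - ?S1" using p0 nd by (auto simp: field_simps)
    show "\<forall>i\<in>(?S - ?S1) - (*) p ` ?S2. ?f i = 0"
    proof
      fix i assume i: "i \<in> (?S - ?S1) - (*) p ` ?S2"
      then have "p dvd i" by auto
      then obtain k where k: "i = p * k" by blast
      have "k \<notin> ?S2" using i k by blast
      moreover have "1 \<le> k" "real k \<le> X / real p" "\<forall>q\<in>T. \<not> q dvd k"
        using i k nd p0 by (auto simp: field_simps Suc_le_eq)
      ultimately have "p dvd k" by auto
      then have "p\<^sup>2 dvd i" using k by (auto simp: power2_eq_square)
      then have "\<not> squarefree i" using p(1) not_squarefreeI[of p i] not_prime_unit by metis
      then show "?f i = 0" by (simp add: moebius_mu_not_squarefree)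
    qed
  qed (use fin in auto)
  also have "\<dots> = (\<Sum>d\<in>?S2. ?f (p * d))"
    using p0 by (subst sum.reindex) (auto simp: inj_on_def)
  also have "\<dots> = (\<Sum>d\<in>?S2. - (1 / real p) * (moebius_mu d / real d * g (X / real p / real d)))"
    using p by (intro sum.cong) (auto simp: moebius_mu_prime_mult)
  also have "\<dots> = - (1 / real p) * mu_sum (insert p T) g (X / real p)"
    unfolding mu_sum_def by (simp only: sum_distrib_left)
  also have "(\<Sum>d\<in>?S1. ?f d) = mu_sum (insert p T) g X" by (simp add: mu_sum_def)
  finally show ?thesis by simp
qed

text \<open>Matches the recursion of \<open>mu_sum_insert\<close>, which descends along X, X / p, X
  / p^2, ... until the argument drops below 1 and the sum is empty.\<close>

lemma nat_scale_induct [consumes 1, case_names small step]: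
  fixes p :: real
  assumes "p > 1" "\<And>X. X < 1 \<Longrightarrow> P X" "\<And>X. X \<ge> 1 \<Longrightarrow> P (X / p) \<Longrightarrow> P X"
  shows "P X"
proof -
  have "\<forall>X < p ^ n. P X" for n
  proof (induction n)
    case (Suc n)
    show ?case
    proof (intro allI impI)
      fix X assume X: "X < p ^ Suc n"
      show "P X"
      proof (cases "X < 1")
        case False
        have "X / p < p ^ n" using X assms(1) by (simp add: field_simps)
        then show ?thesis using Suc assms(3)[of X] False by auto
      qed (rule assms(2))
    qed
  qed (use assms(2) in auto)
  moreover obtain n where "X < p ^ n" using real_arch_pow[OF assms(1)] by blast
  ultimately show ?thesis by blast
qed

section \<open>Transfer to integers free of finitely many primes\<close>

text \<open>This is n / phi(n) when T is the set of prime factors of n; it is the fixed point of the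
  recursion k = kap T + k / p for the main term.\<close>

definition kap :: "nat set \<Rightarrow> real" where
  "kap T = (\<Prod>p\<in>T. real p / (real p - 1))"

text \<open>The counterpart of \<open>kap\<close> at exponent 1/2: it governs errors of order
  X^(-1/2), for which passing to X / p and dividing by p multiplies by p^(-1/2).\<close>

definition kaph :: "nat set \<Rightarrow> real" where
  "kaph T = (\<Prod>p\<in>T. 1 / (1 - real p powr (-1/2)))"

lemma prime_powr_half_less: "prime p \<Longrightarrow> real p powr (-1/2) < 1"
  using prime_gt_1_nat[of p] by (subst powr_less_one) auto

lemma kap_ge_1: "(\<And>p. p \<in> T \<Longrightarrow> prime p) \<Longrightarrow> kap T \<ge> 1"
  unfolding kap_def using prime_gt_1_nat by (intro prod_ge_1) (force simp: field_simps)

lemma kap_le_kaph: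
  assumes "\<And>p. p \<in> T \<Longrightarrow> prime p"
  shows "kap T \<le> kaph T"
  unfolding kap_def kaph_def
proof (intro prod_mono conjI)
  fix p assume "p \<in> T"
  then have p: "prime p" "real p > 1" using assms prime_gt_1_nat by auto
  then show "0 \<le> real p / (real p - 1)" by simp
  have "real p powr (-1) \<le> real p powr (-1/2)" using p by (intro powr_mono) auto
  then have "1 / real p \<le> real p powr (-1/2)" using p by (simp add: powr_minus_divide)
  then have "1 / (1 - 1 / real p) \<le> 1 / (1 - real p powr (-1/2))"
    using prime_powr_half_less[OF p(1)] p by (intro divide_left_mono mult_pos_pos) auto
  also have "1 / (1 - 1 / real p) = real p / (real p - 1)" using p by (simp add: field_simps)
  finally show "real p / (real p - 1) \<le> 1 / (1 - real p powr (-1/2))" .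
qed

text \<open>Adding p to T turns a bound C * kap T into C * kap T + C * kap (insert p T) / p, which
  is exactly C * kap (insert p T), so the bound reproduces itself along the descent.\<close>

lemma abs_mu_sum_le:
  assumes T: "finite T" "\<And>q. q \<in> T \<Longrightarrow> prime q" and C: "\<And>X. \<bar>mu_sum {} g X\<bar> \<le> C"
  shows "\<bar>mu_sum T g X\<bar> \<le> C * kap T"
  using T
proof (induction T arbitrary: X rule: finite_induct)
  case empty
  then show ?case using C by (simp add: kap_def)
next
  case (insert p T)
  have p: "prime p" "real p > 1" using insert prime_gt_1_nat by auto
  have C0: "C \<ge> 0" using C[of 0] by simp
  have k: "kap (insert p T) = real p / (real p - 1) * kap T" using insert by (simp add: kap_def)
  have k0: "kap T \<ge> 1" using insert by (intro kap_ge_1) auto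
  from p(2) show ?case
  proof (induction X rule: nat_scale_induct)
    case (small X)
    then show ?case using C0 k k0 p by (simp add: mu_sum_less_1)
  next
    case (step X)
    have "mu_sum (insert p T) g X = mu_sum T g X + mu_sum (insert p T) g (X / real p) / real p"
      using insert by (intro mu_sum_insert) auto
    also have "\<bar>\<dots>\<bar> \<le> \<bar>mu_sum T g X\<bar> + \<bar>mu_sum (insert p T) g (X / real p)\<bar> / real p"
      using abs_triangle_ineq[of "mu_sum T g X" "mu_sum (insert p T) g (X / real p) / real p"] by simp
    also have "\<dots> \<le> C * kap T + C * kap (insert p T) / real p"
      using insert step p by (intro add_mono divide_right_mono) auto
    also have "\<dots> = C * kap (insert p T)" using p by (simp add: k field_simps)
    finally show ?case .
  qed
qed

text \<open>Main term and error satisfy separate recursions, with fixed points \<open>kap\<close>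
  and \<open>kaph\<close>. The base of the descent is X < 1, where the sum is 0 and the whole main
  term has to fit into the error: there X^(-1/2) >= 1, C >= 1 and kap <= kaph.\<close>

lemma mu_sum_approx_kap:
  assumes T: "finite T" "\<And>q. q \<in> T \<Longrightarrow> prime q"
    and C: "\<And>X. X > 0 \<Longrightarrow> \<bar>mu_sum {} g X - 1\<bar> \<le> e + C * X powr (-1/2)" and C1: "C \<ge> 1" "e \<ge> 0"
    and X: "X > 0"
  shows "\<bar>mu_sum T g X - kap T\<bar> \<le> e * kap T + C * kaph T * X powr (-1/2)"
  using T X
proof (induction T arbitrary: X rule: finite_induct)
  case empty
  then show ?case using C by (simp add: kap_def kaph_def)
next
  case (insert p T)
  have p: "prime p" "real p > 1" using insert prime_gt_1_nat by auto
  define h where "h = real p powr (-1/2)"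
  have h: "0 < h" "h < 1" using p prime_powr_half_less by (auto simp: h_def)
  have hp: "real p powr (1/2) / real p = h"
    using p by (simp add: h_def powr_minus_divide powr_half_sqrt real_div_sqrt field_simps)
  let ?T = "insert p T"
  have k: "kap ?T = real p / (real p - 1) * kap T" using insert by (simp add: kap_def)
  have kh: "kaph ?T = kaph T / (1 - h)" using insert by (simp add: kaph_def h_def)
  have k1: "kap ?T \<le> kaph ?T" "kap ?T \<ge> 1" "kap T \<ge> 1" using insert by (intro kap_le_kaph kap_ge_1; auto)+
  have "X > 0 \<longrightarrow> \<bar>mu_sum ?T g X - kap ?T\<bar> \<le> e * kap ?T + C * kaph ?T * X powr (-1/2)"
    using p(2)
  proof (induction X rule: nat_scale_induct)
    case (small X)
    show ?case
    proof
      assume X: "X > 0"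
      have "1 \<le> X powr (-1/2)" using X small ge_one_powr_ge_zero[of "1/X" "1/2"] 
        by (simp add: powr_divide powr_minus_divide)
      then have "1 * kaph ?T * 1 \<le> C * kaph ?T * X powr (-1/2)"
        using C1 k1 by (intro mult_mono) auto
      then show "\<bar>mu_sum ?T g X - kap ?T\<bar> \<le> e * kap ?T + C * kaph ?T * X powr (-1/2)"
      proof -
        have "\<bar>mu_sum ?T g X - kap ?T\<bar> = kap ?T" using small k1 by (simp add: mu_sum_less_1)
        moreover have "e * kap ?T \<ge> 0" using C1 k1 by simp
        ultimately show ?thesis using \<open>1 * kaph ?T * 1 \<le> _\<close> k1 by linarith
      qed
    qed
  next
    case (step X)
    have X: "X > 0" using step by simp
    have "mu_sum ?T g X - kap ?T = (mu_sum T g X - kap T) + (mu_sum ?T g (X / real p) - kap ?T) / real p"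
    proof -
      have "kap T + kap ?T / real p = kap ?T" using p by (simp add: k field_simps)
      moreover have "mu_sum ?T g X = mu_sum T g X + mu_sum ?T g (X / real p) / real p"
        using insert by (intro mu_sum_insert) auto
      ultimately show ?thesis by (simp add: diff_divide_distrib)
    qed
    also have "\<bar>\<dots>\<bar> \<le> \<bar>mu_sum T g X - kap T\<bar> + \<bar>mu_sum ?T g (X / real p) - kap ?T\<bar> / real p"
      using abs_triangle_ineq[of "mu_sum T g X - kap T" "(mu_sum ?T g (X / real p) - kap ?T) / real p"] by simp
    also have "\<dots> \<le> (e * kap T + C * kaph T * X powr (-1/2))
        + (e * kap ?T + C * kaph ?T * (X / real p) powr (-1/2)) / real p"
      using insert step p X by (intro add_mono divide_right_mono) auto
    also have "(X / real p) powr (-1/2) = X powr (-1/2) * real p powr (1/2)"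
      using p X by (simp add: powr_divide powr_minus_divide field_simps)
    also have "(e * kap T + C * kaph T * X powr (-1/2))
        + (e * kap ?T + C * kaph ?T * (X powr (-1/2) * real p powr (1/2))) / real p
        = e * (kap T + kap ?T / real p) + C * X powr (-1/2) * (kaph T + kaph ?T * (real p powr (1/2) / real p))"
      by (simp add: field_simps add_divide_distrib)
    also have "kap T + kap ?T / real p = kap ?T" using p by (simp add: k field_simps)
    also have "kaph T + kaph ?T * (real p powr (1/2) / real p) = kaph ?T" 
      unfolding hp using h by (simp add: kh field_simps)
    finally show ?case by (simp add: mult.commute mult.left_commute)
  qed
  then show ?case using insert by blast
qed

section \<open>Unrestricted sums with weights 1 and ln\<close>

lemma abs_mu_sum_one_le: "\<bar>mu_sum {} (\<lambda>_. 1) X\<bar> \<le> 2"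
proof (cases "X \<ge> 1")
  case True
  have "{d. 1 \<le> d \<and> real d \<le> X \<and> (\<forall>p\<in>{}. \<not> p dvd d)} = {1..nat \<lfloor>X\<rfloor>}"
    using True by (auto simp: le_nat_floor) linarith
  then show ?thesis using abs_sum_moebius_mu_over_le unfolding mu_sum_def by simp
qed (simp add: mu_sum_less_1)

lemma nat_floor_divide: "X \<ge> 0 \<Longrightarrow> nat \<lfloor>X / real n\<rfloor> = nat \<lfloor>X\<rfloor> div n"
proof -
  assume "X \<ge> 0"
  have "\<lfloor>X / real_of_int (int n)\<rfloor> = \<lfloor>X\<rfloor> div int n" by (rule floor_divide_real_eq_div) simp
  then show ?thesis using \<open>X \<ge> 0\<close> by (simp add: nat_div_distrib)
qed

text \<open>The function t * ln t is replaced by t * H(t) - gamma * floor t, with H the harmonic sum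
  up to t. Its Moebius sums are exact: sum mu(n) / n * H(x / n) = 1 and sum mu(n) * floor(x / n) =
  1. The difference of the two functions is bounded and satisfies the assumptions of Axer's
  argument.\<close>

lemma mu_sum_ln_tendsto:
  assumes M: "(\<lambda>n. (\<Sum>k=1..n. moebius_mu k) / real n) \<longlonglongrightarrow> 0" and e: "e > 0"
  shows "\<exists>X0\<ge>1. \<forall>X\<ge>X0. \<bar>mu_sum {} ln X - 1\<bar> \<le> e"
proof -
  define H where "H t = (harm (nat \<lfloor>t\<rfloor>) :: real)" for t :: real
  define \<gamma> where "\<gamma> = (euler_mascheroni :: real)"
  define \<rho> where "\<rho> t = t * H t - \<gamma> * real (nat \<lfloor>t\<rfloor>) - t * ln t" for t
  have Hk: "H t = harm k" "nat \<lfloor>t\<rfloor> = k" if "real k \<le> t" "t < real k + 1" for k t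
  proof -
    have "\<lfloor>t\<rfloor> = int k" using that by linarith
    then show "nat \<lfloor>t\<rfloor> = k" by simp
    then show "H t = harm k" by (simp add: H_def)
  qed
  have harm_up: "harm k \<le> 1 + ln (real k)" if "k \<ge> 1" for k
    using sum_inverse_upto_le[OF that] by (simp add: harm_def inverse_eq_divide)
  \<comment> \<open>Between consecutive integers \<open>\<rho>\<close> has derivative H_k - ln x -
    1, which lies in [-1, 0] since ln x <= H_k <= 1 + ln x there.\<close>
  have lip: "\<bar>\<rho> s - \<rho> t\<bar> \<le> 1 * (t - s)" if "k \<ge> 1" "real k \<le> s" "s \<le> t" "t < real k + 1" for k s t
  proof (cases "s = t")
    case False
    then have st: "s < t" using that by simp
    define F where "F x = x * harm k - x * ln x" for x :: real
    have "\<exists>z. s < z \<and> z < t \<and> F t - F s = (t - s) * (harm k - ln z - 1)"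
    proof (rule MVT2[OF st])
      fix x assume x: "s \<le> x" "x \<le> t"
      then have "x > 0" using that by simp
      then show "DERIV F x :> harm k - ln x - 1"
        unfolding F_def by (auto intro!: derivative_eq_intros)
    qed
    then obtain z where z: "s < z" "z < t" "F t - F s = (t - s) * (harm k - ln z - 1)" by blast
    have "ln z \<le> ln (real k + 1)" using z that by (intro ln_mono) auto
    then have l: "ln z \<le> harm k" using ln_le_harm[of k] by linarith
    have "ln (real k) \<le> ln z" using z that by (intro ln_mono) auto
    then have "harm k \<le> 1 + ln z" using harm_up[OF that(1)] by linarith
    then have a: "\<bar>harm k - ln z - 1\<bar> \<le> 1" using l by (simp add: abs_le_iff)
    have "\<rho> s - \<rho> t = - (F t - F s)"
      using that by (simp add: \<rho>_def F_def Hk[of k s] Hk[of k t])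
    then have "\<bar>\<rho> s - \<rho> t\<bar> = (t - s) * \<bar>harm k - ln z - 1\<bar>" using z st by (simp add: abs_mult)
    also have "\<dots> \<le> (t - s) * 1" using a st by (intro mult_left_mono) auto
    finally show ?thesis by simp
  qed simp
  \<comment> \<open>At an integer k the value is k * (H_k - gamma - ln k), which lies in [0, 1]; up
    to the next integer it changes by at most 1.\<close>
  have B: "\<bar>\<rho> t\<bar> \<le> 2" if t: "t \<ge> 1" for t
  proof -
    define k where "k = nat \<lfloor>t\<rfloor>"
    have k: "k \<ge> 1" "real k \<le> t" "t < real k + 1" using t by (auto simp: k_def le_nat_floor)
    have "\<bar>\<rho> (real k) - \<rho> t\<bar> \<le> t - real k" using lip[of k "real k" t] k by simp
    moreover have "0 \<le> \<rho> (real k) \<and> \<rho> (real k) \<le> 1"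
    proof -
      have r: "\<rho> (real k) = real k * (harm k - \<gamma> - ln (real k))"
        by (simp add: \<rho>_def H_def algebra_simps)
      have g: "harm k - ln (real (Suc k)) + inverse (real (2 * (k+1))) \<le> \<gamma>"
          "\<gamma> \<le> harm k - ln (real (Suc k)) + inverse (real (2 * k))"
        using euler_mascheroni_bounds[OF k(1)] by (auto simp: \<gamma>_def)
      have "ln (real (Suc k)) - ln (real k) = ln (1 + 1 / real k)"
      proof -
        have "ln (real (Suc k)) - ln (real k) = ln (real (Suc k) / real k)" using k by (simp add: ln_div)
        also have "real (Suc k) / real k = 1 + 1 / real k" using k by (simp add: field_simps)
        finally show ?thesis .
      qed
      also have "\<dots> \<le> 1 / real k" using k by (intro ln_add_one_self_le_self) auto
      finally have u: "ln (real (Suc k)) - ln (real k) \<le> 1 / real k" .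
      have "ln (real k / real (Suc k)) \<le> real k / real (Suc k) - 1"
        using k by (intro ln_le_minus_one) auto
      then have "ln (real (Suc k)) - ln (real k) \<ge> 1 / real (Suc k)"
        using k by (simp add: ln_div field_simps)
      moreover have "1 / real (Suc k) \<ge> inverse (real (2 * k))" using k by (simp add: field_simps)
      ultimately have l: "ln (real (Suc k)) - ln (real k) \<ge> inverse (real (2 * k))" by linarith
      have "0 \<le> harm k - \<gamma> - ln (real k)" using g l by linarith
      moreover have "harm k - \<gamma> - ln (real k) \<le> 1 / real k"
      proof -
        have "inverse (real (2 * (k + 1))) \<ge> 0" by simp
        then show ?thesis using g u by linarith
      qed
      then have "real k * (harm k - \<gamma> - ln (real k)) \<le> real k * (1 / real k)" by (intro mult_left_mono) auto
      ultimately show ?thesis unfolding r using k by simp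
    qed
    ultimately show ?thesis using k by linarith
  qed
  have "\<exists>X1\<ge>1. \<forall>X\<ge>X1. \<bar>\<Sum>n | 1 \<le> (n::nat) \<and> real n \<le> X. moebius_mu n * \<rho> (X / real n)\<bar> \<le> e / 2 * X"
  proof (rule axer_moebius[OF M])
    show "\<bar>\<rho> t\<bar> \<le> 2" if "t \<ge> 1" for t using B[OF that] .
    show "\<bar>\<rho> s - \<rho> t\<bar> \<le> 2 * (t - s)" if "k \<ge> 1" "real k \<le> s" "s \<le> t" "t < real k + 1" for k s t
      using lip[OF that] that by linarith
  qed (use e in simp)
  then obtain X1 where X1: "X1 \<ge> 1" "\<And>X. X \<ge> X1 \<Longrightarrow>
     \<bar>\<Sum>n | 1 \<le> (n::nat) \<and> real n \<le> X. moebius_mu n * \<rho> (X / real n)\<bar> \<le> e / 2 * X" by blast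
  \<comment> \<open>The second bound makes the leftover term gamma at most e / 2 * X.\<close>
  define X0 where "X0 = max X1 (2 * \<gamma> / e)"
  have "\<bar>mu_sum {} ln X - 1\<bar> \<le> e" if X: "X \<ge> X0" for X
  proof -
    have x1: "X \<ge> 1" "X \<ge> X1" using X X1 by (auto simp: X0_def)
    have x2: "\<gamma> \<le> e / 2 * X" using X e by (simp add: X0_def field_simps)
    define x where "x = nat \<lfloor>X\<rfloor>"
    have x: "x \<ge> 1" using x1 by (simp add: x_def le_nat_floor)
    have set_eq: "{d. 1 \<le> d \<and> real d \<le> X} = {1..x}"
      using x1 by (auto simp: x_def le_nat_floor) linarith
    have fl: "nat \<lfloor>X / real n\<rfloor> = x div n" for n unfolding x_def using x1 by (intro nat_floor_divide) simp
    have "X * mu_sum {} ln X = (\<Sum>n=1..x. moebius_mu n * (X / real n * ln (X / real n)))"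
      unfolding mu_sum_def using set_eq by (simp add: sum_distrib_left field_simps)
    also have "\<dots> = (\<Sum>n=1..x. X * (moebius_mu n / real n * harm (x div n))
        - \<gamma> * (moebius_mu n * real (x div n)) - moebius_mu n * \<rho> (X / real n))"
      by (intro sum.cong refl) (simp add: \<rho>_def H_def fl algebra_simps)
    also have "\<dots> = X * (\<Sum>n=1..x. moebius_mu n / real n * harm (x div n))
        - \<gamma> * (\<Sum>n=1..x. moebius_mu n * real (x div n)) - (\<Sum>n=1..x. moebius_mu n * \<rho> (X / real n))"
      by (simp only: sum_subtractf sum_distrib_left)
    also have "(\<Sum>n=1..x. moebius_mu n * real (x div n)) = 1" by (rule sum_moebius_mu_div[OF x])
    also have "(\<Sum>n=1..x. moebius_mu n / real n * harm (x div n)) = 1"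
    proof -
      have "(\<Sum>n=1..x. moebius_mu n / real n * harm (x div n))
          = (\<Sum>d=1..x. moebius_mu d / real d * (\<Sum>k=1..x div d. 1 / real k))"
        by (simp add: harm_def inverse_eq_divide)
      also have "\<dots> = (\<Sum>n=1..x. \<Sum>d | d dvd n. moebius_mu d / real d * (1 / real (n div d)))"
        by (rule sum_divisors_upto[symmetric])
      also have "\<dots> = (\<Sum>n=1..x. \<Sum>d | d dvd n. moebius_mu d / real n)"
      proof (intro sum.cong refl)
        fix n d :: nat assume "d \<in> {d. d dvd n}"
        then have "real n = real d * real (n div d)" by (metis dvd_mult_div_cancel mem_Collect_eq of_nat_mult)
        then show "moebius_mu d / real d * (1 / real (n div d)) = moebius_mu d / real n" by simp
      qed
      also have "\<dots> = (\<Sum>n=1..x. if n = 1 then 1 else 0)"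
        by (intro sum.cong refl) (auto simp: sum_divide_distrib[symmetric] sum_moebius_mu_divisors)
      also have "\<dots> = 1" using x by simp
      finally show ?thesis .
    qed
    finally have "X * mu_sum {} ln X - X = - \<gamma> - (\<Sum>n=1..x. moebius_mu n * \<rho> (X / real n))" by simp
    moreover have "\<bar>\<Sum>n=1..x. moebius_mu n * \<rho> (X / real n)\<bar> \<le> e / 2 * X"
      using X1(2)[OF x1(2)] set_eq by simp
    moreover have "\<gamma> > 0" by (simp add: \<gamma>_def euler_mascheroni_pos)
    ultimately have "\<bar>X * mu_sum {} ln X - X\<bar> \<le> X * e" using x2 by (simp add: abs_le_iff field_simps) linarith
    moreover have "X * mu_sum {} ln X - X = X * (mu_sum {} ln X - 1)" by (simp add: algebra_simps)
    ultimately have "X * \<bar>mu_sum {} ln X - 1\<bar> \<le> X * e" using x1 by (simp add: abs_mult)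
    then show ?thesis using x1 by simp
  qed
  moreover have "X0 \<ge> 1" using X1 by (simp add: X0_def)
  ultimately show ?thesis by blast
qed

lemma abs_mu_sum_ln_trivial:
  assumes "X \<le> X0" "X0 \<ge> 1"
  shows "\<bar>mu_sum {} ln X\<bar> \<le> (1 + ln X0) * ln X0"
proof (cases "X \<ge> 1")
  case True
  have "\<bar>mu_sum {} ln X\<bar> \<le> (\<Sum>d | 1 \<le> d \<and> real d \<le> X \<and> (\<forall>p\<in>{}. \<not> p dvd d). 1 / real d * ln X0)"
    unfolding mu_sum_def
  proof (rule order_trans[OF sum_abs sum_mono])
    fix d assume d: "d \<in> {d. 1 \<le> d \<and> real d \<le> X \<and> (\<forall>p\<in>{}. \<not> p dvd d)}"
    have 1: "0 \<le> ln (X / real d)" using d by (intro ln_ge_zero) auto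
    have "X / real d \<le> X / 1" using d True by (intro divide_left_mono) auto
    then have "ln (X / real d) \<le> ln X0" using assms d True by (intro ln_mono) (auto simp: zero_less_divide_iff)
    then have "\<bar>moebius_mu d\<bar> * (1 / real d * ln (X / real d)) \<le> 1 * (1 / real d * ln X0)"
      using 1 abs_moebius_mu_le by (intro mult_mono divide_right_mono) auto
    then show "\<bar>moebius_mu d / real d * ln (X / real d)\<bar> \<le> 1 / real d * ln X0"
      using 1 by (simp add: abs_mult)
  qed
  also have "\<dots> = (\<Sum>d | 1 \<le> d \<and> real d \<le> X. 1 / real d) * ln X0" by (simp add: sum_distrib_right)
  also have "\<dots> \<le> (1 + ln X0) * ln X0"
  proof (rule mult_right_mono)
    have "ln X \<le> ln X0" using True assms by (intro ln_mono) auto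
    then show "(\<Sum>d | 1 \<le> d \<and> real d \<le> X. 1 / real d) \<le> 1 + ln X0"
      using sum_inverse_real_le[OF True] by linarith
  qed (use assms in auto)
  finally show ?thesis .
qed (use assms in \<open>auto simp: mu_sum_less_1\<close>)

text \<open>Below the threshold X0 the crude bound is inflated by sqrt(X0 / X) >= 1, which turns it
  into a multiple of X^(-1/2). In this form the estimate holds for every X > 0, even where the sum
  is empty, as the descent X, X / p, ... requires.\<close>

lemma mu_sum_ln_approx:
  assumes M: "(\<lambda>n. (\<Sum>k=1..n. moebius_mu k) / real n) \<longlonglongrightarrow> 0" and e: "e > 0"
  shows "\<exists>C\<ge>1. \<forall>X>0. \<bar>mu_sum {} ln X - 1\<bar> \<le> e + C * X powr (-1/2)"
proof -
  obtain X0 where X0: "X0 \<ge> 1" "\<And>X. X \<ge> X0 \<Longrightarrow> \<bar>mu_sum {} ln X - 1\<bar> \<le> e"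
    using mu_sum_ln_tendsto[OF M e] by blast
  define C where "C = ((1 + ln X0) * ln X0 + 1) * sqrt X0"
  have l: "(1 + ln X0) * ln X0 \<ge> 0" using X0 by simp
  have "1 * 1 \<le> ((1 + ln X0) * ln X0 + 1) * sqrt X0"
    using X0 l by (intro mult_mono) auto
  then have C: "C \<ge> 1" by (simp add: C_def)
  have "\<bar>mu_sum {} ln X - 1\<bar> \<le> e + C * X powr (-1/2)" if X: "X > 0" for X
  proof (cases "X \<ge> X0")
    case True
    then show ?thesis using X0(2)[OF True] C by (intro order_trans[OF X0(2)]) auto
  next
    case False
    have "\<bar>mu_sum {} ln X - 1\<bar> \<le> (1 + ln X0) * ln X0 + 1"
      using abs_mu_sum_ln_trivial[of X X0] False X0 by linarith
    also have "\<dots> = C / sqrt X0" using X0 by (simp add: C_def)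
    also have "\<dots> \<le> C / sqrt X" using C X False X0 by (intro divide_left_mono) auto
    also have "\<dots> = C * X powr (-1/2)" using X by (simp add: powr_minus_divide powr_half_sqrt)
    finally show ?thesis using e by linarith
  qed
  then show ?thesis using C by blast
qed

lemma abs_mu_sum_ln_bounded:
  assumes M: "(\<lambda>n. (\<Sum>k=1..n. moebius_mu k) / real n) \<longlonglongrightarrow> 0"
  shows "\<exists>C\<ge>0. \<forall>X. \<bar>mu_sum {} ln X\<bar> \<le> C"
proof -
  obtain X0 where X0: "X0 \<ge> 1" "\<And>X. X \<ge> X0 \<Longrightarrow> \<bar>mu_sum {} ln X - 1\<bar> \<le> 1"
    using mu_sum_ln_tendsto[OF M, of 1] by auto
  have l: "(1 + ln X0) * ln X0 \<ge> 0" using X0 by simp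
  have "\<bar>mu_sum {} ln X\<bar> \<le> (1 + ln X0) * ln X0 + 2" for X
  proof (cases "X \<ge> X0")
    case True
    then show ?thesis using X0(2)[OF True] l by linarith
  next
    case False
    then show ?thesis using abs_mu_sum_ln_trivial[of X X0] X0 by linarith
  qed
  then show ?thesis using l by (intro exI[of _ "(1 + ln X0) * ln X0 + 2"]) auto
qed

section \<open>An upper bound sieve\<close>

lemma card_cong_class:
  fixes b q J N :: nat
  assumes b: "b \<ge> 1" and cop: "coprime q b"
  shows "\<bar>real (card {j\<in>{1..J}. [q * j = N] (mod b)}) - real J / real b\<bar> \<le> 1"
proof -
  obtain x where x: "[q * x = Suc 0] (mod b)" using cong_solve_coprime_nat[OF cop] by auto
  \<comment> \<open>The representative is taken in {1..b} and not in {0..<b}, because j starts at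
    1.\<close>
  define r where "r = (if (x * N) mod b = 0 then b else (x * N) mod b)"
  have r: "1 \<le> r" "r \<le> b" using b by (auto simp: r_def Suc_le_eq less_imp_le)
  have rx: "[r = x * N] (mod b)" by (auto simp: r_def cong_def)
  have iff: "[q * j = N] (mod b) \<longleftrightarrow> [j = r] (mod b)" for j
  proof -
    have "[q * r = N] (mod b)"
    proof -
      have "[q * r = q * (x * N)] (mod b)" using rx by (rule cong_scalar_left)
      also have "q * (x * N) = (q * x) * N" by simp
      also have "[(q * x) * N = Suc 0 * N] (mod b)" using x by (rule cong_scalar_right)
      finally show ?thesis by simp
    qed
    then have "[q * j = N] (mod b) \<longleftrightarrow> [q * j = q * r] (mod b)"
      by (metis cong_sym cong_trans)
    also have "\<dots> \<longleftrightarrow> [j = r] (mod b)" using cop by (simp add: cong_mult_lcancel_nat)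
    finally show ?thesis .
  qed
  show ?thesis
  proof (cases "r \<le> J")
    case True
    have "{j\<in>{1..J}. [q * j = N] (mod b)} = (\<lambda>i. r + b * i) ` {..(J - r) div b}"
    proof (rule Set.set_eqI)
      fix j
      show "j \<in> {j\<in>{1..J}. [q * j = N] (mod b)} \<longleftrightarrow> j \<in> (\<lambda>i. r + b * i) ` {..(J - r) div b}"
      proof
        assume "j \<in> {j\<in>{1..J}. [q * j = N] (mod b)}"
        then have j: "1 \<le> j" "j \<le> J" "[j = r] (mod b)" using iff by auto
        have "r \<le> j"
        proof (rule ccontr)
          assume "\<not> r \<le> j"
          then have "b dvd r - j" using j(3) cong_altdef_nat[of j r b] by (simp add: cong_sym_eq)
          then have "b \<le> r - j" using \<open>\<not> r \<le> j\<close> by (intro dvd_imp_le) auto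
          then show False using j r by linarith
        qed
        then obtain i where i: "j = r + b * i" using j(3)
          by (metis cong_le_nat add.commute mult.commute)
        have "i \<le> (J - r) div b" using i j b by (subst less_eq_div_iff_mult_less_eq) (auto simp: mult.commute)
        then show "j \<in> (\<lambda>i. r + b * i) ` {..(J - r) div b}" using i by blast
      next
        assume "j \<in> (\<lambda>i. r + b * i) ` {..(J - r) div b}"
        then obtain i where i: "j = r + b * i" "i \<le> (J - r) div b" by auto
        then have "b * i \<le> J - r" using b by (subst (asm) less_eq_div_iff_mult_less_eq) (auto simp: mult.commute)
        moreover have "[j = r] (mod b)" unfolding i by (simp add: cong_def)
        ultimately show "j \<in> {j\<in>{1..J}. [q * j = N] (mod b)}" using i iff True r by auto
      qed
    qed
    moreover have "inj_on (\<lambda>i. r + b * i) {..(J - r) div b}" using b by (auto simp: inj_on_def)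
    ultimately have c: "card {j\<in>{1..J}. [q * j = N] (mod b)} = (J - r) div b + 1"
      by (simp add: card_image)
    have d: "real (J - r) = real ((J - r) div b) * real b + real ((J - r) mod b)"
      by (metis div_mult_mod_eq of_nat_add of_nat_mult)
    have "(J - r) mod b < b" using b by simp
    then have m: "real ((J - r) mod b) \<le> real b" by simp
    have "real (J - r) = real J - real r" using True by simp
    then have e: "real J - real r = real ((J - r) div b) * real b + real ((J - r) mod b)" using d by simp
    have 1: "real J \<le> (real ((J - r) div b) + 2) * real b"
    proof -
      have "real r \<le> real b" using r by simp
      then show ?thesis unfolding distrib_right using e m by linarith
    qed
    have 2: "real ((J - r) div b) * real b \<le> real J"
      using e by linarith
    have "real J / real b \<le> real ((J - r) div b) + 2" using 1 b by (simp add: field_simps)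
    moreover have "real ((J - r) div b) \<le> real J / real b" using 2 b by (simp add: field_simps)
    ultimately show ?thesis unfolding c by (simp add: abs_le_iff)
  next
    case False
    have e: "{j\<in>{1..J}. [q * j = N] (mod b)} = {}"
    proof -
      have "\<not> [j = r] (mod b)" if "j \<in> {1..J}" for j
      proof
        assume "[j = r] (mod b)"
        then have "b dvd r - j" using that False cong_altdef_nat[of j r b] by (simp add: cong_sym_eq)
        then have "b \<le> r - j" using that False by (intro dvd_imp_le) auto
        then show False using that r by auto
      qed
      then show ?thesis using iff by auto
    qed
    have "real J / real b \<le> 1" using False r b by simp
    then show ?thesis unfolding e by simp
  qed
qed

section \<open>Selberg's weights and their quadratic form\<close>

definition sieve_support :: "nat \<Rightarrow> nat \<Rightarrow> nat set" where
  "sieve_support R q = {b\<in>{1..R}. squarefree b \<and> coprime b q}"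

definition sieve_mass :: "nat \<Rightarrow> nat \<Rightarrow> real" where
  "sieve_mass R q = (\<Sum>c\<in>sieve_support R q. 1 / real (totient c))"

text \<open>Selberg's optimal weights for the density 1 / b: they minimise the quadratic form
  evaluated below under the constraint that the weight at 1 equals 1.\<close>

definition sieve_weight :: "nat \<Rightarrow> nat \<Rightarrow> nat \<Rightarrow> real" where
  "sieve_weight R q b = real b * moebius_mu b / sieve_mass R q *
     (\<Sum>c | c \<in> sieve_support R q \<and> b dvd c. 1 / real (totient c))"

lemma finite_sieve_support [simp]: "finite (sieve_support R q)"
  by (simp add: sieve_support_def)

lemma sieve_support_dvd:
  assumes c: "c \<in> sieve_support R q" and b: "b dvd c"
  shows "b \<in> sieve_support R q"
proof -
  have c0: "c > 0" "squarefree c" "coprime c q" "c \<le> R" using c by (auto simp: sieve_support_def)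
  have "b > 0" using b c0 dvd_pos_nat by blast
  moreover have "b \<le> R" using dvd_imp_le[OF b] c0 by simp
  moreover have "squarefree b" using squarefree_mono[OF b] c0 by simp
  moreover have "coprime b q" using coprime_divisors[OF b dvd_refl] c0 by simp
  ultimately show ?thesis by (simp add: sieve_support_def Suc_le_eq)
qed

lemma one_in_sieve_support: "R \<ge> 1 \<Longrightarrow> 1 \<in> sieve_support R q"
  by (simp add: sieve_support_def)

lemma sieve_mass_pos: "R \<ge> 1 \<Longrightarrow> sieve_mass R q > 0"
  unfolding sieve_mass_def using one_in_sieve_support[of R q]
  by (intro sum_pos finite_sieve_support) (blast, simp add: sieve_support_def)

lemma sieve_weight_1: "R \<ge> 1 \<Longrightarrow> sieve_weight R q 1 = 1"
  using sieve_mass_pos[of R q] by (simp add: sieve_weight_def sieve_mass_def)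

text \<open>A crude bound. It leads to the error R^4 in the sieve, harmless because R will be a
  small power of the length of the progression.\<close>

lemma abs_sieve_weight_le: 
  assumes "R \<ge> 1"
  shows "\<bar>sieve_weight R q b\<bar> \<le> real b"
proof -
  let ?s = "\<Sum>c | c \<in> sieve_support R q \<and> b dvd c. 1 / real (totient c)"
  have pos: "sieve_mass R q > 0" using sieve_mass_pos[OF assms] .
  have "0 \<le> ?s" by (intro sum_nonneg) auto
  moreover have "?s \<le> sieve_mass R q" unfolding sieve_mass_def by (intro sum_mono2) auto
  ultimately have "?s / sieve_mass R q \<le> 1" "0 \<le> ?s / sieve_mass R q" using pos by auto
  moreover have "sieve_weight R q b = moebius_mu b * (real b * (?s / sieve_mass R q))"
    by (simp add: sieve_weight_def)
  ultimately have "\<bar>sieve_weight R q b\<bar> \<le> \<bar>real b * (?s / sieve_mass R q)\<bar>"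
    using abs_moebius_mu_mult_le by metis
  also have "\<dots> \<le> real b * 1"
    using \<open>?s / _ \<le> 1\<close> \<open>0 \<le> ?s / _\<close> unfolding abs_mult abs_of_nat by (intro mult_left_mono) auto
  finally show ?thesis by simp
qed

text \<open>After exchanging b and c the inner sum runs over l | b | c, that is mu(l) times the
  Moebius sum over the divisors of c / l, so only c = l survives. These sums are the variables that
  diagonalise the quadratic form.\<close>

lemma sum_sieve_weight_multiples:
  assumes R: "R \<ge> 1" and l: "l \<in> sieve_support R q"
  shows "(\<Sum>b | b \<in> sieve_support R q \<and> l dvd b. sieve_weight R q b / real b)
       = moebius_mu l / (real (totient l) * sieve_mass R q)"
proof -
  let ?D = "sieve_support R q" and ?L = "sieve_mass R q"
  have "(\<Sum>b | b \<in> ?D \<and> l dvd b. sieve_weight R q b / real b)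
      = (\<Sum>b | b \<in> ?D \<and> l dvd b. \<Sum>c | c \<in> ?D \<and> b dvd c. moebius_mu b / ?L * (1 / real (totient c)))"
    unfolding sieve_weight_def sum_distrib_left
    by (intro sum.cong refl) (auto simp: sieve_support_def sum_divide_distrib field_simps intro!: sum.cong)
  also have "\<dots> = (\<Sum>c\<in>?D. \<Sum>b | b \<in> ?D \<and> l dvd b \<and> b dvd c. moebius_mu b / ?L * (1 / real (totient c)))"
  proof -
    have "(\<Sum>b | b \<in> ?D \<and> l dvd b. \<Sum>c | c \<in> ?D \<and> b dvd c. moebius_mu b / ?L * (1 / real (totient c)))
       = (\<Sum>c\<in>?D. \<Sum>b | b \<in> {b. b \<in> ?D \<and> l dvd b} \<and> b dvd c. moebius_mu b / ?L * (1 / real (totient c)))"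
      by (rule sum.swap_restrict) auto
    then show ?thesis by (simp add: conj_assoc)
  qed
  also have "\<dots> = (\<Sum>c\<in>?D. if c = l then moebius_mu l / ?L * (1 / real (totient l)) else 0)"
  proof (intro sum.cong refl)
    fix c assume c: "c \<in> ?D"
    have c0: "c > 0" using c by (simp add: sieve_support_def)
    have l0: "l > 0" using l by (simp add: sieve_support_def)
    have set_eq: "{b. b \<in> ?D \<and> l dvd b \<and> b dvd c} = {b. l dvd b \<and> b dvd c}"
      using sieve_support_dvd[OF c] by blast
    show "(\<Sum>b | b \<in> ?D \<and> l dvd b \<and> b dvd c. moebius_mu b / ?L * (1 / real (totient c)))
        = (if c = l then moebius_mu l / ?L * (1 / real (totient l)) else 0)"
    proof (cases "l dvd c")
      case True
      then obtain t where t: "c = l * t" by blast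
      have t0: "t > 0" using t c0 by (cases t) auto
      have sfc: "squarefree (l * t)" using c t by (simp add: sieve_support_def)
      have "{b. l dvd b \<and> b dvd c} = (*) l ` {s. s dvd t}"
        using t l0 by (auto elim!: dvdE)
      then have "(\<Sum>b | l dvd b \<and> b dvd c. moebius_mu b) = (\<Sum>s | s dvd t. moebius_mu (l * s))"
        using l0 by (simp add: sum.reindex inj_on_def)
      also have "\<dots> = (\<Sum>s | s dvd t. moebius_mu l * moebius_mu s)"
      proof (intro sum.cong refl)
        fix s assume "s \<in> {s. s dvd t}"
        then have s: "s dvd t" by simp
        have "coprime l t"
        proof (rule coprimeI)
          fix x assume "x dvd l" "x dvd t"
          then have "x\<^sup>2 dvd l * t" by (simp add: power2_eq_square mult_dvd_mono)
          then show "x dvd 1" using sfc by (rule squarefreeD[rotated])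
        qed
        then have "coprime l s" using s by (metis coprime_mult_right_iff dvd_def)
        then show "moebius_mu (l * s) = moebius_mu l * moebius_mu s" by (rule moebius_mu_mult)
      qed
      also have "\<dots> = moebius_mu l * (if t = 1 then 1 else 0)"
        by (simp only: sum_distrib_left[symmetric] sum_moebius_mu_divisors[OF t0])
      finally have "(\<Sum>b | l dvd b \<and> b dvd c. moebius_mu b) = (if c = l then moebius_mu l else 0)"
        using t l0 by auto
      then have "(\<Sum>b | l dvd b \<and> b dvd c. moebius_mu b) * (1 / ?L * (1 / real (totient c)))
         = (if c = l then moebius_mu l / ?L * (1 / real (totient l)) else 0)" by simp
      then show ?thesis unfolding set_eq sum_distrib_right by simp
    next
      case False
      then have e: "{b. l dvd b \<and> b dvd c} = {}" by (auto dest: dvd_trans)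
      show ?thesis unfolding set_eq e using False by auto
    qed
  qed
  also have "\<dots> = moebius_mu l / ?L * (1 / real (totient l))" using l by simp
  finally show ?thesis by (simp add: field_simps)
qed

text \<open>Since 1 / lcm = gcd / (b1 * b2) and the gcd is the sum of phi(l) over common divisors l,
  the form becomes a sum of phi(l) times squares of the sums computed in
  \<open>sum_sieve_weight_multiples\<close>.\<close>

lemma sieve_quadratic_form:
  assumes R: "R \<ge> 1"
  shows "(\<Sum>b1\<in>sieve_support R q. \<Sum>b2\<in>sieve_support R q.
      sieve_weight R q b1 * sieve_weight R q b2 / real (lcm b1 b2)) = 1 / sieve_mass R q"
proof -
  let ?D = "sieve_support R q" and ?L = "sieve_mass R q" and ?w = "sieve_weight R q"
  have one: "?w b1 * ?w b2 / real (lcm b1 b2)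
      = (\<Sum>l\<in>?D. real (totient l) * ((if l dvd b1 then ?w b1 / real b1 else 0) * (if l dvd b2 then ?w b2 / real b2 else 0)))"
    if b: "b1 \<in> ?D" "b2 \<in> ?D" for b1 b2
  proof -
    have b0: "b1 > 0" "b2 > 0" using b by (auto simp: sieve_support_def)
    have "real (gcd b1 b2) * real (lcm b1 b2) = real b1 * real b2"
      by (metis of_nat_mult prod_gcd_lcm_nat)
    then have "1 / real (lcm b1 b2) = real (gcd b1 b2) / (real b1 * real b2)"
      using b0 by (simp add: field_simps lcm_pos_nat)
    also have "real (gcd b1 b2) = (\<Sum>l | l dvd gcd b1 b2. real (totient l))"
      by (metis of_nat_sum totient_divisor_sum)
    also have "{l. l dvd gcd b1 b2} = {l\<in>?D. l dvd b1 \<and> l dvd b2}"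
      using sieve_support_dvd[OF b(1)] by auto
    finally have "1 / real (lcm b1 b2) = (\<Sum>l | l\<in>?D \<and> l dvd b1 \<and> l dvd b2. real (totient l)) / (real b1 * real b2)" .
    note h = this
    have "?w b1 * ?w b2 / real (lcm b1 b2)
       = ?w b1 * ?w b2 * ((\<Sum>l | l\<in>?D \<and> l dvd b1 \<and> l dvd b2. real (totient l)) / (real b1 * real b2))"
    proof -
      have "?w b1 * ?w b2 / real (lcm b1 b2) = ?w b1 * ?w b2 * (1 / real (lcm b1 b2))" by simp
      then show ?thesis unfolding h .
    qed
    also have "\<dots> = (\<Sum>l | l\<in>?D \<and> l dvd b1 \<and> l dvd b2. real (totient l) * (?w b1 / real b1 * (?w b2 / real b2)))"
      unfolding sum_divide_distrib sum_distrib_left by (intro sum.cong refl) simp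
    also have "\<dots> = (\<Sum>l\<in>?D. if l dvd b1 \<and> l dvd b2 then real (totient l) * (?w b1 / real b1 * (?w b2 / real b2)) else 0)"
      by (subst sum.inter_filter[symmetric]) auto
    also have "\<dots> = (\<Sum>l\<in>?D. real (totient l) * ((if l dvd b1 then ?w b1 / real b1 else 0) * (if l dvd b2 then ?w b2 / real b2 else 0)))"
      by (intro sum.cong) auto
    finally show ?thesis .
  qed
  have "(\<Sum>b1\<in>?D. \<Sum>b2\<in>?D. ?w b1 * ?w b2 / real (lcm b1 b2))
      = (\<Sum>b1\<in>?D. \<Sum>b2\<in>?D. \<Sum>l\<in>?D. real (totient l) * ((if l dvd b1 then ?w b1 / real b1 else 0) * (if l dvd b2 then ?w b2 / real b2 else 0)))"
    using one by (intro sum.cong refl) auto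
  also have "\<dots> = (\<Sum>b1\<in>?D. \<Sum>l\<in>?D. \<Sum>b2\<in>?D. real (totient l) * ((if l dvd b1 then ?w b1 / real b1 else 0) * (if l dvd b2 then ?w b2 / real b2 else 0)))"
    by (intro sum.cong refl sum.swap)
  also have "\<dots> = (\<Sum>l\<in>?D. \<Sum>b1\<in>?D. \<Sum>b2\<in>?D. real (totient l) * ((if l dvd b1 then ?w b1 / real b1 else 0) * (if l dvd b2 then ?w b2 / real b2 else 0)))"
    by (rule sum.swap)
  also have "\<dots> = (\<Sum>l\<in>?D. real (totient l) * ((\<Sum>b\<in>?D. if l dvd b then ?w b / real b else 0) * (\<Sum>b\<in>?D. if l dvd b then ?w b / real b else 0)))"
    by (intro sum.cong refl, subst sum_product) (simp only: sum_distrib_left)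
  also have "\<dots> = (\<Sum>l\<in>?D. 1 / real (totient l) / (?L * ?L))"
  proof (intro sum.cong refl)
    fix l assume l: "l \<in> ?D"
    have s: "(\<Sum>b\<in>?D. if l dvd b then ?w b / real b else 0) = moebius_mu l / (real (totient l) * ?L)"
      using sum_sieve_weight_multiples[OF R l] by (simp add: sum.inter_filter)
    have "moebius_mu l * moebius_mu l = 1" using l by (intro moebius_mu_square) (simp add: sieve_support_def)
    moreover have "totient l > 0" using l by (simp add: sieve_support_def)
    moreover have "c * (m / (c * L) * (m / (c * L))) = m * m / c / (L * L)" if "c > 0" "L > 0" for c m L :: real
      using that by (simp add: field_simps)
    ultimately show "real (totient l) * ((\<Sum>b\<in>?D. if l dvd b then ?w b / real b else 0) * (\<Sum>b\<in>?D. if l dvd b then ?w b / real b else 0))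
        = 1 / real (totient l) / (?L * ?L)"
      unfolding s using sieve_mass_pos[OF R, of q] by simp
  qed
  also have "\<dots> = ?L / (?L * ?L)" unfolding sieve_mass_def by (simp add: sum_divide_distrib)
  finally show ?thesis using sieve_mass_pos[OF R, of q] by simp
qed

section \<open>Lower bound for the sieve mass\<close>

text \<open>Multiples b = p * k contribute 1 / (p - 1) times the terms 1 / phi(k), and k also lies
  below R. So readmitting the prime p costs at most the factor 1 + 1 / (p - 1).\<close>

lemma squarefree_totient_sum_insert:
  assumes T: "\<And>q. q \<in> T \<Longrightarrow> prime q" and p: "prime p" "p \<notin> T"
  shows "(\<Sum>b | b \<in> {1..R} \<and> squarefree b \<and> (\<forall>q\<in>T. \<not> q dvd b). 1 / real (totient b))
    \<le> real p / (real p - 1) * (\<Sum>b | b \<in> {1..R} \<and> squarefree b \<and> (\<forall>q\<in>insert p T. \<not> q dvd b). 1 / real (totient b))"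
    (is "?l \<le> _ * ?r")
proof -
  have p1: "real p > 1" using p prime_gt_1_nat by auto
  let ?S = "{b. b \<in> {1..R} \<and> squarefree b \<and> (\<forall>q\<in>T. \<not> q dvd b)}"
  let ?S1 = "{b. b \<in> {1..R} \<and> squarefree b \<and> (\<forall>q\<in>insert p T. \<not> q dvd b)}"
  have "?S1 \<subseteq> ?S" "finite ?S" by auto
  then have "?l = (\<Sum>b\<in>?S - ?S1. 1 / real (totient b)) + (\<Sum>b\<in>?S1. 1 / real (totient b))"
    by (rule sum.subset_diff)
  then have 1: "?l = ?r + (\<Sum>b\<in>?S - ?S1. 1 / real (totient b))"
    by (simp only: add.commute)
  have "(\<Sum>b\<in>?S - ?S1. 1 / real (totient b)) \<le> (\<Sum>b\<in>(*) p ` ?S1. 1 / real (totient b))"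
  proof (rule sum_mono2)
    show "?S - ?S1 \<subseteq> (*) p ` ?S1"
    proof
      fix b assume b: "b \<in> ?S - ?S1"
      then have "p dvd b" by blast
      then obtain k where k: "b = p * k" by (elim dvdE)
      have "\<not> p dvd k"
      proof
        assume "p dvd k"
        then have "p\<^sup>2 dvd b" using k by (auto simp: power2_eq_square)
        then show False using b p(1) not_squarefreeI[of p b] not_prime_unit by blast
      qed
      moreover have "squarefree k" using b k squarefree_mono[of k b] by auto
      moreover have "k \<le> R"
      proof -
        have "k \<le> p * k" using p1 by simp
        also have "p * k \<le> R" using b k by auto
        finally show ?thesis .
      qed
      moreover have "k \<ge> 1" using b k by (cases k) auto
      moreover have "\<forall>q\<in>T. \<not> q dvd k" using b k by auto
      ultimately have "k \<in> ?S1" by simp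
      then show "b \<in> (*) p ` ?S1" using k by (rule image_eqI[rotated])
    qed
    show "finite ((*) p ` ?S1)" by simp
    show "0 \<le> 1 / real (totient b)" for b by simp
  qed
  also have "\<dots> = (\<Sum>b\<in>?S1. 1 / real (totient (p * b)))"
    using p1 by (subst sum.reindex) (simp_all add: inj_on_def)
  also have "\<dots> = (\<Sum>b\<in>?S1. 1 / (real p - 1) * (1 / real (totient b)))"
    using p by (intro sum.cong) (auto simp: totient_prime_mult)
  also have "\<dots> = 1 / (real p - 1) * ?r" by (simp only: sum_distrib_left)
  finally have "?l \<le> ?r + 1 / (real p - 1) * ?r" unfolding 1 by simp
  moreover have "x + 1 / (real p - 1) * x = real p / (real p - 1) * x" for x
    using p1 by (simp add: field_simps)
  ultimately show ?thesis by simp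
qed

lemma squarefree_totient_sum_ge:
  assumes "finite T" "\<And>q. q \<in> T \<Longrightarrow> prime q"
  shows "(\<Sum>b | b \<in> {1..R} \<and> squarefree b. 1 / real (totient b))
    \<le> kap T * (\<Sum>b | b \<in> {1..R} \<and> squarefree b \<and> (\<forall>q\<in>T. \<not> q dvd b). 1 / real (totient b))"
  using assms
proof (induction T rule: finite_induct)
  case empty
  then show ?case by (simp add: kap_def)
next
  case (insert p T)
  have "kap T \<ge> 1" using insert by (intro kap_ge_1) auto
  have k: "kap (insert p T) = kap T * (real p / (real p - 1))" using insert by (simp add: kap_def)
  have "(\<Sum>b | b \<in> {1..R} \<and> squarefree b. 1 / real (totient b))
    \<le> kap T * (\<Sum>b | b \<in> {1..R} \<and> squarefree b \<and> (\<forall>q\<in>T. \<not> q dvd b). 1 / real (totient b))"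
    using insert by simp
  also have "\<dots> \<le> kap T * (real p / (real p - 1) * (\<Sum>b | b \<in> {1..R} \<and> squarefree b \<and> (\<forall>q\<in>insert p T. \<not> q dvd b). 1 / real (totient b)))"
    using insert \<open>kap T \<ge> 1\<close> by (intro mult_left_mono squarefree_totient_sum_insert) auto
  finally show ?case unfolding k by (simp only: mult.assoc)
qed

lemma kap_prime_factors: "n > 0 \<Longrightarrow> kap (prime_factors n) = real n / real (totient n)"
proof -
  assume n: "n > 0"
  have "real (totient n) = real n * (\<Prod>p\<in>prime_factors n. 1 - 1 / real p)"
    using totient_formula2[of n] by simp
  moreover have "(\<Prod>p\<in>prime_factors n. 1 - 1 / real p) * kap (prime_factors n) = 1"
    unfolding kap_def prod.distrib[symmetric]
  proof (rule prod.neutral, rule ballI)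
    fix p assume "p \<in> prime_factors n"
    then have "real p > 1" using prime_gt_1_nat by (auto simp: in_prime_factors_iff)
    then show "(1 - 1 / real p) * (real p / (real p - 1)) = 1" by (simp add: field_simps)
  qed
  ultimately have "real (totient n) * kap (prime_factors n) = real n" by (simp add: mult.assoc)
  then show ?thesis using n by (simp add: field_simps)
qed

lemma coprime_iff_prime_factors:
  assumes "n > 0"
  shows "coprime b n \<longleftrightarrow> (\<forall>p\<in>prime_factors n. \<not> p dvd (b::nat))"
proof
  assume c: "coprime b n"
  show "\<forall>p\<in>prime_factors n. \<not> p dvd b"
  proof
    fix p assume "p \<in> prime_factors n"
    then show "\<not> p dvd b" using c coprime_common_divisor[of b n p] by (auto simp: in_prime_factors_iff)
  qed
next
  assume h: "\<forall>p\<in>prime_factors n. \<not> p dvd b"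
  show "coprime b n"
  proof (rule ccontr)
    assume "\<not> coprime b n"
    then have "gcd b n \<noteq> 1" using coprime_iff_gcd_eq_1[of b n] by blast
    then obtain p where "prime p" "p dvd gcd b n" using prime_factor_nat by blast
    then show False using h assms by (auto simp: in_prime_factors_iff)
  qed
qed

lemma sieve_mass_ge:
  assumes "R \<ge> 1" "q \<ge> 1"
  shows "sieve_mass R q \<ge> ln (real R + 1) / 2 * (real (totient q) / real q)"
proof -
  have "ln (real R + 1) / 2 \<le> (\<Sum>b | b \<in> {1..R} \<and> squarefree b. 1 / real b)"
    by (rule sum_squarefree_inverse_ge[OF assms(1)])
  also have "\<dots> \<le> (\<Sum>b | b \<in> {1..R} \<and> squarefree b. 1 / real (totient b))"
    by (intro sum_mono divide_left_mono) (auto simp: totient_le)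
  also have "\<dots> \<le> kap (prime_factors q) * (\<Sum>b | b \<in> {1..R} \<and> squarefree b \<and> (\<forall>p\<in>prime_factors q. \<not> p dvd b). 1 / real (totient b))"
    by (rule squarefree_totient_sum_ge) auto
  also have "(\<Sum>b | b \<in> {1..R} \<and> squarefree b \<and> (\<forall>p\<in>prime_factors q. \<not> p dvd b). 1 / real (totient b)) = sieve_mass R q"
    using assms coprime_iff_prime_factors[of q] by (simp add: sieve_mass_def sieve_support_def)
  also have "kap (prime_factors q) = real q / real (totient q)" using assms by (intro kap_prime_factors) simp
  finally show ?thesis using assms by (simp add: field_simps)
qed

section \<open>The sieve bound and the Brun-Titchmarsh inequality\<close>

text \<open>For a sifted j only b = 1 contributes to the weighted sum, so its square is 1; elsewhere
  the square is nonnegative. Expanding the square over all j yields the quadratic form. The rounding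
  error is at most 1 for each of the R^2 pairs, with weights at most R, hence R^4. Only b coprime to
  q enter, so that each congruence selects a single class of j.\<close>

lemma selberg_sieve:
  fixes q J R N :: nat
  assumes R: "R \<ge> 1" and q: "q \<ge> 1"
  shows "real (card {j\<in>{1..J}. \<forall>p. prime p \<longrightarrow> p \<le> R \<longrightarrow> \<not> [q * j = N] (mod p)})
     \<le> real J * (2 * (real q / real (totient q)) / ln (real R + 1)) + real R ^ 4"
proof -
  let ?D = "sieve_support R q" and ?L = "sieve_mass R q" and ?w = "sieve_weight R q"
  let ?P = "\<lambda>b j. [q * j = N] (mod b)"
  let ?S = "{j\<in>{1..J}. \<forall>p. prime p \<longrightarrow> p \<le> R \<longrightarrow> \<not> [q * j = N] (mod p)}"
  let ?h = "\<lambda>j. \<Sum>b\<in>?D. if ?P b j then ?w b else 0"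
  have "real (card ?S) = (\<Sum>j\<in>?S. (?h j)\<^sup>2)"
  proof -
    have "?h j = 1" if j: "j \<in> ?S" for j
    proof -
      have "?h j = (\<Sum>b\<in>?D. if b = 1 then 1 else 0)"
      proof (intro sum.cong refl)
        fix b assume b: "b \<in> ?D"
        show "(if ?P b j then ?w b else 0) = (if b = 1 then 1 else 0)"
        proof (cases "b = 1")
          case False
          then obtain p where p: "prime p" "p dvd b" using prime_factor_nat by blast
          have "p \<le> R" using p b dvd_imp_le[of p b] by (auto simp: sieve_support_def)
          then have "\<not> ?P p j" using j p by auto
          then have "\<not> ?P b j" using p by (metis cong_dvd_modulus_nat)
          then show ?thesis using False by simp
        qed (use sieve_weight_1[OF R] in simp)
      qed
      then show ?thesis using one_in_sieve_support[OF R] by simp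
    qed
    then show ?thesis by simp
  qed
  also have "\<dots> \<le> (\<Sum>j=1..J. (?h j)\<^sup>2)" by (intro sum_mono2) auto
  also have "\<dots> = (\<Sum>j=1..J. \<Sum>b1\<in>?D. \<Sum>b2\<in>?D. ?w b1 * ?w b2 * (if ?P (lcm b1 b2) j then 1 else 0))"
  proof (intro sum.cong refl)
    fix j
    have "?P (lcm b1 b2) j \<longleftrightarrow> ?P b1 j \<and> ?P b2 j" for b1 b2
      by (metis cong_cong_lcm_nat cong_dvd_modulus_nat dvd_lcm1 dvd_lcm2)
    then show "(?h j)\<^sup>2 = (\<Sum>b1\<in>?D. \<Sum>b2\<in>?D. ?w b1 * ?w b2 * (if ?P (lcm b1 b2) j then 1 else 0))"
      unfolding power2_eq_square sum_product by (intro sum.cong refl) auto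
  qed
  also have "\<dots> = (\<Sum>b1\<in>?D. \<Sum>j=1..J. \<Sum>b2\<in>?D. ?w b1 * ?w b2 * (if ?P (lcm b1 b2) j then 1 else 0))"
    by (rule sum.swap)
  also have "\<dots> = (\<Sum>b1\<in>?D. \<Sum>b2\<in>?D. \<Sum>j=1..J. ?w b1 * ?w b2 * (if ?P (lcm b1 b2) j then 1 else 0))"
    by (intro sum.cong refl sum.swap)
  also have "\<dots> = (\<Sum>b1\<in>?D. \<Sum>b2\<in>?D. ?w b1 * ?w b2 * real (card {j\<in>{1..J}. ?P (lcm b1 b2) j}))"
  proof (intro sum.cong refl)
    fix b1 b2
    have "(\<Sum>j=1..J. if ?P (lcm b1 b2) j then 1 else 0) = real (card {j\<in>{1..J}. ?P (lcm b1 b2) j})"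
      by (subst sum.inter_filter[symmetric]) auto
    then show "(\<Sum>j=1..J. ?w b1 * ?w b2 * (if ?P (lcm b1 b2) j then 1 else 0)) = ?w b1 * ?w b2 * real (card {j\<in>{1..J}. ?P (lcm b1 b2) j})"
      by (simp only: sum_distrib_left[symmetric])
  qed
  also have "\<dots> \<le> (\<Sum>b1\<in>?D. \<Sum>b2\<in>?D. real J * (?w b1 * ?w b2 / real (lcm b1 b2)) + real R * real R)"
  proof (intro sum_mono)
    fix b1 b2 assume b: "b1 \<in> ?D" "b2 \<in> ?D"
    let ?c = "real (card {j\<in>{1..J}. ?P (lcm b1 b2) j})" and ?m = "real J / real (lcm b1 b2)"
    have "coprime q b1" "coprime q b2" using b by (auto simp: sieve_support_def coprime_commute)
    then have "coprime q (b1 * b2)" by simp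
    then have "coprime q (lcm b1 b2)"
      using coprime_divisors[of q q "lcm b1 b2" "b1 * b2"] by (simp add: lcm_least)
    moreover have "lcm b1 b2 \<ge> 1" using b by (auto simp: sieve_support_def Suc_le_eq lcm_pos_nat)
    ultimately have c: "\<bar>?c - ?m\<bar> \<le> 1" by (intro card_cong_class)
    have "\<bar>?w b1\<bar> \<le> real R" "\<bar>?w b2\<bar> \<le> real R"
      using abs_sieve_weight_le[OF R, of q b1] abs_sieve_weight_le[OF R, of q b2] b by (auto simp: sieve_support_def)
    then have "\<bar>?w b1\<bar> * \<bar>?w b2\<bar> * \<bar>?c - ?m\<bar> \<le> real R * real R * 1"
      using c by (intro mult_mono) auto
    then have "?w b1 * ?w b2 * (?c - ?m) \<le> real R * real R"
      by (simp add: abs_mult[symmetric])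
    then show "?w b1 * ?w b2 * ?c \<le> real J * (?w b1 * ?w b2 / real (lcm b1 b2)) + real R * real R"
      by (simp add: algebra_simps)
  qed
  also have "\<dots> = real J * (\<Sum>b1\<in>?D. \<Sum>b2\<in>?D. ?w b1 * ?w b2 / real (lcm b1 b2)) + real (card ?D) * (real (card ?D) * (real R * real R))"
    by (simp add: sum.distrib sum_distrib_left)
  also have "(\<Sum>b1\<in>?D. \<Sum>b2\<in>?D. ?w b1 * ?w b2 / real (lcm b1 b2)) = 1 / ?L"
    by (rule sieve_quadratic_form[OF R])
  also have "real (card ?D) * (real (card ?D) * (real R * real R)) \<le> real R * (real R * (real R * real R))"
  proof -
    have "card ?D \<le> card {1..R}" by (intro card_mono) (auto simp: sieve_support_def)
    then have "real (card ?D) \<le> real R" by simp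
    then show ?thesis by (intro mult_mono) auto
  qed
  also have "real R * (real R * (real R * real R)) = real R ^ 4" by (simp add: power4_eq_xxxx)
  also have "1 / ?L \<le> 1 / (ln (real R + 1) / 2 * (real (totient q) / real q))"
    using sieve_mass_ge[OF R q] R q by (intro divide_left_mono mult_pos_pos) (auto intro: sieve_mass_pos)
  also have "1 / (ln (real R + 1) / 2 * (real (totient q) / real q)) = 2 * (real q / real (totient q)) / ln (real R + 1)"
    by (simp add: field_simps)
  finally show ?thesis by (simp add: mult_left_mono)
qed

text \<open>If N - q * j is a power of a prime p > R, then it has no prime factor up to R and j is
  counted by the sieve; otherwise it is one of at most R * log2 N powers of small primes. Terms with
  q * j >= N vanish, because the truncated difference is 0.\<close>

lemma sum_mangoldt_progression_le:
  fixes N q J R :: nat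
  assumes R: "R \<ge> 1" and q: "q \<ge> 1" and N: "N \<ge> 2"
  shows "(\<Sum>j=1..J. mangoldt (N - q * j)) \<le> ln (real N) *
     (real J * (2 * (real q / real (totient q)) / ln (real R + 1)) + real R ^ 4 + real R * log 2 (real N))"
proof -
  let ?S = "{j\<in>{1..J}. \<forall>p. prime p \<longrightarrow> p \<le> R \<longrightarrow> \<not> [q * j = N] (mod p)}"
  let ?B = "{n. real n \<le> real N \<and> primepow n \<and> aprimedivisor n \<in> {1..R}}"
  let ?T = "{j\<in>{1..J}. q * j < N \<and> N - q * j \<in> ?B}"
  have finB: "finite ?B" by (rule finite_subset[of _ "{..N}"]) auto
  have "(\<Sum>j=1..J. mangoldt (N - q * j)) = (\<Sum>j\<in>{j\<in>{1..J}. mangoldt (N - q * j) \<noteq> (0::real)}. mangoldt (N - q * j) :: real)"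
    by (rule sum.mono_neutral_right) auto
  also have "\<dots> \<le> (\<Sum>j\<in>{j\<in>{1..J}. mangoldt (N - q * j) \<noteq> (0::real)}. ln (real N))"
  proof (rule sum_mono)
    fix j assume "j \<in> {j\<in>{1..J}. mangoldt (N - q * j) \<noteq> (0::real)}"
    then have n0: "N - q * j > 0" by (cases "N - q * j = 0") auto
    have "mangoldt n \<le> ln (real N)" if "n > 0" "n \<le> N" for n
      using order_trans[OF mangoldt_le[OF that(1)] ln_mono[of "real n" "real N"]] that by simp
    then show "mangoldt (N - q * j) \<le> ln (real N)" using n0 diff_le_self by blast
  qed
  also have "\<dots> = ln (real N) * real (card {j\<in>{1..J}. mangoldt (N - q * j) \<noteq> (0::real)})" by simp
  also have "real (card {j\<in>{1..J}. mangoldt (N - q * j) \<noteq> (0::real)}) \<le> real (card ?S) + real (card ?T)"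
  proof -
    have "{j\<in>{1..J}. mangoldt (N - q * j) \<noteq> (0::real)} \<subseteq> ?S \<union> ?T"
    proof
      fix j assume j: "j \<in> {j\<in>{1..J}. mangoldt (N - q * j) \<noteq> (0::real)}"
      then have pp: "primepow (N - q * j)" by (auto simp: mangoldt_def split: if_splits)
      then have pos: "q * j < N" using primepow_gt_0_nat by fastforce
      obtain p k where pk: "prime p" "k > 0" "N - q * j = p ^ k" using pp by (auto simp: primepow_def)
      have ap: "aprimedivisor (N - q * j) = p" using pk by (simp add: aprimedivisor_prime_power)
      show "j \<in> ?S \<union> ?T"
      proof (cases "p \<le> R")
        case True
        then have "j \<in> ?T" using j pp pos ap prime_ge_1_nat[OF pk(1)] by auto
        then show ?thesis by blast
      next
        case False
        have "\<not> [q * j = N] (mod p')" if p': "prime p'" "p' \<le> R" for p'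
        proof
          assume "[q * j = N] (mod p')"
          then have "p' dvd N - q * j" using pos cong_altdef_nat[of "q * j" N p'] by (simp add: cong_sym_eq)
          then have "p' dvd p" using pk(3) p' prime_dvd_power by metis
          then have "p' = p" using p' pk primes_dvd_imp_eq by blast
          then show False using False p' by simp
        qed
        then show ?thesis using j by blast
      qed
    qed
    then have "card {j\<in>{1..J}. mangoldt (N - q * j) \<noteq> (0::real)} \<le> card (?S \<union> ?T)"
      by (intro card_mono) auto
    also have "\<dots> \<le> card ?S + card ?T" by (rule card_Un_le)
    finally show ?thesis by linarith
  qed
  also have "real (card ?T) \<le> real R * log 2 (real N)"
  proof -
    have "inj_on (\<lambda>j. N - q * j) ?T"
    proof (rule inj_onI)
      fix x y assume xy: "x \<in> ?T" "y \<in> ?T" "N - q * x = N - q * y"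
      then have "q * x < N" "q * y < N" by auto
      then have "q * x = q * y" using xy(3) by linarith
      then show "x = y" using q by simp
    qed
    then have "card ?T \<le> card ?B" using finB by (intro card_inj_on_le[of "\<lambda>j. N - q * j"]) auto
    moreover have "real (card ?B) \<le> real (card {1..R}) * log 2 (real N)"
      using N by (intro card_primepow_le) auto
    ultimately show ?thesis by simp
  qed
  also have "real (card ?S) \<le> real J * (2 * (real q / real (totient q)) / ln (real R + 1)) + real R ^ 4"
    by (rule selberg_sieve[OF R q])
  finally show ?thesis using N by (simp add: mult_left_mono)
qed

text \<open>With R about J^(1/8) the logarithm of R is at least delta / 8 * ln N, which turns ln N *
  2 / ln R into 16 / delta; the two error terms cost at most J / 2 each. The bound is uniform in q
  and J, even if the progression overshoots N.\<close>

lemma brun_titchmarsh: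
  fixes \<delta> :: real
  assumes \<delta>: "\<delta> > 0"
  shows "\<forall>\<^sub>F N in at_top. \<forall>q\<ge>1. \<forall>J::nat. real J \<ge> real N powr \<delta> \<longrightarrow>
     (\<Sum>j=1..J. mangoldt (N - q * j)) \<le> (16 / \<delta> + 1) * (real q / real (totient q)) * real J"
proof -
  have e1: "\<forall>\<^sub>F N::nat in at_top. ln (real N) \<le> (real N powr \<delta>) powr (1/2) / 2"
    using \<delta> by real_asymp
  have e2: "\<forall>\<^sub>F N::nat in at_top. 4 * ln (real N) * ln (real N) \<le> (real N powr \<delta>) powr (7/8)"
    using \<delta> by real_asymp
  show ?thesis using e1 e2 eventually_ge_at_top[of 3]
  proof eventually_elim
    case (elim N)
    show ?case
    proof (intro allI impI)
      fix q J :: nat assume q: "1 \<le> q" and J: "real N powr \<delta> \<le> real J"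
      have ln1: "ln (real N) > 0" using elim by simp
      have Nd: "real N powr \<delta> \<ge> 1" using elim \<delta> by (intro ge_one_powr_ge_zero) auto
      then have J1: "real J \<ge> 1" using J by linarith
      \<comment> \<open>The exponent 1/8 makes the sieve error R^4 at most sqrt J, small against J /
        ln N.\<close>
      define R where "R = nat \<lfloor>real J powr (1/8)\<rfloor>"
      have "real J powr (1/8) \<ge> 1" using J1 by (intro ge_one_powr_ge_zero) auto
      then have R: "R \<ge> 1" "real R \<le> real J powr (1/8)" "real J powr (1/8) \<le> real R + 1"
        by (auto simp: R_def le_nat_floor)
      have k1: "real q / real (totient q) \<ge> 1" using q totient_le[of q] by simp
      have t1: "ln (real N) * (real J * (2 * (real q / real (totient q)) / ln (real R + 1)))
          \<le> 16 / \<delta> * (real q / real (totient q)) * real J"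
      proof -
        have "\<delta> * ln (real N) = ln (real N powr \<delta>)" using elim by (simp add: ln_powr)
        also have "\<dots> \<le> ln (real J)" using Nd J elim by (intro ln_mono) auto
        finally have a: "\<delta> * ln (real N) \<le> ln (real J)" .
        have "ln (real J) / 8 = ln (real J powr (1/8))" using J1 by (simp add: ln_powr)
        also have "\<dots> \<le> ln (real R + 1)" using R J1 by (intro ln_mono) auto
        finally have "\<delta> * ln (real N) / 8 \<le> ln (real R + 1)" using a by linarith
        then have "ln (real N) / ln (real R + 1) \<le> ln (real N) / (\<delta> * ln (real N) / 8)"
          using ln1 \<delta> R by (intro divide_left_mono) auto
        also have "\<dots> = 8 / \<delta>" using ln1 by simp
        finally have "ln (real N) / ln (real R + 1) \<le> 8 / \<delta>" .
        then have "ln (real N) / ln (real R + 1) * (2 * (real q / real (totient q)) * real J)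
             \<le> 8 / \<delta> * (2 * (real q / real (totient q)) * real J)"
          using k1 by (intro mult_right_mono) auto
        then show ?thesis by (simp add: field_simps)
      qed
      have t2: "ln (real N) * real R ^ 4 \<le> real J / 2"
      proof -
        have "real R ^ 4 \<le> (real J powr (1/8)) ^ 4" using R by (intro power_mono) auto
        also have "\<dots> = real J powr (1/2)" using J1 by (simp add: powr_power)
        finally have "ln (real N) * real R ^ 4 \<le> ((real N powr \<delta>) powr (1/2) / 2) * real J powr (1/2)"
          using elim(1) ln1 by (intro mult_mono) auto
        also have "\<dots> \<le> (real J powr (1/2) / 2) * real J powr (1/2)"
          using J by (intro mult_right_mono divide_right_mono powr_mono2) auto
        also have "\<dots> = real J / 2" using J1 by (simp add: powr_half_sqrt)
        finally show ?thesis .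
      qed
      have t3: "ln (real N) * (real R * log 2 (real N)) \<le> real J / 2"
      proof -
        have "ln (2::real) \<ge> 1/2" using ln2_ge_two_thirds by simp
        then have "ln (real N) / ln 2 \<le> ln (real N) / (1/2)" using ln1 by (intro divide_left_mono) auto
        then have "log 2 (real N) \<le> 2 * ln (real N)" by (simp add: log_def)
        then have "ln (real N) * (real R * log 2 (real N)) \<le> ln (real N) * (real J powr (1/8) * (2 * ln (real N)))"
          using R ln1 elim by (intro mult_mono mult_left_mono) auto
        also have "\<dots> = (4 * ln (real N) * ln (real N)) / 2 * real J powr (1/8)" by simp
        also have "\<dots> \<le> (real J powr (7/8)) / 2 * real J powr (1/8)"
        proof (intro mult_right_mono divide_right_mono)
          have "(real N powr \<delta>) powr (7/8) \<le> real J powr (7/8)" using J by (intro powr_mono2) auto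
          then show "4 * ln (real N) * ln (real N) \<le> real J powr (7/8)" using elim by linarith
        qed auto
        also have "\<dots> = (real J powr (7/8) * real J powr (1/8)) / 2" by simp
        also have "real J powr (7/8) * real J powr (1/8) = real J"
          using J1 by (simp only: powr_add[symmetric]) simp
        finally show ?thesis .
      qed
      have "(\<Sum>j=1..J. mangoldt (N - q * j)) \<le> ln (real N) *
         (real J * (2 * (real q / real (totient q)) / ln (real R + 1)) + real R ^ 4 + real R * log 2 (real N))"
        using elim R q by (intro sum_mangoldt_progression_le) auto
      also have "\<dots> \<le> 16 / \<delta> * (real q / real (totient q)) * real J + real J / 2 + real J / 2"
        using t1 t2 t3 by (simp add: distrib_left)
      also have "\<dots> \<le> (16 / \<delta> + 1) * (real q / real (totient q)) * real J"
      proof -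
        have "1 * real J \<le> real q / real (totient q) * real J" using k1 by (intro mult_right_mono) auto
        then show ?thesis by (simp add: algebra_simps)
      qed
      finally show "(\<Sum>j=1..J. mangoldt (N - q * j)) \<le> (16 / \<delta> + 1) * (real q / real (totient q)) * real J" .
    qed
  qed
qed

section \<open>The shifted weights and their divisor sums\<close>

text \<open>Written in m = N - n. With coprimality to N built in, sums over multiples of any q not
  coprime to N vanish, so moduli can be summed without side conditions.\<close>

definition shift_weight :: "nat \<Rightarrow> nat \<Rightarrow> real" where
  "shift_weight N m = (if coprime m N then mangoldt (N - m) else 0)"

definition shift_sum :: "nat \<Rightarrow> nat \<Rightarrow> real" where
  "shift_sum N q = (\<Sum>m | m \<in> {1..<N} \<and> q dvd m. shift_weight N m)"

text \<open>The value 0 off the integers coprime to N keeps it multiplicative on coprime arguments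
  and puts the dependence on N into the sieve density.\<close>

definition local_density :: "nat \<Rightarrow> nat \<Rightarrow> real" where
  "local_density N q = (if coprime q N then 1 / real (totient q) else 0)"

definition shift_error :: "nat \<Rightarrow> nat \<Rightarrow> real" where
  "shift_error N q = shift_sum N q - real N * local_density N q"

definition sifted_sum :: "nat \<Rightarrow> nat \<Rightarrow> nat \<Rightarrow> real" where
  "sifted_sum N P q = (\<Sum>m | m \<in> {1..<N} \<and> q dvd m \<and> coprime m P. shift_weight N m)"

definition sieve_density :: "nat \<Rightarrow> nat \<Rightarrow> real" where
  "sieve_density N P = (\<Sum>b | b dvd P. moebius_mu b * local_density N b)"

lemma shift_weight_nonneg: "shift_weight N m \<ge> 0"
  by (simp add: shift_weight_def mangoldt_nonneg)

lemma mangoldt_le_ln: "n \<le> N \<Longrightarrow> N \<ge> 1 \<Longrightarrow> mangoldt n \<le> ln (real N)"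
proof -
  assume n: "n \<le> N" "N \<ge> 1"
  show ?thesis
  proof (cases "n > 0")
    case True
    then have "mangoldt n \<le> ln (real n)" by (rule mangoldt_le)
    also have "\<dots> \<le> ln (real N)" using True n by (intro ln_mono) auto
    finally show ?thesis .
  qed (use n in simp)
qed

lemma shift_weight_le: "N \<ge> 1 \<Longrightarrow> shift_weight N m \<le> ln (real N)"
  using mangoldt_le_ln[of "N - m" N] by (simp add: shift_weight_def)

lemma local_density_nonneg: "local_density N q \<ge> 0"
  by (simp add: local_density_def)

lemma local_density_mult:
  "coprime a b \<Longrightarrow> local_density N (a * b) = local_density N a * local_density N b"
  by (simp add: local_density_def totient_mult_coprime)

lemma local_density_1 [simp]: "local_density N 1 = 1" "local_density N (Suc 0) = 1"
  by (simp_all add: local_density_def)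

lemma sifted_sum_nonneg: "sifted_sum N P q \<ge> 0"
  unfolding sifted_sum_def by (intro sum_nonneg) (simp add: shift_weight_nonneg)

lemma sifted_sum_le: "sifted_sum N P q \<le> shift_sum N q"
  unfolding sifted_sum_def shift_sum_def by (rule sum_mono2) (auto simp: shift_weight_nonneg)

lemma shift_sum_not_coprime: "\<not> coprime q N \<Longrightarrow> shift_sum N q = 0"
  unfolding shift_sum_def
proof (rule sum.neutral, rule ballI)
  fix m assume q: "\<not> coprime q N" and "m \<in> {m. m \<in> {1..<N} \<and> q dvd m}"
  then have "\<not> coprime m N" using coprime_divisors[of q m N N] by auto
  then show "shift_weight N m = 0" by (simp add: shift_weight_def)
qed

lemma shift_error_not_coprime: "\<not> coprime q N \<Longrightarrow> shift_error N q = 0"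
  by (simp add: shift_error_def shift_sum_not_coprime local_density_def)

lemma sum_moebius_coprime:
  fixes m P :: nat
  assumes "P > 0"
  shows "(\<Sum>b | b dvd P. if b dvd m then moebius_mu b else 0) = (if coprime m P then 1 else 0)"
proof -
  have "(\<Sum>b | b dvd P. if b dvd m then moebius_mu b else 0) = (\<Sum>b | b \<in> {b. b dvd P} \<and> b dvd m. moebius_mu b)"
    using assms by (subst sum.inter_filter[symmetric]) auto
  also have "{b. b \<in> {b. b dvd P} \<and> b dvd m} = {b. b dvd gcd m P}" by auto
  also have "(\<Sum>b | b dvd gcd m P. moebius_mu b) = (if gcd m P = 1 then 1 else 0)"
    using assms by (intro sum_moebius_mu_divisors) simp
  finally show ?thesis by (simp only: coprime_iff_gcd_eq_1)
qed

lemma sum_coprime_expand: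
  fixes f :: "nat \<Rightarrow> real"
  assumes P: "P > 0" and q: "coprime q P"
  shows "(\<Sum>m | m \<in> {1..<N} \<and> q dvd m \<and> coprime m P. f m)
       = (\<Sum>b | b dvd P. moebius_mu b * (\<Sum>m | m \<in> {1..<N} \<and> (b * q) dvd m. f m))"
proof -
  have "(\<Sum>m | m \<in> {1..<N} \<and> q dvd m \<and> coprime m P. f m)
      = (\<Sum>m | m \<in> {1..<N} \<and> q dvd m. if coprime m P then f m else 0)"
    by (rule sum.mono_neutral_cong_left) auto
  also have "\<dots> = (\<Sum>m | m \<in> {1..<N} \<and> q dvd m. \<Sum>b | b dvd P. if b dvd m then moebius_mu b * f m else 0)"
  proof (intro sum.cong refl)
    fix m
    have "(if coprime m P then f m else 0) = (\<Sum>b | b dvd P. if b dvd m then moebius_mu b else 0) * f m"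
      using sum_moebius_coprime[OF P, of m] by simp
    also have "\<dots> = (\<Sum>b | b dvd P. if b dvd m then moebius_mu b * f m else 0)"
      unfolding sum_distrib_right by (intro sum.cong) auto
    finally show "(if coprime m P then f m else 0) = (\<Sum>b | b dvd P. if b dvd m then moebius_mu b * f m else 0)" .
  qed
  also have "\<dots> = (\<Sum>b | b dvd P. \<Sum>m | m \<in> {1..<N} \<and> q dvd m. if b dvd m then moebius_mu b * f m else 0)"
    by (rule sum.swap)
  also have "\<dots> = (\<Sum>b | b dvd P. moebius_mu b * (\<Sum>m | m \<in> {1..<N} \<and> (b * q) dvd m. f m))"
  proof (intro sum.cong refl)
    fix b assume "b \<in> {b. b dvd P}"
    then have "coprime b q" using q by (metis coprime_commute coprime_divisors dvd_refl mem_Collect_eq)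
    then have iff: "b * q dvd m \<longleftrightarrow> q dvd m \<and> b dvd m" for m
      by (metis divides_mult dvd_mult_left dvd_mult_right)
    have "(\<Sum>m | m \<in> {1..<N} \<and> q dvd m. if b dvd m then moebius_mu b * f m else 0)
       = (\<Sum>m | m \<in> {1..<N} \<and> (b * q) dvd m. moebius_mu b * f m)"
      by (rule sum.mono_neutral_cong_right) (auto simp: iff)
    then show "(\<Sum>m | m \<in> {1..<N} \<and> q dvd m. if b dvd m then moebius_mu b * f m else 0)
       = moebius_mu b * (\<Sum>m | m \<in> {1..<N} \<and> (b * q) dvd m. f m)"
      by (simp only: sum_distrib_left)
  qed
  finally show ?thesis .
qed

text \<open>Exact inclusion-exclusion over all b | P. This is affordable because P does not grow
  with N; the price is that errors at the moduli b * q appear.\<close>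

lemma sifted_sum_approx:
  assumes P: "P > 0" and q: "coprime q P"
  shows "\<bar>sifted_sum N P q - real N * sieve_density N P * local_density N q\<bar> \<le> (\<Sum>b | b dvd P. \<bar>shift_error N (b * q)\<bar>)"
proof -
  have "sifted_sum N P q = (\<Sum>b | b dvd P. moebius_mu b * shift_sum N (b * q))"
    unfolding sifted_sum_def shift_sum_def by (rule sum_coprime_expand[OF P q])
  also have "\<dots> = (\<Sum>b | b dvd P. real N * (moebius_mu b * local_density N b) * local_density N q + moebius_mu b * shift_error N (b * q))"
  proof (intro sum.cong refl)
    fix b assume "b \<in> {b. b dvd P}"
    then have "coprime b q" using q by (metis coprime_commute coprime_divisors dvd_refl mem_Collect_eq)
    then have "local_density N (b * q) = local_density N b * local_density N q" by (rule local_density_mult)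
    then show "moebius_mu b * shift_sum N (b * q) = real N * (moebius_mu b * local_density N b) * local_density N q + moebius_mu b * shift_error N (b * q)"
      by (simp add: shift_error_def algebra_simps)
  qed
  also have "\<dots> = real N * sieve_density N P * local_density N q + (\<Sum>b | b dvd P. moebius_mu b * shift_error N (b * q))"
    by (simp add: sum.distrib sieve_density_def sum_distrib_left sum_distrib_right)
  finally have "sifted_sum N P q - real N * sieve_density N P * local_density N q = (\<Sum>b | b dvd P. moebius_mu b * shift_error N (b * q))"
    by simp
  also have "\<bar>\<dots>\<bar> \<le> (\<Sum>b | b dvd P. \<bar>shift_error N (b * q)\<bar>)"
    by (rule order_trans[OF sum_abs sum_mono]) (rule abs_moebius_mu_mult_le)
  finally show ?thesis .
qed

section \<open>From progressions to shifted weights\<close>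

lemma log2_le: "x \<ge> 1 \<Longrightarrow> log 2 x \<le> 2 * ln x"
proof -
  assume "x \<ge> 1"
  have "ln (2::real) \<ge> 1/2" using ln2_ge_two_thirds by simp
  then have "ln x / ln 2 \<le> ln x / (1/2)" using \<open>x \<ge> 1\<close> by (intro divide_left_mono) auto
  then show ?thesis by (simp add: log_def)
qed

lemma card_primepow_le_ln:
  fixes x :: real
  assumes B: "finite B" and x: "x \<ge> 1"
  shows "real (card {n. real n \<le> x \<and> primepow n \<and> aprimedivisor n \<in> B}) \<le> real (card B) * (2 * ln x)"
  by (rule order_trans[OF card_primepow_le[OF B x] mult_left_mono[OF log2_le[OF x]]]) simp

lemma primepow_not_coprime:
  assumes "primepow (n::nat)" "\<not> coprime n N" "N > 0"
  shows "aprimedivisor n \<in> prime_factors N"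
proof -
  obtain p k where pk: "prime p" "k > 0" "n = p ^ k" using assms(1) by (auto simp: primepow_def)
  have "\<not> coprime p N" using assms(2) pk by auto
  then have "p dvd N" using pk prime_imp_coprime by blast
  then show ?thesis using pk assms(3) by (simp add: aprimedivisor_prime_power in_prime_factors_iff)
qed

text \<open>A common factor of m and N divides N - m, so N - m is a power of one of at most 2 ln N
  primes dividing N. Each of these has at most 2 ln N powers, each of weight at most ln N.\<close>

lemma sum_mangoldt_not_coprime_le:
  assumes N: "N \<ge> 2"
  shows "(\<Sum>m | m \<in> {1..<N} \<and> \<not> coprime m N. mangoldt (N - m)) \<le> 4 * ln (real N) ^ 3"
proof -
  let ?B = "{n. real n \<le> real N \<and> primepow n \<and> aprimedivisor n \<in> prime_factors N}"
  have finB: "finite ?B" by (rule finite_subset[of _ "{..N}"]) auto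
  have l0: "ln (real N) \<ge> 0" using N by simp
  have "(\<Sum>m | m \<in> {1..<N} \<and> \<not> coprime m N. mangoldt (N - m))
      = (\<Sum>m | m \<in> {1..<N} \<and> \<not> coprime m N \<and> primepow (N - m). mangoldt (N - m) :: real)"
    by (rule sum.mono_neutral_right) (auto simp: mangoldt_def)
  also have "\<dots> \<le> (\<Sum>m | m \<in> {1..<N} \<and> \<not> coprime m N \<and> primepow (N - m). ln (real N))"
    using N by (intro sum_mono mangoldt_le_ln) auto
  also have "\<dots> = real (card {m. m \<in> {1..<N} \<and> \<not> coprime m N \<and> primepow (N - m)}) * ln (real N)" by simp
  also have "\<dots> \<le> real (card ?B) * ln (real N)"
  proof (intro mult_right_mono l0 of_nat_mono)
    show "card {m. m \<in> {1..<N} \<and> \<not> coprime m N \<and> primepow (N - m)} \<le> card ?B"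
    proof (rule card_inj_on_le[of "\<lambda>m. N - m", OF _ _ finB])
      show "inj_on (\<lambda>m. N - m) {m. m \<in> {1..<N} \<and> \<not> coprime m N \<and> primepow (N - m)}"
        by (auto simp: inj_on_def)
      show "(\<lambda>m. N - m) ` {m. m \<in> {1..<N} \<and> \<not> coprime m N \<and> primepow (N - m)} \<subseteq> ?B"
      proof (rule image_subsetI)
        fix m assume "m \<in> {m. m \<in> {1..<N} \<and> \<not> coprime m N \<and> primepow (N - m)}"
        then have m: "1 \<le> m" "m < N" "\<not> coprime m N" "primepow (N - m)" by auto
        have "\<not> coprime (N - m) N"
        proof
          assume c: "coprime (N - m) N"
          obtain d where d: "d dvd m" "d dvd N" "\<not> is_unit d" using m(3) by (auto simp: coprime_def)
          then have "d dvd N - m" by (simp add: dvd_diff_nat)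
          then show False using c d coprime_common_divisor by blast
        qed
        then have "aprimedivisor (N - m) \<in> prime_factors N" using m N by (intro primepow_not_coprime) auto
        then show "N - m \<in> ?B" using m by simp
      qed
    qed
  qed
  also have "real (card ?B) \<le> real (card (prime_factors N)) * (2 * ln (real N))"
    using N by (intro card_primepow_le_ln) auto
  also have "real (card (prime_factors N)) \<le> 2 * ln (real N)"
    using card_prime_factors_le[of N] log2_le[of "real N"] N by simp
  finally show ?thesis using l0 by (simp add: mult_right_mono power3_eq_cube)
qed

lemma sum_progression_reindex:
  fixes f :: "nat \<Rightarrow> real"
  shows "(\<Sum>n | n \<in> {1..<N} \<and> [n = N] (mod q). f n) = (\<Sum>m | m \<in> {1..<N} \<and> q dvd m. f (N - m))"
proof (rule sum.reindex_bij_witness[of _ "\<lambda>m. N - m" "\<lambda>n. N - n"])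
  fix n assume n: "n \<in> {n. n \<in> {1..<N} \<and> [n = N] (mod q)}"
  then have "[N = n] (mod q)" by (simp add: cong_sym_eq)
  then have "q dvd N - n" using n cong_altdef_nat[of n N q] by auto
  then show "N - n \<in> {m. m \<in> {1..<N} \<and> q dvd m}" using n by auto
next
  fix m assume m: "m \<in> {m. m \<in> {1..<N} \<and> q dvd m}"
  then have "q dvd N - (N - m)" by auto
  then have "[N = N - m] (mod q)" using m cong_altdef_nat[of "N - m" N q] by auto
  then show "N - m \<in> {n. n \<in> {1..<N} \<and> [n = N] (mod q)}" using m by (auto simp: cong_sym_eq)
qed auto

lemma sum_reindex_sub:
  fixes f :: "nat \<Rightarrow> real"
  shows "(\<Sum>n\<in>{1..<N}. f n) = (\<Sum>m\<in>{1..<N}. f (N - m))"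
  by (rule sum.reindex_bij_witness[of _ "\<lambda>m. N - m" "\<lambda>n. N - n"]) auto

text \<open>The bridge from the sums in the hypotheses to the shifted weights: the two differ only
  at m not coprime to N, uniformly in q.\<close>

lemma shift_weight_progression_diff:
  fixes g :: "nat \<Rightarrow> real"
  assumes N: "N \<ge> 2" and g: "\<And>m. m < N \<Longrightarrow> \<bar>g m\<bar> \<le> G"
  shows "\<bar>(\<Sum>n | n \<in> {1..<N} \<and> [n = N] (mod q). mangoldt n * g (N - n)) - (\<Sum>m | m \<in> {1..<N} \<and> q dvd m. shift_weight N m * g m)\<bar>
     \<le> 4 * ln (real N) ^ 3 * G"
proof -
  have G0: "G \<ge> 0" using g[of 0] N by simp
  have "(\<Sum>n | n \<in> {1..<N} \<and> [n = N] (mod q). mangoldt n * g (N - n)) - (\<Sum>m | m \<in> {1..<N} \<and> q dvd m. shift_weight N m * g m)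
      = (\<Sum>m | m \<in> {1..<N} \<and> q dvd m. (mangoldt (N - m) - shift_weight N m) * g m)"
    unfolding sum_progression_reindex by (simp add: sum_subtractf[symmetric] left_diff_distrib)
  also have "\<bar>\<dots>\<bar> \<le> (\<Sum>m | m \<in> {1..<N} \<and> q dvd m. (mangoldt (N - m) - shift_weight N m) * G)"
  proof (rule order_trans[OF sum_abs sum_mono])
    fix m assume m: "m \<in> {m. m \<in> {1..<N} \<and> q dvd m}"
    have "mangoldt (N - m) - shift_weight N m \<ge> 0" by (simp add: shift_weight_def mangoldt_nonneg)
    then show "\<bar>(mangoldt (N - m) - shift_weight N m) * g m\<bar> \<le> (mangoldt (N - m) - shift_weight N m) * G"
      using g[of m] m by (simp add: abs_mult mult_left_mono)
  qed
  also have "\<dots> \<le> (\<Sum>m\<in>{1..<N}. (mangoldt (N - m) - shift_weight N m) * G)"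
    using G0 by (intro sum_mono2) (auto simp: shift_weight_def mangoldt_nonneg)
  also have "\<dots> = (\<Sum>m | m \<in> {1..<N} \<and> \<not> coprime m N. mangoldt (N - m)) * G"
    unfolding sum_distrib_right by (rule sum.mono_neutral_cong_right) (auto simp: shift_weight_def)
  also have "\<dots> \<le> 4 * ln (real N) ^ 3 * G"
    using sum_mangoldt_not_coprime_le[OF N] G0 by (intro mult_right_mono) auto
  finally show ?thesis .
qed

lemma card_nat_real_le: "x \<ge> 0 \<Longrightarrow> real (card {q::nat. 1 \<le> q \<and> real q \<le> x}) \<le> x"
proof -
  assume x: "x \<ge> 0"
  have "card {q::nat. 1 \<le> q \<and> real q \<le> x} \<le> card {1..nat \<lfloor>x\<rfloor>}"
    by (intro card_mono) (auto simp: le_nat_floor)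
  also have "\<dots> = nat \<lfloor>x\<rfloor>" by simp
  finally have "real (card {q::nat. 1 \<le> q \<and> real q \<le> x}) \<le> real (nat \<lfloor>x\<rfloor>)" by simp
  also have "\<dots> \<le> x" using x by simp
  finally show ?thesis .
qed

text \<open>One spare logarithm turns the unspecified constant of the O-term into any prescribed K >
  0. Since the hypotheses hold for all A, later estimates can be stated with explicit
  constants.\<close>

lemma bigo_log_power_bound:
  fixes f :: "nat \<Rightarrow> real"
  assumes "f \<in> O[at_top](\<lambda>N. real N / ln (real N) powr (A + 1))" and K: "K > 0"
  shows "\<forall>\<^sub>F N in at_top. \<bar>f N\<bar> \<le> K * (real N / ln (real N) powr A)"
proof -
  obtain c where c: "c > 0" "\<forall>\<^sub>F N in at_top. norm (f N) \<le> c * norm (real N / ln (real N) powr (A + 1))"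
    using assms(1) by (auto elim: landau_o.bigE)
  have "\<forall>\<^sub>F N::nat in at_top. c / K \<le> ln (real N)" by real_asymp
  with c(2) eventually_ge_at_top[of 3] show ?thesis
  proof eventually_elim
    case (elim N)
    have l: "ln (real N) > 0" using elim by simp
    have "\<bar>f N\<bar> \<le> c * (real N / ln (real N) powr (A + 1))" using elim by simp
    also have "\<dots> = c / ln (real N) * (real N / ln (real N) powr A)"
      using l by (simp add: powr_add field_simps)
    also have "\<dots> \<le> K * (real N / ln (real N) powr A)"
      using elim l K by (intro mult_right_mono) (auto simp: field_simps)
    finally show ?case .
  qed
qed

section \<open>Consequences of the two hypotheses\<close>

text \<open>Changing weights costs 4 * (ln N)^3 per modulus, negligible for about N^theta * (ln N)^C
  moduli as theta < 1. Moduli not coprime to N may be included because both the sum and its expected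
  value are 0 there.\<close>

lemma level_of_distribution_shift:
  fixes \<theta> C A :: real
  assumes \<theta>: "0 < \<theta>" "\<theta> < 1" and C: "C > 0" and A: "A > 0"
    and H: "\<And>A::real. A > 0 \<Longrightarrow>
      (\<lambda>N::nat. \<Sum>q | 1 \<le> q \<and> real q \<le> real N powr \<theta> * ln (real N) powr C \<and> coprime N q.
          \<bar>(\<Sum>n | n \<in> {1..<N} \<and> [n = N] (mod q). mangoldt n) - real N / real (totient q)\<bar>)
        \<in> O[at_top](\<lambda>N. real N / ln (real N) powr A)"
  shows "\<forall>\<^sub>F N in at_top. (\<Sum>q | 1 \<le> q \<and> real q \<le> real N powr \<theta> * ln (real N) powr C. \<bar>shift_error N q\<bar>)
      \<le> real N / ln (real N) powr A"
proof -
  let ?D = "\<lambda>N::nat. real N powr \<theta> * ln (real N) powr C"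
  let ?h = "\<lambda>N q. \<bar>(\<Sum>n | n \<in> {1..<N} \<and> [n = N] (mod q). mangoldt n) - real N / real (totient q)\<bar>"
  have 1: "\<forall>\<^sub>F N in at_top. \<bar>\<Sum>q | 1 \<le> q \<and> real q \<le> ?D N \<and> coprime N q. ?h N q\<bar> \<le> 1/2 * (real N / ln (real N) powr A)"
    using A by (intro bigo_log_power_bound H) auto
  have 2: "\<forall>\<^sub>F N::nat in at_top. (real N powr \<theta> * ln (real N) powr C) * (4 * ln (real N) ^ 3) \<le> 1/2 * (real N / ln (real N) powr A)"
    using \<theta> by real_asymp
  show ?thesis using 1 2 eventually_ge_at_top[of 3]
  proof eventually_elim
    case (elim N)
    have fin: "finite {q. 1 \<le> q \<and> real q \<le> ?D N \<and> R q}" for R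
      by (rule finite_subset[OF _ finite_nat_real_le[of "?D N"]]) auto
    have fin': "finite {q. 1 \<le> q \<and> real q \<le> ?D N}" using fin[of "\<lambda>_. True"] by simp
    have "(\<Sum>q | 1 \<le> q \<and> real q \<le> ?D N. \<bar>shift_error N q\<bar>) = (\<Sum>q | 1 \<le> q \<and> real q \<le> ?D N \<and> coprime N q. \<bar>shift_error N q\<bar>)"
      using fin' by (intro sum.mono_neutral_right) (auto simp: shift_error_not_coprime coprime_commute)
    also have "\<dots> \<le> (\<Sum>q | 1 \<le> q \<and> real q \<le> ?D N \<and> coprime N q. ?h N q + 4 * ln (real N) ^ 3)"
    proof (rule sum_mono)
      fix q assume "q \<in> {q. 1 \<le> q \<and> real q \<le> ?D N \<and> coprime N q}"
      then have "local_density N q = 1 / real (totient q)" by (simp add: local_density_def coprime_commute)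
      then have "shift_error N q = shift_sum N q - real N / real (totient q)" by (simp add: shift_error_def)
      moreover have "\<bar>(\<Sum>n | n \<in> {1..<N} \<and> [n = N] (mod q). mangoldt n) - shift_sum N q\<bar> \<le> 4 * ln (real N) ^ 3"
        using shift_weight_progression_diff[of N "\<lambda>_. 1" 1 q] elim by (simp add: shift_sum_def)
      ultimately show "\<bar>shift_error N q\<bar> \<le> ?h N q + 4 * ln (real N) ^ 3" by linarith
    qed
    also have "\<dots> = (\<Sum>q | 1 \<le> q \<and> real q \<le> ?D N \<and> coprime N q. ?h N q)
        + real (card {q. 1 \<le> q \<and> real q \<le> ?D N \<and> coprime N q}) * (4 * ln (real N) ^ 3)"
      by (simp add: sum.distrib)
    also have "\<dots> \<le> 1/2 * (real N / ln (real N) powr A) + ?D N * (4 * ln (real N) ^ 3)"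
    proof (intro add_mono mult_right_mono)
      have "card {q. 1 \<le> q \<and> real q \<le> ?D N \<and> coprime N q} \<le> card {q. 1 \<le> q \<and> real q \<le> ?D N}"
        using fin' by (intro card_mono) auto
      also have "real (card {q. 1 \<le> q \<and> real q \<le> ?D N}) \<le> ?D N" by (rule card_nat_real_le) simp
      finally show "real (card {q. 1 \<le> q \<and> real q \<le> ?D N \<and> coprime N q}) \<le> ?D N" by simp
    qed (use elim in auto)
    also have "\<dots> \<le> real N / ln (real N) powr A" using elim by simp
    finally show ?case .
  qed
qed

lemma prime_number_theorem_from_level:
  fixes \<theta> C :: real
  assumes \<theta>: "0 < \<theta>" and C: "C > 0"
    and H: "\<And>A::real. A > 0 \<Longrightarrow>
      (\<lambda>N::nat. \<Sum>q | 1 \<le> q \<and> real q \<le> real N powr \<theta> * ln (real N) powr C \<and> coprime N q.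
          \<bar>(\<Sum>n | n \<in> {1..<N} \<and> [n = N] (mod q). mangoldt n) - real N / real (totient q)\<bar>)
        \<in> O[at_top](\<lambda>N. real N / ln (real N) powr A)"
  shows "(\<lambda>n. (\<Sum>k=1..n. mangoldt k) / real n) \<longlonglongrightarrow> (1::real)"
proof -
  let ?D = "\<lambda>N::nat. real N powr \<theta> * ln (real N) powr C"
  let ?h = "\<lambda>N q. \<bar>(\<Sum>n | n \<in> {1..<N} \<and> [n = N] (mod q). mangoldt n) - real N / real (totient q)\<bar>"
  define f where "f N = (\<Sum>n\<in>{1..<N}. mangoldt n :: real)" for N
  have 1: "\<forall>\<^sub>F N in at_top. \<bar>\<Sum>q | 1 \<le> q \<and> real q \<le> ?D N \<and> coprime N q. ?h N q\<bar> \<le> 1 * (real N / ln (real N) powr 1)"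
    by (intro bigo_log_power_bound H) auto
  have 2: "\<forall>\<^sub>F N::nat in at_top. 1 \<le> real N powr \<theta> * ln (real N) powr C" using \<theta> C by real_asymp
  have b: "\<forall>\<^sub>F N in at_top. \<bar>f N - real N\<bar> \<le> real N / ln (real N)"
    using 1 2 eventually_ge_at_top[of 3]
  proof eventually_elim
    case (elim N)
    have fin: "finite {q. 1 \<le> q \<and> real q \<le> ?D N \<and> coprime N q}"
      by (rule finite_subset[OF _ finite_nat_real_le[of "?D N"]]) auto
    \<comment> \<open>The single modulus q = 1 already controls the full sum of Lambda over n <
      N.\<close>
    have "?h N 1 \<le> (\<Sum>q | 1 \<le> q \<and> real q \<le> ?D N \<and> coprime N q. ?h N q)"
      using fin elim by (intro member_le_sum) auto
    moreover have "{n. n \<in> {1..<N} \<and> [n = N] (mod 1)} = {1..<N}" by auto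
    then have "?h N 1 = \<bar>f N - real N\<bar>" by (simp only: f_def) simp
    ultimately show ?case using elim by simp
  qed
  have lim: "(\<lambda>N. f N / real N) \<longlonglongrightarrow> 1"
  proof (rule tendsto_sandwich[of "\<lambda>N. 1 - 1 / ln (real N)" _ _ "\<lambda>N. 1 + 1 / ln (real N)"])
    show "\<forall>\<^sub>F n in sequentially. 1 - 1 / ln (real n) \<le> f n / real n"
      using b eventually_ge_at_top[of 3]
      by eventually_elim (auto simp: abs_le_iff field_simps)
    show "\<forall>\<^sub>F n in sequentially. f n / real n \<le> 1 + 1 / ln (real n)"
      using b eventually_ge_at_top[of 3]
      by eventually_elim (auto simp: abs_le_iff field_simps)
  qed real_asymp+
  have a: "(\<lambda>n. f (Suc n) / real (Suc n) * (real (Suc n) / real n)) \<longlonglongrightarrow> 1 * 1"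
    by (intro tendsto_mult LIMSEQ_Suc[OF lim]) real_asymp
  have b: "\<forall>\<^sub>F n in sequentially. f (Suc n) / real (Suc n) * (real (Suc n) / real n) = (\<Sum>k=1..n. mangoldt k) / real n"
    using eventually_ge_at_top[of 1]
  proof eventually_elim
    case (elim n)
    have "{1..<Suc n} = {1..n}" by auto
    then show ?case using elim by (simp add: f_def)
  qed
  show ?thesis using Lim_transform_eventually[OF a b] by simp
qed

section \<open>A small prime not dividing N, and the full Moebius sums\<close>

text \<open>If every prime up to x = (ln N)^2 divided N, all prime powers up to x would have their
  bases among the at most 2 ln N prime factors of N. Then psi(x) would be O(ln N * (ln ln N)^2),
  against psi(x) > x / 2.\<close>

lemma exists_small_nondivisor_prime:
  assumes psi: "(\<lambda>n. (\<Sum>k=1..n. mangoldt k) / real n) \<longlonglongrightarrow> (1::real)"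
  shows "\<forall>\<^sub>F N::nat in at_top. \<exists>p. prime p \<and> \<not> p dvd N \<and> real p \<le> ln (real N) ^ 2"
proof -
  let ?x = "\<lambda>N. nat \<lfloor>ln (real N) ^ 2\<rfloor>"
  have lim: "filterlim ?x at_top at_top" by real_asymp
  have "\<forall>\<^sub>F n in sequentially. (\<Sum>k=1..n. mangoldt k) / real n > (1/2::real)"
    using order_tendstoD(1)[OF psi, of "1/2"] by simp
  then have 1: "\<forall>\<^sub>F N in at_top. (\<Sum>k=1..?x N. mangoldt k) / real (?x N) > (1/2::real)"
    using lim by (rule eventually_compose_filterlim)
  have 2: "\<forall>\<^sub>F N::nat in at_top. 2 * ln (real N) * (2 * ln (ln (real N) ^ 2)) * ln (ln (real N) ^ 2) < (ln (real N) ^ 2 - 1) / 2"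
    by real_asymp
  have 3: "\<forall>\<^sub>F N::nat in at_top. ln (real N) ^ 2 \<ge> 3" by real_asymp
  show ?thesis using 1 2 3 eventually_ge_at_top[of 3]
  proof eventually_elim
    case (elim N)
    let ?y = "ln (real N) ^ 2" and ?n = "?x N"
    have n: "?n \<ge> 1" "real ?n \<le> ?y" "real ?n \<ge> ?y - 1" using elim(3) by (auto simp: le_nat_floor)
    have ly: "ln ?y \<ge> 0" using elim(3) by (intro ln_ge_zero) linarith
    show ?case
    proof (rule ccontr)
      assume "\<not> ?thesis"
      then have all: "p dvd N" if "prime p" "real p \<le> ?y" for p using that by blast
      let ?B = "{k. real k \<le> ?y \<and> primepow k \<and> aprimedivisor k \<in> prime_factors N}"
      have finB: "finite ?B" by (rule finite_subset[OF _ finite_nat_real_le[of ?y]]) auto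
      have "(\<Sum>k=1..?n. mangoldt k :: real) = (\<Sum>k | k \<in> {1..?n} \<and> primepow k. mangoldt k)"
        by (rule sum.mono_neutral_right) (auto simp: mangoldt_def)
      also have "\<dots> \<le> (\<Sum>k\<in>?B. ln ?y)"
      proof (rule order_trans[OF sum_mono])
        fix k assume k: "k \<in> {k. k \<in> {1..?n} \<and> primepow k}"
        then have "mangoldt k \<le> ln (real k)" by (intro mangoldt_le) auto
        also have "\<dots> \<le> ln ?y"
        proof (rule ln_mono)
          have "real k \<le> real ?n" using k by (intro of_nat_mono) simp
          then show "real k \<le> ?y" using n by linarith
        qed (use k in auto)
        finally show "mangoldt k \<le> ln ?y" .
      next
        show "(\<Sum>k | k \<in> {1..?n} \<and> primepow k. ln ?y) \<le> (\<Sum>k\<in>?B. ln ?y)"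
        proof (rule sum_mono2[OF finB])
          show "{k. k \<in> {1..?n} \<and> primepow k} \<subseteq> ?B"
          proof
            fix k assume k: "k \<in> {k. k \<in> {1..?n} \<and> primepow k}"
            then have "real k \<le> real ?n" by (intro of_nat_mono) simp
            then have ky: "real k \<le> ?y" using n by linarith
            obtain p j where pj: "prime p" "j > 0" "k = p ^ j" using k by (auto simp: primepow_def)
            have "p dvd k" using pj by auto
            then have "p \<le> k" using k by (intro dvd_imp_le) auto
            then have "p dvd N" using all[OF pj(1)] ky by linarith
            then show "k \<in> ?B" using pj ky k elim by (simp add: aprimedivisor_prime_power in_prime_factors_iff)
          qed
        qed (use ly in auto)
      qed
      also have "\<dots> = real (card ?B) * ln ?y" by simp
      also have "\<dots> \<le> (real (card (prime_factors N)) * (2 * ln ?y)) * ln ?y"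
        using elim(3) ly by (intro mult_right_mono card_primepow_le_ln) auto
      also have "\<dots> \<le> (2 * ln (real N) * (2 * ln ?y)) * ln ?y"
        using card_prime_factors_le[of N] log2_le[of "real N"] elim ly by (intro mult_right_mono) auto
      also have "\<dots> < (?y - 1) / 2" using elim by simp
      also have "\<dots> \<le> real ?n / 2" by (intro divide_right_mono n(3)) simp
      finally have "(\<Sum>k=1..?n. mangoldt k :: real) < real ?n / 2" .
      moreover have half: "b / 2 < a" if "1 / 2 < a / b" "b \<ge> 1" for a b :: real
        using that by (simp add: field_simps)
      have "real 1 \<le> real ?n" using n(1) by (rule of_nat_mono)
      then have "real ?n / 2 < (\<Sum>k=1..?n. mangoldt k :: real)" using half[OF elim(1)] by linarith
      ultimately show False by linarith
    qed
  qed
qed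

text \<open>
  The modulus \<open>q = p\<^sup>2\<close> with \<open>p\<close> the least prime not dividing \<open>N\<close> is admissible, and \<open>g\<close> vanishes
  on its multiples. So the second hypothesis bounds the full sum itself.
\<close>

lemma total_sum_small:
  fixes \<theta> A :: real and g :: "nat \<Rightarrow> real"
  assumes \<theta>: "\<theta> < 1" and A: "A > 0"
    and g0: "\<And>m. \<not> squarefree m \<Longrightarrow> g m = 0"
    and psi: "(\<lambda>n. (\<Sum>k=1..n. mangoldt k) / real n) \<longlonglongrightarrow> (1::real)"
    and H: "\<And>A::real. A > 0 \<Longrightarrow>
      (\<lambda>N::nat. \<Sum>q | 1 \<le> q \<and> real q \<le> real N powr (1 - \<theta>) \<and> coprime N q.
          \<bar>(\<Sum>n | n \<in> {1..<N} \<and> [n = N] (mod q). mangoldt n * g (N - n))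
            - 1 / real (totient q) * (\<Sum>n\<in>{1..<N}. mangoldt n * g (N - n))\<bar>)
        \<in> O[at_top](\<lambda>N. real N / ln (real N) powr A)"
  shows "\<forall>\<^sub>F N in at_top. \<bar>\<Sum>n\<in>{1..<N}. mangoldt n * g (N - n)\<bar> \<le> real N / ln (real N) powr A"
proof -
  let ?T = "\<lambda>N. \<Sum>n\<in>{1..<N}. mangoldt n * g (N - n)"
  let ?h = "\<lambda>N q. \<bar>(\<Sum>n | n \<in> {1..<N} \<and> [n = N] (mod q). mangoldt n * g (N - n)) - 1 / real (totient q) * ?T N\<bar>"
  \<comment> \<open>The four extra logarithms pay for the factor totient q <= p^2 <= (ln
    N)^4.\<close>
  have 1: "\<forall>\<^sub>F N in at_top. \<bar>\<Sum>q | 1 \<le> q \<and> real q \<le> real N powr (1 - \<theta>) \<and> coprime N q. ?h N q\<bar> \<le> 1 * (real N / ln (real N) powr (A + 4))"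
    using A by (intro bigo_log_power_bound H) auto
  have 2: "\<forall>\<^sub>F N::nat in at_top. ln (real N) ^ 4 \<le> real N powr (1 - \<theta>)"
    using \<theta> by real_asymp
  show ?thesis using 1 2 exists_small_nondivisor_prime[OF psi] eventually_ge_at_top[of 3]
  proof eventually_elim
    case (elim N)
    then obtain p where p: "prime p" "\<not> p dvd N" "real p \<le> ln (real N) ^ 2" by blast
    define q where "q = p\<^sup>2"
    have q1: "q \<ge> 1" using prime_ge_1_nat[OF p(1)] by (simp add: q_def)
    have "real q = real p ^ 2" by (simp add: q_def)
    also have "\<dots> \<le> (ln (real N) ^ 2) ^ 2" using p by (intro power_mono) auto
    finally have q4: "real q \<le> ln (real N) ^ 4" by simp
    have cop: "coprime N q" using p prime_imp_coprime[of p N] by (simp add: q_def coprime_commute)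
    have fin: "finite {q. 1 \<le> q \<and> real q \<le> real N powr (1 - \<theta>) \<and> coprime N q}"
      by (rule finite_subset[OF _ finite_nat_real_le[of "real N powr (1 - \<theta>)"]]) auto
    have "(\<Sum>n | n \<in> {1..<N} \<and> [n = N] (mod q). mangoldt n * g (N - n)) = (\<Sum>m | m \<in> {1..<N} \<and> q dvd m. mangoldt (N - m) * g m)"
      unfolding sum_progression_reindex by (intro sum.cong) auto
    also have "\<dots> = 0"
    proof (rule sum.neutral, rule ballI)
      fix m assume "m \<in> {m. m \<in> {1..<N} \<and> q dvd m}"
      then have "\<not> squarefree m" using p(1) not_squarefreeI[of p m] not_prime_unit by (auto simp: q_def)
      then show "mangoldt (N - m) * g m = 0" using g0 by simp
    qed
    finally have "?h N q = \<bar>?T N\<bar> / real (totient q)" by (simp add: abs_mult)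
    moreover have "?h N q \<le> (\<Sum>q | 1 \<le> q \<and> real q \<le> real N powr (1 - \<theta>) \<and> coprime N q. ?h N q)"
      using fin q1 q4 elim cop by (intro member_le_sum[of q]) auto
    ultimately have "\<bar>?T N\<bar> / real (totient q) \<le> real N / ln (real N) powr (A + 4)" using elim by simp
    then have "\<bar>?T N\<bar> \<le> real (totient q) * (real N / ln (real N) powr (A + 4))"
      using q1 by (simp add: pos_divide_le_eq mult.commute)
    also have "\<dots> \<le> ln (real N) ^ 4 * (real N / ln (real N) powr (A + 4))"
    proof (rule mult_right_mono)
      have "real (totient q) \<le> real q" by (simp add: totient_le)
      then show "real (totient q) \<le> ln (real N) ^ 4" using q4 by linarith
    qed simp
    also have "\<dots> = real N / ln (real N) powr A"
      using elim(4) by (simp add: powr_add powr_numeral)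
    finally show ?case .
  qed
qed

section \<open>Sums of reciprocals of totients\<close>

lemma inverse_totient_mult_le:
  assumes "squarefree (j::nat)"
  shows "1 / (real j * real (totient j)) \<le> 2 * real j powr (-3/2)"
proof -
  have j: "j > 0" using assms by (auto intro!: Nat.gr0I)
  have s: "real j powr (3/2) = real j * sqrt (real j)"
  proof -
    have "real j powr (3/2) = real j powr (1 + 1/2)" by simp
    also have "\<dots> = real j * sqrt (real j)" using j by (simp only: powr_add powr_half_sqrt) simp
    finally show ?thesis .
  qed
  have "1 / (real j * real (totient j)) \<le> 1 / (real j * (sqrt (real j) / 2))"
    using squarefree_totient_ge_sqrt[OF assms] j by (intro divide_left_mono mult_left_mono mult_pos_pos) auto
  also have "\<dots> = 2 * real j powr (-3/2)" using s j by (simp add: powr_minus_divide)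
  finally show ?thesis .
qed

lemma sum_inverse_totient_mult_tail:
  assumes "finite J" "\<And>j. j \<in> J \<Longrightarrow> squarefree j" "\<And>j. j \<in> J \<Longrightarrow> real j > z" "z \<ge> 1"
  shows "(\<Sum>j\<in>J. 1 / (real j * real (totient j))) \<le> 8 / sqrt z"
proof -
  have "(\<Sum>j\<in>J. 1 / (real j * real (totient j))) \<le> (\<Sum>j\<in>J. 2 * real j powr (-3/2))"
    using assms by (intro sum_mono inverse_totient_mult_le) auto
  also have "\<dots> = 2 * (\<Sum>j\<in>J. real j powr (-3/2))" by (simp only: sum_distrib_left)
  also have "\<dots> \<le> 2 * (4 / sqrt z)" using assms by (intro mult_left_mono sum_powr_tail_le) auto
  finally show ?thesis by simp
qed

lemma sum_inverse_totient_mult_le: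
  assumes "finite J" "\<And>j. j \<in> J \<Longrightarrow> squarefree j"
  shows "(\<Sum>j\<in>J. 1 / (real j * real (totient j))) \<le> 10"
proof -
  have "J \<subseteq> insert 1 (J - {1})" by auto
  then have "(\<Sum>j\<in>J. 1 / (real j * real (totient j))) \<le> (\<Sum>j\<in>insert 1 (J - {1}). 1 / (real j * real (totient j)))"
    using assms by (intro sum_mono2) auto
  also have "\<dots> = 1 + (\<Sum>j\<in>J - {1}. 1 / (real j * real (totient j)))"
    using assms by (subst sum.insert) auto
  also have "(\<Sum>j\<in>J - {1}. 1 / (real j * real (totient j))) \<le> 8 / sqrt 1"
  proof (rule sum_inverse_totient_mult_tail)
    fix j assume j: "j \<in> J - {1}"
    have "j \<noteq> 0" using assms(2)[of j] j by (metis DiffD1 not_squarefree_0)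
    moreover have "j \<noteq> 1" using j by simp
    ultimately have "j > 1" by linarith
    then show "real j > 1" by simp
  qed (use assms in auto)
  finally show ?thesis by simp
qed

text \<open>Expand 1 / phi(d) = 1 / d * sum over j | d of 1 / phi(j) and put d = j * k. The window
  for k has the same ratio b / a for every j, so the estimate for 1 / k is uniform, and sum 1 / (j *
  phi(j)) <= 10.\<close>

lemma sum_inverse_totient_window_le:
  fixes a b :: real
  assumes ab: "0 < a" "a \<le> b"
  shows "(\<Sum>d | 1 \<le> d \<and> a < real d \<and> real d \<le> b \<and> squarefree d. 1 / real (totient d)) \<le> 10 * (1 + ln (b / a))"
proof -
  let ?D = "{d. 1 \<le> d \<and> a < real d \<and> real d \<le> b \<and> squarefree d}"
  let ?J = "{j. 1 \<le> j \<and> real j \<le> b \<and> squarefree j}"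
  have finD: "finite ?D" by (rule finite_subset[OF _ finite_nat_real_le[of b]]) auto
  have finJ: "finite ?J" by (rule finite_subset[OF _ finite_nat_real_le[of b]]) auto
  have l: "ln (b / a) \<ge> 0" using ab by (intro ln_ge_zero) auto
  have dj: "{j. j dvd d} = {j. j \<in> ?J \<and> j dvd d}" if d: "d \<in> ?D" for d
  proof (rule Set.set_eqI, rule iffI)
    fix j assume "j \<in> {j. j dvd d}"
    then have j: "j dvd d" by simp
    have "j > 0" using j d by (auto intro: dvd_pos_nat)
    moreover have "j \<le> d" using j d by (intro dvd_imp_le) auto
    then have "real j \<le> b" using d by (auto intro: order_trans[of "real j" "real d"])
    moreover have "squarefree j" using squarefree_mono[OF j] d by simp
    ultimately show "j \<in> {j. j \<in> ?J \<and> j dvd d}" using j by (simp add: Suc_le_eq)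
  qed simp
  have "(\<Sum>d\<in>?D. 1 / real (totient d)) = (\<Sum>d\<in>?D. \<Sum>j | j \<in> ?J \<and> j dvd d. 1 / real (totient j) * (1 / real d))"
  proof (intro sum.cong refl)
    fix d assume d: "d \<in> ?D"
    have "1 / real (totient d) = (real d / real (totient d)) * (1 / real d)" using d by simp
    also have "\<dots> = (\<Sum>j | j dvd d. 1 / real (totient j)) * (1 / real d)"
      using squarefree_over_totient[of d] d by simp
    finally show "1 / real (totient d) = (\<Sum>j | j \<in> ?J \<and> j dvd d. 1 / real (totient j) * (1 / real d))"
      unfolding dj[OF d] sum_distrib_right .
  qed
  also have "\<dots> = (\<Sum>j\<in>?J. \<Sum>d | d \<in> ?D \<and> j dvd d. 1 / real (totient j) * (1 / real d))"
    using finD finJ by (rule sum.swap_restrict)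
  also have "\<dots> \<le> (\<Sum>j\<in>?J. 1 / (real j * real (totient j)) * (1 + ln (b / a)))"
  proof (rule sum_mono)
    fix j assume j: "j \<in> ?J"
    have j0: "j > 0" using j by simp
    let ?K = "{k. 1 \<le> k \<and> a / real j < real k \<and> real k \<le> b / real j}"
    have finK: "finite ?K" by (rule finite_subset[OF _ finite_nat_real_le[of "b / real j"]]) auto
    have "(\<Sum>d | d \<in> ?D \<and> j dvd d. 1 / real d) \<le> (\<Sum>d\<in>(*) j ` ?K. 1 / real d)"
    proof (rule sum_mono2)
      show "{d. d \<in> ?D \<and> j dvd d} \<subseteq> (*) j ` ?K"
      proof
        fix d assume d: "d \<in> {d. d \<in> ?D \<and> j dvd d}"
        then have "j dvd d" by simp
        then obtain k where k: "d = j * k" by (elim dvdE)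
        have "k \<in> ?K" using d k j0 by (auto simp: field_simps Suc_le_eq)
        then show "d \<in> (*) j ` ?K" using k by blast
      qed
    qed (use finK in auto)
    also have "\<dots> = (\<Sum>k\<in>?K. 1 / real j * (1 / real k))"
      using j0 by (subst sum.reindex) (auto simp: inj_on_def)
    also have "\<dots> = 1 / real j * (\<Sum>k\<in>?K. 1 / real k)" by (simp only: sum_distrib_left)
    also have "(\<Sum>k\<in>?K. 1 / real k) \<le> 1 + ln ((b / real j) / (a / real j))"
      using ab j0 by (intro sum_inverse_window_le) (auto intro: divide_right_mono)
    also have "(b / real j) / (a / real j) = b / a" using j0 by simp
    finally have "(\<Sum>d | d \<in> ?D \<and> j dvd d. 1 / real d) \<le> 1 / real j * (1 + ln (b / a))"
      by (simp add: divide_right_mono)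
    then have "1 / real (totient j) * (\<Sum>d | d \<in> ?D \<and> j dvd d. 1 / real d) \<le> 1 / real (totient j) * (1 / real j * (1 + ln (b / a)))"
      by (intro mult_left_mono) auto
    then show "(\<Sum>d | d \<in> ?D \<and> j dvd d. 1 / real (totient j) * (1 / real d)) \<le> 1 / (real j * real (totient j)) * (1 + ln (b / a))"
      by (simp add: sum_distrib_left mult.commute)
  qed
  also have "\<dots> = (\<Sum>j\<in>?J. 1 / (real j * real (totient j))) * (1 + ln (b / a))"
    by (simp only: sum_distrib_right)
  also have "\<dots> \<le> 10 * (1 + ln (b / a))"
    using l finJ by (intro mult_right_mono sum_inverse_totient_mult_le) auto
  finally show ?thesis .
qed

lemma sum_inverse_totient_upto_le:
  fixes x :: real
  assumes "x \<ge> 1"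
  shows "(\<Sum>d | 1 \<le> d \<and> real d \<le> x \<and> squarefree d. 1 / real (totient d)) \<le> 20 * (1 + ln x)"
proof -
  have "{d. 1 \<le> d \<and> real d \<le> x \<and> squarefree d} = {d. 1 \<le> d \<and> 1/2 < real d \<and> real d \<le> x \<and> squarefree d}" by auto
  then have "(\<Sum>d | 1 \<le> d \<and> real d \<le> x \<and> squarefree d. 1 / real (totient d)) \<le> 10 * (1 + ln (x / (1/2)))"
    using sum_inverse_totient_window_le[of "1/2" x] assms by simp
  also have "ln (x / (1/2)) = ln 2 + ln x" using assms by (simp add: ln_mult mult.commute)
  also have "10 * (1 + (ln 2 + ln x)) \<le> 20 * (1 + ln x)"
    using ln_2_less_1 ln_ge_zero[OF assms] by argo
  finally show ?thesis by simp
qed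

section \<open>Integers without prime factors up to z\<close>

lemma card_coprime_upto_le:
  assumes P: "P > 0"
  shows "card {d. 1 \<le> d \<and> d \<le> x \<and> coprime d P} \<le> (x div P + 1) * totient P"
proof -
  let ?T = "{r. r < P \<and> coprime r P}"
  have "card ?T = totient P"
  \<comment> \<open>For P = 1 the residue 0 is coprime to P, whereas \<open>totatives\<close> has
    the representative 1.\<close>
  proof (cases "P = 1")
    case True
    then have "?T = {0}" by auto
    then show ?thesis using True by simp
  next
    case False
    then have "?T = totatives P"
    proof (intro Set.set_eqI iffI)
      fix r assume "r \<in> ?T"
      then show "r \<in> totatives P" using False by (cases "r = 0") (auto simp: in_totatives_iff)
    next
      fix r assume r: "r \<in> totatives P"
      then have "r \<noteq> P" using False by (auto simp: in_totatives_iff)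
      then show "r \<in> ?T" using r by (auto simp: in_totatives_iff)
    qed
    then show ?thesis by (simp add: totient_def)
  qed
  have "card {d. 1 \<le> d \<and> d \<le> x \<and> coprime d P} \<le> card ({..x div P} \<times> ?T)"
  proof (rule card_inj_on_le[of "\<lambda>d. (d div P, d mod P)"])
    show "inj_on (\<lambda>d. (d div P, d mod P)) {d. 1 \<le> d \<and> d \<le> x \<and> coprime d P}"
    proof (rule inj_onI)
      fix a b assume ab: "(a div P, a mod P) = (b div P, b mod P)"
      have "a = a div P * P + a mod P" by simp
      also have "\<dots> = b div P * P + b mod P" using ab by (simp only: prod.inject)
      also have "\<dots> = b" by simp
      finally show "a = b" .
    qed
    show "(\<lambda>d. (d div P, d mod P)) ` {d. 1 \<le> d \<and> d \<le> x \<and> coprime d P} \<subseteq> {..x div P} \<times> ?T"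
      using P by (auto simp: div_le_mono)
  qed simp
  also have "\<dots> = (x div P + 1) * totient P"
    using \<open>card ?T = totient P\<close> by (simp add: card_cartesian_product)
  finally show ?thesis .
qed

definition primorial :: "nat \<Rightarrow> nat" where
  "primorial z = \<Prod>{p. prime p \<and> p \<le> z}"

lemma finite_primes_upto [simp]: "finite {p::nat. prime p \<and> p \<le> z}"
  by (rule finite_subset[of _ "{..z}"]) auto

lemma primorial_pos [simp]: "primorial z > 0"
  unfolding primorial_def by (intro prod_pos) (auto simp: prime_gt_0_nat)

lemma prime_factors_primorial: "prime_factors (primorial z) = {p. prime p \<and> p \<le> z}"
proof -
  have "prime_factors (prod (\<lambda>x. x) {p. prime p \<and> p \<le> z}) = \<Union>((prime_factors \<circ> (\<lambda>x. x)) ` {p. prime p \<and> p \<le> z})"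
    by (rule prime_factors_prod) auto
  also have "\<dots> = {p. prime p \<and> p \<le> z}" by (auto simp: prime_prime_factors)
  finally show ?thesis by (simp add: primorial_def)
qed

lemma squarefree_primorial: "squarefree (primorial z)"
  unfolding primorial_def
  by (rule squarefree_prod_coprime) (auto simp: primes_coprime squarefree_prime)

lemma coprime_primorial_gt:
  assumes "coprime j (primorial z)" "j > 1"
  shows "j > z"
proof (rule ccontr)
  assume "\<not> j > z"
  obtain p where p: "prime p" "p dvd j" using prime_factor_nat[of j] assms by auto
  then have "p \<le> z" using dvd_imp_le[of p j] assms \<open>\<not> j > z\<close> by auto
  then have "p \<in> prime_factors (primorial z)" using p by (simp add: prime_factors_primorial)
  then show False using assms p coprime_common_divisor[of j "primorial z" p] by (auto simp: in_prime_factors_iff)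
qed

text \<open>The upper half of Mertens' product theorem, with a crude constant: once all primes up to
  z are forbidden, the only squarefree b <= z left is 1, so the factor \<open>kap\<close> alone must
  account for the logarithm.\<close>

lemma totient_primorial_le: 
  assumes "z \<ge> 1"
  shows "real (totient (primorial z)) / real (primorial z) \<le> 2 / ln (real z + 1)"
proof -
  let ?T = "{p. prime p \<and> p \<le> z}"
  have "ln (real z + 1) / 2 \<le> (\<Sum>b | b \<in> {1..z} \<and> squarefree b. 1 / real b)"
    by (rule sum_squarefree_inverse_ge[OF assms(1)])
  also have "\<dots> \<le> (\<Sum>b | b \<in> {1..z} \<and> squarefree b. 1 / real (totient b))"
    by (intro sum_mono divide_left_mono) (auto simp: totient_le)
  also have "\<dots> \<le> kap ?T * (\<Sum>b | b \<in> {1..z} \<and> squarefree b \<and> (\<forall>q\<in>?T. \<not> q dvd b). 1 / real (totient b))"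
    by (rule squarefree_totient_sum_ge) auto
  also have "{b. b \<in> {1..z} \<and> squarefree b \<and> (\<forall>q\<in>?T. \<not> q dvd b)} = {1}"
  proof (intro Set.set_eqI iffI)
    fix b assume b: "b \<in> {b. b \<in> {1..z} \<and> squarefree b \<and> (\<forall>q\<in>?T. \<not> q dvd b)}"
    show "b \<in> {1}"
    proof (rule ccontr)
      assume "b \<notin> {1}"
      then obtain p where p: "prime p" "p dvd b" using prime_factor_nat[of b] by auto
      then have "p \<le> z" using b dvd_imp_le[of p b] by auto
      then show False using b p by auto
    qed
  qed (use assms in auto)
  also have "kap ?T = real (primorial z) / real (totient (primorial z))"
    using kap_prime_factors[of "primorial z"] by (simp add: prime_factors_primorial)
  finally have h: "ln (real z + 1) / 2 \<le> real (primorial z) / real (totient (primorial z))" by simp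
  have "ln (real z + 1) > 0" using assms by simp
  moreover have "totient (primorial z) > 0" by simp
  ultimately show ?thesis using h by (simp add: field_simps)
qed

text \<open>On the window 1 / phi(d) is at most d / phi(d) divided by eta * y, and d / phi(d) is
  expanded over its divisors j. The divisor j = 1 counts integers coprime to P, of density phi(P) /
  P <= 2 / ln(z + 1) up to a boundary term P; every other j exceeds z and these contribute 8 / sqrt
  z. The bound is small for large z, unlike the one for the unsifted window.\<close>

lemma sum_inverse_totient_sifted_window:
  fixes y \<eta> :: real
  assumes \<eta>: "0 < \<eta>" and y: "y \<ge> 1" and z: "z \<ge> 1"
  shows "(\<Sum>d | 1 \<le> d \<and> \<eta> * y < real d \<and> real d \<le> y \<and> squarefree d \<and> coprime d (primorial z). 1 / real (totient d))
    \<le> 1 / \<eta> * (2 / ln (real z + 1) + real (primorial z) / y + 8 / sqrt (real z))"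
proof -
  let ?P = "primorial z"
  let ?E = "{d. 1 \<le> d \<and> \<eta> * y < real d \<and> real d \<le> y \<and> squarefree d \<and> coprime d ?P}"
  let ?D = "{d. 1 \<le> d \<and> real d \<le> y \<and> squarefree d \<and> coprime d ?P}"
  have finD: "finite ?D" by (rule finite_subset[OF _ finite_nat_real_le[of y]]) auto
  have dj: "{j. j dvd d} = {j. j \<in> ?D \<and> j dvd d}" if d: "d \<in> ?D" for d
  proof (rule Set.set_eqI, rule iffI)
    fix j assume "j \<in> {j. j dvd d}"
    then have j: "j dvd d" by simp
    have "j > 0" using j d by (auto intro: dvd_pos_nat)
    moreover have "j \<le> d" using j d by (intro dvd_imp_le) auto
    then have "real j \<le> y" using d by (auto intro: order_trans[of "real j" "real d"])
    moreover have "squarefree j" using squarefree_mono[OF j] d by simp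
    moreover have "coprime j ?P" using coprime_divisors[OF j dvd_refl] d by simp
    ultimately show "j \<in> {j. j \<in> ?D \<and> j dvd d}" using j by (simp add: Suc_le_eq)
  qed simp
  have "(\<Sum>d\<in>?E. 1 / real (totient d)) \<le> (\<Sum>d\<in>?E. 1 / (\<eta> * y) * (real d / real (totient d)))"
  proof (rule sum_mono)
    fix d assume d: "d \<in> ?E"
    have "\<eta> * y < real d" using d by blast
    then have "1 \<le> real d / (\<eta> * y)" using \<eta> y by (simp add: less_imp_le)
    then have "1 * (1 / real (totient d)) \<le> real d / (\<eta> * y) * (1 / real (totient d))"
      by (intro mult_right_mono) auto
    then show "1 / real (totient d) \<le> 1 / (\<eta> * y) * (real d / real (totient d))" by simp
  qed
  also have "\<dots> \<le> (\<Sum>d\<in>?D. 1 / (\<eta> * y) * (real d / real (totient d)))"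
    using \<eta> y finD by (intro sum_mono2) auto
  also have "\<dots> = 1 / (\<eta> * y) * (\<Sum>d\<in>?D. real d / real (totient d))" by (simp only: sum_distrib_left)
  also have "(\<Sum>d\<in>?D. real d / real (totient d)) \<le> y * (2 / ln (real z + 1)) + real ?P + y * (8 / sqrt (real z))"
  proof -
    have "(\<Sum>d\<in>?D. real d / real (totient d)) = (\<Sum>d\<in>?D. \<Sum>j | j \<in> ?D \<and> j dvd d. 1 / real (totient j))"
      using dj by (intro sum.cong refl) (simp add: squarefree_over_totient)
    also have "\<dots> = (\<Sum>j\<in>?D. \<Sum>d | d \<in> ?D \<and> j dvd d. 1 / real (totient j))"
      using finD finD by (rule sum.swap_restrict)
    also have "\<dots> = (\<Sum>j\<in>?D. real (card {d. d \<in> ?D \<and> j dvd d}) * (1 / real (totient j)))" by simp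
    also have "\<dots> = real (card {d. d \<in> ?D \<and> 1 dvd d}) * (1 / real (totient 1))
        + (\<Sum>j\<in>?D - {1}. real (card {d. d \<in> ?D \<and> j dvd d}) * (1 / real (totient j)))"
      using finD y by (intro sum.remove) auto
    also have "real (card {d. d \<in> ?D \<and> 1 dvd d}) * (1 / real (totient 1)) \<le> y * (2 / ln (real z + 1)) + real ?P"
    proof -
      define x where "x = nat \<lfloor>y\<rfloor>"
      have "card {d. d \<in> ?D \<and> 1 dvd d} \<le> card {d. 1 \<le> d \<and> d \<le> x \<and> coprime d ?P}"
        by (intro card_mono) (auto simp: x_def le_nat_floor)
      also have "\<dots> \<le> (x div ?P + 1) * totient ?P" by (rule card_coprime_upto_le) simp
      finally have "real (card {d. d \<in> ?D \<and> 1 dvd d}) \<le> real ((x div ?P + 1) * totient ?P)"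
        by (rule of_nat_mono)
      also have "\<dots> = (real (x div ?P) + 1) * real (totient ?P)"
        by (simp only: of_nat_mult of_nat_add of_nat_1)
      also have "\<dots> \<le> (y / real ?P + 1) * real (totient ?P)"
      proof (intro mult_right_mono add_right_mono)
        have "real (x div ?P * ?P) \<le> real x" by (intro of_nat_mono div_times_less_eq_dividend)
        then have "real (x div ?P) \<le> real x / real ?P" by (subst pos_le_divide_eq) simp_all
        also have "\<dots> \<le> y / real ?P" using y by (intro divide_right_mono) (auto simp: x_def)
        finally show "real (x div ?P) \<le> y / real ?P" .
      qed auto
      also have "\<dots> = y * (real (totient ?P) / real ?P) + real (totient ?P)" by (simp add: algebra_simps)
      also have "\<dots> \<le> y * (2 / ln (real z + 1)) + real ?P"
        using y totient_primorial_le[OF z] totient_le[of ?P] by (intro add_mono mult_left_mono) auto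
      finally show ?thesis by simp
    qed
    also have "(\<Sum>j\<in>?D - {1}. real (card {d. d \<in> ?D \<and> j dvd d}) * (1 / real (totient j)))
       \<le> (\<Sum>j\<in>?D - {1}. y * (1 / (real j * real (totient j))))"
    proof (rule sum_mono)
      fix j assume j: "j \<in> ?D - {1}"
      have j0: "j > 0" using j by auto
      have "{d. d \<in> ?D \<and> j dvd d} \<subseteq> (*) j ` {k. 1 \<le> k \<and> real k \<le> y / real j}"
      proof
        fix d assume d: "d \<in> {d. d \<in> ?D \<and> j dvd d}"
        then have "j dvd d" by simp
        then obtain k where k: "d = j * k" by (elim dvdE)
        have "k \<in> {k. 1 \<le> k \<and> real k \<le> y / real j}" using d k j0 by (auto simp: field_simps Suc_le_eq)
        then show "d \<in> (*) j ` {k. 1 \<le> k \<and> real k \<le> y / real j}" using k by blast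
      qed
      moreover have fk: "finite {k. 1 \<le> k \<and> real k \<le> y / real j}"
        by (rule finite_subset[OF _ finite_nat_real_le[of "y / real j"]]) auto
      ultimately have "card {d. d \<in> ?D \<and> j dvd d} \<le> card {k. 1 \<le> k \<and> real k \<le> y / real j}"
        by (meson card_image_le card_mono finite_imageI order_trans)
      also have "real (card {k. 1 \<le> k \<and> real k \<le> y / real j}) \<le> y / real j"
        using y by (intro card_nat_real_le) auto
      finally have "real (card {d. d \<in> ?D \<and> j dvd d}) * (1 / real (totient j)) \<le> (y / real j) * (1 / real (totient j))"
        by (intro mult_right_mono) auto
      then show "real (card {d. d \<in> ?D \<and> j dvd d}) * (1 / real (totient j)) \<le> y * (1 / (real j * real (totient j)))"
        by simp
    qed
    also have "\<dots> = y * (\<Sum>j\<in>?D - {1}. 1 / (real j * real (totient j)))" by (simp only: sum_distrib_left)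
    also have "\<dots> \<le> y * (8 / sqrt (real z))"
    proof (intro mult_left_mono sum_inverse_totient_mult_tail)
      fix j assume j: "j \<in> ?D - {1}"
      then have "j > z" using coprime_primorial_gt[of j z] by auto
      then show "real j > real z" by simp
    qed (use finD y z in auto)
    finally show ?thesis by simp
  qed
  also have "1 / (\<eta> * y) * (y * (2 / ln (real z + 1)) + real ?P + y * (8 / sqrt (real z)))
      = 1 / \<eta> * (2 / ln (real z + 1) + real ?P / y + 8 / sqrt (real z))"
    using \<eta> y by (simp add: field_simps)
  finally show ?thesis using \<eta> y by (simp add: divide_right_mono)
qed

section \<open>The local densities\<close>

lemma sum_divisors_prime_mult:
  fixes f :: "nat \<Rightarrow> real"
  assumes p: "prime p" "\<not> p dvd m" and m: "m > 0"
  shows "(\<Sum>d | d dvd p * m. f d) = (\<Sum>d | d dvd m. f d + f (p * d))"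
proof -
  have p0: "p > 0" using p prime_gt_0_nat by blast
  have eq: "{d. d dvd p * m} = {d. d dvd m} \<union> (*) p ` {d. d dvd m}"
  proof (rule Set.set_eqI, rule iffI)
    fix d assume d: "d \<in> {d. d dvd p * m}"
    show "d \<in> {d. d dvd m} \<union> (*) p ` {d. d dvd m}"
    proof (cases "p dvd d")
      case True
      then obtain k where "d = p * k" by blast
      then show ?thesis using d p0 by auto
    next
      case False
      then have "coprime d p" using p(1) prime_imp_coprime coprime_commute by blast
      then show ?thesis using d by (simp add: coprime_dvd_mult_right_iff)
    qed
  qed (auto intro: dvd_mult)
  have "(\<Sum>d | d dvd p * m. f d) = (\<Sum>d | d dvd m. f d) + (\<Sum>d\<in>(*) p ` {d. d dvd m}. f d)"
    unfolding eq
  proof (rule sum.union_disjoint)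
    show "{d. d dvd m} \<inter> (*) p ` {d. d dvd m} = {}"
      using p(2) dvd_mult_left[of p _ m] by blast
  qed (use m in simp_all)
  also have "(\<Sum>d\<in>(*) p ` {d. d dvd m}. f d) = (\<Sum>d | d dvd m. f (p * d))"
    using p0 by (subst sum.reindex) (simp_all add: inj_on_def)
  finally show ?thesis by (simp add: sum.distrib)
qed

lemma sieve_density_prod:
  assumes "squarefree P"
  shows "sieve_density N P = (\<Prod>p\<in>prime_factors P. 1 - local_density N p)"
  using assms
proof (induction P rule: squarefree_induct)
  case one
  then show ?case by (simp add: sieve_density_def)
next
  case (prime_mult p m)
  have m0: "m > 0" using prime_mult by (auto intro!: Nat.gr0I)
  have pf: "prime_factors (p * m) = insert p (prime_factors m)"
    using prime_mult m0 prime_gt_0_nat[of p] by (simp add: prime_factors_product prime_prime_factors)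
  have "sieve_density N (p * m) = (\<Sum>d | d dvd m. moebius_mu d * local_density N d + moebius_mu (p * d) * local_density N (p * d))"
    unfolding sieve_density_def by (rule sum_divisors_prime_mult) (use prime_mult m0 in auto)
  also have "\<dots> = (\<Sum>d | d dvd m. (1 - local_density N p) * (moebius_mu d * local_density N d))"
  proof (intro sum.cong refl)
    fix d assume "d \<in> {d. d dvd m}"
    then have nd: "\<not> p dvd d" using prime_mult by (auto intro: dvd_trans)
    then have "local_density N (p * d) = local_density N p * local_density N d"
      using prime_mult by (intro local_density_mult) (auto intro: prime_imp_coprime)
    then show "moebius_mu d * local_density N d + moebius_mu (p * d) * local_density N (p * d)
       = (1 - local_density N p) * (moebius_mu d * local_density N d)"
      by (simp only: moebius_mu_prime_mult[OF prime_mult(1) nd]) (simp add: algebra_simps)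
  qed
  also have "\<dots> = (1 - local_density N p) * sieve_density N m"
    by (simp only: sum_distrib_left sieve_density_def)
  finally show ?case unfolding pf using prime_mult by (simp add: in_prime_factors_iff)
qed

text \<open>Truncation at z of the part of the singular series that belongs to primes not dividing
  N. For even N > 0 the prime 2, whose factor would be 0, is absent.\<close>

definition twin_factor :: "nat \<Rightarrow> nat \<Rightarrow> real" where
  "twin_factor N z = (\<Prod>p\<in>{p. prime p \<and> p \<le> z} - prime_factors N. 1 - 1 / (real p - 1)\<^sup>2)"

lemma local_density_prime:
  assumes "prime p" "N > 0"
  shows "local_density N p = (if p dvd N then 0 else 1 / (real p - 1))"
proof -
  have "coprime p N \<longleftrightarrow> \<not> p dvd N" using assms prime_imp_coprime[of p N] coprime_absorb_left not_prime_unit by blast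
  then show ?thesis using assms prime_ge_1_nat[of p] by (simp add: local_density_def totient_prime of_nat_diff)
qed

lemma odd_prime_nondivisor:
  assumes "even N" "prime p" "\<not> p dvd N"
  shows "real p \<ge> 3"
proof -
  have "p \<noteq> 2" using assms by auto
  then show ?thesis using prime_ge_2_nat[OF assms(2)] by simp
qed

lemma sieve_density_range:
  assumes N: "even N" "N > 0"
  shows "0 \<le> sieve_density N (primorial z)" "sieve_density N (primorial z) \<le> 1"
proof -
  have "0 \<le> 1 - local_density N p \<and> 1 - local_density N p \<le> 1" if "prime p" for p
    using odd_prime_nondivisor[OF N(1) that] that N by (auto simp: local_density_prime field_simps)
  then show "0 \<le> sieve_density N (primorial z)" "sieve_density N (primorial z) \<le> 1"
    unfolding sieve_density_prod[OF squarefree_primorial] prime_factors_primorial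
    by (auto intro!: prod_nonneg prod_le_1)
qed

lemma twin_factor_range:
  assumes N: "even N"
  shows "0 \<le> twin_factor N z" "twin_factor N z \<le> 1"
proof -
  have "0 \<le> 1 - 1 / (real p - 1)\<^sup>2 \<and> 1 - 1 / (real p - 1)\<^sup>2 \<le> 1" if "prime p" "p \<notin> prime_factors N" for p
  \<comment> \<open>\<open>prime_factors 0\<close> is empty, so here p = 2 does occur, with factor
    0.\<close>
  proof (cases "N = 0")
    case True
    then show ?thesis using prime_ge_2_nat[OF that(1)] one_le_power[of "real p - 1" 2] by (auto simp: field_simps)
  next
    case False
    then have "real p \<ge> 3" using odd_prime_nondivisor[OF N that(1)] that by (auto simp: in_prime_factors_iff)
    then show ?thesis using one_le_power[of "real p - 1" 2] by (auto simp: field_simps)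
  qed
  then show "0 \<le> twin_factor N z" "twin_factor N z \<le> 1"
    unfolding twin_factor_def by (auto intro!: prod_nonneg prod_le_1)
qed

lemma kap_union_disjoint: "finite A \<Longrightarrow> finite B \<Longrightarrow> A \<inter> B = {} \<Longrightarrow> kap (A \<union> B) = kap A * kap B"
  unfolding kap_def by (rule prod.union_disjoint)

text \<open>The local computation from which the singular series arises: for p not dividing N, (1 -
  1 / (p - 1)) * p / (p - 1) = 1 - 1 / (p - 1)^2, while for p | N the sieve factor is 1 and p / (p -
  1) remains. In the product the dependence on the primes up to z becomes convergent.\<close>

lemma sieve_density_kap:
  assumes N: "even N" "N > 0"
  shows "sieve_density N (primorial z) * kap ({p. prime p \<and> p \<le> z} \<union> prime_factors N) = kap (prime_factors N) * twin_factor N z"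
proof -
  let ?T = "{p. prime p \<and> p \<le> z}" and ?F = "prime_factors N"
  have "sieve_density N (primorial z) = (\<Prod>p\<in>?T. 1 - local_density N p)"
    by (simp add: sieve_density_prod squarefree_primorial prime_factors_primorial)
  also have "\<dots> = (\<Prod>p\<in>?T - ?F. 1 - 1 / (real p - 1))"
    using N by (intro prod.mono_neutral_cong_right) (auto simp: local_density_prime in_prime_factors_iff)
  finally have 1: "sieve_density N (primorial z) = (\<Prod>p\<in>?T - ?F. 1 - 1 / (real p - 1))" .
  have "?T \<union> ?F = ?F \<union> (?T - ?F)" by auto
  then have 2: "kap (?T \<union> ?F) = kap ?F * kap (?T - ?F)"
    using kap_union_disjoint[of ?F "?T - ?F"] by auto
  have 3: "(\<Prod>p\<in>?T - ?F. 1 - 1 / (real p - 1)) * kap (?T - ?F) = twin_factor N z"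
    unfolding kap_def twin_factor_def prod.distrib[symmetric]
  proof (rule prod.cong[OF refl])
    fix p assume "p \<in> ?T - ?F"
    then have "real p - 1 > 0" using prime_gt_1_nat by auto
    moreover have "(1 - 1 / u) * ((u + 1) / u) = 1 - 1 / u\<^sup>2" if "u > 0" for u :: real
      using that by (simp add: divide_simps power2_eq_square algebra_simps)
    ultimately have "(1 - 1 / (real p - 1)) * (((real p - 1) + 1) / (real p - 1)) = 1 - 1 / (real p - 1)\<^sup>2" by blast
    then show "(1 - 1 / (real p - 1)) * (real p / (real p - 1)) = 1 - 1 / (real p - 1)\<^sup>2" by simp
  qed
  show ?thesis unfolding 1 2 using 3 by (simp add: mult.left_commute)
qed

lemma sieve_density_kap_le:
  assumes N: "even N" "N > 0"
  shows "sieve_density N (primorial z) * kap ({p. prime p \<and> p \<le> z} \<union> prime_factors N) \<le> kap (prime_factors N)"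
proof -
  have "kap (prime_factors N) \<ge> 1" by (rule kap_ge_1) auto
  then have "kap (prime_factors N) * twin_factor N z \<le> kap (prime_factors N) * 1"
    using twin_factor_range[OF N(1)] by (intro mult_left_mono) auto
  then show ?thesis using sieve_density_kap[OF N] by simp
qed

section \<open>The main term\<close>

definition phi_sum :: "nat set \<Rightarrow> (real \<Rightarrow> real) \<Rightarrow> real \<Rightarrow> real" where
  "phi_sum T g X = (\<Sum>d | 1 \<le> d \<and> real d \<le> X \<and> (\<forall>p\<in>T. \<not> p dvd d). moebius_mu d / real (totient d) * g (X / real d))"

lemma moebius_mu_eq_0_iff: "moebius_mu n = 0 \<longleftrightarrow> \<not> squarefree n"
  by (simp add: moebius_mu_def)

text \<open>Insert d / phi(d) = sum over j | d of 1 / phi(j) and write d = j * k. Squarefreeness of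
  d forces k coprime to j, so the primes of j join the forbidden set.\<close>

lemma phi_sum_eq_mu_sums:
  assumes T: "\<And>p. p \<in> T \<Longrightarrow> prime p"
  shows "phi_sum T g X = (\<Sum>j | 1 \<le> j \<and> real j \<le> X \<and> (\<forall>p\<in>T. \<not> p dvd j) \<and> squarefree j.
           moebius_mu j / (real j * real (totient j)) * mu_sum (T \<union> prime_factors j) g (X / real j))"
proof -
  let ?D = "{d. 1 \<le> d \<and> real d \<le> X \<and> (\<forall>p\<in>T. \<not> p dvd d)}"
  let ?S = "{d. 1 \<le> d \<and> real d \<le> X \<and> (\<forall>p\<in>T. \<not> p dvd d) \<and> squarefree d}"
  have finD: "finite ?D" by (rule finite_subset[OF _ finite_nat_real_le[of X]]) auto
  have finS: "finite ?S" by (rule finite_subset[OF _ finite_nat_real_le[of X]]) auto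
  have dj: "{j. j dvd d} = {j. j \<in> ?S \<and> j dvd d}" if d: "d \<in> ?S" for d
  proof (rule Set.set_eqI, rule iffI)
    fix j assume "j \<in> {j. j dvd d}"
    then have j: "j dvd d" by simp
    have "j > 0" using j d by (auto intro: dvd_pos_nat)
    moreover have "j \<le> d" using j d by (intro dvd_imp_le) auto
    then have "real j \<le> X" using d by (auto intro: order_trans[of "real j" "real d"])
    moreover have "squarefree j" using squarefree_mono[OF j] d by simp
    moreover have "\<forall>p\<in>T. \<not> p dvd j" using d j dvd_trans by blast
    ultimately show "j \<in> {j. j \<in> ?S \<and> j dvd d}" using j by (simp add: Suc_le_eq)
  qed simp
  let ?f = "\<lambda>d. moebius_mu d / real d * g (X / real d)"
  have "phi_sum T g X = (\<Sum>d\<in>?S. moebius_mu d / real (totient d) * g (X / real d))"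
    unfolding phi_sum_def using finD by (intro sum.mono_neutral_right) (auto simp: moebius_mu_eq_0_iff)
  also have "\<dots> = (\<Sum>d\<in>?S. \<Sum>j | j \<in> ?S \<and> j dvd d. 1 / real (totient j) * ?f d)"
  proof (intro sum.cong refl)
    fix d assume d: "d \<in> ?S"
    have "moebius_mu d / real (totient d) * g (X / real d) = (real d / real (totient d)) * ?f d" using d by simp
    also have "\<dots> = (\<Sum>j | j dvd d. 1 / real (totient j)) * ?f d"
      using squarefree_over_totient[of d] d by simp
    finally show "moebius_mu d / real (totient d) * g (X / real d) = (\<Sum>j | j \<in> ?S \<and> j dvd d. 1 / real (totient j) * ?f d)"
      unfolding dj[OF d] sum_distrib_right .
  qed
  also have "\<dots> = (\<Sum>j\<in>?S. \<Sum>d | d \<in> ?S \<and> j dvd d. 1 / real (totient j) * ?f d)"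
    using finS finS by (rule sum.swap_restrict)
  also have "\<dots> = (\<Sum>j\<in>?S. moebius_mu j / (real j * real (totient j)) * mu_sum (T \<union> prime_factors j) g (X / real j))"
  proof (intro sum.cong refl)
    fix j assume j: "j \<in> ?S"
    have j0: "j > 0" using j by simp
    let ?K = "{k. 1 \<le> k \<and> real k \<le> X / real j \<and> (\<forall>p\<in>T \<union> prime_factors j. \<not> p dvd k)}"
    have finK: "finite ?K" by (rule finite_mu_sum_range)
    have cop: "coprime k j \<longleftrightarrow> (\<forall>p\<in>prime_factors j. \<not> p dvd k)" for k
      by (rule coprime_iff_prime_factors[OF j0])
    have img: "(*) j ` {k\<in>?K. squarefree k} = {d. d \<in> ?S \<and> j dvd d}"
    proof (rule Set.set_eqI, rule iffI)
      fix d assume "d \<in> (*) j ` {k\<in>?K. squarefree k}"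
      then obtain k where k: "d = j * k" "k \<in> ?K" "squarefree k" by blast
      have "coprime j k" using k cop[of k] by (auto simp: coprime_commute)
      then have "squarefree d" using k j squarefree_mult_coprime by auto
      moreover have "\<forall>p\<in>T. \<not> p dvd d" using k j T prime_dvd_mult_iff by blast
      moreover have "real d \<le> X" using k j0 by (simp add: field_simps)
      ultimately show "d \<in> {d. d \<in> ?S \<and> j dvd d}" using k j0 by (simp add: Suc_le_eq)
    next
      fix d assume d: "d \<in> {d. d \<in> ?S \<and> j dvd d}"
      then have "j dvd d" by simp
      then obtain k where k: "d = j * k" by (elim dvdE)
      have k0: "k > 0" using d k by (intro Nat.gr0I) auto
      have "real k \<le> X / real j" using d k j0 by (simp add: field_simps)
      moreover have "squarefree k" using squarefree_mono[of k d] d k by simp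
      moreover have "coprime k j"
      proof (rule coprimeI)
        fix x assume "x dvd k" "x dvd j"
        then have "x\<^sup>2 dvd d" using k by (simp add: power2_eq_square mult_dvd_mono mult.commute)
        then show "x dvd 1" using d squarefreeD by blast
      qed
      moreover have "\<forall>p\<in>T. \<not> p dvd k" using d k by auto
      ultimately have "k \<in> {k\<in>?K. squarefree k}" using k0 cop[of k] by (simp add: Suc_le_eq) blast
      then show "d \<in> (*) j ` {k\<in>?K. squarefree k}" using k by blast
    qed
    have "(\<Sum>d | d \<in> ?S \<and> j dvd d. 1 / real (totient j) * ?f d) = (\<Sum>k | k \<in> ?K \<and> squarefree k. 1 / real (totient j) * ?f (j * k))"
      unfolding img[symmetric] using j0 by (subst sum.reindex) (simp_all add: inj_on_def)
    also have "\<dots> = (\<Sum>k | k \<in> ?K \<and> squarefree k. moebius_mu j / (real j * real (totient j)) * (moebius_mu k / real k * g (X / real j / real k)))"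
    proof (intro sum.cong refl)
      fix k assume k: "k \<in> {k. k \<in> ?K \<and> squarefree k}"
      have "coprime j k" using k cop[of k] by (auto simp: coprime_commute)
      then have "moebius_mu (j * k) = moebius_mu j * moebius_mu k" by (rule moebius_mu_mult)
      then show "1 / real (totient j) * ?f (j * k) = moebius_mu j / (real j * real (totient j)) * (moebius_mu k / real k * g (X / real j / real k))"
        by (simp add: mult.commute mult.left_commute)
    qed
    also have "\<dots> = (\<Sum>k\<in>?K. moebius_mu j / (real j * real (totient j)) * (moebius_mu k / real k * g (X / real j / real k)))"
      using finK by (intro sum.mono_neutral_left) (auto simp: moebius_mu_eq_0_iff)
    also have "\<dots> = moebius_mu j / (real j * real (totient j)) * mu_sum (T \<union> prime_factors j) g (X / real j)"
      by (simp only: sum_distrib_left mu_sum_def)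
    finally show "(\<Sum>d | d \<in> ?S \<and> j dvd d. 1 / real (totient j) * ?f d)
      = moebius_mu j / (real j * real (totient j)) * mu_sum (T \<union> prime_factors j) g (X / real j)" .
  qed
  finally show ?thesis .
qed

lemma free_of_small_primes:
  assumes T: "{p. prime p \<and> p \<le> z} \<subseteq> T" and z: "z \<ge> (3::nat)" and j: "\<forall>p\<in>T. \<not> p dvd j"
  shows "prime p \<Longrightarrow> p dvd j \<Longrightarrow> p > z" "prime p \<Longrightarrow> p dvd j \<Longrightarrow> p \<ge> 5" "j > 1 \<Longrightarrow> j > z"
proof -
  show a: "p > z" if "prime p" "p dvd j" for p
  proof (rule ccontr)
    assume "\<not> p > z"
    then have "p \<in> T" using T that(1) by auto
    then show False using j that(2) by blast
  qed
  show "p \<ge> 5" if "prime p" "p dvd j"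
  proof -
    have "p \<noteq> 4"
    proof
      assume "p = 4"
      then have "2 dvd p" by simp
      then show False using that(1) \<open>p = 4\<close> primes_dvd_imp_eq[OF two_is_prime_nat that(1)] by simp
    qed
    then show ?thesis using a[OF that] z by linarith
  qed
  show "j > z" if j1: "j > 1"
  proof -
    obtain p where p: "prime p" "p dvd j" using prime_factor_nat[of j] j1 by auto
    then show ?thesis using a[OF p] dvd_imp_le[OF p(2)] j1 by linarith
  qed
qed

text \<open>The term j = 1 of \<open>phi_sum_eq_mu_sums\<close> is the sum with denominators d. All
  other j exceed z. Enlarging T by the primes of j costs j / phi(j), so these terms are bounded by C
  * kap T / phi(j)^2, hence by C * kap T * j^(-3/2).\<close>

lemma phi_sum_mu_sum_diff:
  assumes T: "finite T" "\<And>p. p \<in> T \<Longrightarrow> prime p" and Tz: "{p. prime p \<and> p \<le> z} \<subseteq> T" and z: "z \<ge> 3"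
    and C: "\<And>X. \<bar>mu_sum {} g X\<bar> \<le> C"
  shows "\<bar>phi_sum T g X - mu_sum T g X\<bar> \<le> C * kap T * (4 / sqrt (real z))"
proof -
  let ?S = "{d. 1 \<le> d \<and> real d \<le> X \<and> (\<forall>p\<in>T. \<not> p dvd d) \<and> squarefree d}"
  have finS: "finite ?S" by (rule finite_subset[OF _ finite_nat_real_le[of X]]) auto
  have C0: "C \<ge> 0" using C[of 0] by simp
  have k0: "kap T \<ge> 1" using T by (intro kap_ge_1) auto
  show ?thesis
  proof (cases "X \<ge> 1")
    case True
    let ?t = "\<lambda>j. moebius_mu j / (real j * real (totient j)) * mu_sum (T \<union> prime_factors j) g (X / real j)"
    have one: "1 \<in> ?S" using True T by (auto dest!: T(2))
    have "phi_sum T g X = (\<Sum>j\<in>?S. ?t j)" by (rule phi_sum_eq_mu_sums) (rule T(2))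
    also have "\<dots> = ?t 1 + (\<Sum>j\<in>?S - {1}. ?t j)" by (rule sum.remove[OF finS one])
    finally have "phi_sum T g X = ?t 1 + (\<Sum>j\<in>?S - {1}. ?t j)" .
    then have "phi_sum T g X - mu_sum T g X = (\<Sum>j\<in>?S - {1}. ?t j)" by simp
    also have "\<bar>\<dots>\<bar> \<le> (\<Sum>j\<in>?S - {1}. C * kap T * real j powr (-3/2))"
    proof (rule order_trans[OF sum_abs sum_mono])
      fix j assume j: "j \<in> ?S - {1}"
      have jf: "\<forall>p\<in>T. \<not> p dvd j" and j0: "j > 0" and sf: "squarefree j" using j by auto
      have "T \<inter> prime_factors j = {}" using jf by (auto simp: in_prime_factors_iff)
      then have k: "kap (T \<union> prime_factors j) = kap T * (real j / real (totient j))"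
        using T j0 by (simp add: kap_union_disjoint kap_prime_factors)
      have "\<bar>mu_sum (T \<union> prime_factors j) g (X / real j)\<bar> \<le> C * kap (T \<union> prime_factors j)"
        using T C by (intro abs_mu_sum_le) (auto simp: in_prime_factors_iff)
      then have "\<bar>mu_sum (T \<union> prime_factors j) g (X / real j)\<bar> \<le> C * (kap T * (real j / real (totient j)))"
        unfolding k .
      then have "\<bar>moebius_mu j\<bar> * (1 / (real j * real (totient j)) * \<bar>mu_sum (T \<union> prime_factors j) g (X / real j)\<bar>)
          \<le> 1 * (1 / (real j * real (totient j)) * (C * (kap T * (real j / real (totient j)))))"
        using C0 k0 by (intro mult_mono mult_left_mono abs_moebius_mu_le) auto
      also have "\<dots> = C * kap T * (1 / (real (totient j) * real (totient j)))" using j0 by simp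
      also have "\<dots> \<le> C * kap T * real j powr (-3/2)"
      proof (rule mult_left_mono)
        have ge: "real (totient j) \<ge> real j powr (3/4)"
          using sf free_of_small_primes(2)[OF Tz z jf] by (intro squarefree_totient_ge_powr) auto
        have "real j powr (3/4) * real j powr (3/4) = real j powr (3/2)" by (simp flip: powr_add)
        then have "real j powr (3/2) \<le> real (totient j) * real (totient j)"
          using mult_mono[OF ge ge] by simp
        then have "1 / (real (totient j) * real (totient j)) \<le> 1 / real j powr (3/2)"
          using j0 by (intro divide_left_mono mult_pos_pos) auto
        then show "1 / (real (totient j) * real (totient j)) \<le> real j powr (-3/2)"
          by (simp add: powr_minus_divide)
      qed (use C0 k0 in auto)
      finally show "\<bar>?t j\<bar> \<le> C * kap T * real j powr (-3/2)" by (simp add: abs_mult)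
    qed
    also have "\<dots> = C * kap T * (\<Sum>j\<in>?S - {1}. real j powr (-3/2))" by (simp only: sum_distrib_left)
    also have "\<dots> \<le> C * kap T * (4 / sqrt (real z))"
    proof (intro mult_left_mono sum_powr_tail_le)
      fix j assume j: "j \<in> ?S - {1}"
      then have "j > 1" by auto
      then have "j > z" using free_of_small_primes(3)[OF Tz z, of j] j by blast
      then show "real j > real z" by simp
    qed (use C0 k0 z finS in auto)
    finally show ?thesis .
  next
    case False
    then have e: "{d. 1 \<le> d \<and> real d \<le> X \<and> (\<forall>p\<in>T. \<not> p dvd d)} = {}" by auto
    have "phi_sum T g X = 0" "mu_sum T g X = 0" unfolding phi_sum_def mu_sum_def e by simp_all
    then show ?thesis using C0 k0 by simp
  qed
qed

lemma abs_phi_sum_le: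
  assumes T: "finite T" "\<And>p. p \<in> T \<Longrightarrow> prime p" and Tz: "{p. prime p \<and> p \<le> z} \<subseteq> T" and z: "z \<ge> 3"
    and C: "\<And>X. \<bar>mu_sum {} g X\<bar> \<le> C"
  shows "\<bar>phi_sum T g X\<bar> \<le> 5 * C * kap T"
proof -
  have C0: "C \<ge> 0" using C[of 0] by simp
  have k0: "kap T \<ge> 1" using T by (intro kap_ge_1) auto
  have "4 / sqrt (real z) \<le> 4 / 1" using z by (intro divide_left_mono) auto
  then have "C * kap T * (4 / sqrt (real z)) \<le> C * kap T * 4" using C0 k0 by (intro mult_left_mono) auto
  then show ?thesis
    using phi_sum_mu_sum_diff[OF T Tz z C, of X] abs_mu_sum_le[OF T C, of X] by linarith
qed

section \<open>Uniformity in N\<close>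

text \<open>The i-th smallest element of a set of positive integers is at least i; the induction
  removes the maximum, which is at least the cardinality.\<close>

lemma sum_inverse_sqrt_set_le:
  fixes A :: "nat set"
  assumes "finite A" "0 \<notin> A"
  shows "(\<Sum>a\<in>A. 1 / sqrt (real a)) \<le> (\<Sum>i=1..card A. 1 / sqrt (real i))"
  using assms
proof (induction "card A" arbitrary: A)
  case 0
  then show ?case by simp
next
  case (Suc n)
  then have ne: "A \<noteq> {}" by auto
  let ?m = "Max A"
  have m: "?m \<in> A" using Suc ne by (intro Max_in)
  have "A \<subseteq> {1..?m}" using Suc by (auto simp: Suc_le_eq intro: Nat.gr0I)
  then have "card A \<le> card {1..?m}" by (intro card_mono) auto
  then have cm: "card A \<le> ?m" by simp
  have c: "card (A - {?m}) = n" using Suc m by simp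
  have "(\<Sum>a\<in>A. 1 / sqrt (real a)) = 1 / sqrt (real ?m) + (\<Sum>a\<in>A - {?m}. 1 / sqrt (real a))"
    using Suc m by (intro sum.remove) auto
  also have "\<dots> \<le> 1 / sqrt (real (card A)) + (\<Sum>i=1..n. 1 / sqrt (real i))"
    using Suc(1)[of "A - {?m}"] c Suc cm by (intro add_mono divide_left_mono) auto
  also have "\<dots> = (\<Sum>i=1..card A. 1 / sqrt (real i))" using Suc(2) by (simp flip: Suc(2))
  finally show ?case .
qed

text \<open>Each factor is at most exp(4 * p^(-1/2)), and the sum of p^(-1/2) over the at most 2 ln
  N prime factors is at most 2 * sqrt(2 ln N). The bound is smaller than any positive power of N,
  which makes coprimality to N affordable.\<close>

lemma kaph_prime_factors_le:
  assumes N: "N \<ge> 2"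
  shows "kaph (prime_factors N) \<le> exp (8 * sqrt (2 * ln (real N)))"
proof -
  have "kaph (prime_factors N) \<le> (\<Prod>p\<in>prime_factors N. exp (4 * (1 / sqrt (real p))))"
    unfolding kaph_def
  proof (intro prod_mono conjI)
    fix p assume p: "p \<in> prime_factors N"
    then have pp: "prime p" and p2: "real p \<ge> 2" using prime_ge_2_nat by (auto simp: in_prime_factors_iff)
    define t where "t = 1 / sqrt (real p)"
    have t: "real p powr (-1/2) = t" using p2 by (simp add: t_def powr_minus_divide powr_half_sqrt)
    \<comment> \<open>Yields t <= 3/4, hence 1 - t >= 1/4; this is where the constant 4 in the
      exponent comes from.\<close>
    have "sqrt 2 \<ge> 4/3" by (rule real_le_rsqrt) (simp add: power2_eq_square)
    then have "sqrt (real p) \<ge> 4/3" using p2 real_sqrt_le_mono[of 2 "real p"] by linarith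
    then have "t \<le> 1 / (4/3)" unfolding t_def using p2 by (intro divide_left_mono) auto
    then have t34: "t \<le> 3/4" "t \<ge> 0" by (auto simp: t_def)
    show "0 \<le> 1 / (1 - real p powr (-1/2))" unfolding t using t34 by simp
    have "1 / (1 - t) = 1 + t / (1 - t)" using t34 by (simp add: field_simps)
    also have "t / (1 - t) \<le> t / (1/4)" using t34 by (intro divide_left_mono) auto
    also have "1 + t / (1/4) \<le> exp (4 * t)" using exp_ge_add_one_self[of "4 * t"] by (simp add: mult.commute)
    finally show "1 / (1 - real p powr (-1/2)) \<le> exp (4 * (1 / sqrt (real p)))" unfolding t t_def[symmetric] by simp
  qed
  also have "\<dots> = exp (4 * (\<Sum>p\<in>prime_factors N. 1 / sqrt (real p)))"
    by (simp add: exp_sum sum_distrib_left)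
  also have "\<dots> \<le> exp (8 * sqrt (2 * ln (real N)))"
  proof -
    have "(\<Sum>p\<in>prime_factors N. 1 / sqrt (real p)) \<le> (\<Sum>i=1..card (prime_factors N). 1 / sqrt (real i))"
      by (rule sum_inverse_sqrt_set_le) (auto simp: in_prime_factors_iff)
    also have "\<dots> \<le> 2 * sqrt (real (card (prime_factors N)))" by (rule sum_inverse_sqrt_le)
    also have "real (card (prime_factors N)) \<le> 2 * ln (real N)"
      using card_prime_factors_le[of N] log2_le[of "real N"] N by simp
    finally show ?thesis by simp
  qed
  finally show ?thesis .
qed

lemma kaph_union_le:
  assumes "finite A" "finite B" "\<And>p. p \<in> A \<union> B \<Longrightarrow> prime p"
  shows "kaph (A \<union> B) \<le> kaph A * kaph B"
proof -
  have f: "1 / (1 - real p powr (-1/2)) \<ge> 1" if "p \<in> A \<union> B" for p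
    using prime_powr_half_less[of p] assms(3)[OF that] by simp
  have 1: "kaph (A \<union> B) = kaph A * kaph (B - A)"
  proof -
    have "kaph (A \<union> (B - A)) = kaph A * kaph (B - A)"
      unfolding kaph_def using assms by (intro prod.union_disjoint) auto
    then show ?thesis by simp
  qed
  have 2: "kaph (B - A) \<le> kaph B"
    unfolding kaph_def
  proof (rule prod_mono2)
    show "0 \<le> 1 / (1 - real p powr (-1/2))" if "p \<in> B - A" for p
    proof -
      have "p \<in> A \<union> B" using that by blast
      from f[OF this] show ?thesis by linarith
    qed
    show "1 \<le> 1 / (1 - real p powr (-1/2))" if "p \<in> B - (B - A)" for p using f[of p] that by simp
  qed (use assms in auto)
  have "kap A \<ge> 1" by (rule kap_ge_1) (use assms in auto)
  moreover have "kap A \<le> kaph A" by (rule kap_le_kaph) (use assms in auto)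
  ultimately have "kaph A \<ge> 0" by linarith
  then show ?thesis unfolding 1 by (rule mult_left_mono[OF 2])
qed

text \<open>The order of quantifiers matters: C depends on neither z nor e, so z can be chosen
  afterwards to make C / sqrt z small, while e is reached by letting N grow. The contribution of
  \<open>kaph\<close> is beaten by (N^theta)^(-1/2).\<close>

lemma main_term_asymp:
  fixes \<theta> :: real
  assumes \<theta>: "\<theta> > 0" and psi: "(\<lambda>n. (\<Sum>k=1..n. mangoldt k) / real n) \<longlonglongrightarrow> (1::real)"
  shows "\<exists>C\<ge>0. \<forall>z\<ge>3. \<forall>e>0. \<forall>\<^sub>F N::nat in at_top.
     \<bar>phi_sum ({p. prime p \<and> p \<le> z} \<union> prime_factors N) ln (real (primorial z) * real N powr \<theta>)
        - kap ({p. prime p \<and> p \<le> z} \<union> prime_factors N)\<bar>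
      \<le> (e + C / sqrt (real z)) * kap ({p. prime p \<and> p \<le> z} \<union> prime_factors N)"
proof -
  note M = moebius_mu_mean_zero[OF psi]
  obtain C where C: "C \<ge> 0" "\<And>X. \<bar>mu_sum {} ln X\<bar> \<le> C" using abs_mu_sum_ln_bounded[OF M] by blast
  have "\<forall>\<^sub>F N::nat in at_top.
     \<bar>phi_sum ({p. prime p \<and> p \<le> z} \<union> prime_factors N) ln (real (primorial z) * real N powr \<theta>)
        - kap ({p. prime p \<and> p \<le> z} \<union> prime_factors N)\<bar>
      \<le> (e + (4 * C) / sqrt (real z)) * kap ({p. prime p \<and> p \<le> z} \<union> prime_factors N)"
    if z: "z \<ge> 3" and e: "e > 0" for z e
  proof -
    let ?Z = "{p. prime p \<and> p \<le> z}"
    obtain D where D: "D \<ge> 1" "\<And>X. X > 0 \<Longrightarrow> \<bar>mu_sum {} ln X - 1\<bar> \<le> e/2 + D * X powr (-1/2)"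
      using mu_sum_ln_approx[OF M half_gt_zero[OF e]] by blast
    define K where "K = D * kaph ?Z"
    have "kap ?Z \<ge> 1" by (rule kap_ge_1) simp
    moreover have "kap ?Z \<le> kaph ?Z" by (rule kap_le_kaph) simp
    ultimately have kZ: "kaph ?Z \<ge> 1" by linarith
    have K: "K > 0" using D kZ by (simp add: K_def)
    have "\<forall>\<^sub>F N::nat in at_top. K * (exp (8 * sqrt (2 * ln (real N))) * (real N powr \<theta>) powr (-1/2)) < e / 2"
    proof -
      have "((\<lambda>N::nat. exp (8 * sqrt (2 * ln (real N))) * (real N powr \<theta>) powr (-1/2)) \<longlongrightarrow> 0) at_top"
        using \<theta> by real_asymp
      then have "((\<lambda>N::nat. K * (exp (8 * sqrt (2 * ln (real N))) * (real N powr \<theta>) powr (-1/2))) \<longlongrightarrow> K * 0) at_top"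
        by (intro tendsto_mult tendsto_const)
      then show ?thesis using e by (intro order_tendstoD(2)) auto
    qed
    then show ?thesis using eventually_ge_at_top[of 3]
    proof eventually_elim
      case (elim N)
      let ?T = "?Z \<union> prime_factors N" and ?X = "real (primorial z) * real N powr \<theta>"
      have T: "finite ?T" "\<And>p. p \<in> ?T \<Longrightarrow> prime p" by (auto simp: in_prime_factors_iff)
      have k1: "kap ?T \<ge> 1" by (rule kap_ge_1) (rule T(2))
      have "primorial z \<ge> 1" by (simp add: Suc_le_eq)
      then have P1: "real (primorial z) \<ge> 1" by simp
      have Np: "real N powr \<theta> > 0" using elim by simp
      have XN: "real N powr \<theta> \<le> ?X" using P1 Np by simp
      have X0: "?X > 0" using XN Np by linarith
      have 1: "\<bar>mu_sum ?T ln ?X - kap ?T\<bar> \<le> e/2 * kap ?T + D * kaph ?T * ?X powr (-1/2)"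
        by (rule mu_sum_approx_kap[OF T D(2) D(1) _ X0]) (use e in simp_all)
      have 2: "\<bar>phi_sum ?T ln ?X - mu_sum ?T ln ?X\<bar> \<le> C * kap ?T * (4 / sqrt (real z))"
        by (rule phi_sum_mu_sum_diff[OF T _ z C(2)]) auto
      have "kaph ?T \<le> kaph ?Z * exp (8 * sqrt (2 * ln (real N)))"
      proof -
        have "kaph ?T \<le> kaph ?Z * kaph (prime_factors N)" by (rule kaph_union_le) (auto simp: in_prime_factors_iff)
        also have "\<dots> \<le> kaph ?Z * exp (8 * sqrt (2 * ln (real N)))"
          using kZ elim by (intro mult_left_mono kaph_prime_factors_le) auto
        finally show ?thesis .
      qed
      moreover have "?X powr (-1/2) \<le> (real N powr \<theta>) powr (-1/2)"
        using XN Np by (intro powr_mono2') auto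
      moreover have "kaph ?T \<ge> 0"
      proof -
        have "kap ?T \<le> kaph ?T" by (rule kap_le_kaph) (rule T(2))
        then show ?thesis using k1 by linarith
      qed
      ultimately have "D * (kaph ?T * ?X powr (-1/2)) \<le> D * ((kaph ?Z * exp (8 * sqrt (2 * ln (real N)))) * (real N powr \<theta>) powr (-1/2))"
        using D kZ by (intro mult_left_mono mult_mono) auto
      also have "\<dots> = K * (exp (8 * sqrt (2 * ln (real N))) * (real N powr \<theta>) powr (-1/2))" by (simp add: K_def)
      also have "\<dots> \<le> e / 2 * 1" using elim by simp
      also have "\<dots> \<le> e / 2 * kap ?T" using e k1 by (intro mult_left_mono) auto
      finally have "D * kaph ?T * ?X powr (-1/2) \<le> e / 2 * kap ?T" by (simp add: mult.assoc)
      moreover have "C * kap ?T * (4 / sqrt (real z)) = (4 * C) / sqrt (real z) * kap ?T" by simp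
      ultimately have "\<bar>phi_sum ?T ln ?X - kap ?T\<bar> \<le> e/2 * kap ?T + e/2 * kap ?T + (4 * C) / sqrt (real z) * kap ?T"
        using 1 2 by linarith
      also have "\<dots> = (e + (4 * C) / sqrt (real z)) * kap ?T" by (simp add: algebra_simps)
      finally show ?case .
    qed
  qed
  then show ?thesis using C by (intro exI[of _ "4 * C"]) auto
qed

section \<open>The bilinear hypothesis for the shifted weights\<close>

text \<open>The expected values are the full sum times 1 / phi(q). By \<open>total_sum_small\<close>
  that full sum is itself tiny, so only the plain sums over multiples of q remain. As g lives on
  squarefree m, only squarefree q count, and their sum of 1 / phi(q) costs one logarithm, covered by
  the exponent A + 2.\<close>

lemma moebius_level_shift:
  fixes \<theta> A :: real and g :: "nat \<Rightarrow> real"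
  assumes \<theta>: "0 < \<theta>" "\<theta> < 1" and A: "A > 0"
    and g0: "\<And>m. \<not> squarefree m \<Longrightarrow> g m = 0"
    and g1: "\<And>N m. N \<ge> 3 \<Longrightarrow> m < N \<Longrightarrow> \<bar>g m\<bar> \<le> ln (real N)"
    and psi: "(\<lambda>n. (\<Sum>k=1..n. mangoldt k) / real n) \<longlonglongrightarrow> (1::real)"
    and H: "\<And>A::real. A > 0 \<Longrightarrow>
      (\<lambda>N::nat. \<Sum>q | 1 \<le> q \<and> real q \<le> real N powr (1 - \<theta>) \<and> coprime N q.
          \<bar>(\<Sum>n | n \<in> {1..<N} \<and> [n = N] (mod q). mangoldt n * g (N - n))
            - 1 / real (totient q) * (\<Sum>n\<in>{1..<N}. mangoldt n * g (N - n))\<bar>)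
        \<in> O[at_top](\<lambda>N. real N / ln (real N) powr A)"
  shows "\<forall>\<^sub>F N in at_top. (\<Sum>q | 1 \<le> q \<and> real q \<le> real N powr (1 - \<theta>). \<bar>\<Sum>m | m \<in> {1..<N} \<and> q dvd m. shift_weight N m * g m\<bar>)
      \<le> real N / ln (real N) powr A"
proof -
  let ?T = "\<lambda>N. \<Sum>n\<in>{1..<N}. mangoldt n * g (N - n)"
  let ?I = "\<lambda>N q. \<Sum>n | n \<in> {1..<N} \<and> [n = N] (mod q). mangoldt n * g (N - n)"
  let ?h = "\<lambda>N q. \<bar>?I N q - 1 / real (totient q) * ?T N\<bar>"
  let ?s = "\<lambda>N q. \<Sum>m | m \<in> {1..<N} \<and> q dvd m. shift_weight N m * g m"
  have 1: "\<forall>\<^sub>F N in at_top. \<bar>\<Sum>q | 1 \<le> q \<and> real q \<le> real N powr (1 - \<theta>) \<and> coprime N q. ?h N q\<bar> \<le> 1/3 * (real N / ln (real N) powr A)"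
    using A by (intro bigo_log_power_bound H) auto
  have 2: "\<forall>\<^sub>F N in at_top. \<bar>?T N\<bar> \<le> real N / ln (real N) powr (A + 2)"
    using A by (intro total_sum_small[OF \<theta>(2) _ g0 psi H]) auto
  have 3: "\<forall>\<^sub>F N::nat in at_top. real N powr (1 - \<theta>) * (4 * ln (real N) ^ 3 * ln (real N)) \<le> 1/3 * (real N / ln (real N) powr A)"
    using \<theta> by real_asymp
  have 4: "\<forall>\<^sub>F N::nat in at_top. 20 * (1 + ln (real N powr (1 - \<theta>))) \<le> 1/3 * ln (real N) ^ 2"
    using \<theta> by real_asymp
  show ?thesis using 1 2 3 4 eventually_ge_at_top[of 3]
  proof eventually_elim
    case (elim N)
    let ?x = "real N powr (1 - \<theta>)"
    have x1: "?x \<ge> 1" using elim(5) \<theta> by (intro ge_one_powr_ge_zero) auto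
    have fin: "finite {q. 1 \<le> q \<and> real q \<le> ?x \<and> R q}" for R
      by (rule finite_subset[OF _ finite_nat_real_le[of ?x]]) auto
    let ?Q = "{q. 1 \<le> q \<and> real q \<le> ?x \<and> coprime N q \<and> squarefree q}"
    have zero: "?s N q = 0" if "\<not> (coprime N q \<and> squarefree q)" for q
    proof (rule sum.neutral, rule ballI)
      fix m assume m: "m \<in> {m. m \<in> {1..<N} \<and> q dvd m}"
      show "shift_weight N m * g m = 0"
      proof (cases "coprime N q")
        case True
        then have "\<not> squarefree m" using that m squarefree_mono[of q m] by auto
        then show ?thesis using g0 by simp
      next
        case False
        then have "\<not> coprime m N" using m coprime_divisors[of q m N N] by (auto simp: coprime_commute)
        then show ?thesis by (simp add: shift_weight_def)
      qed
    qed
    have "(\<Sum>q | 1 \<le> q \<and> real q \<le> ?x. \<bar>?s N q\<bar>) = (\<Sum>q\<in>?Q. \<bar>?s N q\<bar>)"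
      using fin[of "\<lambda>_. True"] zero by (intro sum.mono_neutral_right) auto
    also have "\<dots> \<le> (\<Sum>q\<in>?Q. ?h N q + \<bar>?T N\<bar> * (1 / real (totient q)) + 4 * ln (real N) ^ 3 * ln (real N))"
    proof (rule sum_mono)
      fix q
      have "\<bar>?I N q - ?s N q\<bar> \<le> 4 * ln (real N) ^ 3 * ln (real N)"
        using elim(5) g1[of N] by (intro shift_weight_progression_diff) auto
      moreover have "\<bar>1 / real (totient q) * ?T N\<bar> = \<bar>?T N\<bar> * (1 / real (totient q))" by (simp add: abs_mult)
      ultimately show "\<bar>?s N q\<bar> \<le> ?h N q + \<bar>?T N\<bar> * (1 / real (totient q)) + 4 * ln (real N) ^ 3 * ln (real N)"
        by linarith
    qed
    also have "\<dots> = (\<Sum>q\<in>?Q. ?h N q) + \<bar>?T N\<bar> * (\<Sum>q\<in>?Q. 1 / real (totient q)) + real (card ?Q) * (4 * ln (real N) ^ 3 * ln (real N))"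
      by (simp only: sum.distrib sum_distrib_left sum_constant)
    also have "\<dots> \<le> 1/3 * (real N / ln (real N) powr A) + 1/3 * (real N / ln (real N) powr A) + 1/3 * (real N / ln (real N) powr A)"
    proof (intro add_mono)
      have "(\<Sum>q\<in>?Q. ?h N q) \<le> (\<Sum>q | 1 \<le> q \<and> real q \<le> ?x \<and> coprime N q. ?h N q)"
        using fin by (intro sum_mono2) auto
      then show "(\<Sum>q\<in>?Q. ?h N q) \<le> 1/3 * (real N / ln (real N) powr A)" using elim(1) by linarith
    next
      have "(\<Sum>q\<in>?Q. 1 / real (totient q)) \<le> (\<Sum>q | 1 \<le> q \<and> real q \<le> ?x \<and> squarefree q. 1 / real (totient q))"
        using fin by (intro sum_mono2) auto
      also have "\<dots> \<le> 20 * (1 + ln ?x)" by (rule sum_inverse_totient_upto_le[OF x1])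
      also have "\<dots> \<le> 1/3 * ln (real N) ^ 2" by (rule elim(4))
      finally have "\<bar>?T N\<bar> * (\<Sum>q\<in>?Q. 1 / real (totient q)) \<le> (real N / ln (real N) powr (A + 2)) * (1/3 * ln (real N) ^ 2)"
        using elim(2) by (intro mult_mono) (auto intro!: sum_nonneg)
      also have "\<dots> = 1/3 * (real N / ln (real N) powr A)"
        using elim(5) by (simp add: powr_add powr_numeral)
      finally show "\<bar>?T N\<bar> * (\<Sum>q\<in>?Q. 1 / real (totient q)) \<le> 1/3 * (real N / ln (real N) powr A)" .
    next
      have "card ?Q \<le> card {q. 1 \<le> q \<and> real q \<le> ?x}" using fin[of "\<lambda>_. True"] by (intro card_mono) auto
      also have "real (card {q. 1 \<le> q \<and> real q \<le> ?x}) \<le> ?x" by (rule card_nat_real_le) simp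
      finally have "real (card ?Q) * (4 * ln (real N) ^ 3 * ln (real N)) \<le> ?x * (4 * ln (real N) ^ 3 * ln (real N))"
        using elim(5) by (intro mult_right_mono) auto
      then show "real (card ?Q) * (4 * ln (real N) ^ 3 * ln (real N)) \<le> 1/3 * (real N / ln (real N) powr A)"
        using elim(3) by linarith
    qed
    also have "\<dots> = real N / ln (real N) powr A" by simp
    finally show ?case .
  qed
qed

section \<open>The decomposition of the von Mangoldt function\<close>

text \<open>The positive part of ln; it encodes the cut-off d <= y inside the weight, so that sums
  may run over all divisors.\<close>

definition lnp :: "real \<Rightarrow> real" where
  "lnp t = (if t > 1 then ln t else 0)"

definition type_I :: "real \<Rightarrow> nat \<Rightarrow> real" where
  "type_I y m = (\<Sum>d | d dvd m. moebius_mu d * lnp (y / real d))"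

text \<open>For squarefree m this is the sum of mu(d) * ln(y / d) over d = m / e. Pulling out mu(m)
  and splitting off ln m leaves, for each fixed e, sums of mu(m) and mu(m) * ln m over multiples of
  e, the two functions g of the second hypothesis.\<close>

definition type_II :: "nat \<Rightarrow> real \<Rightarrow> nat \<Rightarrow> real" where
  "type_II N y m = moebius_mu m * (\<Sum>e | e dvd m \<and> real e < real N / y. moebius_mu e * (ln (y * real e) - ln (real m)))"

definition overlap :: "nat \<Rightarrow> real \<Rightarrow> nat \<Rightarrow> real" where
  "overlap N y m = (\<Sum>d | d dvd m \<and> real d \<le> y \<and> real (m div d) < real N / y. moebius_mu d * ln (y / real d))"

lemma lnp_nonneg: "lnp t \<ge> 0"
  by (simp add: lnp_def)

lemma lnp_mono: "s \<le> t \<Longrightarrow> lnp s \<le> lnp t"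
  by (auto simp: lnp_def)

lemma lnp_eq_ln: "t \<ge> 1 \<Longrightarrow> lnp t = ln t"
  by (auto simp: lnp_def)

lemma lnp_eq_0: "t \<le> 1 \<Longrightarrow> lnp t = 0"
  by (auto simp: lnp_def)

lemma lnp_divide_eq_0: "0 < d \<Longrightarrow> y < real d \<Longrightarrow> lnp (y / real d) = 0"
  by (rule lnp_eq_0) simp

text \<open>Since the Moebius sum over divisors vanishes for m > 1, ln d may be replaced by -ln(y /
  d) for any y. A divisor d > y has m / d < N / y because m <= N, so \<open>type_II\<close> contains
  all d > y and, in addition, exactly the d counted by \<open>overlap\<close>.\<close>

lemma mangoldt_decomposition:
  assumes y: "y > 0" and m: "m > 1" "m \<le> N" "squarefree m"
  shows "mangoldt m = type_I y m + type_II N y m - overlap N y m"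
proof -
  have m0: "m > 0" using m by simp
  have fin: "finite {d. d dvd m}" using m0 by simp
  have finR: "finite {d. d dvd m \<and> R d}" for R by (rule finite_subset[OF _ fin]) auto
  have d0: "d > 0" if "d dvd m" for d using that m0 dvd_pos_nat by blast
  let ?f = "\<lambda>d. moebius_mu d * ln (y / real d)"
  have "(\<Sum>d | d dvd m. ?f d) = (\<Sum>d | d dvd m. moebius_mu d * ln y - moebius_mu d * ln (real d))"
    using d0 y by (intro sum.cong refl) (auto simp: ln_div right_diff_distrib)
  also have "\<dots> = (\<Sum>d | d dvd m. moebius_mu d) * ln y - (\<Sum>d | d dvd m. moebius_mu d * ln (real d))"
    by (simp only: sum_subtractf sum_distrib_right)
  also have "\<dots> = mangoldt m" using m by (simp add: sum_moebius_mu_divisors sum_moebius_mu_ln)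
  finally have L: "mangoldt m = (\<Sum>d | d dvd m. ?f d)" by simp
  have split: "(\<Sum>d | d dvd m. ?f d) = (\<Sum>d | d dvd m \<and> real d \<le> y. ?f d) + (\<Sum>d | d dvd m \<and> real d > y. ?f d)"
    using fin by (subst sum.union_disjoint[symmetric]) (auto intro!: sum.cong)
  have I: "type_I y m = (\<Sum>d | d dvd m \<and> real d \<le> y. ?f d)"
    unfolding type_I_def
  proof (rule sum.mono_neutral_cong_right[OF fin])
    show "\<forall>d\<in>{d. d dvd m} - {d. d dvd m \<and> real d \<le> y}. moebius_mu d * lnp (y / real d) = 0"
      using d0 by (auto simp: lnp_divide_eq_0 not_le)
    show "moebius_mu d * lnp (y / real d) = ?f d" if "d \<in> {d. d dvd m \<and> real d \<le> y}" for d
      using that d0 y by (simp add: lnp_eq_ln)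
  qed auto
  have II: "type_II N y m = (\<Sum>d | d dvd m \<and> real (m div d) < real N / y. ?f d)"
  proof -
    have "type_II N y m = (\<Sum>e | e dvd m \<and> real e < real N / y. moebius_mu m * (moebius_mu e * (ln (y * real e) - ln (real m))))"
      unfolding type_II_def by (simp only: sum_distrib_left)
    also have "\<dots> = (\<Sum>d | d dvd m \<and> real (m div d) < real N / y. ?f d)"
    proof (rule sum.reindex_bij_witness[of _ "\<lambda>d. m div d" "\<lambda>e. m div e"])
      fix e assume "e \<in> {e. e dvd m \<and> real e < real N / y}"
      then obtain k where k: "m = e * k" and eN: "real e < real N / y" by auto
      have e0: "e > 0" "k > 0" using k m0 by auto
      have mk: "m div e = k" using k e0 by simp
      show "m div (m div e) = e" using mk k e0 by simp
      show "m div e \<in> {d. d dvd m \<and> real (m div d) < real N / y}"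
        using mk k e0 eN by simp
      have cop: "coprime e k"
      proof (rule coprimeI)
        fix x assume "x dvd e" "x dvd k"
        then have "x\<^sup>2 dvd m" using k by (simp add: power2_eq_square mult_dvd_mono)
        then show "x dvd 1" using m(3) by (rule squarefreeD[rotated])
      qed
      have "squarefree e" using squarefree_mono[of e m] m k by simp
      then have "moebius_mu e * moebius_mu e = 1" by (rule moebius_mu_square)
      moreover have "moebius_mu m = moebius_mu e * moebius_mu k" using cop k by (simp add: moebius_mu_mult)
      ultimately have mu: "moebius_mu m * moebius_mu e = moebius_mu k"
        by (metis mult.assoc mult.commute mult.right_neutral)
      have "ln (y * real e) - ln (real m) = ln (y / real k)"
        using y e0 k by (simp add: ln_mult ln_div)
      then show "moebius_mu (m div e) * ln (y / real (m div e)) = moebius_mu m * (moebius_mu e * (ln (y * real e) - ln (real m)))"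
        unfolding mk by (simp add: mu mult.assoc[symmetric])
    next
      fix d assume "d \<in> {d. d dvd m \<and> real (m div d) < real N / y}"
      then have "d dvd m" and dN: "real (m div d) < real N / y" by auto
      then obtain k where k: "m = d * k" by blast
      have d0': "d > 0" "k > 0" using k m0 by auto
      show "m div (m div d) = d" using k d0' by simp
      show "m div d \<in> {e. e dvd m \<and> real e < real N / y}" using k d0' dN by simp
    qed
    finally show ?thesis .
  qed
  have sub: "real (m div d) < real N / y" if "d dvd m" "real d > y" for d
  proof -
    have "real (m div d) * real d = real m" using that by (metis dvd_div_mult_self of_nat_mult)
    moreover have d: "real d > 0" using that y by linarith
    ultimately have "real (m div d) = real m / real d" by (simp add: field_simps)
    also have "\<dots> \<le> real N / real d" using m d by (intro divide_right_mono) auto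
    also have "\<dots> < real N / y" using that y m by (intro divide_strict_left_mono) auto
    finally show ?thesis .
  qed
  have "(\<Sum>d | d dvd m \<and> real (m div d) < real N / y. ?f d) = overlap N y m + (\<Sum>d | d dvd m \<and> real d > y. ?f d)"
    unfolding overlap_def using finR sub
    by (subst sum.union_disjoint[symmetric]) (auto intro!: sum.cong)
  then show ?thesis using L split I II by simp
qed

text \<open>At m = 1 the decomposition fails: the Moebius sum is 1 and the value is ln y, not
  Lambda(1) = 0. This single term is removed by hand.\<close>

lemma type_at_one:
  assumes "y \<ge> 1" "y < real N"
  shows "type_I y 1 + type_II N y 1 - overlap N y 1 = ln y"
proof -
  have "{e::nat. e dvd 1 \<and> real e < real N / y} = {1}" using assms by (auto simp: field_simps)
  moreover have "{d::nat. d dvd 1 \<and> real d \<le> y \<and> real (1 div d) < real N / y} = {1}" using assms by (auto simp: field_simps)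
  moreover have "{d::nat. d dvd 1} = {1}" by auto
  ultimately show ?thesis using assms
    by (simp only: type_I_def type_II_def overlap_def) (simp add: lnp_eq_ln)
qed

section \<open>Reduction of the Goldbach sum\<close>

definition sifted_set :: "nat \<Rightarrow> nat \<Rightarrow> nat set" where
  "sifted_set N P = {m. m \<in> {1..<N} \<and> coprime m P}"

lemma finite_sifted_set [simp]: "finite (sifted_set N P)"
  by (simp add: sifted_set_def)

text \<open>The discarded m are prime powers whose base divides N, is at most z, or is at most sqrt
  N because the exponent is at least 2. With their powers there are about sqrt N * ln N of them,
  each of weight at most (ln N)^2.\<close>

lemma goldbach_sum_reduce:
  assumes N: "N \<ge> 2"
  shows "\<bar>goldbach_sum N - (\<Sum>m | m \<in> sifted_set N (primorial z) \<and> squarefree m. shift_weight N m * mangoldt m)\<bar>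
    \<le> ln (real N) ^ 2 * ((2 * ln (real N) + real z + sqrt (real N)) * (2 * ln (real N)))"
proof -
  let ?P = "primorial z"
  let ?G = "{m. m \<in> sifted_set N ?P \<and> squarefree m}"
  let ?B = "prime_factors N \<union> {1..z} \<union> {1..nat \<lfloor>sqrt (real N)\<rfloor>}"
  let ?C = "{n. real n \<le> real N \<and> primepow n \<and> aprimedivisor n \<in> ?B}"
  let ?bad = "{m\<in>{1..<N}. primepow m \<and> (\<not> coprime m N \<or> \<not> coprime m ?P \<or> \<not> squarefree m)}"
  have l0: "ln (real N) \<ge> 0" using N by simp
  have g: "goldbach_sum N = (\<Sum>m\<in>{1..<N}. mangoldt (N - m) * mangoldt m)"
    unfolding goldbach_sum_def by (subst sum_reindex_sub) (intro sum.cong, auto)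
  have G: "(\<Sum>m\<in>?G. shift_weight N m * mangoldt m) = (\<Sum>m\<in>{1..<N}. if coprime m ?P \<and> squarefree m then shift_weight N m * mangoldt m else 0)"
    by (rule sum.mono_neutral_cong_left) (auto simp: sifted_set_def)
  have "goldbach_sum N - (\<Sum>m\<in>?G. shift_weight N m * mangoldt m)
      = (\<Sum>m\<in>{1..<N}. mangoldt (N - m) * mangoldt m - (if coprime m ?P \<and> squarefree m then shift_weight N m * mangoldt m else 0))"
    unfolding g G by (simp only: sum_subtractf)
  also have "\<dots> = (\<Sum>m\<in>?bad. mangoldt (N - m) * mangoldt m)" (is "_ = ?R")
    by (rule sum.mono_neutral_cong_right) (auto simp: shift_weight_def mangoldt_def)
  finally have eq: "goldbach_sum N - (\<Sum>m\<in>?G. shift_weight N m * mangoldt m) = ?R" .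
  have "\<bar>?R\<bar> \<le> (\<Sum>m\<in>?bad. ln (real N) * ln (real N))"
  proof (rule order_trans[OF sum_abs sum_mono])
    fix m assume m: "m \<in> ?bad"
    have "mangoldt (N - m) \<le> ln (real N)" "mangoldt m \<le> ln (real N)" using m N by (auto intro!: mangoldt_le_ln)
    then show "\<bar>mangoldt (N - m) * mangoldt m\<bar> \<le> ln (real N) * ln (real N)"
      using l0 by (auto simp: abs_mult mangoldt_nonneg intro!: mult_mono)
  qed
  also have "\<dots> = ln (real N) ^ 2 * real (card ?bad)" by (simp add: power2_eq_square)
  also have "\<dots> \<le> ln (real N) ^ 2 * ((2 * ln (real N) + real z + sqrt (real N)) * (2 * ln (real N)))"
  proof (rule mult_left_mono)
    have "?bad \<subseteq> ?C"
    proof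
      fix m assume m: "m \<in> ?bad"
      then obtain p k where pk: "prime p" "k > 0" "m = p ^ k" by (auto simp: primepow_def)
      have ap: "aprimedivisor m = p" using pk by (simp add: aprimedivisor_prime_power)
      have "p \<in> ?B"
      proof (cases "coprime m N")
        case False
        then show ?thesis using primepow_not_coprime[of m N] m ap N by auto
      next
        case c1: True
        show ?thesis
        proof (cases "coprime m ?P")
          case False
          then have "p \<in> prime_factors ?P" using primepow_not_coprime[of m ?P] m ap by auto
          then show ?thesis using prime_ge_1_nat[OF pk(1)] by (simp add: prime_factors_primorial)
        next
          case True
          then have ns: "\<not> squarefree m" using m c1 by auto
          have "k \<noteq> 1" using ns pk squarefree_prime[of p] by (metis power_one_right )
          then have "k \<ge> 2" using pk by linarith
          then have "p ^ 2 \<le> p ^ k" using prime_ge_1_nat[OF pk(1)] by (intro power_increasing) auto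
          then have "p ^ 2 \<le> N" using m pk by auto
          then have "real (p ^ 2) \<le> real N" by (rule of_nat_mono)
          then have "real p ^ 2 \<le> real N" by simp
          then have "real p \<le> sqrt (real N)" by (rule real_le_rsqrt)
          then have "p \<le> nat \<lfloor>sqrt (real N)\<rfloor>" by (simp add: le_nat_floor)
          then show ?thesis using prime_ge_1_nat[OF pk(1)] by simp
        qed
      qed
      then show "m \<in> ?C" using ap m by auto
    qed
    moreover have "finite ?C" by (rule finite_subset[of _ "{..N}"]) auto
    ultimately have "card ?bad \<le> card ?C" by (intro card_mono)
    then have "real (card ?bad) \<le> real (card ?C)" by (rule of_nat_mono)
    also have "\<dots> \<le> real (card ?B) * (2 * ln (real N))" using N by (intro card_primepow_le_ln) auto
    also have "\<dots> \<le> (2 * ln (real N) + real z + sqrt (real N)) * (2 * ln (real N))"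
    proof (rule mult_right_mono)
      have "card ?B \<le> card (prime_factors N) + card {1..z} + card {1..nat \<lfloor>sqrt (real N)\<rfloor>}"
        by (intro order_trans[OF card_Un_le] add_mono card_Un_le) auto
      then have "card ?B \<le> card (prime_factors N) + z + nat \<lfloor>sqrt (real N)\<rfloor>" by simp
      then have "real (card ?B) \<le> real (card (prime_factors N) + z + nat \<lfloor>sqrt (real N)\<rfloor>)" by (rule of_nat_mono)
      also have "\<dots> \<le> 2 * ln (real N) + real z + sqrt (real N)"
      proof -
        have "real (nat \<lfloor>sqrt (real N)\<rfloor>) \<le> sqrt (real N)" by simp
        moreover have "real (card (prime_factors N)) \<le> 2 * ln (real N)"
          using card_prime_factors_le[of N] log2_le[of "real N"] N by simp
        ultimately show ?thesis unfolding of_nat_add by linarith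
      qed
      finally show "real (card ?B) \<le> 2 * ln (real N) + real z + sqrt (real N)" .
    qed (use l0 in simp)
    finally show "real (card ?bad) \<le> (2 * ln (real N) + real z + sqrt (real N)) * (2 * ln (real N))" .
  qed simp
  finally show ?thesis unfolding eq .
qed

text \<open>The type I sum is extended to all sifted m, since only then does it open up into sums
  over multiples of d; the integers that are not squarefree are subtracted again. The type II sum
  extends for free, because it carries the factor mu(m).\<close>

lemma goldbach_sum_decomposition:
  assumes N: "N \<ge> 2" and y: "y \<ge> 1" "y < real N"
  shows "\<bar>goldbach_sum N - ((\<Sum>m\<in>sifted_set N (primorial z). shift_weight N m * type_I y m)
      - (\<Sum>m | m \<in> sifted_set N (primorial z) \<and> \<not> squarefree m. shift_weight N m * type_I y m)
      + (\<Sum>m\<in>sifted_set N (primorial z). shift_weight N m * type_II N y m)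
      - (\<Sum>m | m \<in> sifted_set N (primorial z) \<and> squarefree m. shift_weight N m * overlap N y m))\<bar>
    \<le> ln (real N) ^ 2 * ((2 * ln (real N) + real z + sqrt (real N)) * (2 * ln (real N))) + ln (real N) ^ 2"
proof -
  let ?Q = "sifted_set N (primorial z)"
  let ?S = "{m. m \<in> ?Q \<and> squarefree m}"
  let ?w = "shift_weight N"
  have fin: "finite {m. m \<in> ?Q \<and> R m}" for R by (rule finite_subset[of _ ?Q]) auto
  have one: "1 \<in> ?S" using N by (simp add: sifted_set_def)
  have rest: "mangoldt m = type_I y m + type_II N y m - overlap N y m" if "m \<in> ?S - {1}" for m
    using that y by (intro mangoldt_decomposition) (auto simp: sifted_set_def)
  have "(\<Sum>m\<in>?S. ?w m * mangoldt m) = (\<Sum>m\<in>?S - {1}. ?w m * mangoldt m)"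
    using sum.remove[OF fin one, of "\<lambda>m. ?w m * mangoldt m"] by simp
  also have "\<dots> = (\<Sum>m\<in>?S - {1}. ?w m * (type_I y m + type_II N y m - overlap N y m))"
    by (intro sum.cong refl) (simp only: rest)
  also have "\<dots> = (\<Sum>m\<in>?S. ?w m * (type_I y m + type_II N y m - overlap N y m)) - ?w 1 * ln y"
    using sum.remove[OF fin one, of "\<lambda>m. ?w m * (type_I y m + type_II N y m - overlap N y m)"]
      type_at_one[OF y] by simp
  also have "(\<Sum>m\<in>?S. ?w m * (type_I y m + type_II N y m - overlap N y m))
     = (\<Sum>m\<in>?S. ?w m * type_I y m) + (\<Sum>m\<in>?S. ?w m * type_II N y m) - (\<Sum>m\<in>?S. ?w m * overlap N y m)"
    by (simp only: ring_distribs sum_subtractf sum.distrib)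
  also have "(\<Sum>m\<in>?S. ?w m * type_II N y m) = (\<Sum>m\<in>?Q. ?w m * type_II N y m)"
    by (rule sum.mono_neutral_left) (auto simp: type_II_def moebius_mu_eq_0_iff)
  also have "(\<Sum>m\<in>?S. ?w m * type_I y m) = (\<Sum>m\<in>?Q. ?w m * type_I y m) - (\<Sum>m | m \<in> ?Q \<and> \<not> squarefree m. ?w m * type_I y m)"
  proof -
    have "(\<Sum>m\<in>?Q. ?w m * type_I y m) = (\<Sum>m\<in>?S. ?w m * type_I y m) + (\<Sum>m | m \<in> ?Q \<and> \<not> squarefree m. ?w m * type_I y m)"
      using fin by (subst sum.union_disjoint[symmetric]) (auto intro!: sum.cong)
    then show ?thesis by simp
  qed
  finally have eq: "(\<Sum>m\<in>?S. ?w m * mangoldt m) = ((\<Sum>m\<in>?Q. ?w m * type_I y m)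
      - (\<Sum>m | m \<in> ?Q \<and> \<not> squarefree m. ?w m * type_I y m)
      + (\<Sum>m\<in>?Q. ?w m * type_II N y m) - (\<Sum>m\<in>?S. ?w m * overlap N y m)) - ?w 1 * ln y" by simp
  have "\<bar>?w 1 * ln y\<bar> \<le> ln (real N) ^ 2"
  proof -
    have "ln y \<le> ln (real N)" "0 \<le> ln y" using y by auto
    moreover have "?w 1 \<le> ln (real N)" "?w 1 \<ge> 0" using N by (auto intro: shift_weight_le shift_weight_nonneg)
    ultimately show ?thesis by (auto simp: abs_mult power2_eq_square intro!: mult_mono)
  qed
  then show ?thesis using goldbach_sum_reduce[OF N, of z] eq by linarith
qed

section \<open>The bilinear part and the main part\<close>

lemma sum_divisors_swap:
  fixes f :: "nat \<Rightarrow> nat \<Rightarrow> real"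
  assumes Q: "finite Q" "\<And>m. m \<in> Q \<Longrightarrow> m > 0" and D: "finite D"
    and cov: "\<And>m d. m \<in> Q \<Longrightarrow> d dvd m \<Longrightarrow> R d \<Longrightarrow> d \<in> D" and DR: "\<And>d. d \<in> D \<Longrightarrow> R d"
  shows "(\<Sum>m\<in>Q. \<Sum>d | d dvd m \<and> R d. f m d) = (\<Sum>d\<in>D. \<Sum>m | m \<in> Q \<and> d dvd m. f m d)"
proof -
  have "(\<Sum>m\<in>Q. \<Sum>d | d dvd m \<and> R d. f m d) = (\<Sum>m\<in>Q. \<Sum>d | d \<in> D \<and> d dvd m. f m d)"
    using cov DR by (intro sum.cong) auto
  also have "\<dots> = (\<Sum>d\<in>D. \<Sum>m | m \<in> Q \<and> d dvd m. f m d)"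
    using Q(1) D by (rule sum.swap_restrict)
  finally show ?thesis .
qed

lemma sum_over_multiples_le:
  fixes f :: "nat \<Rightarrow> real"
  assumes f: "\<And>q. f q \<ge> 0" and b: "b > 0" and D: "finite D" and F: "finite F"
    and sub: "\<And>d. d \<in> D \<Longrightarrow> b * d \<in> F"
  shows "(\<Sum>d\<in>D. f (b * d)) \<le> (\<Sum>q\<in>F. f q)"
proof -
  have "(\<Sum>d\<in>D. f (b * d)) = (\<Sum>q\<in>(*) b ` D. f q)"
    using b by (subst sum.reindex) (auto simp: inj_on_def)
  also have "\<dots> \<le> (\<Sum>q\<in>F. f q)" using F f sub by (intro sum_mono2) auto
  finally show ?thesis .
qed

lemma finite_real_range: "finite {q::nat. 1 \<le> q \<and> real q \<le> x}" "finite {q::nat. 1 \<le> q \<and> real q \<le> x \<and> R q}"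
  "finite {q::nat. 1 \<le> q \<and> real q < x \<and> R q}"
  by (rule finite_subset[OF _ finite_nat_real_le[of x]], auto)+

text \<open>For fixed e the factor ln(y * e) does not depend on m. Coprimality to P is opened by
  inclusion-exclusion, so the moduli are b * e < P * N / y, and each modulus arises at most once for
  each b.\<close>

lemma sum_type_II_le:
  fixes N P :: nat and y x :: real
  assumes P: "P > 0" and y: "y \<ge> 1" "y < real N" and x: "real P * (real N / y) \<le> x"
  shows "\<bar>\<Sum>m\<in>sifted_set N P. shift_weight N m * type_II N y m\<bar> \<le>
     real (card {b. b dvd P}) * (ln (real N) * (\<Sum>q | 1 \<le> q \<and> real q \<le> x. \<bar>\<Sum>m | m \<in> {1..<N} \<and> q dvd m. shift_weight N m * moebius_mu m\<bar>)
        + (\<Sum>q | 1 \<le> q \<and> real q \<le> x. \<bar>\<Sum>m | m \<in> {1..<N} \<and> q dvd m. shift_weight N m * (moebius_mu m * ln (real m))\<bar>))"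
proof -
  let ?w = "shift_weight N" and ?Q = "sifted_set N P"
  define s0 where "s0 q = (\<Sum>m | m \<in> {1..<N} \<and> q dvd m. ?w m * moebius_mu m)" for q
  define s1 where "s1 q = (\<Sum>m | m \<in> {1..<N} \<and> q dvd m. ?w m * (moebius_mu m * ln (real m)))" for q
  let ?D = "{e. 1 \<le> e \<and> real e < real N / y \<and> coprime e P}"
  let ?F = "{q. 1 \<le> q \<and> real q \<le> x}"
  have finD: "finite ?D" and finF: "finite ?F" by (rule finite_real_range)+
  have lnN: "ln (real N) \<ge> 0" using y by simp
  have "(\<Sum>m\<in>?Q. ?w m * type_II N y m) = (\<Sum>m\<in>?Q. \<Sum>e | e dvd m \<and> (real e < real N / y \<and> coprime e P \<and> 1 \<le> e).
       ?w m * (moebius_mu m * (moebius_mu e * (ln (y * real e) - ln (real m)))))"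
    unfolding type_II_def sum_distrib_left
  proof (intro sum.cong refl)
    fix m e assume "m \<in> ?Q"
    then have m: "m > 0" "coprime m P" by (auto simp: sifted_set_def)
    show "{e. e dvd m \<and> real e < real N / y} = {e. e dvd m \<and> (real e < real N / y \<and> coprime e P \<and> 1 \<le> e)}"
      using m coprime_divisors[of _ m P P] dvd_pos_nat[of m] by (auto simp: Suc_le_eq)
  qed
  also have "\<dots> = (\<Sum>e\<in>?D. \<Sum>m | m \<in> ?Q \<and> e dvd m. ?w m * (moebius_mu m * (moebius_mu e * (ln (y * real e) - ln (real m)))))"
    by (rule sum_divisors_swap) (use finD in \<open>auto simp: sifted_set_def\<close>)
  also have "\<dots> = (\<Sum>e\<in>?D. moebius_mu e * (\<Sum>b | b dvd P. moebius_mu b * (ln (y * real e) * s0 (b * e) - s1 (b * e))))"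
    (is "_ = ?R")
  proof (intro sum.cong refl)
    fix e assume e: "e \<in> ?D"
    have "(\<Sum>m | m \<in> ?Q \<and> e dvd m. ?w m * (moebius_mu m * (moebius_mu e * (ln (y * real e) - ln (real m)))))
       = moebius_mu e * (\<Sum>m | m \<in> {1..<N} \<and> e dvd m \<and> coprime m P. ?w m * (moebius_mu m * (ln (y * real e) - ln (real m))))"
      unfolding sum_distrib_left by (intro sum.cong) (auto simp: sifted_set_def)
    also have "(\<Sum>m | m \<in> {1..<N} \<and> e dvd m \<and> coprime m P. ?w m * (moebius_mu m * (ln (y * real e) - ln (real m))))
       = (\<Sum>b | b dvd P. moebius_mu b * (\<Sum>m | m \<in> {1..<N} \<and> (b * e) dvd m. ?w m * (moebius_mu m * (ln (y * real e) - ln (real m)))))"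
      using e by (intro sum_coprime_expand[OF P]) auto
    also have "\<dots> = (\<Sum>b | b dvd P. moebius_mu b * (ln (y * real e) * s0 (b * e) - s1 (b * e)))"
    proof (intro sum.cong refl arg_cong2[where f = "(*)"])
      fix b
      show "(\<Sum>m | m \<in> {1..<N} \<and> (b * e) dvd m. ?w m * (moebius_mu m * (ln (y * real e) - ln (real m)))) = ln (y * real e) * s0 (b * e) - s1 (b * e)"
        unfolding s0_def s1_def sum_distrib_left sum_subtractf[symmetric] by (intro sum.cong refl) (simp add: algebra_simps)
    qed
    finally show "(\<Sum>m | m \<in> ?Q \<and> e dvd m. ?w m * (moebius_mu m * (moebius_mu e * (ln (y * real e) - ln (real m)))))
       = moebius_mu e * (\<Sum>b | b dvd P. moebius_mu b * (ln (y * real e) * s0 (b * e) - s1 (b * e)))" .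
  qed
  finally have eq: "(\<Sum>m\<in>?Q. ?w m * type_II N y m) = ?R" .
  have "\<bar>?R\<bar> \<le> (\<Sum>e\<in>?D. \<Sum>b | b dvd P. ln (real N) * \<bar>s0 (b * e)\<bar> + \<bar>s1 (b * e)\<bar>)"
  proof (rule order_trans[OF sum_abs sum_mono])
    fix e assume e: "e \<in> ?D"
    have "1 * 1 \<le> y * real e" using y e by (intro mult_mono) auto
    moreover have "y * real e \<le> real N" using e y by (simp add: field_simps)
    ultimately have l: "0 \<le> ln (y * real e)" "ln (y * real e) \<le> ln (real N)" by auto
    have "\<bar>moebius_mu e * (\<Sum>b | b dvd P. moebius_mu b * (ln (y * real e) * s0 (b * e) - s1 (b * e)))\<bar>
       \<le> \<bar>\<Sum>b | b dvd P. moebius_mu b * (ln (y * real e) * s0 (b * e) - s1 (b * e))\<bar>" by (rule abs_moebius_mu_mult_le)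
    also have "\<dots> \<le> (\<Sum>b | b dvd P. ln (real N) * \<bar>s0 (b * e)\<bar> + \<bar>s1 (b * e)\<bar>)"
    proof (rule order_trans[OF sum_abs sum_mono])
      fix b
      have "\<bar>moebius_mu b * (ln (y * real e) * s0 (b * e) - s1 (b * e))\<bar> \<le> \<bar>ln (y * real e) * s0 (b * e) - s1 (b * e)\<bar>"
        by (rule abs_moebius_mu_mult_le)
      also have "\<dots> \<le> \<bar>ln (y * real e)\<bar> * \<bar>s0 (b * e)\<bar> + \<bar>s1 (b * e)\<bar>"
        using abs_triangle_ineq4[of "ln (y * real e) * s0 (b * e)" "s1 (b * e)"] by (simp add: abs_mult)
      also have "\<dots> \<le> ln (real N) * \<bar>s0 (b * e)\<bar> + \<bar>s1 (b * e)\<bar>"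
        using l by (intro add_right_mono mult_right_mono) auto
      finally show "\<bar>moebius_mu b * (ln (y * real e) * s0 (b * e) - s1 (b * e))\<bar> \<le> ln (real N) * \<bar>s0 (b * e)\<bar> + \<bar>s1 (b * e)\<bar>" .
    qed
    finally show "\<bar>moebius_mu e * (\<Sum>b | b dvd P. moebius_mu b * (ln (y * real e) * s0 (b * e) - s1 (b * e)))\<bar>
       \<le> (\<Sum>b | b dvd P. ln (real N) * \<bar>s0 (b * e)\<bar> + \<bar>s1 (b * e)\<bar>)" .
  qed
  also have "\<dots> \<le> (\<Sum>b | b dvd P. \<Sum>q\<in>?F. ln (real N) * \<bar>s0 q\<bar> + \<bar>s1 q\<bar>)"
  proof (subst sum.swap, rule sum_mono)
    fix b assume "b \<in> {b. b dvd P}"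
    then have b: "b dvd P" "b > 0" "b \<le> P" using P by (auto intro: dvd_pos_nat dvd_imp_le)
    show "(\<Sum>e\<in>?D. ln (real N) * \<bar>s0 (b * e)\<bar> + \<bar>s1 (b * e)\<bar>) \<le> (\<Sum>q\<in>?F. ln (real N) * \<bar>s0 q\<bar> + \<bar>s1 q\<bar>)"
    proof (rule sum_over_multiples_le[where f = "\<lambda>q. ln (real N) * \<bar>s0 q\<bar> + \<bar>s1 q\<bar>", OF _ b(2) finD finF])
      fix e assume e: "e \<in> ?D"
      have "real (b * e) \<le> real P * (real N / y)" using b e unfolding of_nat_mult by (intro mult_mono) auto
      then show "b * e \<in> ?F" using x b e by (auto simp: Suc_le_eq)
    qed (use lnN in auto)
  qed
  also have "\<dots> = real (card {b. b dvd P}) * (ln (real N) * (\<Sum>q\<in>?F. \<bar>s0 q\<bar>) + (\<Sum>q\<in>?F. \<bar>s1 q\<bar>))"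
    by (simp add: sum.distrib sum_distrib_left)
  finally show ?thesis unfolding eq unfolding s0_def s1_def .
qed

lemma coprime_primorial_iff: "coprime d (primorial z) \<longleftrightarrow> (\<forall>p\<in>{p. prime p \<and> p \<le> z}. \<not> p dvd d)"
  using coprime_iff_prime_factors[of "primorial z" d] by (simp add: prime_factors_primorial)

lemma coprime_both_iff:
  assumes "N > 0"
  shows "coprime d (primorial z) \<and> coprime d N \<longleftrightarrow> (\<forall>p\<in>{p. prime p \<and> p \<le> z} \<union> prime_factors N. \<not> p dvd d)"
  unfolding coprime_primorial_iff coprime_iff_prime_factors[OF assms] by blast

text \<open>Opening the divisor sum leads to sifted sums over multiples of d with d coprime to P. By
  multiplicativity the main term separates into the sieve density and the totient sum over
  d.\<close>

lemma sum_type_I_le: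
  fixes N z :: nat and y :: real
  assumes N: "N > 0" and y: "y \<ge> 1"
  shows "\<bar>(\<Sum>m\<in>sifted_set N (primorial z). shift_weight N m * type_I y m)
      - real N * sieve_density N (primorial z) * phi_sum ({p. prime p \<and> p \<le> z} \<union> prime_factors N) ln y\<bar>
    \<le> real (card {b. b dvd primorial z}) * (ln y * (\<Sum>q | 1 \<le> q \<and> real q \<le> real (primorial z) * y. \<bar>shift_error N q\<bar>))"
proof -
  let ?P = "primorial z"
  let ?w = "shift_weight N" and ?Q = "sifted_set N ?P" and ?T = "{p. prime p \<and> p \<le> z} \<union> prime_factors N"
  let ?D = "{d. 1 \<le> d \<and> real d \<le> y \<and> coprime d ?P}"
  let ?F = "{q. 1 \<le> q \<and> real q \<le> real ?P * y}"
  have finD: "finite ?D" and finF: "finite ?F" by (rule finite_real_range)+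
  have ly: "ln y \<ge> 0" using y by simp
  have "(\<Sum>m\<in>?Q. ?w m * type_I y m) = (\<Sum>m\<in>?Q. \<Sum>d | d dvd m \<and> (real d \<le> y \<and> coprime d ?P \<and> 1 \<le> d). ?w m * (moebius_mu d * ln (y / real d)))"
  proof (intro sum.cong refl)
    fix m assume "m \<in> ?Q"
    then have m: "m > 0" "coprime m ?P" by (auto simp: sifted_set_def)
    have d0: "d > 0" if "d dvd m" for d using that m dvd_pos_nat by blast
    have "?w m * type_I y m = (\<Sum>d | d dvd m. ?w m * (moebius_mu d * lnp (y / real d)))"
      unfolding type_I_def by (simp only: sum_distrib_left)
    also have "\<dots> = (\<Sum>d | d dvd m \<and> (real d \<le> y \<and> coprime d ?P \<and> 1 \<le> d). ?w m * (moebius_mu d * ln (y / real d)))"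
    proof (rule sum.mono_neutral_cong_right)
      show "finite {d. d dvd m}" using m by simp
      have "coprime d ?P" if "d dvd m" for d using coprime_divisors[OF that dvd_refl] m by blast
      then have *: "y < real d" if "d \<in> {d. d dvd m} - {d. d dvd m \<and> (real d \<le> y \<and> coprime d ?P \<and> 1 \<le> d)}" for d
        using that d0[of d] by (auto simp: Suc_le_eq not_le)
      show "\<forall>d\<in>{d. d dvd m} - {d. d dvd m \<and> (real d \<le> y \<and> coprime d ?P \<and> 1 \<le> d)}. ?w m * (moebius_mu d * lnp (y / real d)) = 0"
        using * d0 by (simp add: lnp_divide_eq_0)
      show "?w m * (moebius_mu d * lnp (y / real d)) = ?w m * (moebius_mu d * ln (y / real d))"
        if "d \<in> {d. d dvd m \<and> (real d \<le> y \<and> coprime d ?P \<and> 1 \<le> d)}" for d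
        using that by (simp add: lnp_eq_ln)
    qed auto
    finally show "?w m * type_I y m = (\<Sum>d | d dvd m \<and> (real d \<le> y \<and> coprime d ?P \<and> 1 \<le> d). ?w m * (moebius_mu d * ln (y / real d)))" .
  qed
  also have "\<dots> = (\<Sum>d\<in>?D. \<Sum>m | m \<in> ?Q \<and> d dvd m. ?w m * (moebius_mu d * ln (y / real d)))"
    by (rule sum_divisors_swap) (use finD in \<open>auto simp: sifted_set_def\<close>)
  also have "\<dots> = (\<Sum>d\<in>?D. moebius_mu d * (ln (y / real d) * sifted_sum N ?P d))"
  proof (intro sum.cong refl)
    fix d
    show "(\<Sum>m | m \<in> ?Q \<and> d dvd m. ?w m * (moebius_mu d * ln (y / real d))) = moebius_mu d * (ln (y / real d) * sifted_sum N ?P d)"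
      unfolding sifted_sum_def sum_distrib_left by (intro sum.cong) (auto simp: sifted_set_def)
  qed
  finally have 1: "(\<Sum>m\<in>?Q. ?w m * type_I y m) = (\<Sum>d\<in>?D. moebius_mu d * (ln (y / real d) * sifted_sum N ?P d))" .
  have 2: "real N * sieve_density N ?P * phi_sum ?T ln y = (\<Sum>d\<in>?D. moebius_mu d * (ln (y / real d) * (real N * sieve_density N ?P * local_density N d)))"
  proof -
    have "{d. 1 \<le> d \<and> real d \<le> y \<and> (\<forall>p\<in>?T. \<not> p dvd d)} = {d. d \<in> ?D \<and> coprime d N}"
      using coprime_both_iff[OF N, of _ z] by blast
    then have "phi_sum ?T ln y = (\<Sum>d | d \<in> ?D \<and> coprime d N. moebius_mu d / real (totient d) * ln (y / real d))"
      unfolding phi_sum_def by (simp only:)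
    also have "\<dots> = (\<Sum>d\<in>?D. moebius_mu d * (ln (y / real d) * local_density N d))"
      using finD by (intro sum.mono_neutral_cong_left) (auto simp: local_density_def)
    finally have "phi_sum ?T ln y = (\<Sum>d\<in>?D. moebius_mu d * (ln (y / real d) * local_density N d))" .
    then show ?thesis by (simp add: sum_distrib_left mult.left_commute)
  qed
  have "(\<Sum>m\<in>?Q. ?w m * type_I y m) - real N * sieve_density N ?P * phi_sum ?T ln y
     = (\<Sum>d\<in>?D. moebius_mu d * (ln (y / real d) * (sifted_sum N ?P d - real N * sieve_density N ?P * local_density N d)))"
    (is "_ = ?R")
    unfolding 1 2 by (simp only: sum_subtractf[symmetric] right_diff_distrib)
  then have eq: "(\<Sum>m\<in>?Q. ?w m * type_I y m) - real N * sieve_density N ?P * phi_sum ?T ln y = ?R" .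
  have "\<bar>?R\<bar> \<le> (\<Sum>d\<in>?D. ln y * (\<Sum>b | b dvd ?P. \<bar>shift_error N (b * d)\<bar>))"
  proof (rule order_trans[OF sum_abs sum_mono])
    fix d assume d: "d \<in> ?D"
    have "y / real d \<le> y / 1" using d y by (intro divide_left_mono) auto
    then have l: "0 \<le> ln (y / real d)" "ln (y / real d) \<le> ln y" using d y by auto
    have "\<bar>moebius_mu d * (ln (y / real d) * (sifted_sum N ?P d - real N * sieve_density N ?P * local_density N d))\<bar>
      \<le> \<bar>ln (y / real d) * (sifted_sum N ?P d - real N * sieve_density N ?P * local_density N d)\<bar>" by (rule abs_moebius_mu_mult_le)
    also have "\<dots> \<le> ln y * (\<Sum>b | b dvd ?P. \<bar>shift_error N (b * d)\<bar>)"
      unfolding abs_mult using l d by (intro mult_mono sifted_sum_approx) (auto intro: sum_nonneg)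
    finally show "\<bar>moebius_mu d * (ln (y / real d) * (sifted_sum N ?P d - real N * sieve_density N ?P * local_density N d))\<bar>
      \<le> ln y * (\<Sum>b | b dvd ?P. \<bar>shift_error N (b * d)\<bar>)" .
  qed
  also have "\<dots> \<le> ln y * (\<Sum>b | b dvd ?P. \<Sum>q\<in>?F. \<bar>shift_error N q\<bar>)"
    unfolding sum_distrib_left[symmetric]
  proof (subst sum.swap, intro mult_left_mono sum_mono ly)
    fix b assume "b \<in> {b. b dvd ?P}"
    then have b: "b dvd ?P" "b > 0" "b \<le> ?P" by (auto intro: dvd_pos_nat[OF primorial_pos] dvd_imp_le)
    show "(\<Sum>d\<in>?D. \<bar>shift_error N (b * d)\<bar>) \<le> (\<Sum>q\<in>?F. \<bar>shift_error N q\<bar>)"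
    proof (rule sum_over_multiples_le[where f = "\<lambda>q. \<bar>shift_error N q\<bar>", OF _ b(2) finD finF])
      fix d assume d: "d \<in> ?D"
      have "real (b * d) \<le> real ?P * y" using b d unfolding of_nat_mult by (intro mult_mono) auto
      then show "b * d \<in> ?F" using b d by (auto simp: Suc_le_eq)
    qed auto
  qed
  also have "\<dots> = real (card {b. b dvd ?P}) * (ln y * (\<Sum>q\<in>?F. \<bar>shift_error N q\<bar>))" by simp
  finally show ?thesis unfolding eq .
qed

section \<open>The contribution of integers that are not squarefree\<close>

text \<open>Every squarefree d factors uniquely as g * e with g = gcd(d, k) and e coprime to
  k.\<close>

lemma sum_moebius_divisors_split:
  fixes F :: "nat \<Rightarrow> real"
  assumes k: "squarefree k" "k dvd m" and m: "m > 0"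
  shows "(\<Sum>d | d dvd m. moebius_mu d * F d)
       = (\<Sum>e | e dvd m \<and> coprime e k. moebius_mu e * (\<Sum>g | g dvd k. moebius_mu g * F (g * e)))"
proof -
  let ?E = "{e. e dvd m \<and> coprime e k \<and> squarefree e}" and ?G = "{g. g dvd k}"
  have k0: "k > 0" using k by (auto intro!: Nat.gr0I)
  have finm: "finite {d. d dvd m \<and> R d}" for R by (rule finite_subset[of _ "{d. d dvd m}"]) (use m in auto)
  have "(\<Sum>e | e dvd m \<and> coprime e k. moebius_mu e * (\<Sum>g\<in>?G. moebius_mu g * F (g * e)))
      = (\<Sum>e\<in>?E. \<Sum>g\<in>?G. moebius_mu (g * e) * F (g * e))"
  proof (rule sum.mono_neutral_cong_right)
    fix e assume e: "e \<in> ?E"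
    have "moebius_mu (g * e) = moebius_mu g * moebius_mu e" if "g \<in> ?G" for g
      using that e coprime_divisors[of g k e e] by (intro moebius_mu_mult) (auto simp: coprime_commute)
    then show "moebius_mu e * (\<Sum>g\<in>?G. moebius_mu g * F (g * e)) = (\<Sum>g\<in>?G. moebius_mu (g * e) * F (g * e))"
      unfolding sum_distrib_left by (intro sum.cong) auto
  qed (use finm in \<open>auto simp: moebius_mu_eq_0_iff\<close>)
  also have "\<dots> = (\<Sum>(e, g)\<in>?E \<times> ?G. moebius_mu (g * e) * F (g * e))"
    by (rule sum.cartesian_product)
  also have "\<dots> = (\<Sum>d | d dvd m \<and> squarefree d. moebius_mu d * F d)"
  proof (rule sum.reindex_bij_witness[of _ "\<lambda>d. (d div gcd d k, gcd d k)" "\<lambda>(e, g). g * e"])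
    fix x assume x: "x \<in> ?E \<times> ?G"
    obtain e g where xe: "x = (e, g)" by (cases x)
    have e: "e dvd m" "coprime e k" "squarefree e" and g: "g dvd k" using x xe by auto
    have g0: "g > 0" using g k0 dvd_pos_nat by blast
    have cop: "coprime g e" using coprime_divisors[OF g dvd_refl[of e]] e by (simp add: coprime_commute)
    have gc: "gcd (g * e) k = g"
    proof -
      have "gcd (g * e) k = gcd g k" using e(2) by (simp add: gcd_mult_right_right_cancel coprime_commute gcd.commute)
      then show ?thesis using g by (simp add: gcd_proj1_iff)
    qed
    show "(\<lambda>d. (d div gcd d k, gcd d k)) ((\<lambda>(e, g). g * e) x) = x" using xe gc g0 by simp
    have "squarefree g" using g k squarefree_mono by blast
    moreover have "g * e dvd m" using divides_mult[of g m e] g k(2) e cop dvd_trans by blast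
    ultimately show "(\<lambda>(e, g). g * e) x \<in> {d. d dvd m \<and> squarefree d}"
      using xe cop e squarefree_mult_coprime by auto
    show "moebius_mu ((\<lambda>(e, g). g * e) x) * F ((\<lambda>(e, g). g * e) x) = (case x of (e, g) \<Rightarrow> moebius_mu (g * e) * F (g * e))"
      using xe by simp
  next
    fix d assume "d \<in> {d. d dvd m \<and> squarefree d}"
    then have d: "d dvd m" "squarefree d" by auto
    define g where "g = gcd d k"
    have "g dvd d" by (simp add: g_def)
    then obtain e where e: "d = g * e" by blast
    have g0: "g > 0" using k0 by (simp add: g_def)
    have de: "d div g = e" using e g0 by simp
    show "(\<lambda>(e, g). g * e) (d div gcd d k, gcd d k) = d" by simp
    have cop: "coprime e k"
    proof (rule ccontr)
      assume "\<not> coprime e k"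
      then have "gcd e k \<noteq> 1" unfolding coprime_iff_gcd_eq_1 .
      then obtain p where "prime p" "p dvd gcd e k" using prime_factor_nat by blast
      then have p: "prime p" "p dvd e" "p dvd k" by auto
      have "e dvd d" using e by simp
      then have "p dvd d" using p dvd_trans by blast
      then have "p dvd g" using p unfolding g_def by simp
      then have "p\<^sup>2 dvd d" using p e by (simp add: power2_eq_square mult_dvd_mono)
      then show False using d p squarefreeD[of d p] by auto
    qed
    have "e dvd d" using e by simp
    have "g dvd k" by (simp add: g_def)
    show "(d div gcd d k, gcd d k) \<in> ?E \<times> ?G"
    proof -
      have "e dvd m" using \<open>e dvd d\<close> d(1) by (rule dvd_trans)
      moreover have "squarefree e" using squarefree_mono[OF \<open>e dvd d\<close> d(2)] .
      ultimately show ?thesis using cop \<open>g dvd k\<close> de unfolding g_def by simp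
    qed
  qed
  also have "\<dots> = (\<Sum>d | d dvd m. moebius_mu d * F d)"
    by (rule sum.mono_neutral_left) (use m in \<open>auto simp: moebius_mu_eq_0_iff\<close>)
  finally show ?thesis by simp
qed

section \<open>Divisor sums over multiples of a square\<close>

text \<open>The inner sum that results when the divisors of m in \<open>type_I\<close> are split
  into a part g | k and a part e coprime to k.\<close>

definition square_weight :: "real \<Rightarrow> nat \<Rightarrow> nat \<Rightarrow> real" where
  "square_weight y k e = (\<Sum>g | g dvd k. moebius_mu g * lnp (y / (real g * real e)))"

text \<open>When k * e <= y the cut-off is inactive and the complete divisor sum of k appears. For
  squarefree k it vanishes unless k is prime, so in this range composite k disappear
  altogether.\<close>

lemma square_weight_eq_mangoldt:
  assumes k: "k > 1" and e: "e \<ge> 1" "real k * real e \<le> y"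
  shows "square_weight y k e = mangoldt k"
proof -
  have k0: "k > 0" using k by simp
  have "square_weight y k e = (\<Sum>g | g dvd k. moebius_mu g * ln (y / real e) - moebius_mu g * ln (real g))"
    unfolding square_weight_def
  proof (intro sum.cong refl)
    fix g assume "g \<in> {g. g dvd k}"
    then have g: "g > 0" "g \<le> k" using k0 by (auto intro: dvd_pos_nat dvd_imp_le)
    have "real g * real e \<le> real k * real e" using g by (intro mult_right_mono) auto
    then have y: "real g * real e \<le> y" using e by linarith
    have "0 < real g * real e" using g e by simp
    then have y0: "y > 0" using y by linarith
    have "lnp (y / (real g * real e)) = ln (y / (real g * real e))"
      using y \<open>0 < real g * real e\<close> by (intro lnp_eq_ln) simp
    also have "ln (y / (real g * real e)) = ln (y / real e) - ln (real g)" using y0 g e by (simp add: ln_div ln_mult)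
    finally show "moebius_mu g * lnp (y / (real g * real e)) = moebius_mu g * ln (y / real e) - moebius_mu g * ln (real g)"
      by (simp add: right_diff_distrib)
  qed
  also have "\<dots> = (\<Sum>g | g dvd k. moebius_mu g) * ln (y / real e) - (\<Sum>g | g dvd k. moebius_mu g * ln (real g))"
    by (simp only: sum_subtractf sum_distrib_right)
  also have "\<dots> = mangoldt k" using k by (simp add: sum_moebius_mu_divisors sum_moebius_mu_ln)
  finally show ?thesis .
qed

lemma abs_square_weight_le:
  assumes k: "k > 0" and e: "e \<ge> 1" "y / real e \<le> t" and t: "t \<ge> 1" and y: "y \<ge> 0"
  shows "\<bar>square_weight y k e\<bar> \<le> real (card {g. g dvd k}) * ln t"
proof -
  have "\<bar>square_weight y k e\<bar> \<le> (\<Sum>g | g dvd k. ln t)"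
    unfolding square_weight_def
  proof (rule order_trans[OF sum_abs sum_mono])
    fix g assume "g \<in> {g. g dvd k}"
    then have g: "g > 0" using k by (auto intro: dvd_pos_nat)
    have "y / (real g * real e) \<le> y / (1 * real e)" using g e y by (intro divide_left_mono mult_right_mono) auto
    then have "lnp (y / (real g * real e)) \<le> lnp t" using e by (intro lnp_mono) simp
    also have "\<dots> = ln t" using t by (rule lnp_eq_ln)
    finally show "\<bar>moebius_mu g * lnp (y / (real g * real e))\<bar> \<le> ln t"
      using abs_moebius_mu_mult_le[of g "lnp (y / (real g * real e))"] lnp_nonneg[of "y / (real g * real e)"] by linarith
  qed
  then show ?thesis by simp
qed

definition square_part_sum :: "nat \<Rightarrow> nat \<Rightarrow> real \<Rightarrow> nat \<Rightarrow> real" where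
  "square_part_sum N P y k = (\<Sum>m | m \<in> sifted_set N P \<and> k\<^sup>2 dvd m. shift_weight N m * type_I y m)"

text \<open>Removing k = 1 from the sum of mu(k) over k^2 | m leaves -1 exactly for m that are not
  squarefree. Such k divide m and are therefore coprime to P; with P a primorial this means k > z,
  the source of the saving.\<close>

lemma not_squarefree_sum_eq:
  "(\<Sum>m | m \<in> sifted_set N P \<and> \<not> squarefree m. shift_weight N m * type_I y m)
    = - (\<Sum>k | k \<in> {2..N} \<and> squarefree k \<and> coprime k P. moebius_mu k * square_part_sum N P y k)"
proof -
  let ?Q = "sifted_set N P"
  let ?K = "{k. k \<in> {2..N} \<and> squarefree k \<and> coprime k P}"
  let ?f = "\<lambda>m. shift_weight N m * type_I y m"
  have finK: "finite ?K" by (rule finite_subset[of _ "{2..N}"]) auto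
  have key: "(\<Sum>k | k \<in> ?K \<and> k\<^sup>2 dvd m. moebius_mu k) = (if squarefree m then 0 else -1)" if "m \<in> ?Q" for m
  proof -
    have m: "m > 0" "m < N" "coprime m P" using that by (auto simp: sifted_set_def)
    have fin: "finite {k. k\<^sup>2 dvd m}"
    proof (rule finite_subset[of _ "{..m}"], rule subsetI)
      fix k assume "k \<in> {k. k\<^sup>2 dvd m}"
      then have "k dvd m" by (auto simp: power2_eq_square intro: dvd_mult_left)
      then show "k \<in> {..m}" using m dvd_imp_le by auto
    qed simp
    have "(\<Sum>k | k\<^sup>2 dvd m. moebius_mu k) = moebius_mu 1 + (\<Sum>k\<in>{k. k\<^sup>2 dvd m} - {1}. moebius_mu k)"
      by (rule sum.remove[OF fin]) simp
    also have "(\<Sum>k\<in>{k. k\<^sup>2 dvd m} - {1}. moebius_mu k) = (\<Sum>k | k \<in> ?K \<and> k\<^sup>2 dvd m. moebius_mu k)"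
    proof (rule sum.mono_neutral_right)
      show "finite ({k. k\<^sup>2 dvd m} - {1})" using fin by simp
      show "{k. k \<in> ?K \<and> k\<^sup>2 dvd m} \<subseteq> {k. k\<^sup>2 dvd m} - {1}" by auto
      show "\<forall>i\<in>{k. k\<^sup>2 dvd m} - {1} - {k. k \<in> ?K \<and> k\<^sup>2 dvd m}. moebius_mu i = 0"
      proof (intro ballI, rule ccontr)
        fix k assume k: "k \<in> {k. k\<^sup>2 dvd m} - {1} - {k. k \<in> ?K \<and> k\<^sup>2 dvd m}" and "moebius_mu k \<noteq> 0"
        then have sf: "squarefree k" by (simp add: moebius_mu_eq_0_iff)
        have km: "k dvd m" using k by (auto simp: power2_eq_square intro: dvd_mult_left)
        have "coprime k P" using coprime_divisors[OF km dvd_refl] m by blast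
        moreover have "k > 0" "k \<le> m" using km m by (auto intro: dvd_pos_nat dvd_imp_le)
        moreover have "k \<noteq> 1" using k by simp
        ultimately show False using sf k m by auto
      qed
    qed
    finally show ?thesis using sum_moebius_mu_square_divisors[OF m(1)] by (auto split: if_splits)
  qed
  have "(\<Sum>k\<in>?K. moebius_mu k * square_part_sum N P y k)
      = (\<Sum>k\<in>?K. \<Sum>m | m \<in> ?Q \<and> k\<^sup>2 dvd m. moebius_mu k * ?f m)"
    unfolding square_part_sum_def sum_distrib_left ..
  also have "\<dots> = (\<Sum>m\<in>?Q. \<Sum>k | k \<in> ?K \<and> k\<^sup>2 dvd m. moebius_mu k * ?f m)"
    using finK by (intro sum.swap_restrict) auto
  also have "\<dots> = (\<Sum>m\<in>?Q. (if squarefree m then 0 else -1) * ?f m)"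
    by (intro sum.cong refl) (simp only: key sum_distrib_right[symmetric])
  also have "\<dots> = (\<Sum>m | m \<in> ?Q \<and> \<not> squarefree m. - ?f m)"
    by (rule sum.mono_neutral_cong_right) auto
  finally show ?thesis by (simp add: sum_negf)
qed

text \<open>The divisors of m are split along k; since e is coprime to k, divisibility by k^2 and by
  e combine into the single modulus k^2 * e.\<close>

lemma square_part_sum_eq:
  assumes k: "squarefree k" "coprime k P" and y: "y \<ge> 0"
  shows "square_part_sum N P y k = (\<Sum>e | 1 \<le> e \<and> real e \<le> y \<and> coprime e P \<and> coprime e k.
      moebius_mu e * (square_weight y k e * sifted_sum N P (k\<^sup>2 * e)))"
proof -
  let ?Q = "{m. m \<in> sifted_set N P \<and> k\<^sup>2 dvd m}"
  let ?w = "shift_weight N"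
  let ?D = "{e. 1 \<le> e \<and> real e \<le> y \<and> coprime e P \<and> coprime e k}"
  have finQ: "finite ?Q" by (rule finite_subset[of _ "sifted_set N P"]) auto
  have finD: "finite ?D" by (rule finite_real_range)
  have "square_part_sum N P y k = (\<Sum>m\<in>?Q. \<Sum>e | e dvd m \<and> (real e \<le> y \<and> coprime e P \<and> coprime e k \<and> 1 \<le> e).
       ?w m * (moebius_mu e * square_weight y k e))"
    unfolding square_part_sum_def
  proof (intro sum.cong refl)
    fix m assume "m \<in> ?Q"
    then have m: "m > 0" "coprime m P" "k dvd m" by (auto simp: sifted_set_def power2_eq_square intro: dvd_mult_left)
    have d0: "d > 0" if "d dvd m" for d using that m dvd_pos_nat by blast
    have cP: "coprime d P" if "d dvd m" for d using coprime_divisors[OF that dvd_refl] m by blast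
    have "type_I y m = (\<Sum>e | e dvd m \<and> coprime e k. moebius_mu e * square_weight y k e)"
      unfolding type_I_def sum_moebius_divisors_split[OF k(1) m(3) m(1)] square_weight_def
      by simp
    also have "\<dots> = (\<Sum>e | e dvd m \<and> (real e \<le> y \<and> coprime e P \<and> coprime e k \<and> 1 \<le> e). moebius_mu e * square_weight y k e)"
    proof (rule sum.mono_neutral_right)
      show "finite {e. e dvd m \<and> coprime e k}" by (rule finite_subset[of _ "{d. d dvd m}"]) (use m in auto)
      show "\<forall>e\<in>{e. e dvd m \<and> coprime e k} - {e. e dvd m \<and> (real e \<le> y \<and> coprime e P \<and> coprime e k \<and> 1 \<le> e)}.
          moebius_mu e * square_weight y k e = 0"
      proof
        fix e assume e: "e \<in> {e. e dvd m \<and> coprime e k} - {e. e dvd m \<and> (real e \<le> y \<and> coprime e P \<and> coprime e k \<and> 1 \<le> e)}"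
        then have "real e > y" and e1: "e \<ge> 1" using d0[of e] cP[of e] by (auto simp: Suc_le_eq not_le)
        then have "y / real e \<le> 1" by simp
        then have "\<bar>square_weight y k e\<bar> \<le> real (card {g. g dvd k}) * ln 1"
          using k e1 y by (intro abs_square_weight_le) (auto intro!: Nat.gr0I)
        then show "moebius_mu e * square_weight y k e = 0" by simp
      qed
    qed auto
    finally show "?w m * type_I y m = (\<Sum>e | e dvd m \<and> (real e \<le> y \<and> coprime e P \<and> coprime e k \<and> 1 \<le> e). ?w m * (moebius_mu e * square_weight y k e))"
      by (simp only: sum_distrib_left)
  qed
  also have "\<dots> = (\<Sum>e\<in>?D. \<Sum>m | m \<in> ?Q \<and> e dvd m. ?w m * (moebius_mu e * square_weight y k e))"
    by (rule sum_divisors_swap) (use finD finQ in \<open>auto simp: sifted_set_def\<close>)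
  also have "\<dots> = (\<Sum>e\<in>?D. moebius_mu e * (square_weight y k e * sifted_sum N P (k\<^sup>2 * e)))"
  proof (intro sum.cong refl)
    fix e assume e: "e \<in> ?D"
    have cop: "coprime (k\<^sup>2) e" using e by (simp add: coprime_commute)
    have set: "{m. m \<in> ?Q \<and> e dvd m} = {m. m \<in> {1..<N} \<and> k\<^sup>2 * e dvd m \<and> coprime m P}"
    proof -
      have "k\<^sup>2 dvd m \<and> e dvd m \<longleftrightarrow> k\<^sup>2 * e dvd m" for m
        using divides_mult[OF _ _ cop, of m] dvd_mult_left[of "k\<^sup>2" e m] dvd_mult_right[of "k\<^sup>2" e m] by argo
      then show ?thesis unfolding sifted_set_def by blast
    qed
    show "(\<Sum>m | m \<in> ?Q \<and> e dvd m. ?w m * (moebius_mu e * square_weight y k e))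
       = moebius_mu e * (square_weight y k e * sifted_sum N P (k\<^sup>2 * e))"
      unfolding set sifted_sum_def sum_distrib_left by (intro sum.cong refl) (simp only: mult_ac)
  qed
  finally show ?thesis .
qed

section \<open>Bounds for the contribution of a single square\<close>

lemma card_multiples_le:
  assumes q: "q \<ge> 1" and X: "X \<ge> 0"
  shows "real (card {m. 1 \<le> m \<and> real m \<le> X \<and> q dvd m}) \<le> X / real q"
proof -
  have "card {m. 1 \<le> m \<and> real m \<le> X \<and> q dvd m} \<le> card ((*) q ` {1..nat \<lfloor>X / real q\<rfloor>})"
  proof (rule card_mono)
    show "{m. 1 \<le> m \<and> real m \<le> X \<and> q dvd m} \<subseteq> (*) q ` {1..nat \<lfloor>X / real q\<rfloor>}"
    proof
      fix m assume "m \<in> {m. 1 \<le> m \<and> real m \<le> X \<and> q dvd m}"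
      then have m: "1 \<le> m" "real m \<le> X" "q dvd m" by auto
      then obtain j where j: "m = q * j" by blast
      have "j \<ge> 1" using m j by (auto simp: Suc_le_eq intro!: Nat.gr0I)
      moreover have "real j \<le> X / real q" using m j q by (simp add: pos_le_divide_eq mult.commute)
      ultimately show "m \<in> (*) q ` {1..nat \<lfloor>X / real q\<rfloor>}" unfolding j by (intro imageI) (simp add: le_nat_floor)
    qed
  qed simp
  also have "\<dots> \<le> card {1..nat \<lfloor>X / real q\<rfloor>}" by (rule card_image_le) simp
  finally have "real (card {m. 1 \<le> m \<and> real m \<le> X \<and> q dvd m}) \<le> real (nat \<lfloor>X / real q\<rfloor>)" by simp
  also have "\<dots> \<le> X / real q" using X by simp
  finally show ?thesis .
qed

lemma shift_sum_upto_le_trivial: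
  assumes N: "N \<ge> 1" and q: "q \<ge> 1" and X: "X \<ge> 0"
  shows "(\<Sum>m | m \<in> {1..<N} \<and> q dvd m \<and> real m \<le> X. shift_weight N m) \<le> ln (real N) * (X / real q)"
proof -
  have lN: "ln (real N) \<ge> 0" using N by simp
  have "(\<Sum>m | m \<in> {1..<N} \<and> q dvd m \<and> real m \<le> X. shift_weight N m)
      \<le> (\<Sum>m | 1 \<le> m \<and> real m \<le> X \<and> q dvd m. ln (real N))"
    using N lN shift_weight_le by (intro sum_le_included[where i = id] finite_real_range) (auto intro: finite_subset[of _ "{..N}"])
  also have "\<dots> = ln (real N) * real (card {m. 1 \<le> m \<and> real m \<le> X \<and> q dvd m})" by simp
  also have "\<dots> \<le> ln (real N) * (X / real q)" using card_multiples_le[OF q X] lN by (rule mult_left_mono)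
  finally show ?thesis .
qed

lemma shift_sum_le_trivial:
  assumes N: "N \<ge> 1" and q: "q \<ge> 1"
  shows "shift_sum N q \<le> ln (real N) * (real N / real q)"
proof -
  have "{m. m \<in> {1..<N} \<and> q dvd m} = {m. m \<in> {1..<N} \<and> q dvd m \<and> real m \<le> real N}" by auto
  then show ?thesis using shift_sum_upto_le_trivial[OF N q, of "real N"] by (simp add: shift_sum_def)
qed

text \<open>Meant for k beyond a power of N: there 1 / k^2 saves a power of N, and the lost
  logarithms do not matter.\<close>

lemma abs_square_part_sum_trivial:
  assumes k: "squarefree k" "coprime k P" and y: "1 \<le> y" "y \<le> real N"
  shows "\<bar>square_part_sum N P y k\<bar> \<le>
    real (card {g. g dvd k}) * (ln (real N) ^ 2 * (1 + ln (real N)) * (real N / (real k)\<^sup>2))"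
proof -
  let ?D = "{e. 1 \<le> e \<and> real e \<le> y \<and> coprime e P \<and> coprime e k}"
  let ?c = "real (card {g. g dvd k})"
  have k0: "k > 0" using k by (auto intro!: Nat.gr0I)
  have N1: "N \<ge> 1" "ln (real N) \<ge> 0" using y by auto
  have ly: "0 \<le> ln y" "ln y \<le> ln (real N)" using y by auto
  have "\<bar>square_part_sum N P y k\<bar> \<le> (\<Sum>e\<in>?D. (?c * ln (real N)) * (ln (real N) * (real N / (real k)\<^sup>2)) * (1 / real e))"
    unfolding square_part_sum_eq[OF k order_trans[OF zero_le_one y(1)]]
  proof (rule order_trans[OF sum_abs sum_mono])
    fix e assume e: "e \<in> ?D"
    have "y / real e \<le> y / 1" using e y by (intro divide_left_mono) auto
    then have "\<bar>square_weight y k e\<bar> \<le> ?c * ln y"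
      using k0 e y by (intro abs_square_weight_le) auto
    also have "\<dots> \<le> ?c * ln (real N)" using ly by (intro mult_left_mono) auto
    finally have 1: "\<bar>square_weight y k e\<bar> \<le> ?c * ln (real N)" .
    have "sifted_sum N P (k\<^sup>2 * e) \<le> shift_sum N (k\<^sup>2 * e)" by (rule sifted_sum_le)
    also have "\<dots> \<le> ln (real N) * (real N / real (k\<^sup>2 * e))" using N1 k0 e by (intro shift_sum_le_trivial) auto
    finally have 2: "\<bar>sifted_sum N P (k\<^sup>2 * e)\<bar> \<le> ln (real N) * (real N / real (k\<^sup>2 * e))"
      using sifted_sum_nonneg[of N P "k\<^sup>2 * e"] by linarith
    have "\<bar>moebius_mu e * (square_weight y k e * sifted_sum N P (k\<^sup>2 * e))\<bar>
       \<le> \<bar>square_weight y k e * sifted_sum N P (k\<^sup>2 * e)\<bar>" by (rule abs_moebius_mu_mult_le)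
    also have "\<dots> \<le> (?c * ln (real N)) * (ln (real N) * (real N / real (k\<^sup>2 * e)))"
      unfolding abs_mult using 1 2 N1 by (intro mult_mono) auto
    also have "\<dots> = (?c * ln (real N)) * (ln (real N) * (real N / (real k)\<^sup>2)) * (1 / real e)"
      by simp
    finally show "\<bar>moebius_mu e * (square_weight y k e * sifted_sum N P (k\<^sup>2 * e))\<bar>
       \<le> (?c * ln (real N)) * (ln (real N) * (real N / (real k)\<^sup>2)) * (1 / real e)" .
  qed
  also have "\<dots> = (?c * ln (real N)) * (ln (real N) * (real N / (real k)\<^sup>2)) * (\<Sum>e\<in>?D. 1 / real e)"
    by (simp only: sum_distrib_left)
  also have "\<dots> \<le> (?c * ln (real N)) * (ln (real N) * (real N / (real k)\<^sup>2)) * (1 + ln (real N))"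
  proof (rule mult_left_mono)
    have "(\<Sum>e\<in>?D. 1 / real e) \<le> (\<Sum>e | 1 \<le> e \<and> real e \<le> y. 1 / real e)"
      by (intro sum_mono2 finite_real_range) auto
    also have "\<dots> \<le> 1 + ln y" by (rule sum_inverse_real_le[OF y(1)])
    finally show "(\<Sum>e\<in>?D. 1 / real e) \<le> 1 + ln (real N)" using ly by linarith
  qed (use N1 in simp)
  finally show ?thesis by (simp add: power2_eq_square mult_ac)
qed

lemma totient_square: "real (totient (k\<^sup>2)) = real k * real (totient k)" if "squarefree k"
  using that
proof (induction k rule: squarefree_induct)
  case one
  then show ?case by simp
next
  case (prime_mult p m)
  have cop: "coprime p m" using prime_mult prime_imp_coprime by blast
  have "totient ((p * m)\<^sup>2) = totient (p\<^sup>2) * totient (m\<^sup>2)"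
    unfolding power_mult_distrib using cop by (intro totient_mult_coprime) simp
  moreover have "totient (p\<^sup>2) = p * totient p"
    using totient_prime_power_Suc[OF prime_mult(1), of 1] totient_prime[OF prime_mult(1)] by (simp add: power2_eq_square)
  moreover have "totient (p * m) = totient p * totient m" using cop by (rule totient_mult_coprime)
  ultimately show ?case using prime_mult by simp
qed

lemma kap_insert_le:
  assumes "finite T" "\<And>q. q \<in> T \<Longrightarrow> prime q" "prime p"
  shows "kap (insert p T) \<le> 2 * kap T"
proof (cases "p \<in> T")
  case True
  then show ?thesis using kap_ge_1[of T] assms by (simp add: insert_absorb)
next
  case False
  have "real p / (real p - 1) \<le> 2" using prime_ge_2_nat[OF assms(3)] by (simp add: field_simps)
  then have "real p / (real p - 1) * kap T \<le> 2 * kap T"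
    using kap_ge_1[of T] assms(2) by (intro mult_right_mono) auto
  then show ?thesis using False assms(1) by (simp add: kap_def)
qed

text \<open>Here the moduli stay within the level of distribution, so the Moebius signs of e can be
  exploited: the main term is a totient sum with weight 1 and is bounded without any logarithm. The
  constant is 5 * 2 * 2, from the bound 2 for that sum and the extra prime p, times 2 from phi(p^2)
  >= p^2 / 2.\<close>

lemma sum_prime_square_sifted_le:
  fixes N z p :: nat and y :: real
  assumes N: "even N" "N > 0" and z: "z \<ge> 3" and p: "prime p" "p > z"
  shows "\<bar>\<Sum>e | 1 \<le> e \<and> real e \<le> y / (real p)\<^sup>2 \<and> coprime e (primorial z) \<and> coprime e p. moebius_mu e * sifted_sum N (primorial z) (p\<^sup>2 * e)\<bar>
    \<le> 40 * real N * kap (prime_factors N) / (real p)\<^sup>2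
      + (\<Sum>e | 1 \<le> e \<and> real e \<le> y / (real p)\<^sup>2. \<Sum>b | b dvd primorial z. \<bar>shift_error N (b * (p\<^sup>2 * e))\<bar>)"
proof -
  let ?P = "primorial z" and ?T = "{q. prime q \<and> q \<le> z} \<union> prime_factors N"
  let ?r = "sieve_density N ?P"
  let ?D = "{e. 1 \<le> e \<and> real e \<le> y / (real p)\<^sup>2 \<and> coprime e ?P \<and> coprime e p}"
  let ?D' = "{e. 1 \<le> e \<and> real e \<le> y / (real p)\<^sup>2}"
  have finD: "finite ?D" "finite ?D'" by (rule finite_real_range)+
  have p0: "p > 0" using p by simp
  have pP: "coprime p ?P"
    unfolding coprime_primorial_iff
  proof
    fix q assume q: "q \<in> {q. prime q \<and> q \<le> z}"
    show "\<not> q dvd p"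
    proof
      assume "q dvd p"
      then have "q = p" using q p by (intro primes_dvd_imp_eq) auto
      then show False using q p by simp
    qed
  qed
  let ?m = "\<lambda>e. moebius_mu e * (real N * ?r * local_density N (p\<^sup>2 * e))"
  have main: "(\<Sum>e\<in>?D. ?m e) = real N * ?r * local_density N (p\<^sup>2) * phi_sum (insert p ?T) (\<lambda>_. 1) (y / (real p)\<^sup>2)"
  proof -
    have eq: "{e. 1 \<le> e \<and> real e \<le> y / (real p)\<^sup>2 \<and> (\<forall>q\<in>insert p ?T. \<not> q dvd e)} = {e. e \<in> ?D \<and> coprime e N}"
    proof -
      have "\<not> p dvd e \<longleftrightarrow> coprime e p" for e
        using prime_imp_coprime[OF p(1), of e] coprime_common_divisor[of p e p] not_prime_unit[of p] p(1)
        unfolding coprime_commute[of e p] by (metis dvd_refl)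
      then have "(\<forall>q\<in>insert p ?T. \<not> q dvd e) \<longleftrightarrow> coprime e p \<and> coprime e ?P \<and> coprime e N" for e
        using coprime_both_iff[OF N(2), of e z] unfolding ball_simps by (simp only:)
      then show ?thesis by blast
    qed
    have "phi_sum (insert p ?T) (\<lambda>_. 1) (y / (real p)\<^sup>2) = (\<Sum>e | e \<in> ?D \<and> coprime e N. moebius_mu e / real (totient e))"
      unfolding phi_sum_def eq by simp
    also have "\<dots> = (\<Sum>e\<in>?D. moebius_mu e * local_density N e)"
      using finD by (intro sum.mono_neutral_cong_left) (auto simp: local_density_def)
    finally have "real N * ?r * local_density N (p\<^sup>2) * phi_sum (insert p ?T) (\<lambda>_. 1) (y / (real p)\<^sup>2)
       = (\<Sum>e\<in>?D. real N * ?r * local_density N (p\<^sup>2) * (moebius_mu e * local_density N e))"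
      by (simp only: sum_distrib_left)
    also have "\<dots> = (\<Sum>e\<in>?D. ?m e)"
    proof (intro sum.cong refl)
      fix e assume "e \<in> ?D"
      then have "coprime (p\<^sup>2) e" by (simp add: coprime_commute)
      then show "real N * ?r * local_density N (p\<^sup>2) * (moebius_mu e * local_density N e) = ?m e"
        by (simp add: local_density_mult)
    qed
    finally show ?thesis by simp
  qed
  have k1: "kap ?T \<ge> 1" by (rule kap_ge_1) auto
  have k2: "kap (prime_factors N) \<ge> 1" by (rule kap_ge_1) auto
  have phi: "\<bar>phi_sum (insert p ?T) (\<lambda>_. 1) (y / (real p)\<^sup>2)\<bar> \<le> 20 * kap ?T"
  proof -
    have "\<bar>phi_sum (insert p ?T) (\<lambda>_. 1) (y / (real p)\<^sup>2)\<bar> \<le> 5 * 2 * kap (insert p ?T)"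
      by (rule abs_phi_sum_le[OF _ _ _ z abs_mu_sum_one_le]) (use p in auto)
    also have "kap (insert p ?T) \<le> 2 * kap ?T" by (rule kap_insert_le) (use p in auto)
    finally show ?thesis by simp
  qed
  have ld: "local_density N (p\<^sup>2) \<le> 2 / (real p)\<^sup>2"
  proof -
    have "totient (p\<^sup>2) = p * (p - 1)" using totient_prime_power_Suc[OF p(1), of 1] by (simp add: power2_eq_square)
    then have t: "real (totient (p\<^sup>2)) = real p * (real p - 1)" using p0 by (simp add: of_nat_diff)
    have p2: "real p \<ge> 2" using prime_ge_2_nat[OF p(1)] by simp
    have "1 / (real p * (real p - 1)) \<le> 1 / (real p * (real p / 2))"
      using p2 by (intro divide_left_mono mult_left_mono mult_pos_pos) auto
    also have "\<dots> = 2 / (real p)\<^sup>2" by (simp add: power2_eq_square)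
    finally show ?thesis using p0 by (simp add: local_density_def t)
  qed
  have rk: "0 \<le> ?r" "?r * kap ?T \<le> kap (prime_factors N)"
    using sieve_density_range[OF N] sieve_density_kap_le[OF N] by auto
  have "\<bar>\<Sum>e\<in>?D. ?m e\<bar> \<le> 40 * real N * kap (prime_factors N) / (real p)\<^sup>2"
  proof -
    have "\<bar>\<Sum>e\<in>?D. ?m e\<bar> = real N * ?r * local_density N (p\<^sup>2) * \<bar>phi_sum (insert p ?T) (\<lambda>_. 1) (y / (real p)\<^sup>2)\<bar>"
      unfolding main using rk(1) by (simp add: abs_mult local_density_nonneg)
    also have "\<dots> \<le> real N * ?r * (2 / (real p)\<^sup>2) * (20 * kap ?T)"
      using phi ld rk by (intro mult_mono) (auto intro: local_density_nonneg)
    also have "\<dots> = 40 * real N / (real p)\<^sup>2 * (?r * kap ?T)" by simp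
    also have "\<dots> \<le> 40 * real N / (real p)\<^sup>2 * kap (prime_factors N)" using rk by (intro mult_left_mono) auto
    finally show ?thesis by simp
  qed
  moreover have "\<bar>(\<Sum>e\<in>?D. moebius_mu e * sifted_sum N ?P (p\<^sup>2 * e)) - (\<Sum>e\<in>?D. ?m e)\<bar>
      \<le> (\<Sum>e\<in>?D'. \<Sum>b | b dvd ?P. \<bar>shift_error N (b * (p\<^sup>2 * e))\<bar>)"
  proof -
    have "\<bar>(\<Sum>e\<in>?D. moebius_mu e * sifted_sum N ?P (p\<^sup>2 * e)) - (\<Sum>e\<in>?D. ?m e)\<bar>
      \<le> (\<Sum>e\<in>?D. \<Sum>b | b dvd ?P. \<bar>shift_error N (b * (p\<^sup>2 * e))\<bar>)"
      unfolding sum_subtractf[symmetric]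
    proof (rule order_trans[OF sum_abs sum_mono])
      fix e assume e: "e \<in> ?D"
      have "\<bar>moebius_mu e * sifted_sum N ?P (p\<^sup>2 * e) - ?m e\<bar>
         = \<bar>moebius_mu e * (sifted_sum N ?P (p\<^sup>2 * e) - real N * ?r * local_density N (p\<^sup>2 * e))\<bar>"
        by (simp only: right_diff_distrib)
      also have "\<dots> \<le> \<bar>sifted_sum N ?P (p\<^sup>2 * e) - real N * ?r * local_density N (p\<^sup>2 * e)\<bar>"
        by (rule abs_moebius_mu_mult_le)
      also have "\<dots> \<le> (\<Sum>b | b dvd ?P. \<bar>shift_error N (b * (p\<^sup>2 * e))\<bar>)"
        using e pP by (intro sifted_sum_approx) auto
      finally show "\<bar>moebius_mu e * sifted_sum N ?P (p\<^sup>2 * e) - ?m e\<bar> \<le> (\<Sum>b | b dvd ?P. \<bar>shift_error N (b * (p\<^sup>2 * e))\<bar>)" .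
    qed
    also have "\<dots> \<le> (\<Sum>e\<in>?D'. \<Sum>b | b dvd ?P. \<bar>shift_error N (b * (p\<^sup>2 * e))\<bar>)"
      by (intro sum_mono2 finD sum_nonneg) auto
    finally show ?thesis .
  qed
  ultimately show ?thesis by linarith
qed

text \<open>The cut at e = y / k^2 keeps the moduli b * k^2 * e below P * y in the lower range,
  where the weight is Lambda(k). In the upper range y / e < k^2, so the weight and the logarithmic
  length of the window depend on k alone; an upper bound of Brun-Titchmarsh strength, here the
  assumption on B, then suffices and no factor ln N is lost.\<close>

lemma abs_square_part_sum_le:
  fixes N z k :: nat and y B :: real
  assumes N: "even N" "N > 0" and z: "z \<ge> 3" and y: "y \<ge> 1"
    and k: "squarefree k" "coprime k (primorial z)" "k > 1"
    and B: "B \<ge> 0" and bt: "\<And>q. q \<ge> 1 \<Longrightarrow> real q \<le> (real k)\<^sup>2 * y \<Longrightarrow> shift_sum N q \<le> B * (real N / real (totient q))"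
  shows "\<bar>square_part_sum N (primorial z) y k\<bar> \<le>
     (if prime k then ln (real k) * (40 * real N * kap (prime_factors N) / (real k)\<^sup>2
        + (\<Sum>e | 1 \<le> e \<and> real e \<le> y / (real k)\<^sup>2. \<Sum>b | b dvd primorial z. \<bar>shift_error N (b * (k\<^sup>2 * e))\<bar>)) else 0)
     + real (card {g. g dvd k}) * (2 * ln (real k)) * (B * real N * (10 * (1 + 2 * ln (real k)))) / (real k * real (totient k))"
proof -
  let ?P = "primorial z"
  let ?D = "{e. 1 \<le> e \<and> real e \<le> y \<and> coprime e ?P \<and> coprime e k}"
  let ?L = "{e. 1 \<le> e \<and> real e \<le> y / (real k)\<^sup>2 \<and> coprime e ?P \<and> coprime e k}"
  let ?W = "{e. 1 \<le> e \<and> y / (real k)\<^sup>2 < real e \<and> real e \<le> y \<and> squarefree e}"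
  let ?H = "{e. e \<in> ?D \<and> y / (real k)\<^sup>2 < real e}"
  let ?c = "real (card {g. g dvd k})"
  let ?t = "\<lambda>e. moebius_mu e * (square_weight y k e * sifted_sum N ?P (k\<^sup>2 * e))"
  have k0: "real k > 1" using k by simp
  have lk: "ln (real k) > 0" using k0 by simp
  have k2: "(real k)\<^sup>2 > 1" using k0 by simp
  have finL: "finite ?L" and finD: "finite ?D" by (rule finite_real_range)+
  have finH: "finite ?H" by (rule finite_subset[OF _ finD]) auto
  have finW: "finite ?W" by (rule finite_subset[OF _ finite_nat_real_le[of y]]) auto
  have yk: "y / (real k)\<^sup>2 \<le> y" using k2 y by (simp add: divide_le_eq)
  have split: "square_part_sum N ?P y k = (\<Sum>e\<in>?L. ?t e) + (\<Sum>e\<in>?H. ?t e)"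
  proof -
    have "square_part_sum N ?P y k = (\<Sum>e\<in>?D. ?t e)" using k y by (intro square_part_sum_eq) auto
    also have "?D = ?L \<union> ?H" using yk by fastforce
    also have "(\<Sum>e\<in>?L \<union> ?H. ?t e) = (\<Sum>e\<in>?L. ?t e) + (\<Sum>e\<in>?H. ?t e)"
      by (rule sum.union_disjoint[OF finL finH]) auto
    finally show ?thesis .
  qed
  have low: "(\<Sum>e\<in>?L. ?t e) = mangoldt k * (\<Sum>e\<in>?L. moebius_mu e * sifted_sum N ?P (k\<^sup>2 * e))"
    unfolding sum_distrib_left
  proof (intro sum.cong refl)
    fix e assume e: "e \<in> ?L"
    then have "real e * (real k)\<^sup>2 \<le> y" using k0 by (simp add: pos_le_divide_eq)
    moreover have "real k * real e \<le> real e * (real k)\<^sup>2" using k0 e by (simp add: power2_eq_square)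
    ultimately have "real k * real e \<le> y" by (rule order_trans[rotated])
    then have "square_weight y k e = mangoldt k" using k e by (intro square_weight_eq_mangoldt) auto
    then show "?t e = mangoldt k * (moebius_mu e * sifted_sum N ?P (k\<^sup>2 * e))" by simp
  qed
  have lowb: "\<bar>\<Sum>e\<in>?L. ?t e\<bar> \<le> (if prime k then ln (real k) * (40 * real N * kap (prime_factors N) / (real k)\<^sup>2
        + (\<Sum>e | 1 \<le> e \<and> real e \<le> y / (real k)\<^sup>2. \<Sum>b | b dvd ?P. \<bar>shift_error N (b * (k\<^sup>2 * e))\<bar>)) else 0)"
  proof (cases "prime k")
    case True
    have "k > z" by (rule coprime_primorial_gt) (use k in auto)
    then have "\<bar>\<Sum>e\<in>?L. moebius_mu e * sifted_sum N ?P (k\<^sup>2 * e)\<bar> \<le> 40 * real N * kap (prime_factors N) / (real k)\<^sup>2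
        + (\<Sum>e | 1 \<le> e \<and> real e \<le> y / (real k)\<^sup>2. \<Sum>b | b dvd ?P. \<bar>shift_error N (b * (k\<^sup>2 * e))\<bar>)"
      using True by (intro sum_prime_square_sifted_le[OF N z])
    then show ?thesis unfolding low using True lk mangoldt_primepow[of k 1] by (simp add: abs_mult mult_left_mono)
  next
    case False
    have "\<not> primepow k"
    proof
      assume "primepow k"
      then obtain p j where pj: "prime p" "j > 0" "k = p ^ j" by (auto simp: primepow_def)
      have "j \<noteq> 1" using pj False by auto
      then have "p\<^sup>2 dvd k" using pj by (auto intro: le_imp_power_dvd)
      then show False using k pj squarefreeD[of k p] by auto
    qed
    then show ?thesis unfolding low using False by (simp add: mangoldt_def)
  qed
  have "\<bar>\<Sum>e\<in>?H. ?t e\<bar> \<le> (\<Sum>e\<in>?H. if squarefree e then ?c * (2 * ln (real k)) * (B * (real N / (real k * real (totient k) * real (totient e)))) else 0)"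
  proof (rule order_trans[OF sum_abs sum_mono])
    fix e assume e: "e \<in> ?H"
    show "\<bar>?t e\<bar> \<le> (if squarefree e then ?c * (2 * ln (real k)) * (B * (real N / (real k * real (totient k) * real (totient e)))) else 0)"
    proof (cases "squarefree e")
      case False
      then show ?thesis by (simp add: moebius_mu_not_squarefree)
    next
      case True
      have "y < real e * (real k)\<^sup>2" using e k0 by (simp add: pos_divide_less_eq)
      then have "y / real e \<le> (real k)\<^sup>2" using e by (simp add: pos_divide_le_eq mult.commute)
      then have "\<bar>square_weight y k e\<bar> \<le> ?c * ln ((real k)\<^sup>2)"
        using k e y k2 by (intro abs_square_weight_le) auto
      then have 1: "\<bar>square_weight y k e\<bar> \<le> ?c * (2 * ln (real k))" using k0 by (simp add: ln_realpow)
      have "sifted_sum N ?P (k\<^sup>2 * e) \<le> shift_sum N (k\<^sup>2 * e)" by (rule sifted_sum_le)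
      also have "\<dots> \<le> B * (real N / real (totient (k\<^sup>2 * e)))"
        using e k by (intro bt) (auto simp: Suc_le_eq intro!: mult_left_mono)
      also have "real (totient (k\<^sup>2 * e)) = real k * real (totient k) * real (totient e)"
        using totient_mult_coprime[of "k\<^sup>2" e] e totient_square[OF k(1)] by (simp add: coprime_commute)
      finally have 2: "\<bar>sifted_sum N ?P (k\<^sup>2 * e)\<bar> \<le> B * (real N / (real k * real (totient k) * real (totient e)))"
        using sifted_sum_nonneg[of N ?P "k\<^sup>2 * e"] by linarith
      have "\<bar>?t e\<bar> \<le> \<bar>square_weight y k e * sifted_sum N ?P (k\<^sup>2 * e)\<bar>" by (rule abs_moebius_mu_mult_le)
      also have "\<dots> \<le> ?c * (2 * ln (real k)) * (B * (real N / (real k * real (totient k) * real (totient e))))"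
        unfolding abs_mult using 1 2 lk by (intro mult_mono) auto
      finally show ?thesis using True by simp
    qed
  qed
  also have "\<dots> \<le> (\<Sum>e\<in>?W. ?c * (2 * ln (real k)) * (B * (real N / (real k * real (totient k) * real (totient e)))))"
    unfolding sum.inter_filter[symmetric, OF finH]
  proof (rule sum_mono2[OF finW])
    show "0 \<le> ?c * (2 * ln (real k)) * (B * (real N / (real k * real (totient k) * real (totient b))))" for b
      using B lk by simp
  qed auto
  also have "\<dots> = ?c * (2 * ln (real k)) * (B * real N) / (real k * real (totient k)) * (\<Sum>e\<in>?W. 1 / real (totient e))"
    by (simp add: sum_distrib_left)
  also have "\<dots> \<le> ?c * (2 * ln (real k)) * (B * real N) / (real k * real (totient k)) * (10 * (1 + 2 * ln (real k)))"
  proof (rule mult_left_mono)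
    have "(\<Sum>e\<in>?W. 1 / real (totient e)) \<le> 10 * (1 + ln (y / (y / (real k)\<^sup>2)))"
      using y k0 yk by (intro sum_inverse_totient_window_le divide_pos_pos) auto
    also have "y / (y / (real k)\<^sup>2) = (real k)\<^sup>2" using y by simp
    also have "ln ((real k)\<^sup>2) = 2 * ln (real k)" using k0 by (simp add: ln_realpow)
    finally show "(\<Sum>e\<in>?W. 1 / real (totient e)) \<le> 10 * (1 + 2 * ln (real k))" .
  qed (use B lk in simp)
  finally have high: "\<bar>\<Sum>e\<in>?H. ?t e\<bar> \<le> ?c * (2 * ln (real k)) * (B * real N * (10 * (1 + 2 * ln (real k)))) / (real k * real (totient k))"
    by (simp add: mult_ac)
  show ?thesis unfolding split using lowb high by linarith
qed

text \<open>The divisor count is at most k^(1/8), the two logarithms cost another k^(1/8) through ln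
  k <= 16 * k^(1/16), and the denominator is at least k^(7/4). The exponents add up to -3/2, and 60
  * 256 = 15360 is rounded up.\<close>

lemma rough_weight_le:
  assumes k: "squarefree k" "k > 1" and big: "\<And>p. prime p \<Longrightarrow> p dvd k \<Longrightarrow> p \<ge> 256"
  shows "real (card {g. g dvd k}) * (2 * ln (real k)) * (10 * (1 + 2 * ln (real k))) / (real k * real (totient k)) \<le> 20000 * real k powr (-3/2)"
proof -
  have k0: "real k > 1" using k by simp
  have k256: "real k \<ge> 256"
  proof -
    obtain p where p: "prime p" "p dvd k" using prime_factor_nat[of k] k by auto
    then show ?thesis using big[OF p] dvd_imp_le[of p k] k by simp
  qed
  have "exp 1 \<le> real k" using k256 exp_le by linarith
  then have l1: "ln (real k) \<ge> 1" using k0 by (simp add: ln_ge_iff)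
  have l2: "ln (real k) \<le> 16 * real k powr (1/16)" using ln_le_powr[of "1/16" "real k"] k0 by simp
  have t: "real (totient k) \<ge> real k powr (3/4)"
  proof (rule squarefree_totient_ge_powr[OF k(1)])
    fix p :: nat assume "prime p" "p dvd k"
    then have "p \<ge> 256" by (rule big)
    then show "p \<ge> 5" by simp
  qed
  have c: "real (card {g. g dvd k}) \<le> real k powr (1/8)" by (rule squarefree_card_divisors_le[OF k(1) big])
  have "(2 * ln (real k)) * (10 * (1 + 2 * ln (real k))) \<le> (2 * ln (real k)) * (10 * (3 * ln (real k)))"
    using l1 by (intro mult_left_mono) auto
  also have "\<dots> = 60 * (ln (real k) * ln (real k))" by simp
  also have "\<dots> \<le> 60 * ((16 * real k powr (1/16)) * (16 * real k powr (1/16)))"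
    using l1 l2 by (intro mult_left_mono mult_mono) auto
  also have "\<dots> = 15360 * real k powr (1/8)" using k0 by (simp add: powr_add[symmetric])
  finally have "(2 * ln (real k)) * (10 * (1 + 2 * ln (real k))) \<le> 15360 * real k powr (1/8)" .
  then obtain w where w: "w = (2 * ln (real k)) * (10 * (1 + 2 * ln (real k)))" and l: "w \<le> 15360 * real k powr (1/8)" by blast
  have w0: "w \<ge> 0" using l1 by (simp add: w)
  have "real (card {g. g dvd k}) * (2 * ln (real k)) * (10 * (1 + 2 * ln (real k))) / (real k * real (totient k))
     = real (card {g. g dvd k}) * w / (real k * real (totient k))" by (simp add: w mult.assoc)
  also have "\<dots> \<le> real k powr (1/8) * (15360 * real k powr (1/8)) / (real k * real k powr (3/4))"
    using l c t k0 w0 by (intro frac_le mult_mono mult_nonneg_nonneg mult_pos_pos) auto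
  also have "real k * real k powr (3/4) = real k powr (7/4)" using powr_add[of "real k" 1 "3/4"] k0 by simp
  also have "real k powr (1/8) * (15360 * real k powr (1/8)) / real k powr (7/4) = 15360 * real k powr (-3/2)"
  proof -
    have "real k powr (-3/2) = real k powr (1/8 + 1/8 - 7/4)" by simp
    also have "\<dots> = real k powr (1/8) * real k powr (1/8) / real k powr (7/4)"
      using k0 by (simp only: powr_add powr_diff)
    finally show ?thesis by simp
  qed
  also have "\<dots> \<le> 20000 * real k powr (-3/2)" by (intro mult_right_mono) auto
  finally show ?thesis .
qed

text \<open>For fixed b, a modulus q equals b * k^2 * e for at most as many primes k as q has prime
  factors, and each k determines e. So every error is counted at most 2 ln N times per b.\<close>

lemma sum_prime_square_errors_le:
  fixes P N :: nat and y :: real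
  assumes P: "P > 0" and PyN: "real P * y \<le> real N" and K: "finite K" "\<And>k. k \<in> K \<Longrightarrow> prime k"
  shows "(\<Sum>k\<in>K. \<Sum>e | 1 \<le> e \<and> real e \<le> y / (real k)\<^sup>2. \<Sum>b | b dvd P. \<bar>shift_error N (b * (k\<^sup>2 * e))\<bar>)
    \<le> real (card {b. b dvd P}) * (2 * ln (real N) * (\<Sum>q | 1 \<le> q \<and> real q \<le> real P * y. \<bar>shift_error N q\<bar>))"
proof -
  let ?F = "{q. 1 \<le> q \<and> real q \<le> real P * y}"
  let ?D = "\<lambda>k. {e. 1 \<le> e \<and> real e \<le> y / (real k)\<^sup>2}"
  let ?E = "\<lambda>q. \<bar>shift_error N q\<bar>"
  have finF: "finite ?F" and finD: "finite (?D k)" for k by (rule finite_real_range)+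
  have one: "(\<Sum>k\<in>K. \<Sum>e\<in>?D k. ?E (b * (k\<^sup>2 * e))) \<le> 2 * ln (real N) * (\<Sum>q\<in>?F. ?E q)" if b: "b dvd P" for b
  proof -
    have b0: "b > 0" "b \<le> P" using b P by (auto intro: dvd_pos_nat dvd_imp_le)
    have "(\<Sum>k\<in>K. \<Sum>e\<in>?D k. ?E (b * (k\<^sup>2 * e))) \<le> (\<Sum>k\<in>K. \<Sum>q | q \<in> ?F \<and> k dvd q. ?E q)"
    proof (rule sum_mono)
      fix k assume k: "k \<in> K"
      then have k0: "k > 0" using K(2) prime_gt_0_nat by blast
      have "(\<Sum>e\<in>?D k. ?E ((b * k\<^sup>2) * e)) \<le> (\<Sum>q | q \<in> ?F \<and> k dvd q. ?E q)"
      proof (rule sum_over_multiples_le[where f = ?E, OF _ _ finD])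
        show "finite {q. q \<in> ?F \<and> k dvd q}" by (rule finite_subset[OF _ finF]) auto
        show "0 < b * k\<^sup>2" using b0 k0 by simp
        fix e assume e: "e \<in> ?D k"
        then have "(real k)\<^sup>2 * real e \<le> y" using k0 by (simp add: pos_le_divide_eq mult.commute)
        then have "real b * ((real k)\<^sup>2 * real e) \<le> real P * y" using b0 by (intro mult_mono) auto
        then have "real (b * k\<^sup>2 * e) \<le> real P * y" by (simp add: mult.assoc)
        moreover have "k dvd b * k\<^sup>2 * e" by (simp add: power2_eq_square)
        moreover have "1 \<le> b * k\<^sup>2 * e" using b0 k0 e by (simp add: Suc_le_eq)
        ultimately show "b * k\<^sup>2 * e \<in> {q. q \<in> ?F \<and> k dvd q}" by simp
      qed auto
      then show "(\<Sum>e\<in>?D k. ?E (b * (k\<^sup>2 * e))) \<le> (\<Sum>q | q \<in> ?F \<and> k dvd q. ?E q)" by (simp only: mult.assoc)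
    qed
    also have "(\<Sum>k\<in>K. \<Sum>q | q \<in> ?F \<and> k dvd q. ?E q) = (\<Sum>q\<in>?F. \<Sum>k | k \<in> K \<and> k dvd q. ?E q)"
      by (rule sum.swap_restrict[OF K(1) finF])
    also have "\<dots> \<le> (\<Sum>q\<in>?F. 2 * ln (real N) * ?E q)"
    proof (rule sum_mono)
      fix q assume q: "q \<in> ?F"
      then have q0: "q > 0" and qN: "real q \<le> real N" using PyN by auto
      have "card {k. k \<in> K \<and> k dvd q} \<le> card (prime_factors q)"
        using K(2) q0 by (intro card_mono) (auto simp: in_prime_factors_iff)
      then have "real (card {k. k \<in> K \<and> k dvd q}) \<le> log 2 (real q)"
        using card_prime_factors_le[OF q0] by linarith
      also have "\<dots> \<le> 2 * ln (real q)" using q0 by (intro log2_le) simp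
      also have "\<dots> \<le> 2 * ln (real N)" using q0 qN by simp
      finally have "real (card {k. k \<in> K \<and> k dvd q}) * ?E q \<le> 2 * ln (real N) * ?E q"
        by (rule mult_right_mono) simp
      then show "(\<Sum>k | k \<in> K \<and> k dvd q. ?E q) \<le> 2 * ln (real N) * ?E q" by simp
    qed
    finally show ?thesis by (simp only: sum_distrib_left)
  qed
  have "(\<Sum>k\<in>K. \<Sum>e\<in>?D k. \<Sum>b | b dvd P. ?E (b * (k\<^sup>2 * e)))
     = (\<Sum>k\<in>K. \<Sum>b | b dvd P. \<Sum>e\<in>?D k. ?E (b * (k\<^sup>2 * e)))"
    by (intro sum.cong refl sum.swap)
  also have "\<dots> = (\<Sum>b | b dvd P. \<Sum>k\<in>K. \<Sum>e\<in>?D k. ?E (b * (k\<^sup>2 * e)))"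
    by (rule sum.swap)
  also have "\<dots> \<le> (\<Sum>b | b dvd P. 2 * ln (real N) * (\<Sum>q\<in>?F. ?E q))"
    using one by (intro sum_mono) auto
  also have "\<dots> = real (card {b. b dvd P}) * (2 * ln (real N) * (\<Sum>q\<in>?F. ?E q))" by simp
  finally show ?thesis .
qed

lemma prime_dvd_coprime_primorial:
  assumes "coprime k (primorial z)" "prime p" "p dvd k"
  shows "p > z"
  using coprime_primorial_gt[of p z] coprime_divisors[OF assms(3) dvd_refl assms(1)] prime_gt_1_nat[OF assms(2)] by blast

text \<open>Up to K the bounds are summable like k^(-3/2) over k > z, which yields 1 / sqrt z with
  constants 80 * 4 and 20000 * 4; beyond K the trivial bound is used. Only the first term lacks a
  saving in N, and it is measured against N * N / phi(N).\<close>

lemma sum_not_squarefree_le: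
  fixes N z :: nat and y K B :: real
  assumes N: "even N" "N > 0" and z: "z \<ge> 256" and y: "1 \<le> y" and PyN: "real (primorial z) * y \<le> real N"
    and K: "K \<ge> 1" and B: "B \<ge> 0"
    and bt: "\<And>q. q \<ge> 1 \<Longrightarrow> real q \<le> K\<^sup>2 * y \<Longrightarrow> shift_sum N q \<le> B * (real N / real (totient q))"
  shows "\<bar>\<Sum>m | m \<in> sifted_set N (primorial z) \<and> \<not> squarefree m. shift_weight N m * type_I y m\<bar> \<le>
     (320 + 80000 * B) / sqrt (real z) * (real N * kap (prime_factors N))
     + real (card {b. b dvd primorial z}) * (2 * ln (real N) ^ 2 * (\<Sum>q | 1 \<le> q \<and> real q \<le> real (primorial z) * y. \<bar>shift_error N q\<bar>))
     + 4 * ln (real N) ^ 2 * (1 + ln (real N)) * real N / sqrt K"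
proof -
  let ?P = "primorial z" and ?\<kappa> = "kap (prime_factors N)"
  let ?K = "{k. k \<in> {2..N} \<and> squarefree k \<and> coprime k ?P}"
  let ?S = "{k. k \<in> ?K \<and> real k \<le> K}" and ?L = "{k. k \<in> ?K \<and> real k > K}"
  let ?E = "\<lambda>k. \<Sum>e | 1 \<le> e \<and> real e \<le> y / (real k)\<^sup>2. \<Sum>b | b dvd ?P. \<bar>shift_error N (b * (k\<^sup>2 * e))\<bar>"
  let ?pr = "{k. k \<in> ?S \<and> prime k}"
  have finK: "finite ?K" by (rule finite_subset[of _ "{2..N}"]) auto
  have fins: "finite ?S" "finite ?L" "finite ?pr" by (rule finite_subset[OF _ finK], force)+
  have kz: "k > z" "k > 1" "\<And>p. prime p \<Longrightarrow> p dvd k \<Longrightarrow> p \<ge> 256" if "k \<in> ?K" for k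
  proof -
    show "k > 1" using that by simp
    show "k > z" by (rule coprime_primorial_gt) (use that in auto)
    fix p assume p: "prime p" "p dvd k"
    then have "p > z" using that by (intro prime_dvd_coprime_primorial[of k]) auto
    then show "p \<ge> 256" using z by simp
  qed
  have lN: "ln (real N) \<ge> 0" using N by simp
  have k1: "?\<kappa> \<ge> 1" by (rule kap_ge_1) auto
  have yN: "y \<le> real N"
  proof -
    have "1 * y \<le> real ?P * y" using y primorial_pos[of z] by (intro mult_right_mono) (auto simp: Suc_le_eq)
    then show ?thesis using PyN by simp
  qed
  have E0: "?E k \<ge> 0" for k by (intro sum_nonneg) auto
  have tail: "(\<Sum>k\<in>A. real k powr (-3/2)) \<le> 4 / sqrt (real z)" if "A \<subseteq> ?K" for A
  proof (rule sum_powr_tail_le)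
    show "finite A" using that finK by (rule finite_subset)
    show "real k > real z" if "k \<in> A" for k using that \<open>A \<subseteq> ?K\<close> kz(1) by auto
  qed (use z in simp)
  have small: "\<bar>square_part_sum N ?P y k\<bar> \<le> (80 * (real N * ?\<kappa>)) * real k powr (-3/2)
      + (if prime k then ln (real N) * ?E k else 0) + (20000 * B * real N) * real k powr (-3/2)" if k: "k \<in> ?S" for k
  proof -
    have kK: "k \<in> ?K" "real k \<le> K" using k by auto
    have k0: "real k > 1" using kz(2)[OF kK(1)] by simp
    have bt': "shift_sum N q \<le> B * (real N / real (totient q))" if "q \<ge> 1" "real q \<le> (real k)\<^sup>2 * y" for q
    proof (rule bt[OF that(1)])
      have "(real k)\<^sup>2 * y \<le> K\<^sup>2 * y" using kK k0 y by (intro mult_right_mono power_mono) auto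
      then show "real q \<le> K\<^sup>2 * y" using that by linarith
    qed
    let ?X = "real (card {g. g dvd k}) * (2 * ln (real k)) * (B * real N * (10 * (1 + 2 * ln (real k)))) / (real k * real (totient k))"
    have "?X = (real (card {g. g dvd k}) * (2 * ln (real k)) * (10 * (1 + 2 * ln (real k))) / (real k * real (totient k))) * (B * real N)"
      by simp
    also have "\<dots> \<le> (20000 * real k powr (-3/2)) * (B * real N)"
    proof (rule mult_right_mono)
      show "real (card {g. g dvd k}) * (2 * ln (real k)) * (10 * (1 + 2 * ln (real k))) / (real k * real (totient k)) \<le> 20000 * real k powr (-3/2)"
        by (rule rough_weight_le) (use kz[OF kK(1)] kK in auto)
    qed (use B in simp)
    finally have X: "?X \<le> (20000 * B * real N) * real k powr (-3/2)" by (simp add: mult_ac)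
    have lk: "0 \<le> ln (real k)" "ln (real k) \<le> ln (real N)" using k0 kK by auto
    have Y: "ln (real k) * (40 * real N * ?\<kappa> / (real k)\<^sup>2 + ?E k) \<le> (80 * (real N * ?\<kappa>)) * real k powr (-3/2) + ln (real N) * ?E k"
    proof -
      have "ln (real k) * (40 * real N * ?\<kappa> / (real k)\<^sup>2) \<le> (2 * real k powr (1/2)) * (40 * real N * ?\<kappa> / (real k)\<^sup>2)"
        using ln_le_powr[of "1/2" "real k"] k0 k1 by (intro mult_right_mono) auto
      also have "\<dots> = (80 * (real N * ?\<kappa>)) * (real k powr (1/2) / (real k)\<^sup>2)" by simp
      also have "real k powr (1/2) / (real k)\<^sup>2 = real k powr (-3/2)"
        using powr_diff[of "real k" "1/2" 2] k0 by (simp add: powr_realpow)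
      finally show ?thesis using mult_right_mono[OF lk(2) E0[of k]] by (simp add: distrib_left)
    qed
    have "\<bar>square_part_sum N ?P y k\<bar> \<le>
     (if prime k then ln (real k) * (40 * real N * ?\<kappa> / (real k)\<^sup>2 + ?E k) else 0) + ?X"
      by (rule abs_square_part_sum_le[OF N _ y _ _ _ B bt']) (use kz(2)[OF kK(1)] kK z in auto)
    moreover have "0 \<le> (80 * (real N * ?\<kappa>)) * real k powr (-3/2)" using k1 by simp
    ultimately show ?thesis using X Y by (simp split: if_splits)
  qed
  have large: "\<bar>square_part_sum N ?P y k\<bar> \<le> (ln (real N) ^ 2 * (1 + ln (real N)) * real N) * real k powr (-3/2)" if k: "k \<in> ?L" for k
  proof -
    have kK: "k \<in> ?K" using k by auto
    have k0: "real k > 1" using kz(2)[OF kK] by simp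
    have "\<bar>square_part_sum N ?P y k\<bar> \<le> real (card {g. g dvd k}) * (ln (real N) ^ 2 * (1 + ln (real N)) * (real N / (real k)\<^sup>2))"
      using kK y yN by (intro abs_square_part_sum_trivial) auto
    also have "\<dots> \<le> real k powr (1/8) * (ln (real N) ^ 2 * (1 + ln (real N)) * (real N / (real k)\<^sup>2))"
    proof (rule mult_right_mono)
      show "real (card {g. g dvd k}) \<le> real k powr (1/8)"
        by (rule squarefree_card_divisors_le) (use kK kz(3)[OF kK] in auto)
    qed (use lN in simp)
    also have "\<dots> = (ln (real N) ^ 2 * (1 + ln (real N)) * real N) * (real k powr (1/8) / (real k)\<^sup>2)" by simp
    also have "real k powr (1/8) / (real k)\<^sup>2 = real k powr (-15/8)"
      using powr_diff[of "real k" "1/8" 2] k0 by (simp add: powr_realpow)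
    also have "(ln (real N) ^ 2 * (1 + ln (real N)) * real N) * real k powr (-15/8)
       \<le> (ln (real N) ^ 2 * (1 + ln (real N)) * real N) * real k powr (-3/2)"
      using k0 lN by (intro mult_left_mono powr_mono) auto
    finally show ?thesis .
  qed
  have S: "(\<Sum>k\<in>?S. \<bar>square_part_sum N ?P y k\<bar>) \<le> (320 + 80000 * B) / sqrt (real z) * (real N * ?\<kappa>)
     + real (card {b. b dvd ?P}) * (2 * ln (real N) ^ 2 * (\<Sum>q | 1 \<le> q \<and> real q \<le> real ?P * y. \<bar>shift_error N q\<bar>))"
  proof -
    have "(\<Sum>k\<in>?S. \<bar>square_part_sum N ?P y k\<bar>) \<le> (\<Sum>k\<in>?S. (80 * (real N * ?\<kappa>)) * real k powr (-3/2)
      + (if prime k then ln (real N) * ?E k else 0) + (20000 * B * real N) * real k powr (-3/2))"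
      by (rule sum_mono) (rule small)
    also have "\<dots> = (80 * (real N * ?\<kappa>)) * (\<Sum>k\<in>?S. real k powr (-3/2)) + (\<Sum>k\<in>?S. if prime k then ln (real N) * ?E k else 0)
       + (20000 * B * real N) * (\<Sum>k\<in>?S. real k powr (-3/2))"
      by (simp only: sum.distrib sum_distrib_left)
    also have "(\<Sum>k\<in>?S. if prime k then ln (real N) * ?E k else 0) = ln (real N) * (\<Sum>k\<in>?pr. ?E k)"
      unfolding sum_distrib_left by (rule sum.inter_filter[symmetric, OF fins(1)])
    finally have 1: "(\<Sum>k\<in>?S. \<bar>square_part_sum N ?P y k\<bar>) \<le> (80 * (real N * ?\<kappa>)) * (\<Sum>k\<in>?S. real k powr (-3/2))
       + ln (real N) * (\<Sum>k\<in>?pr. ?E k) + (20000 * B * real N) * (\<Sum>k\<in>?S. real k powr (-3/2))" .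
    have t: "(\<Sum>k\<in>?S. real k powr (-3/2)) \<le> 4 / sqrt (real z)" by (rule tail) auto
    have 2: "(80 * (real N * ?\<kappa>)) * (\<Sum>k\<in>?S. real k powr (-3/2)) \<le> (80 * (real N * ?\<kappa>)) * (4 / sqrt (real z))"
      using t k1 by (intro mult_left_mono) auto
    have "(20000 * B * real N) * (\<Sum>k\<in>?S. real k powr (-3/2)) \<le> (20000 * B * real N) * (4 / sqrt (real z))"
      using t B by (intro mult_left_mono) auto
    also have "\<dots> = (80000 * B / sqrt (real z)) * (real N * 1)" by simp
    also have "\<dots> \<le> (80000 * B / sqrt (real z)) * (real N * ?\<kappa>)" using k1 B by (intro mult_left_mono) auto
    finally have 3: "(20000 * B * real N) * (\<Sum>k\<in>?S. real k powr (-3/2)) \<le> (80000 * B / sqrt (real z)) * (real N * ?\<kappa>)" .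
    have "ln (real N) * (\<Sum>k\<in>?pr. ?E k) \<le> ln (real N) * (real (card {b. b dvd ?P}) * (2 * ln (real N) * (\<Sum>q | 1 \<le> q \<and> real q \<le> real ?P * y. \<bar>shift_error N q\<bar>)))"
      using fins PyN lN by (intro mult_left_mono sum_prime_square_errors_le) auto
    also have "\<dots> = real (card {b. b dvd ?P}) * (2 * ln (real N) ^ 2 * (\<Sum>q | 1 \<le> q \<and> real q \<le> real ?P * y. \<bar>shift_error N q\<bar>))"
      by (simp add: power2_eq_square)
    finally show ?thesis using 1 2 3 by (simp add: add_divide_distrib distrib_right)
  qed
  have L: "(\<Sum>k\<in>?L. \<bar>square_part_sum N ?P y k\<bar>) \<le> 4 * ln (real N) ^ 2 * (1 + ln (real N)) * real N / sqrt K"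
  proof -
    have "(\<Sum>k\<in>?L. \<bar>square_part_sum N ?P y k\<bar>) \<le> (\<Sum>k\<in>?L. (ln (real N) ^ 2 * (1 + ln (real N)) * real N) * real k powr (-3/2))"
      by (rule sum_mono) (rule large)
    also have "\<dots> = (ln (real N) ^ 2 * (1 + ln (real N)) * real N) * (\<Sum>k\<in>?L. real k powr (-3/2))"
      by (simp only: sum_distrib_left)
    also have "\<dots> \<le> (ln (real N) ^ 2 * (1 + ln (real N)) * real N) * (4 / sqrt K)"
      using lN K fins by (intro mult_left_mono sum_powr_tail_le) auto
    finally show ?thesis by (simp add: mult_ac)
  qed
  have "\<bar>\<Sum>k\<in>?K. moebius_mu k * square_part_sum N ?P y k\<bar> \<le> (\<Sum>k\<in>?K. \<bar>square_part_sum N ?P y k\<bar>)"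
    by (rule order_trans[OF sum_abs sum_mono]) (rule abs_moebius_mu_mult_le)
  also have "(\<Sum>k\<in>?K. \<bar>square_part_sum N ?P y k\<bar>) = (\<Sum>k\<in>?S. \<bar>square_part_sum N ?P y k\<bar>) + (\<Sum>k\<in>?L. \<bar>square_part_sum N ?P y k\<bar>)"
    using fins by (subst sum.union_disjoint[symmetric]) (auto intro!: sum.cong)
  finally show ?thesis unfolding not_squarefree_sum_eq using S L by linarith
qed

section \<open>The contribution of the overlap\<close>

text \<open>Applied with delta / 2, so that the floor of X / q, at least N^delta - 1, is still long
  enough; this doubles 16 / delta to 32 / delta.\<close>

lemma shift_sum_upto_brun_titchmarsh:
  fixes \<delta> :: real
  assumes \<delta>: "\<delta> > 0"
  shows "\<forall>\<^sub>F N in at_top. \<forall>q\<ge>1. \<forall>X. real q * real N powr \<delta> \<le> X \<longrightarrow>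
     (\<Sum>m | m \<in> {1..<N} \<and> q dvd m \<and> real m \<le> X. shift_weight N m) \<le> (32 / \<delta> + 1) * (X / real (totient q))"
proof -
  have e: "\<forall>\<^sub>F N::nat in at_top. real N powr (\<delta> / 2) \<le> real N powr \<delta> - 1" using \<delta> by real_asymp
  have "\<forall>\<^sub>F N in at_top. \<forall>q\<ge>1. \<forall>J::nat. real J \<ge> real N powr (\<delta> / 2) \<longrightarrow>
     (\<Sum>j=1..J. mangoldt (N - q * j)) \<le> (16 / (\<delta> / 2) + 1) * (real q / real (totient q)) * real J"
    using \<delta> by (intro brun_titchmarsh) simp
  with e show ?thesis
  proof eventually_elim
    case (elim N)
    show ?case
    proof (intro allI impI)
      fix q :: nat and X :: real
      assume q: "q \<ge> 1" and X: "real q * real N powr \<delta> \<le> X"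
      let ?J = "nat \<lfloor>X / real q\<rfloor>"
      have X0: "X \<ge> 0" using order_trans[OF _ X, of 0] by simp
      have "real N powr \<delta> \<le> X / real q" using X q by (simp add: pos_le_divide_eq mult.commute)
      then have J: "real N powr (\<delta> / 2) \<le> real ?J" using elim(1) by linarith
      have Jle: "real ?J \<le> X / real q" using X0 by simp
      have "(\<Sum>m | m \<in> {1..<N} \<and> q dvd m \<and> real m \<le> X. shift_weight N m)
         \<le> (\<Sum>m\<in>(*) q ` {1..?J}. mangoldt (N - m))"
      proof (rule order_trans[OF sum_mono sum_mono2])
        show "{m. m \<in> {1..<N} \<and> q dvd m \<and> real m \<le> X} \<subseteq> (*) q ` {1..?J}"
        proof
          fix m assume "m \<in> {m. m \<in> {1..<N} \<and> q dvd m \<and> real m \<le> X}"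
          then have m: "1 \<le> m" "real m \<le> X" "q dvd m" by auto
          then obtain j where j: "m = q * j" by blast
          have "j \<ge> 1" using m j by (auto simp: Suc_le_eq intro!: Nat.gr0I)
          moreover have "real j \<le> X / real q" using m j q by (simp add: pos_le_divide_eq mult.commute)
          ultimately show "m \<in> (*) q ` {1..?J}" unfolding j by (intro imageI) (simp add: le_nat_floor)
        qed
        show "shift_weight N m \<le> mangoldt (N - m)" for m by (simp add: shift_weight_def mangoldt_nonneg)
      qed (simp_all add: mangoldt_nonneg)
      also have "\<dots> = (\<Sum>j=1..?J. mangoldt (N - q * j))"
        using q by (subst sum.reindex) (auto simp: inj_on_def)
      also have "\<dots> \<le> (16 / (\<delta> / 2) + 1) * (real q / real (totient q)) * real ?J"
        using elim(2) q J by blast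
      also have "\<dots> \<le> (16 / (\<delta> / 2) + 1) * (real q / real (totient q)) * (X / real q)"
        using Jle \<delta> by (intro mult_left_mono) auto
      also have "\<dots> = (32 / \<delta> + 1) * (X / real (totient q))" using q by simp
      finally show "(\<Sum>m | m \<in> {1..<N} \<and> q dvd m \<and> real m \<le> X. shift_weight N m) \<le> (32 / \<delta> + 1) * (X / real (totient q))" .
    qed
  qed
qed

section \<open>Dyadic blocks\<close>

definition dyadic_block :: "nat \<Rightarrow> nat \<Rightarrow> nat \<Rightarrow> nat set" where
  "dyadic_block N P i = {m. m \<in> sifted_set N P \<and> squarefree m \<and> 2 ^ i * real m < real N \<and> real N \<le> 2 ^ (i + 1) * real m}"

lemma sum_dyadic_split:
  fixes f :: "nat \<Rightarrow> real"
  shows "(\<Sum>m | m \<in> sifted_set N P \<and> squarefree m. f m)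
    = (\<Sum>i<L. \<Sum>m\<in>dyadic_block N P i. f m) + (\<Sum>m | m \<in> sifted_set N P \<and> squarefree m \<and> 2 ^ L * real m < real N. f m)"
proof (induction L)
  case 0
  show ?case by (auto intro!: sum.cong simp: sifted_set_def)
next
  case (Suc L)
  let ?A = "\<lambda>L. {m. m \<in> sifted_set N P \<and> squarefree m \<and> 2 ^ L * real m < real N}"
  have fin: "finite (?A L)" for L by (rule finite_subset[of _ "sifted_set N P"]) auto
  have "?A L = dyadic_block N P L \<union> ?A (Suc L)"
    unfolding dyadic_block_def by auto
  moreover have "dyadic_block N P L \<inter> ?A (Suc L) = {}" unfolding dyadic_block_def by auto
  moreover have "finite (dyadic_block N P L)" by (rule finite_subset[OF _ fin[of L]]) (auto simp: dyadic_block_def)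
  ultimately have "(\<Sum>m\<in>?A L. f m) = (\<Sum>m\<in>dyadic_block N P L. f m) + (\<Sum>m\<in>?A (Suc L). f m)"
    using fin[of "Suc L"] by (simp add: sum.union_disjoint)
  then show ?case using Suc by simp
qed

text \<open>The condition m / d < N / y gives d > y * m / N >= y / 2^(i + 1). Hence ln(y / d) is at
  most (i + 1) * ln 2, and d runs through a window whose ratio depends only on i.\<close>

lemma abs_overlap_block_le:
  assumes y: "y \<ge> 1" and m: "m > 0" "squarefree m" "coprime m P" "real N \<le> 2 ^ (i + 1) * real m"
  shows "\<bar>overlap N y m\<bar> \<le> (\<Sum>d | d dvd m \<and> (1 \<le> d \<and> y / 2 ^ (i + 1) < real d \<and> real d \<le> y \<and> squarefree d \<and> coprime d P). real (i + 1))"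
proof -
  let ?A = "{d. d dvd m \<and> real d \<le> y \<and> real (m div d) < real N / y}"
  let ?B = "{d. d dvd m \<and> (1 \<le> d \<and> y / 2 ^ (i + 1) < real d \<and> real d \<le> y \<and> squarefree d \<and> coprime d P)}"
  have finB: "finite ?B" by (rule finite_subset[of _ "{d. d dvd m}"]) (use m in auto)
  have key: "d \<in> ?B \<and> \<bar>moebius_mu d * ln (y / real d)\<bar> \<le> real (i + 1)" if "d \<in> ?A" for d
  proof -
    have d: "d dvd m" "real d \<le> y" "real (m div d) < real N / y" using that by auto
    have d0: "d > 0" using d m by (auto intro: dvd_pos_nat)
    have md: "real (m div d) = real m / real d" using d by (simp add: real_of_nat_div)
    have "real m / real d * y < real N" using d(3) y unfolding md by (simp add: pos_less_divide_eq)
    then have "y / real d * real m < 2 ^ (i + 1) * real m" using m(4) by (simp add: mult.commute)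
    then have yd: "y / real d < 2 ^ (i + 1)" by (rule mult_right_less_imp_less) simp
    then have "y < 2 ^ (i + 1) * real d" using d0 by (simp add: pos_divide_less_eq)
    then have 1: "y / 2 ^ (i + 1) < real d" by (simp add: pos_divide_less_eq mult.commute)
    have 2: "squarefree d" using d m squarefree_mono by blast
    have 3: "coprime d P" using coprime_divisors[OF d(1) dvd_refl] m by blast
    have ge1: "y / real d \<ge> 1" using d d0 by simp
    have "ln (y / real d) \<le> ln (2 ^ (i + 1))" using yd ge1 by (intro ln_mono) auto
    also have "\<dots> = real (i + 1) * ln 2" by (rule ln_realpow)
    also have "\<dots> \<le> real (i + 1) * 1" using ln_2_less_1 by (intro mult_left_mono) auto
    finally have "\<bar>moebius_mu d * ln (y / real d)\<bar> \<le> real (i + 1)"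
      using abs_moebius_mu_mult_le[of d "ln (y / real d)"] ge1 by auto
    then show ?thesis using d d0 1 2 3 by (simp add: Suc_le_eq)
  qed
  have "\<bar>overlap N y m\<bar> \<le> (\<Sum>d\<in>?A. real (i + 1))"
    unfolding overlap_def by (rule order_trans[OF sum_abs sum_mono]) (use key in blast)
  also have "\<dots> \<le> (\<Sum>d\<in>?B. real (i + 1))" using key by (intro sum_mono2[OF finB]) auto
  finally show ?thesis .
qed

definition block_divisors :: "nat \<Rightarrow> real \<Rightarrow> nat \<Rightarrow> nat set" where
  "block_divisors P y i = {d. 1 \<le> d \<and> y / 2 ^ (i + 1) < real d \<and> real d \<le> y \<and> squarefree d \<and> coprime d P}"

lemma finite_block_divisors [simp]: "finite (block_divisors P y i)"
  by (rule finite_subset[OF _ finite_nat_real_le[of y]]) (auto simp: block_divisors_def)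

lemma overlap_block_le:
  assumes y: "y \<ge> 1"
  shows "\<bar>\<Sum>m\<in>dyadic_block N P i. shift_weight N m * overlap N y m\<bar>
     \<le> real (i + 1) * (\<Sum>d\<in>block_divisors P y i. \<Sum>m | m \<in> sifted_set N P \<and> 2 ^ i * real m < real N \<and> d dvd m. shift_weight N m)"
proof -
  let ?w = "shift_weight N" and ?D = "block_divisors P y i"
  let ?R = "\<lambda>d. 1 \<le> d \<and> y / 2 ^ (i + 1) < real d \<and> real d \<le> y \<and> squarefree d \<and> coprime d P"
  let ?M = "{m. m \<in> sifted_set N P \<and> 2 ^ i * real m < real N}"
  have finM: "finite ?M" by (rule finite_subset[of _ "sifted_set N P"]) auto
  have finB: "finite (dyadic_block N P i)" by (rule finite_subset[of _ "sifted_set N P"]) (auto simp: dyadic_block_def)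
  have "\<bar>\<Sum>m\<in>dyadic_block N P i. ?w m * overlap N y m\<bar> \<le> (\<Sum>m\<in>dyadic_block N P i. \<Sum>d | d dvd m \<and> ?R d. real (i + 1) * ?w m)"
  proof (rule order_trans[OF sum_abs sum_mono])
    fix m assume "m \<in> dyadic_block N P i"
    then have "\<bar>overlap N y m\<bar> \<le> (\<Sum>d | d dvd m \<and> ?R d. real (i + 1))"
      using y by (intro abs_overlap_block_le) (auto simp: dyadic_block_def sifted_set_def)
    then have "?w m * \<bar>overlap N y m\<bar> \<le> ?w m * (\<Sum>d | d dvd m \<and> ?R d. real (i + 1))"
      by (rule mult_left_mono) (rule shift_weight_nonneg)
    then show "\<bar>?w m * overlap N y m\<bar> \<le> (\<Sum>d | d dvd m \<and> ?R d. real (i + 1) * ?w m)"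
      by (simp add: abs_mult shift_weight_nonneg mult_ac)
  qed
  also have "\<dots> \<le> (\<Sum>m\<in>?M. \<Sum>d | d dvd m \<and> ?R d. real (i + 1) * ?w m)"
    by (intro sum_mono2[OF finM] sum_nonneg) (auto simp: dyadic_block_def shift_weight_nonneg)
  also have "\<dots> = (\<Sum>d\<in>?D. \<Sum>m | m \<in> ?M \<and> d dvd m. real (i + 1) * ?w m)"
    by (rule sum_divisors_swap[OF finM _ finite_block_divisors]) (auto simp: sifted_set_def block_divisors_def)
  also have "\<dots> = real (i + 1) * (\<Sum>d\<in>?D. \<Sum>m | m \<in> ?M \<and> d dvd m. ?w m)"
    by (simp only: sum_distrib_left)
  finally show ?thesis by simp
qed

text \<open>For boundedly many i the restriction m < N / 2^i is dropped and the first hypothesis is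
  applied. The gain comes from the scarcity of d without primes up to z; the loss 2^(i + 1) from the
  length of the window is harmless because z is chosen after the number of such blocks.\<close>

lemma overlap_block_small_index:
  fixes y :: real
  assumes N: "even N" "N > 0" and z: "z \<ge> 1" and y: "y \<ge> 1"
  shows "(\<Sum>d\<in>block_divisors (primorial z) y i. \<Sum>m | m \<in> sifted_set N (primorial z) \<and> 2 ^ i * real m < real N \<and> d dvd m. shift_weight N m)
    \<le> real N * (2 ^ (i + 1) * (2 / ln (real z + 1) + real (primorial z) / y + 8 / sqrt (real z)))
      + real (card {b. b dvd primorial z}) * (\<Sum>q | 1 \<le> q \<and> real q \<le> real (primorial z) * y. \<bar>shift_error N q\<bar>)"
proof -
  let ?P = "primorial z" and ?D = "block_divisors (primorial z) y i"
  let ?F = "{q. 1 \<le> q \<and> real q \<le> real ?P * y}"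
  have finF: "finite ?F" by (rule finite_real_range)
  have "(\<Sum>d\<in>?D. \<Sum>m | m \<in> sifted_set N ?P \<and> 2 ^ i * real m < real N \<and> d dvd m. shift_weight N m) \<le> (\<Sum>d\<in>?D. sifted_sum N ?P d)"
    unfolding sifted_sum_def
    by (intro sum_mono sum_mono2) (auto simp: sifted_set_def shift_weight_nonneg)
  also have "\<dots> \<le> (\<Sum>d\<in>?D. real N * (1 / real (totient d)) + (\<Sum>b | b dvd ?P. \<bar>shift_error N (b * d)\<bar>))"
  proof (rule sum_mono)
    fix d assume d: "d \<in> ?D"
    have "\<bar>sifted_sum N ?P d - real N * sieve_density N ?P * local_density N d\<bar> \<le> (\<Sum>b | b dvd ?P. \<bar>shift_error N (b * d)\<bar>)"
      using d by (intro sifted_sum_approx) (auto simp: block_divisors_def)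
    moreover have "real N * sieve_density N ?P * local_density N d \<le> real N * 1 * (1 / real (totient d))"
      using sieve_density_range[OF N, of z] by (intro mult_mono) (auto simp: local_density_def)
    ultimately show "sifted_sum N ?P d \<le> real N * (1 / real (totient d)) + (\<Sum>b | b dvd ?P. \<bar>shift_error N (b * d)\<bar>)" by linarith
  qed
  also have "\<dots> = real N * (\<Sum>d\<in>?D. 1 / real (totient d)) + (\<Sum>d\<in>?D. \<Sum>b | b dvd ?P. \<bar>shift_error N (b * d)\<bar>)"
    by (simp only: sum.distrib sum_distrib_left)
  finally have 1: "(\<Sum>d\<in>?D. \<Sum>m | m \<in> sifted_set N ?P \<and> 2 ^ i * real m < real N \<and> d dvd m. shift_weight N m)
     \<le> real N * (\<Sum>d\<in>?D. 1 / real (totient d)) + (\<Sum>d\<in>?D. \<Sum>b | b dvd ?P. \<bar>shift_error N (b * d)\<bar>)" .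
  have "(\<Sum>d\<in>?D. 1 / real (totient d)) \<le> 1 / (1 / 2 ^ (i + 1)) * (2 / ln (real z + 1) + real ?P / y + 8 / sqrt (real z))"
    using sum_inverse_totient_sifted_window[of "1 / 2 ^ (i + 1)" y z] y z by (simp add: block_divisors_def)
  then have 2: "real N * (\<Sum>d\<in>?D. 1 / real (totient d)) \<le> real N * (2 ^ (i + 1) * (2 / ln (real z + 1) + real ?P / y + 8 / sqrt (real z)))"
    by (intro mult_left_mono) auto
  have "(\<Sum>d\<in>?D. \<Sum>b | b dvd ?P. \<bar>shift_error N (b * d)\<bar>) = (\<Sum>b | b dvd ?P. \<Sum>d\<in>?D. \<bar>shift_error N (b * d)\<bar>)"
    by (rule sum.swap)
  moreover have "(\<Sum>b | b dvd ?P. \<Sum>d\<in>?D. \<bar>shift_error N (b * d)\<bar>) \<le> (\<Sum>b | b dvd ?P. \<Sum>q\<in>?F. \<bar>shift_error N q\<bar>)"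
  proof (rule sum_mono)
    fix b assume "b \<in> {b. b dvd ?P}"
    then have b: "b dvd ?P" "b > 0" "b \<le> ?P" by (auto intro: dvd_pos_nat[OF primorial_pos] dvd_imp_le)
    show "(\<Sum>d\<in>?D. \<bar>shift_error N (b * d)\<bar>) \<le> (\<Sum>q\<in>?F. \<bar>shift_error N q\<bar>)"
    proof (rule sum_over_multiples_le[where f = "\<lambda>q. \<bar>shift_error N q\<bar>", OF _ b(2) finite_block_divisors finF])
      fix d assume d: "d \<in> ?D"
      have "real (b * d) \<le> real ?P * y" using b d unfolding of_nat_mult by (intro mult_mono) (auto simp: block_divisors_def)
      then show "b * d \<in> ?F" using b d by (auto simp: Suc_le_eq block_divisors_def)
    qed auto
  qed
  ultimately show ?thesis using 1 2 by simp
qed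

text \<open>Here the gain is the factor 2^(-i) from m < N / 2^i. The assumption on B, of
  Brun-Titchmarsh strength, makes it available for all d up to y, and the result is summable over
  i.\<close>

lemma overlap_block_large_index:
  fixes y B :: real
  assumes y: "y \<ge> 1" and B: "B \<ge> 0"
    and bt: "\<And>q. q \<ge> 1 \<Longrightarrow> real q \<le> y \<Longrightarrow>
      (\<Sum>m | m \<in> {1..<N} \<and> q dvd m \<and> real m \<le> real N / 2 ^ i. shift_weight N m) \<le> B * (real N / 2 ^ i / real (totient q))"
  shows "(\<Sum>d\<in>block_divisors P y i. \<Sum>m | m \<in> sifted_set N P \<and> 2 ^ i * real m < real N \<and> d dvd m. shift_weight N m)
    \<le> B * (real N / 2 ^ i) * (10 * (real i + 2))"
proof -
  let ?D = "block_divisors P y i"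
  let ?W = "{d. 1 \<le> d \<and> y / 2 ^ (i + 1) < real d \<and> real d \<le> y \<and> squarefree d}"
  have finW: "finite ?W" by (rule finite_subset[OF _ finite_nat_real_le[of y]]) auto
  have "(\<Sum>d\<in>?D. \<Sum>m | m \<in> sifted_set N P \<and> 2 ^ i * real m < real N \<and> d dvd m. shift_weight N m)
      \<le> (\<Sum>d\<in>?D. B * (real N / 2 ^ i) * (1 / real (totient d)))"
  proof (rule sum_mono)
    fix d assume d: "d \<in> ?D"
    have "(\<Sum>m | m \<in> sifted_set N P \<and> 2 ^ i * real m < real N \<and> d dvd m. shift_weight N m)
        \<le> (\<Sum>m | m \<in> {1..<N} \<and> d dvd m \<and> real m \<le> real N / 2 ^ i. shift_weight N m)"
      by (intro sum_mono2) (auto simp: sifted_set_def shift_weight_nonneg pos_le_divide_eq mult.commute)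
    also have "\<dots> \<le> B * (real N / 2 ^ i / real (totient d))" using d by (intro bt) (auto simp: block_divisors_def)
    finally show "(\<Sum>m | m \<in> sifted_set N P \<and> 2 ^ i * real m < real N \<and> d dvd m. shift_weight N m) \<le> B * (real N / 2 ^ i) * (1 / real (totient d))"
      by simp
  qed
  also have "\<dots> = B * (real N / 2 ^ i) * (\<Sum>d\<in>?D. 1 / real (totient d))" by (simp only: sum_distrib_left)
  also have "\<dots> \<le> B * (real N / 2 ^ i) * (10 * (real i + 2))"
  proof (rule mult_left_mono)
    have "(\<Sum>d\<in>?D. 1 / real (totient d)) \<le> (\<Sum>d\<in>?W. 1 / real (totient d))"
      by (intro sum_mono2[OF finW]) (auto simp: block_divisors_def)
    also have "\<dots> \<le> 10 * (1 + ln (y / (y / 2 ^ (i + 1))))"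
    proof (rule sum_inverse_totient_window_le)
      have "y \<le> y * 2 ^ (i + 1)" using y one_le_power[of "2::real" "i + 1"] by (intro mult_left_mono[of 1 _ y, simplified]) auto
      then show "y / 2 ^ (i + 1) \<le> y" by (simp add: pos_divide_le_eq)
    qed (use y in simp)
    also have "y / (y / 2 ^ (i + 1)) = 2 ^ (i + 1)" using y by simp
    also have "ln (2 ^ (i + 1) :: real) = real (i + 1) * ln 2" by (rule ln_realpow)
    also have "real (i + 1) * ln 2 \<le> real (i + 1) * 1" using ln_2_less_1 by (intro mult_left_mono) auto
    finally show "(\<Sum>d\<in>?D. 1 / real (totient d)) \<le> 10 * (real i + 2)" by simp
  qed (use B in simp)
  finally show ?thesis .
qed

text \<open>The last m, below N / 2^L, are estimated trivially; with 2^L a power of N the lost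
  logarithms are absorbed.\<close>

lemma overlap_tail_le:
  fixes y :: real
  assumes N: "N \<ge> 2" and y: "1 \<le> y" "y \<le> real N"
  shows "\<bar>\<Sum>m | m \<in> sifted_set N P \<and> squarefree m \<and> 2 ^ L * real m < real N. shift_weight N m * overlap N y m\<bar>
    \<le> ln (real N) ^ 2 * (1 + ln (real N)) * (real N / 2 ^ L)"
proof -
  let ?A = "{m. m \<in> sifted_set N P \<and> squarefree m \<and> 2 ^ L * real m < real N}"
  let ?D = "{d. 1 \<le> d \<and> real d \<le> y}"
  let ?X = "real N / 2 ^ L"
  have finA: "finite ?A" by (rule finite_subset[of _ "sifted_set N P"]) auto
  have finD: "finite ?D" by (rule finite_real_range)
  have lN: "ln (real N) \<ge> 0" using N by simp
  have "\<bar>\<Sum>m\<in>?A. shift_weight N m * overlap N y m\<bar> \<le> (\<Sum>m\<in>?A. \<Sum>d | d dvd m \<and> (1 \<le> d \<and> real d \<le> y). shift_weight N m * ln (real N))"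
  proof (rule order_trans[OF sum_abs sum_mono])
    fix m assume m: "m \<in> ?A"
    then have m0: "m > 0" by (auto simp: sifted_set_def)
    have fin: "finite {d. d dvd m \<and> (1 \<le> d \<and> real d \<le> y)}" by (rule finite_subset[of _ "{d. d dvd m}"]) (use m0 in auto)
    have "\<bar>overlap N y m\<bar> \<le> (\<Sum>d | d dvd m \<and> real d \<le> y \<and> real (m div d) < real N / y. ln (real N))"
      unfolding overlap_def
    proof (rule order_trans[OF sum_abs sum_mono])
      fix d assume "d \<in> {d. d dvd m \<and> real d \<le> y \<and> real (m div d) < real N / y}"
      then have d: "d > 0" "real d \<le> y" using m0 by (auto intro: dvd_pos_nat)
      then have "1 \<le> y / real d" by simp
      moreover have "y / real d \<le> y / 1" using d y by (intro divide_left_mono) auto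
      ultimately have "0 \<le> ln (y / real d)" "ln (y / real d) \<le> ln (real N)" using y by auto
      then show "\<bar>moebius_mu d * ln (y / real d)\<bar> \<le> ln (real N)"
        using abs_moebius_mu_mult_le[of d "ln (y / real d)"] by linarith
    qed
    also have "\<dots> \<le> (\<Sum>d | d dvd m \<and> (1 \<le> d \<and> real d \<le> y). ln (real N))"
      using m0 lN by (intro sum_mono2[OF fin]) (auto simp: Suc_le_eq intro: dvd_pos_nat)
    finally have "shift_weight N m * \<bar>overlap N y m\<bar> \<le> shift_weight N m * (\<Sum>d | d dvd m \<and> (1 \<le> d \<and> real d \<le> y). ln (real N))"
      by (rule mult_left_mono) (rule shift_weight_nonneg)
    then show "\<bar>shift_weight N m * overlap N y m\<bar> \<le> (\<Sum>d | d dvd m \<and> (1 \<le> d \<and> real d \<le> y). shift_weight N m * ln (real N))"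
      by (simp add: abs_mult shift_weight_nonneg mult_ac)
  qed
  also have "\<dots> = (\<Sum>d\<in>?D. \<Sum>m | m \<in> ?A \<and> d dvd m. shift_weight N m * ln (real N))"
    by (rule sum_divisors_swap[OF finA _ finD]) (auto simp: sifted_set_def)
  also have "\<dots> \<le> (\<Sum>d\<in>?D. (ln (real N) ^ 2 * ?X) * (1 / real d))"
  proof (rule sum_mono)
    fix d assume d: "d \<in> ?D"
    have "(\<Sum>m | m \<in> ?A \<and> d dvd m. shift_weight N m) \<le> (\<Sum>m | m \<in> {1..<N} \<and> d dvd m \<and> real m \<le> ?X. shift_weight N m)"
      by (intro sum_mono2) (auto simp: sifted_set_def shift_weight_nonneg pos_le_divide_eq mult.commute)
    also have "\<dots> \<le> ln (real N) * (?X / real d)" using N d by (intro shift_sum_upto_le_trivial) auto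
    finally have "(\<Sum>m | m \<in> ?A \<and> d dvd m. shift_weight N m) * ln (real N) \<le> ln (real N) * (?X / real d) * ln (real N)"
      by (rule mult_right_mono) (rule lN)
    then show "(\<Sum>m | m \<in> ?A \<and> d dvd m. shift_weight N m * ln (real N)) \<le> (ln (real N) ^ 2 * ?X) * (1 / real d)"
      unfolding sum_distrib_right[symmetric] by (simp add: power2_eq_square mult_ac)
  qed
  also have "\<dots> = (ln (real N) ^ 2 * ?X) * (\<Sum>d\<in>?D. 1 / real d)" by (simp only: sum_distrib_left)
  also have "\<dots> \<le> (ln (real N) ^ 2 * ?X) * (1 + ln (real N))"
  proof (rule mult_left_mono)
    have "ln y \<le> ln (real N)" using y by simp
    then show "(\<Sum>d\<in>?D. 1 / real d) \<le> 1 + ln (real N)" using sum_inverse_real_le[OF y(1)] by linarith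
  qed (use lN in simp)
  finally show ?thesis by (simp add: mult_ac)
qed

lemma sum_overlap_le:
  fixes y B :: real
  assumes N: "even N" "N \<ge> 2" and z: "z \<ge> 1" and y: "1 \<le> y" "y \<le> real N" and B: "B \<ge> 0" and L: "I \<le> L"
    and bt: "\<And>i q. i < L \<Longrightarrow> q \<ge> 1 \<Longrightarrow> real q \<le> y \<Longrightarrow>
      (\<Sum>m | m \<in> {1..<N} \<and> q dvd m \<and> real m \<le> real N / 2 ^ i. shift_weight N m) \<le> B * (real N / 2 ^ i / real (totient q))"
  shows "\<bar>\<Sum>m | m \<in> sifted_set N (primorial z) \<and> squarefree m. shift_weight N m * overlap N y m\<bar> \<le>
     (\<Sum>i<I. real (i + 1) * (real N * (2 ^ (i + 1) * (2 / ln (real z + 1) + real (primorial z) / y + 8 / sqrt (real z)))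
        + real (card {b. b dvd primorial z}) * (\<Sum>q | 1 \<le> q \<and> real q \<le> real (primorial z) * y. \<bar>shift_error N q\<bar>)))
     + (\<Sum>i\<in>{I..<L}. real (i + 1) * (B * (real N / 2 ^ i) * (10 * (real i + 2))))
     + ln (real N) ^ 2 * (1 + ln (real N)) * (real N / 2 ^ L)"
proof -
  let ?P = "primorial z"
  let ?f = "\<lambda>m. shift_weight N m * overlap N y m"
  let ?b = "\<lambda>i. \<Sum>m\<in>dyadic_block N ?P i. ?f m"
  let ?s = "\<lambda>i. real (i + 1) * (real N * (2 ^ (i + 1) * (2 / ln (real z + 1) + real ?P / y + 8 / sqrt (real z)))
        + real (card {b. b dvd ?P}) * (\<Sum>q | 1 \<le> q \<and> real q \<le> real ?P * y. \<bar>shift_error N q\<bar>))"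
  let ?l = "\<lambda>i. real (i + 1) * (B * (real N / 2 ^ i) * (10 * (real i + 2)))"
  have small: "\<bar>?b i\<bar> \<le> ?s i" for i
    using N z y by (intro order_trans[OF overlap_block_le[OF y(1)]] mult_left_mono overlap_block_small_index) auto
  have large: "\<bar>?b i\<bar> \<le> ?l i" if "i < L" for i
    using that by (intro order_trans[OF overlap_block_le[OF y(1)]] mult_left_mono overlap_block_large_index y(1) B bt) auto
  have "(\<Sum>i<L. \<bar>?b i\<bar>) = (\<Sum>i<I. \<bar>?b i\<bar>) + (\<Sum>i\<in>{I..<L}. \<bar>?b i\<bar>)"
  proof -
    have "{..<L} = {..<I} \<union> {I..<L}" using L by auto
    then show ?thesis by (simp add: sum.union_disjoint ivl_disj_int)
  qed
  moreover have "(\<Sum>i<I. \<bar>?b i\<bar>) \<le> (\<Sum>i<I. ?s i)" by (intro sum_mono small)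
  moreover have "(\<Sum>i\<in>{I..<L}. \<bar>?b i\<bar>) \<le> (\<Sum>i\<in>{I..<L}. ?l i)" by (intro sum_mono large) auto
  moreover have "\<bar>\<Sum>i<L. ?b i\<bar> \<le> (\<Sum>i<L. \<bar>?b i\<bar>)" by (rule sum_abs)
  moreover have "\<bar>\<Sum>m | m \<in> sifted_set N ?P \<and> squarefree m \<and> 2 ^ L * real m < real N. ?f m\<bar>
    \<le> ln (real N) ^ 2 * (1 + ln (real N)) * (real N / 2 ^ L)" by (rule overlap_tail_le[OF N(2) y])
  ultimately show ?thesis unfolding sum_dyadic_split[where f = ?f and L = L] by linarith
qed

section \<open>The asymptotic formula\<close>

text \<open>The relation theta + 4 * delta = 1 distributes the room between N^theta and N: one
  N^delta bounds P in y = P * N^theta, two serve k^2 for the squares up to K = N^delta, and one is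
  the length required by the Brun-Titchmarsh bound. The dyadic range fits as well, since 2^i <=
  N^delta.\<close>

lemma goldbach_error_le:
  fixes \<theta> \<delta> B \<eta> :: real and N z I L :: nat
  defines "P \<equiv> primorial z" and "c \<equiv> real (card {b. b dvd primorial z})"
  assumes N: "even N" "N \<ge> 2" and z: "z \<ge> 256" and \<theta>: "\<theta> > 0" "\<delta> > 0" "\<theta> + 4 * \<delta> = 1" and B: "B \<ge> 0"
    and bt: "\<And>q X. q \<ge> 1 \<Longrightarrow> real q * real N powr \<delta> \<le> X \<Longrightarrow>
      (\<Sum>m | m \<in> {1..<N} \<and> q dvd m \<and> real m \<le> X. shift_weight N m) \<le> B * (X / real (totient q))"
    and P: "real P \<le> real N powr \<delta>" and L: "2 ^ L \<le> real N powr \<delta>" "I \<le> L"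
    and E: "(\<Sum>q | 1 \<le> q \<and> real q \<le> (real P)\<^sup>2 * real N powr \<theta>. \<bar>shift_error N q\<bar>) \<le> \<eta>"
    and S0: "(\<Sum>q | 1 \<le> q \<and> real q \<le> real N powr (1 - \<theta>). \<bar>\<Sum>m | m \<in> {1..<N} \<and> q dvd m. shift_weight N m * moebius_mu m\<bar>) \<le> \<eta>"
    and S1: "(\<Sum>q | 1 \<le> q \<and> real q \<le> real N powr (1 - \<theta>). \<bar>\<Sum>m | m \<in> {1..<N} \<and> q dvd m. shift_weight N m * (moebius_mu m * ln (real m))\<bar>) \<le> \<eta>"
  shows "\<bar>goldbach_sum N - real N * sieve_density N P * phi_sum ({p. prime p \<and> p \<le> z} \<union> prime_factors N) ln (real P * real N powr \<theta>)\<bar> \<le>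
     (320 + 80000 * B) / sqrt (real z) * (real N * kap (prime_factors N))
     + (\<Sum>i<I. real (i + 1) * (real N * (2 ^ (i + 1) * (2 / ln (real z + 1) + real N powr - \<theta> + 8 / sqrt (real z))) + c * \<eta>))
     + (\<Sum>i\<in>{I..<L}. real (i + 1) * (B * (real N / 2 ^ i) * (10 * (real i + 2))))
     + ln (real N) ^ 2 * (1 + ln (real N)) * (real N / 2 ^ L)
     + 4 * ln (real N) ^ 2 * (1 + ln (real N)) * real N / sqrt (real N powr \<delta>)
     + c * (2 * ln (real N) ^ 2 * \<eta>) + c * (ln (real N) * \<eta> + \<eta>) + c * (ln (real N) * \<eta>)
     + (ln (real N) ^ 2 * ((2 * ln (real N) + real z + sqrt (real N)) * (2 * ln (real N))) + ln (real N) ^ 2)"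
proof -
  define y where "y = real P * real N powr \<theta>"
  let ?Q = "sifted_set N P" and ?w = "shift_weight N"
  let ?T = "{p. prime p \<and> p \<le> z} \<union> prime_factors N"
  have N0: "N > 0" "real N \<ge> 2" using N by auto
  have P1: "real P \<ge> 1" using primorial_pos[of z] by (simp add: P_def Suc_le_eq)
  have Nth: "real N powr \<theta> \<ge> 1" "real N powr \<delta> > 1" using N0 \<theta> by (auto intro: ge_one_powr_ge_zero)
  have y1: "y \<ge> 1" unfolding y_def using P1 Nth by (metis mult_mono mult_1 order.trans zero_le_one of_nat_0_le_iff)
  have prod: "real N powr \<delta> * real N powr \<delta> * real N powr \<delta> * (real N powr \<delta> * real N powr \<theta>) = real N"
    using N0 \<theta> by (simp add: powr_add[symmetric] algebra_simps)
  have yD: "y \<le> real N powr \<delta> * real N powr \<theta>" unfolding y_def using P by (intro mult_right_mono) auto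
  have D1: "1 \<le> real N powr \<delta>" using Nth by simp
  have yDDD: "real N powr \<delta> * real N powr \<delta> * real N powr \<delta> * y \<le> real N"
    using mult_left_mono[OF yD, of "real N powr \<delta> * real N powr \<delta> * real N powr \<delta>"] prod by simp
  have yDD: "real N powr \<delta> * real N powr \<delta> * y \<le> real N"
  proof -
    have "1 * (real N powr \<delta> * real N powr \<delta> * y) \<le> real N powr \<delta> * (real N powr \<delta> * real N powr \<delta> * y)"
      using y1 D1 by (intro mult_right_mono) auto
    then show ?thesis using yDDD by (simp add: mult.assoc)
  qed
  have yD1: "real N powr \<delta> * y \<le> real N"
  proof -
    have "1 * (real N powr \<delta> * y) \<le> real N powr \<delta> * (real N powr \<delta> * y)"
      using y1 D1 by (intro mult_right_mono) auto
    then show ?thesis using yDD by (simp add: mult.assoc)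
  qed
  have yN: "y < real N"
  proof -
    have "1 * y < real N powr \<delta> * y" using y1 Nth by (intro mult_strict_right_mono) auto
    then show ?thesis using yD1 by simp
  qed
  have PyN: "real P * y \<le> real N" using mult_right_mono[OF P, of y] y1 yD1 by linarith
  have Py: "real P * y = (real P)\<^sup>2 * real N powr \<theta>" by (simp add: y_def power2_eq_square)
  have lN: "ln (real N) \<ge> 0" using N0 by simp
  have ly: "0 \<le> ln y" "ln y \<le> ln (real N)" using y1 yN by auto
  have E': "(\<Sum>q | 1 \<le> q \<and> real q \<le> real P * y. \<bar>shift_error N q\<bar>) \<le> \<eta>" unfolding Py by (rule E)
  have E0: "0 \<le> (\<Sum>q | 1 \<le> q \<and> real q \<le> real P * y. \<bar>shift_error N q\<bar>)" by (rule sum_nonneg) auto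
  have \<eta>0: "\<eta> \<ge> 0" using E' E0 by linarith
  have c0: "c \<ge> 0" by (simp add: c_def)
  have cP: "real (card {b. b dvd P}) = c" by (simp add: c_def P_def)
  have Pz: "primorial z = P" by (simp add: P_def)
  have Py': "real P / y = real N powr - \<theta>" using P1 N0 by (simp add: y_def powr_minus divide_inverse)
  have main: "\<bar>(\<Sum>m\<in>?Q. ?w m * type_I y m) - real N * sieve_density N P * phi_sum ?T ln y\<bar> \<le> c * (ln (real N) * \<eta>)"
  proof -
    have "\<bar>(\<Sum>m\<in>?Q. ?w m * type_I y m) - real N * sieve_density N P * phi_sum ?T ln y\<bar>
       \<le> c * (ln y * (\<Sum>q | 1 \<le> q \<and> real q \<le> real P * y. \<bar>shift_error N q\<bar>))"
      using sum_type_I_le[OF N0(1) y1, of z] unfolding Pz cP .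
    also have "\<dots> \<le> c * (ln (real N) * \<eta>)" using ly E' E0 c0 lN by (intro mult_left_mono mult_mono) auto
    finally show ?thesis .
  qed
  have II: "\<bar>\<Sum>m\<in>?Q. ?w m * type_II N y m\<bar> \<le> c * (ln (real N) * \<eta> + \<eta>)"
  proof -
    have "real P * (real N / y) = real N powr (1 - \<theta>)"
      using P1 N0 by (simp add: y_def powr_diff)
    then have "\<bar>\<Sum>m\<in>?Q. ?w m * type_II N y m\<bar> \<le>
     c * (ln (real N) * (\<Sum>q | 1 \<le> q \<and> real q \<le> real N powr (1 - \<theta>). \<bar>\<Sum>m | m \<in> {1..<N} \<and> q dvd m. shift_weight N m * moebius_mu m\<bar>)
        + (\<Sum>q | 1 \<le> q \<and> real q \<le> real N powr (1 - \<theta>). \<bar>\<Sum>m | m \<in> {1..<N} \<and> q dvd m. shift_weight N m * (moebius_mu m * ln (real m))\<bar>))"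
      unfolding cP[symmetric] using P1 y1 yN by (intro sum_type_II_le) auto
    also have "\<dots> \<le> c * (ln (real N) * \<eta> + \<eta>)"
      by (intro mult_left_mono add_mono S0 S1 lN c0)
    finally show ?thesis .
  qed
  have NS: "\<bar>\<Sum>m | m \<in> ?Q \<and> \<not> squarefree m. ?w m * type_I y m\<bar> \<le>
     (320 + 80000 * B) / sqrt (real z) * (real N * kap (prime_factors N))
     + c * (2 * ln (real N) ^ 2 * \<eta>) + 4 * ln (real N) ^ 2 * (1 + ln (real N)) * real N / sqrt (real N powr \<delta>)"
  proof -
    have bt1: "shift_sum N q \<le> B * (real N / real (totient q))" if q: "q \<ge> 1" "real q \<le> (real N powr \<delta>)\<^sup>2 * y" for q
    proof -
      have "real q * real N powr \<delta> \<le> (real N powr \<delta>)\<^sup>2 * y * real N powr \<delta>" using q by (intro mult_right_mono) auto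
      also have "\<dots> \<le> real N" using yDDD by (simp add: power2_eq_square mult_ac)
      finally have "(\<Sum>m | m \<in> {1..<N} \<and> q dvd m \<and> real m \<le> real N. shift_weight N m) \<le> B * (real N / real (totient q))"
        by (rule bt[OF q(1)])
      moreover have "{m. m \<in> {1..<N} \<and> q dvd m \<and> real m \<le> real N} = {m. m \<in> {1..<N} \<and> q dvd m}" by auto
      ultimately show ?thesis by (simp add: shift_sum_def)
    qed
    have "\<bar>\<Sum>m | m \<in> ?Q \<and> \<not> squarefree m. ?w m * type_I y m\<bar> \<le>
     (320 + 80000 * B) / sqrt (real z) * (real N * kap (prime_factors N))
     + c * (2 * ln (real N) ^ 2 * (\<Sum>q | 1 \<le> q \<and> real q \<le> real P * y. \<bar>shift_error N q\<bar>))
     + 4 * ln (real N) ^ 2 * (1 + ln (real N)) * real N / sqrt (real N powr \<delta>)"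
      using sum_not_squarefree_le[OF N(1) N0(1) z y1, where K = "real N powr \<delta>" and B = B, unfolded Pz cP, OF PyN D1 B bt1] .
    moreover have "c * (2 * ln (real N) ^ 2 * (\<Sum>q | 1 \<le> q \<and> real q \<le> real P * y. \<bar>shift_error N q\<bar>)) \<le> c * (2 * ln (real N) ^ 2 * \<eta>)"
      using E' c0 by (intro mult_left_mono) auto
    ultimately show ?thesis by linarith
  qed
  have OV: "\<bar>\<Sum>m | m \<in> ?Q \<and> squarefree m. ?w m * overlap N y m\<bar> \<le>
     (\<Sum>i<I. real (i + 1) * (real N * (2 ^ (i + 1) * (2 / ln (real z + 1) + real N powr - \<theta> + 8 / sqrt (real z))) + c * \<eta>))
     + (\<Sum>i\<in>{I..<L}. real (i + 1) * (B * (real N / 2 ^ i) * (10 * (real i + 2))))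
     + ln (real N) ^ 2 * (1 + ln (real N)) * (real N / 2 ^ L)"
  proof -
    have bt2: "(\<Sum>m | m \<in> {1..<N} \<and> q dvd m \<and> real m \<le> real N / 2 ^ i. shift_weight N m) \<le> B * (real N / 2 ^ i / real (totient q))"
      if i: "i < L" and q: "q \<ge> 1" "real q \<le> y" for i q
    proof (rule bt[OF q(1)])
      have "(2::real) ^ i \<le> 2 ^ L" using i by (intro power_increasing) auto
      then have "2 ^ i \<le> real N powr \<delta>" using L by linarith
      then have "real q * real N powr \<delta> * 2 ^ i \<le> y * real N powr \<delta> * real N powr \<delta>"
        using q y1 by (intro mult_mono) auto
      also have "\<dots> \<le> real N" using yDD by (simp add: mult_ac)
      finally show "real q * real N powr \<delta> \<le> real N / 2 ^ i" by (simp add: pos_le_divide_eq)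
    qed
    have "z \<ge> 1" using z by simp
    from sum_overlap_le[OF N this y1 less_imp_le[OF yN] B L(2) bt2]
    have "\<bar>\<Sum>m | m \<in> ?Q \<and> squarefree m. ?w m * overlap N y m\<bar> \<le>
     (\<Sum>i<I. real (i + 1) * (real N * (2 ^ (i + 1) * (2 / ln (real z + 1) + real N powr - \<theta> + 8 / sqrt (real z)))
         + c * (\<Sum>q | 1 \<le> q \<and> real q \<le> real P * y. \<bar>shift_error N q\<bar>)))
     + (\<Sum>i\<in>{I..<L}. real (i + 1) * (B * (real N / 2 ^ i) * (10 * (real i + 2))))
     + ln (real N) ^ 2 * (1 + ln (real N)) * (real N / 2 ^ L)"
      unfolding Pz cP Py' .
    moreover have "(\<Sum>i<I. real (i + 1) * (real N * (2 ^ (i + 1) * (2 / ln (real z + 1) + real N powr - \<theta> + 8 / sqrt (real z)))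
         + c * (\<Sum>q | 1 \<le> q \<and> real q \<le> real P * y. \<bar>shift_error N q\<bar>)))
       \<le> (\<Sum>i<I. real (i + 1) * (real N * (2 ^ (i + 1) * (2 / ln (real z + 1) + real N powr - \<theta> + 8 / sqrt (real z))) + c * \<eta>))"
      using E' c0 by (intro sum_mono mult_left_mono add_left_mono) auto
    ultimately show ?thesis by linarith
  qed
  show ?thesis
    using goldbach_sum_decomposition[OF N(2) y1 yN, of z] main II NS OV unfolding Pz y_def[symmetric] by linarith
qed

text \<open>Collects, after division by N, the terms of \<open>goldbach_error_le\<close> that vanish
  as N grows with z and I fixed.\<close>

lemma remainder_tendsto_0:
  fixes \<theta> \<delta> c D D' z :: real
  assumes "\<theta> > 0" "\<delta> > 0"
  shows "((\<lambda>N::nat. D * real N powr - \<theta> + D' * c * (1 / ln (real N) powr 3)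
     + ln (real N) ^ 2 * (1 + ln (real N)) * (2 / real N powr \<delta>)
     + 4 * ln (real N) ^ 2 * (1 + ln (real N)) / sqrt (real N powr \<delta>)
     + c * (2 * ln (real N) ^ 2 * (1 / ln (real N) powr 3))
     + c * (ln (real N) * (1 / ln (real N) powr 3) + 1 / ln (real N) powr 3)
     + c * (ln (real N) * (1 / ln (real N) powr 3))
     + ((ln (real N) ^ 2 * (2 * ln (real N) + sqrt (real N)) * (2 * ln (real N))) / real N
       + z * (ln (real N) ^ 2 * (2 * ln (real N)) / real N) + ln (real N) ^ 2 / real N)) \<longlongrightarrow> 0) at_top"
proof -
  have 1: "((\<lambda>N::nat. real N powr - \<theta>) \<longlongrightarrow> 0) at_top" using assms by real_asymp
  have 2: "((\<lambda>N::nat. 1 / ln (real N) powr 3) \<longlongrightarrow> 0) at_top" by real_asymp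
  have 3: "((\<lambda>N::nat. ln (real N) ^ 2 * (1 + ln (real N)) * (2 / real N powr \<delta>)) \<longlongrightarrow> 0) at_top"
    using assms by real_asymp
  have 4: "((\<lambda>N::nat. 4 * ln (real N) ^ 2 * (1 + ln (real N)) / sqrt (real N powr \<delta>)) \<longlongrightarrow> 0) at_top"
    using assms by real_asymp
  have 5: "((\<lambda>N::nat. 2 * ln (real N) ^ 2 * (1 / ln (real N) powr 3)) \<longlongrightarrow> 0) at_top" by real_asymp
  have 6: "((\<lambda>N::nat. ln (real N) * (1 / ln (real N) powr 3) + 1 / ln (real N) powr 3) \<longlongrightarrow> 0) at_top" by real_asymp
  have 7: "((\<lambda>N::nat. ln (real N) * (1 / ln (real N) powr 3)) \<longlongrightarrow> 0) at_top" by real_asymp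
  have 8: "((\<lambda>N::nat. (ln (real N) ^ 2 * (2 * ln (real N) + sqrt (real N)) * (2 * ln (real N))) / real N) \<longlongrightarrow> 0) at_top" by real_asymp
  have 9: "((\<lambda>N::nat. ln (real N) ^ 2 * (2 * ln (real N)) / real N) \<longlongrightarrow> 0) at_top" by real_asymp
  have 10: "((\<lambda>N::nat. ln (real N) ^ 2 / real N) \<longlongrightarrow> 0) at_top" by real_asymp
  show ?thesis
    by (intro tendsto_add_zero tendsto_mult_right_zero[OF 1] tendsto_mult_right_zero[OF 2] 3 4
        tendsto_mult_right_zero[OF 5] tendsto_mult_right_zero[OF 6] tendsto_mult_right_zero[OF 7] 8 tendsto_mult_right_zero[OF 9] 10)
qed

text \<open>What survives when N grows: \<open>\<tau>\<close> bounds the tail of the dyadic series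
  and is made small by I, the terms with z are made small by z depending on I, and e takes the rest.
  For odd N nothing is claimed.\<close>

lemma goldbach_error_eventually:
  fixes \<theta> C \<tau> e :: real and z I :: nat
  assumes \<theta>: "0 < \<theta>" "\<theta> < 1" and C: "C > 0"
    and H1: "\<And>A::real. A > 0 \<Longrightarrow>
      (\<lambda>N::nat. \<Sum>q | 1 \<le> q \<and> real q \<le> real N powr \<theta> * ln (real N) powr C \<and> coprime N q.
          \<bar>(\<Sum>n | n \<in> {1..<N} \<and> [n = N] (mod q). mangoldt n) - real N / real (totient q)\<bar>)
        \<in> O[at_top](\<lambda>N. real N / ln (real N) powr A)"
    and H2: "\<And>(g :: nat \<Rightarrow> real) (A::real).
      g \<in> {moebius_mu, (\<lambda>n. moebius_mu n * ln (real n))} \<Longrightarrow> A > 0 \<Longrightarrow>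
      (\<lambda>N::nat. \<Sum>q | 1 \<le> q \<and> real q \<le> real N powr (1 - \<theta>) \<and> coprime N q.
          \<bar>(\<Sum>n | n \<in> {1..<N} \<and> [n = N] (mod q). mangoldt n * g (N - n))
            - 1 / real (totient q) * (\<Sum>n\<in>{1..<N}. mangoldt n * g (N - n))\<bar>)
        \<in> O[at_top](\<lambda>N. real N / ln (real N) powr A)"
    and z: "z \<ge> 256" and \<tau>: "\<And>L. (\<Sum>i\<in>{I..<L}. real (i + 1) * (real i + 2) / 2 ^ i) \<le> \<tau>" and e: "e > 0"
  defines "B \<equiv> 32 / ((1 - \<theta>) / 4) + 1"
  shows "\<forall>\<^sub>F N in at_top. even N \<longrightarrow>
    \<bar>goldbach_sum N - real N * sieve_density N (primorial z) *
        phi_sum ({p. prime p \<and> p \<le> z} \<union> prime_factors N) ln (real (primorial z) * real N powr \<theta>)\<bar>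
      \<le> ((320 + 80000 * B) / sqrt (real z) + (\<Sum>i<I. real (i + 1) * 2 ^ (i + 1)) * (2 / ln (real z + 1) + 8 / sqrt (real z))
          + 10 * B * \<tau> + e) * (real N * kap (prime_factors N))"
proof -
  define \<delta> where "\<delta> = (1 - \<theta>) / 4"
  have \<delta>: "\<delta> > 0" "\<theta> + 4 * \<delta> = 1" using \<theta> by (simp_all add: \<delta>_def field_simps)
  have B: "B \<ge> 0" unfolding B_def using \<theta> by simp
  have Bd: "B = 32 / \<delta> + 1" by (simp add: B_def \<delta>_def)
  let ?P = "real (primorial z)"
  define c where "c = real (card {b. b dvd primorial z})"
  define D where "D = (\<Sum>i<I. real (i + 1) * 2 ^ (i + 1))"
  define D' where "D' = (\<Sum>i<I. real (i + 1))"
  \<comment> \<open>2^(L N) lies between N^delta / 2 and N^delta: large enough for the trivial tail,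
    small enough for the Brun-Titchmarsh range.\<close>
  define L where "L N = nat \<lfloor>log 2 (real N powr \<delta>)\<rfloor>" for N :: nat
  note psi = prime_number_theorem_from_level[OF \<theta>(1) C H1]
  \<comment> \<open>The exponent 3 suffices because these bounds are later multiplied by at most (ln
    N)^2 and constants.\<close>
  have e1: "\<forall>\<^sub>F N in at_top. (\<Sum>q | 1 \<le> q \<and> real q \<le> real N powr \<theta> * ln (real N) powr C. \<bar>shift_error N q\<bar>) \<le> real N / ln (real N) powr 3"
    by (rule level_of_distribution_shift[OF \<theta> C _ H1]) simp
  have e2: "\<forall>\<^sub>F N in at_top. (\<Sum>q | 1 \<le> q \<and> real q \<le> real N powr (1 - \<theta>). \<bar>\<Sum>m | m \<in> {1..<N} \<and> q dvd m. shift_weight N m * moebius_mu m\<bar>) \<le> real N / ln (real N) powr 3"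
  proof (rule moebius_level_shift[OF \<theta> _ _ _ psi H2])
    show "\<bar>moebius_mu m\<bar> \<le> ln (real N)" if "N \<ge> 3" "m < N" for N m :: nat
    proof -
      have "exp 1 \<le> real N" using that exp_le by linarith
      then have "1 \<le> ln (real N)" using that by (simp add: ln_ge_iff)
      then show ?thesis using abs_moebius_mu_le[of m] by linarith
    qed
  qed (auto simp: moebius_mu_not_squarefree)
  have e3: "\<forall>\<^sub>F N in at_top. (\<Sum>q | 1 \<le> q \<and> real q \<le> real N powr (1 - \<theta>). \<bar>\<Sum>m | m \<in> {1..<N} \<and> q dvd m. shift_weight N m * (moebius_mu m * ln (real m))\<bar>) \<le> real N / ln (real N) powr 3"
  proof (rule moebius_level_shift[OF \<theta> _ _ _ psi H2])
    show "\<bar>moebius_mu m * ln (real m)\<bar> \<le> ln (real N)" if "N \<ge> 3" "m < N" for N m :: nat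
    proof (cases "m = 0")
      case False
      then have "0 \<le> ln (real m)" "ln (real m) \<le> ln (real N)" using that by auto
      then show ?thesis using abs_moebius_mu_mult_le[of m "ln (real m)"] by linarith
    qed (use that in simp)
  qed (auto simp: moebius_mu_not_squarefree)
  have e4: "\<forall>\<^sub>F N in at_top. \<forall>q\<ge>1. \<forall>X. real q * real N powr \<delta> \<le> X \<longrightarrow>
     (\<Sum>m | m \<in> {1..<N} \<and> q dvd m \<and> real m \<le> X. shift_weight N m) \<le> B * (X / real (totient q))"
    unfolding Bd by (rule shift_sum_upto_brun_titchmarsh[OF \<delta>(1)])
  have Ppos: "?P > 0" using primorial_pos[of z] by (simp del: primorial_pos)
  have e5: "\<forall>\<^sub>F N::nat in at_top. ?P \<le> real N powr \<delta>" using \<delta> by real_asymp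
  \<comment> \<open>Any C > 0 is enough here: P^2 is constant, and this is the only demand on the
    level beyond N^theta.\<close>
  have e6: "\<forall>\<^sub>F N::nat in at_top. ?P\<^sup>2 \<le> ln (real N) powr C" using C by real_asymp
  have e7: "\<forall>\<^sub>F N::nat in at_top. real I + 1 \<le> log 2 (real N powr \<delta>)" using \<delta> by real_asymp
  note e8 = order_tendstoD(2)[OF remainder_tendsto_0[OF \<theta>(1) \<delta>(1)] e, where D1 = D and D'1 = D' and c1 = c and z1 = "real z"]
  show ?thesis using e1 e2 e3 e4 e5 e6 e7 e8 eventually_ge_at_top[of 3]
  proof eventually_elim
    case (elim N)
    show ?case
    proof
      assume ev: "even N"
      let ?\<kappa> = "kap (prime_factors N)" and ?\<eta> = "real N / ln (real N) powr 3"
      have N: "real N \<ge> 3" "N \<ge> 2" using elim by auto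
      have k1: "?\<kappa> \<ge> 1" by (rule kap_ge_1) auto
      have Nd: "real N powr \<delta> > 0" using N by simp
      have L1: "2 ^ L N \<le> real N powr \<delta>"
      proof -
        have "real (L N) \<le> log 2 (real N powr \<delta>)" using elim(7) by (simp add: L_def)
        then have "2 powr real (L N) \<le> real N powr \<delta>" using Nd by (simp add: le_log_iff)
        then show ?thesis by (simp add: powr_realpow)
      qed
      have L2: "real N / 2 ^ L N \<le> real N * (2 / real N powr \<delta>)"
      proof -
        have "log 2 (real N powr \<delta>) \<le> real (L N) + 1" unfolding L_def by linarith
        then have "real N powr \<delta> \<le> 2 powr (real (L N) + 1)" using Nd by (simp add: log_le_iff)
        also have "\<dots> = 2 * 2 ^ L N" by (simp add: powr_add powr_realpow)
        finally have "real N powr \<delta> * real N \<le> (2 * 2 ^ L N) * real N" using N by (intro mult_right_mono) auto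
        then show ?thesis using Nd by (simp add: field_simps)
      qed
      have L3: "I \<le> L N" unfolding L_def using elim(7) by linarith
      have lN: "ln (real N) \<ge> 0" using N by simp
      have E: "(\<Sum>q | 1 \<le> q \<and> real q \<le> ?P\<^sup>2 * real N powr \<theta>. \<bar>shift_error N q\<bar>) \<le> ?\<eta>"
      proof (rule order_trans[OF sum_mono2 elim(1)])
        have "?P\<^sup>2 * real N powr \<theta> \<le> ln (real N) powr C * real N powr \<theta>" using elim(6) by (intro mult_right_mono) auto
        then show "{q. 1 \<le> q \<and> real q \<le> ?P\<^sup>2 * real N powr \<theta>} \<subseteq> {q. 1 \<le> q \<and> real q \<le> real N powr \<theta> * ln (real N) powr C}"
          by (auto simp: mult.commute)
      qed (rule finite_real_range, simp)
      have bt: "(\<Sum>m | m \<in> {1..<N} \<and> q dvd m \<and> real m \<le> X. shift_weight N m) \<le> B * (X / real (totient q))"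
        if "q \<ge> 1" "real q * real N powr \<delta> \<le> X" for q X using elim(4) that by blast
      note main = goldbach_error_le[OF ev N(2) z \<theta>(1) \<delta> B bt elim(5) L1 L3 E elim(2) elim(3), folded c_def]
      have s: "(\<Sum>i<I. real (i + 1) * (real N * (2 ^ (i + 1) * (2 / ln (real z + 1) + real N powr - \<theta> + 8 / sqrt (real z))) + c * ?\<eta>))
         = real N * (D * (2 / ln (real z + 1) + 8 / sqrt (real z))) + real N * (D * real N powr - \<theta>) + real N * (D' * c * (1 / ln (real N) powr 3))"
      proof -
        have gen1: "r * (n * (p * u) + w) = (r * p) * (n * u) + r * w" for r n p u w :: real
          by (simp add: algebra_simps)
        have gen2: "D * (n * (a + t + b)) + D' * (c * (n / l)) = n * (D * (a + b)) + n * (D * t) + n * (D' * c * (1 / l))" for n a t b l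
          by (simp add: algebra_simps)
        have "(\<Sum>i<I. real (i + 1) * (real N * (2 ^ (i + 1) * (2 / ln (real z + 1) + real N powr - \<theta> + 8 / sqrt (real z))) + c * ?\<eta>))
          = (\<Sum>i<I. (real (i + 1) * 2 ^ (i + 1)) * (real N * (2 / ln (real z + 1) + real N powr - \<theta> + 8 / sqrt (real z))) + real (i + 1) * (c * ?\<eta>))"
          by (intro sum.cong refl gen1)
        also have "\<dots> = D * (real N * (2 / ln (real z + 1) + real N powr - \<theta> + 8 / sqrt (real z))) + D' * (c * ?\<eta>)"
          unfolding D_def D'_def by (simp only: sum.distrib sum_distrib_right)
        finally show ?thesis unfolding gen2 .
      qed
      have t: "(\<Sum>i\<in>{I..<L N}. real (i + 1) * (B * (real N / 2 ^ i) * (10 * (real i + 2)))) \<le> real N * (10 * B * \<tau>)"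
      proof -
        have "(\<Sum>i\<in>{I..<L N}. real (i + 1) * (B * (real N / 2 ^ i) * (10 * (real i + 2))))
           = (10 * B * real N) * (\<Sum>i\<in>{I..<L N}. real (i + 1) * (real i + 2) / 2 ^ i)"
          unfolding sum_distrib_left by (intro sum.cong refl) simp
        also have "\<dots> \<le> (10 * B * real N) * \<tau>" using \<tau>[of "L N"] B by (intro mult_left_mono) auto
        finally show ?thesis by (simp add: mult_ac)
      qed
      have u: "ln (real N) ^ 2 * (1 + ln (real N)) * (real N / 2 ^ L N) \<le> ln (real N) ^ 2 * (1 + ln (real N)) * (real N * (2 / real N powr \<delta>))"
        using L2 lN by (intro mult_left_mono) auto
      let ?r = "D * real N powr - \<theta> + D' * c * (1 / ln (real N) powr 3)
     + ln (real N) ^ 2 * (1 + ln (real N)) * (2 / real N powr \<delta>)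
     + 4 * ln (real N) ^ 2 * (1 + ln (real N)) / sqrt (real N powr \<delta>)
     + c * (2 * ln (real N) ^ 2 * (1 / ln (real N) powr 3))
     + c * (ln (real N) * (1 / ln (real N) powr 3) + 1 / ln (real N) powr 3)
     + c * (ln (real N) * (1 / ln (real N) powr 3))
     + ((ln (real N) ^ 2 * (2 * ln (real N) + sqrt (real N)) * (2 * ln (real N))) / real N
       + real z * (ln (real N) ^ 2 * (2 * ln (real N)) / real N) + ln (real N) ^ 2 / real N)"
      have r: "real N * (D * real N powr - \<theta>) + real N * (D' * c * (1 / ln (real N) powr 3))
        + ln (real N) ^ 2 * (1 + ln (real N)) * (real N * (2 / real N powr \<delta>))
        + 4 * ln (real N) ^ 2 * (1 + ln (real N)) * real N / sqrt (real N powr \<delta>)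
        + c * (2 * ln (real N) ^ 2 * ?\<eta>) + c * (ln (real N) * ?\<eta> + ?\<eta>) + c * (ln (real N) * ?\<eta>)
        + (ln (real N) ^ 2 * ((2 * ln (real N) + real z + sqrt (real N)) * (2 * ln (real N))) + ln (real N) ^ 2) = real N * ?r"
      proof -
        have n: "real N * (x / real N) = x" for x using N by simp
        show ?thesis unfolding distrib_left[of "real N"]
          unfolding mult.left_commute[of "real N" "real z"] n by (simp add: algebra_simps)
      qed
      have "real N * ?r \<le> real N * e" using elim(8) by (intro mult_left_mono) auto
      then have "\<bar>goldbach_sum N - real N * sieve_density N (primorial z) *
        phi_sum ({p. prime p \<and> p \<le> z} \<union> prime_factors N) ln (?P * real N powr \<theta>)\<bar>
        \<le> (320 + 80000 * B) / sqrt (real z) * (real N * ?\<kappa>) + real N * (D * (2 / ln (real z + 1) + 8 / sqrt (real z))) + real N * (10 * B * \<tau>) + real N * e"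
        using main s t u r by linarith
      also have "\<dots> = (320 + 80000 * B) / sqrt (real z) * (real N * ?\<kappa>) + (D * (2 / ln (real z + 1) + 8 / sqrt (real z)) + 10 * B * \<tau> + e) * (real N * 1)"
        by (simp only: distrib_right mult_1_right mult.commute[of "real N"] add.assoc)
      also have "\<dots> \<le> (320 + 80000 * B) / sqrt (real z) * (real N * ?\<kappa>) + (D * (2 / ln (real z + 1) + 8 / sqrt (real z)) + 10 * B * \<tau> + e) * (real N * ?\<kappa>)"
      proof (intro add_left_mono mult_left_mono)
        have "D \<ge> 0" unfolding D_def by (intro sum_nonneg) auto
        moreover have "\<tau> \<ge> 0" using \<tau>[of I] by simp
        ultimately show "0 \<le> D * (2 / ln (real z + 1) + 8 / sqrt (real z)) + 10 * B * \<tau> + e"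
          using B e z by (intro add_nonneg_nonneg mult_nonneg_nonneg) auto
      qed (use k1 in auto)
      finally show "\<bar>goldbach_sum N - real N * sieve_density N (primorial z) *
        phi_sum ({p. prime p \<and> p \<le> z} \<union> prime_factors N) ln (?P * real N powr \<theta>)\<bar>
        \<le> ((320 + 80000 * B) / sqrt (real z) + (\<Sum>i<I. real (i + 1) * 2 ^ (i + 1)) * (2 / ln (real z + 1) + 8 / sqrt (real z))
          + 10 * B * \<tau> + e) * (real N * ?\<kappa>)"
        unfolding D_def[symmetric] by (simp add: algebra_simps)
    qed
  qed
qed

section \<open>The singular series\<close>

lemma sum_inverse_square_le:
  assumes "2 \<le> z" "z \<le> n"
  shows "(\<Sum>k\<in>{z<..n}. 1 / (real k - 1)\<^sup>2) \<le> 1 / (real z - 1) - 1 / (real n - 1)"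
  using assms(2)
proof (induction n rule: dec_induct)
  case base
  then show ?case by simp
next
  case (step n)
  have n: "real n \<ge> 2" using step assms by simp
  have "1 / (real (Suc n) - 1)\<^sup>2 = 1 / (real n)\<^sup>2" by simp
  also have "\<dots> \<le> 1 / (real n * (real n - 1))"
    using n by (intro divide_left_mono) (auto simp: power2_eq_square)
  also have "\<dots> = 1 / (real n - 1) - 1 / (real (Suc n) - 1)" using n by (simp add: field_simps)
  finally have "1 / (real (Suc n) - 1)\<^sup>2 \<le> 1 / (real n - 1) - 1 / (real (Suc n) - 1)" .
  moreover have "{z<..Suc n} = insert (Suc n) {z<..n}" using step by auto
  ultimately show ?case using step by simp
qed

text \<open>The factors beyond z are 1 - a_p with a_p in [0, 1], so their product is at least 1
  minus the sum of the a_p, and that sum telescopes to at most 1 / (z - 1).\<close>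

lemma twin_factor_tail:
  assumes N: "even N" and z: "3 \<le> z" "z \<le> n"
  shows "twin_factor N z * (1 - 1 / (real z - 1)) \<le> twin_factor N n" "twin_factor N n \<le> twin_factor N z"
proof -
  let ?a = "\<lambda>p::nat. 1 / (real p - 1)\<^sup>2"
  let ?A = "{p. prime p \<and> p \<le> z} - prime_factors N" and ?B = "{p. prime p \<and> z < p \<and> p \<le> n} - prime_factors N"
  have finA: "finite ?A" by simp
  have finB: "finite ?B" by (rule finite_subset[of _ "{..n}"]) auto
  have "{p. prime p \<and> p \<le> n} - prime_factors N = ?A \<union> ?B" using z by auto
  then have split: "twin_factor N n = twin_factor N z * (\<Prod>p\<in>?B. 1 - ?a p)"
    unfolding twin_factor_def using finA finB by (simp only:) (rule prod.union_disjoint, auto)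
  have a01: "?a p \<in> {0..1}" if "p \<in> ?B" for p
  proof -
    have "real p - 1 \<ge> 1" using that z by simp
    then have "(real p - 1)\<^sup>2 \<ge> 1" by (rule one_le_power)
    then have "?a p \<le> 1 / 1" by (intro divide_left_mono) auto
    then show ?thesis by simp
  qed
  have "(\<Sum>p\<in>?B. ?a p) \<le> (\<Sum>k\<in>{z<..n}. ?a k)" by (intro sum_mono2) auto
  also have "\<dots> \<le> 1 / (real z - 1) - 1 / (real n - 1)" using z by (intro sum_inverse_square_le) auto
  also have "\<dots> \<le> 1 / (real z - 1)" using z by simp
  finally have "1 - 1 / (real z - 1) \<le> (\<Prod>p\<in>?B. 1 - ?a p)" using Weierstrass_prod_ineq[of ?B ?a] a01 by fastforce
  then show "twin_factor N z * (1 - 1 / (real z - 1)) \<le> twin_factor N n"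
    unfolding split using twin_factor_range[OF N] by (intro mult_left_mono) auto
  have "(\<Prod>p\<in>?B. 1 - ?a p) \<le> 1" using a01 by (intro prod_le_1) fastforce
  then show "twin_factor N n \<le> twin_factor N z"
    unfolding split using twin_factor_range[OF N, of z] mult_left_mono[of "\<Prod>p\<in>?B. 1 - ?a p" 1 "twin_factor N z"] by simp
qed

text \<open>The prime 3 contributes at least 3/4 and the tail beyond it at least 1 - 1/2. The bound
  is independent of N.\<close>

lemma twin_factor_ge:
  assumes N: "even N" "N > 0" and n: "n \<ge> 3"
  shows "twin_factor N n \<ge> 3 / 8"
proof -
  have sub: "{p. prime p \<and> p \<le> 3} - prime_factors N \<subseteq> {3::nat}"
  proof
    fix p assume p: "p \<in> {p. prime p \<and> p \<le> 3} - prime_factors N"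
    then have "p \<noteq> 2" using N by (auto simp: in_prime_factors_iff)
    then show "p \<in> {3}" using p prime_ge_2_nat[of p] by auto
  qed
  then consider "{p. prime p \<and> p \<le> 3} - prime_factors N = {}" | "{p. prime p \<and> p \<le> 3} - prime_factors N = {3}" by blast
  then have "twin_factor N 3 \<ge> 3 / 4"
  proof cases
    case 1
    show ?thesis unfolding twin_factor_def 1 by simp
  next
    case 2
    show ?thesis unfolding twin_factor_def 2 by simp
  qed
  then have "3 / 4 * (1 / 2) \<le> twin_factor N 3 * (1 - 1 / (real 3 - 1))" by simp
  also have "\<dots> \<le> twin_factor N n" by (rule twin_factor_tail(1)[OF N(1)]) (use n in auto)
  finally show ?thesis by simp
qed

text \<open>For an odd prime p | N, (1 + 1 / (p - 2)) * (1 - 1 / (p - 1)^2) = p / (p - 1), and the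
  leading 2 is the factor of p = 2. The condition n >= N ensures that all primes dividing N occur in
  the partial product.\<close>

lemma singular_series_partial:
  assumes N: "even N" "N > 0" and n: "n \<ge> N"
  shows "2 * (\<Prod>p | p \<in> prime_factors N \<and> p > 2. 1 + 1 / (real p - 2))
            * (\<Prod>p\<le>n. if prime p \<and> p > 2 then 1 - 1 / (real p - 1)\<^sup>2 else 1)
       = kap (prime_factors N) * twin_factor N n"
proof -
  let ?a = "\<lambda>p::nat. 1 - 1 / (real p - 1)\<^sup>2"
  let ?O = "{p. p \<in> prime_factors N \<and> p > 2}" and ?R = "{p. prime p \<and> p \<le> n} - prime_factors N"
  have finO: "finite ?O" by (rule finite_subset[of _ "prime_factors N"]) auto
  have two: "2 \<in> prime_factors N" using N by (auto simp: in_prime_factors_iff)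
  have pf: "prime_factors N = insert 2 ?O"
  proof (intro Set.set_eqI iffI)
    fix p assume p: "p \<in> prime_factors N"
    then have "p \<ge> 2" by (auto simp: in_prime_factors_iff intro: prime_ge_2_nat)
    then show "p \<in> insert 2 ?O" using p by auto
  qed (use two in auto)
  have k: "kap (prime_factors N) = 2 * (\<Prod>p\<in>?O. real p / (real p - 1))"
    unfolding kap_def by (subst pf) (use finO in simp)
  have leN: "p \<le> n" if "p \<in> prime_factors N" for p
  proof -
    have "p dvd N" using that by (simp add: in_prime_factors_iff)
    then show ?thesis using N n dvd_imp_le[of p N] by simp
  qed
  have "(\<Prod>p\<le>n. if prime p \<and> p > 2 then ?a p else 1) = (\<Prod>p\<in>?O \<union> ?R. ?a p)"
  proof (rule prod.mono_neutral_cong_right)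
    show "?O \<union> ?R \<subseteq> {..n}" using leN by auto
    show "\<forall>p\<in>{..n} - (?O \<union> ?R). (if prime p \<and> p > 2 then ?a p else 1) = 1" by auto
    show "(if prime p \<and> p > 2 then ?a p else 1) = ?a p" if "p \<in> ?O \<union> ?R" for p
    proof -
      have "prime p" using that by (auto simp: in_prime_factors_iff)
      moreover have "p \<noteq> 2" using that two by auto
      ultimately show ?thesis using prime_ge_2_nat[of p] by simp
    qed
  qed simp
  also have "\<dots> = (\<Prod>p\<in>?O. ?a p) * twin_factor N n"
    unfolding twin_factor_def using finO by (intro prod.union_disjoint) auto
  finally have 1: "(\<Prod>p\<le>n. if prime p \<and> p > 2 then ?a p else 1) = (\<Prod>p\<in>?O. ?a p) * twin_factor N n" .
  have 2: "(\<Prod>p\<in>?O. 1 + 1 / (real p - 2)) * (\<Prod>p\<in>?O. ?a p) = (\<Prod>p\<in>?O. real p / (real p - 1))"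
    unfolding prod.distrib[symmetric]
  proof (rule prod.cong[OF refl])
    fix p assume "p \<in> ?O"
    then have "real p - 2 > 0" by simp
    moreover have "(1 + 1 / u) * (1 - 1 / (u + 1)\<^sup>2) = (u + 2) / (u + 1)" if "u > 0" for u :: real
      using that by (simp add: divide_simps) (simp add: power2_eq_square algebra_simps)
    ultimately have "(1 + 1 / (real p - 2)) * (1 - 1 / ((real p - 2) + 1)\<^sup>2) = ((real p - 2) + 2) / ((real p - 2) + 1)" by blast
    then show "(1 + 1 / (real p - 2)) * ?a p = real p / (real p - 1)" by (simp add: algebra_simps)
  qed
  show ?thesis unfolding 1 k 2[symmetric] by (simp only: mult_ac)
qed

lemma singular_series_limit:
  assumes N: "even N" "N > 0"
  shows "(\<lambda>n. kap (prime_factors N) * twin_factor N n) \<longlonglongrightarrow> singular_series N"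
proof -
  have "(\<lambda>n. 2 * (\<Prod>p | p \<in> prime_factors N \<and> p > 2. 1 + 1 / (real p - 2))
            * (\<Prod>p\<le>n. if prime p \<and> p > 2 then 1 - 1 / (real p - 1)\<^sup>2 else 1)) \<longlonglongrightarrow> singular_series N"
    unfolding singular_series_def using N(1)
    by (simp only: if_True) (intro tendsto_mult tendsto_const convergent_prod_LIMSEQ convergent_prod_singular_series)
  moreover have "\<forall>\<^sub>F n in at_top. 2 * (\<Prod>p | p \<in> prime_factors N \<and> p > 2. 1 + 1 / (real p - 2))
            * (\<Prod>p\<le>n. if prime p \<and> p > 2 then 1 - 1 / (real p - 1)\<^sup>2 else 1) = kap (prime_factors N) * twin_factor N n"
    using eventually_ge_at_top[of N] by eventually_elim (rule singular_series_partial[OF N])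
  ultimately show ?thesis by (rule Lim_transform_eventually)
qed

lemma singular_series_ge:
  assumes N: "even N" "N > 0"
  shows "kap (prime_factors N) * (3 / 8) \<le> singular_series N"
proof (rule tendsto_lowerbound[OF singular_series_limit[OF N]])
  have k: "kap (prime_factors N) \<ge> 1" by (rule kap_ge_1) auto
  show "\<forall>\<^sub>F n in at_top. kap (prime_factors N) * (3 / 8) \<le> kap (prime_factors N) * twin_factor N n"
    using eventually_ge_at_top[of 3]
  proof eventually_elim
    case (elim n)
    show ?case by (rule mult_left_mono[OF twin_factor_ge[OF N elim]]) (use k in simp)
  qed
qed simp

lemma singular_series_approx:
  assumes N: "even N" "N > 0" and z: "z \<ge> 3"
  shows "\<bar>kap (prime_factors N) * twin_factor N z - singular_series N\<bar> \<le> kap (prime_factors N) * (1 / (real z - 1))"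
proof -
  let ?k = "kap (prime_factors N)"
  have k: "?k \<ge> 1" by (rule kap_ge_1) auto
  have ev: "\<forall>\<^sub>F n in at_top. ?k * twin_factor N z - ?k * (1 / (real z - 1)) \<le> ?k * twin_factor N n \<and> ?k * twin_factor N n \<le> ?k * twin_factor N z"
    using eventually_ge_at_top[of z]
  proof eventually_elim
    case (elim n)
    have "twin_factor N z * (1 / (real z - 1)) \<le> 1 * (1 / (real z - 1))"
      using twin_factor_range[OF N(1), of z] z by (intro mult_right_mono) auto
    then have "twin_factor N z - 1 / (real z - 1) \<le> twin_factor N n"
      using twin_factor_tail(1)[OF N(1) z elim] by (simp add: right_diff_distrib)
    then have "?k * (twin_factor N z - 1 / (real z - 1)) \<le> ?k * twin_factor N n" using k by (intro mult_left_mono) auto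
    moreover have "?k * twin_factor N n \<le> ?k * twin_factor N z"
      using twin_factor_tail(2)[OF N(1) z elim] k by (intro mult_left_mono) auto
    ultimately show ?case by (simp only: right_diff_distrib)
  qed
  have "singular_series N \<le> ?k * twin_factor N z"
    by (rule tendsto_upperbound[OF singular_series_limit[OF N] eventually_mono[OF ev]]) auto
  moreover have "?k * twin_factor N z - ?k * (1 / (real z - 1)) \<le> singular_series N"
    by (rule tendsto_lowerbound[OF singular_series_limit[OF N] eventually_mono[OF ev]]) auto
  ultimately show ?thesis by linarith
qed

text \<open>Factor by factor, 1 - 1 / (p * (p - 1)) is at least 1 - 1 / (p - 1)^2, so the bound for
  \<open>twin_factor\<close> carries over.\<close>

lemma artin_product_ge:
  assumes N: "even N" "N > 0"
  shows "artin_product N \<ge> 3 / 8"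
proof -
  let ?f = "\<lambda>p. if prime p \<and> \<not> p dvd N \<and> p > 2 then 1 - 1 / (real p * (real p - 1)) else 1"
  have lim: "(\<lambda>n. \<Prod>p\<le>n. ?f p) \<longlonglongrightarrow> artin_product N"
    unfolding artin_product_def by (intro convergent_prod_LIMSEQ convergent_prod_artin_product)
  have "3 / 8 \<le> (\<Prod>p\<le>n. ?f p)" if n: "n \<ge> 3" for n
  proof -
    let ?R = "{p. prime p \<and> p \<le> n} - prime_factors N"
    have p3: "real p \<ge> 3" if "p \<in> ?R" for p
      using that odd_prime_nondivisor[OF N(1), of p] N by (auto simp: in_prime_factors_iff)
    have "3 / 8 \<le> twin_factor N n" by (rule twin_factor_ge[OF N n])
    also have "\<dots> \<le> (\<Prod>p\<in>?R. 1 - 1 / (real p * (real p - 1)))"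
      unfolding twin_factor_def
    proof (intro prod_mono conjI)
      fix p assume p: "p \<in> ?R"
      have "1 / (real p - 1)\<^sup>2 \<le> 1 / 1" using p3[OF p] one_le_power[of "real p - 1" 2] by (intro divide_left_mono) auto
      then show "0 \<le> 1 - 1 / (real p - 1)\<^sup>2" by simp
      have "(real p - 1)\<^sup>2 \<le> real p * (real p - 1)"
        using p3[OF p] by (auto simp: power2_eq_square intro!: mult_right_mono)
      then have "1 / (real p * (real p - 1)) \<le> 1 / (real p - 1)\<^sup>2" using p3[OF p] by (intro divide_left_mono) auto
      then show "1 - 1 / (real p - 1)\<^sup>2 \<le> 1 - 1 / (real p * (real p - 1))" by simp
    qed
    also have "\<dots> = (\<Prod>p\<le>n. ?f p)"
    proof (rule prod.mono_neutral_cong_left)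
      show "\<forall>p\<in>{..n} - ?R. ?f p = 1" using N by (auto simp: in_prime_factors_iff)
      show "1 - 1 / (real p * (real p - 1)) = ?f p" if "p \<in> ?R" for p
        using that p3[OF that] N by (auto simp: in_prime_factors_iff)
    qed auto
    finally show ?thesis .
  qed
  then show ?thesis
    by (intro tendsto_lowerbound[OF lim]) (auto intro: eventually_mono[OF eventually_ge_at_top[of 3]])
qed

section \<open>Conclusion\<close>

text \<open>The quadratic polynomial is the solution g of g(i) - g(i + 1) / 2 = (i + 1) * (i + 2),
  which makes the sum telescope.\<close>

lemma dyadic_tail_le: "(\<Sum>i\<in>{I..<L}. real (i + 1) * (real i + 2) / 2 ^ i) \<le> (2 * real I ^ 2 + 10 * real I + 16) / 2 ^ I"
proof -
  let ?g = "\<lambda>i. (2 * real i ^ 2 + 10 * real i + 16) / 2 ^ i"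
  have g: "real (i + 1) * (real i + 2) / 2 ^ i = ?g i - ?g (Suc i)" for i
  proof -
    have "?g (Suc i) = ((2 * (real i + 1) ^ 2 + 10 * (real i + 1) + 16) / 2) / 2 ^ i" by simp
    then show ?thesis by (simp only: diff_divide_distrib[symmetric]) (simp add: power2_eq_square algebra_simps)
  qed
  show ?thesis
  proof (cases "I \<le> L")
    case True
    have "(\<Sum>i\<in>{I..<L}. real (i + 1) * (real i + 2) / 2 ^ i) = (\<Sum>i\<in>{I..<L}. ?g i - ?g (Suc i))"
      by (intro sum.cong refl g)
    also have "\<dots> = ?g I - ?g L" using sum_Suc_diff'[OF True, of "\<lambda>i. - ?g i"] by simp
    also have "\<dots> \<le> ?g I" by simp
    finally show ?thesis .
  qed simp
qed

lemma goldbach_asymptotic: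
  fixes \<theta> C \<epsilon> :: real
  assumes \<theta>: "0 < \<theta>" "\<theta> < 1" and C: "C > 0"
    and H1: "\<And>A::real. A > 0 \<Longrightarrow>
      (\<lambda>N::nat. \<Sum>q | 1 \<le> q \<and> real q \<le> real N powr \<theta> * ln (real N) powr C \<and> coprime N q.
          \<bar>(\<Sum>n | n \<in> {1..<N} \<and> [n = N] (mod q). mangoldt n) - real N / real (totient q)\<bar>)
        \<in> O[at_top](\<lambda>N. real N / ln (real N) powr A)"
    and H2: "\<And>(g :: nat \<Rightarrow> real) (A::real).
      g \<in> {moebius_mu, (\<lambda>n. moebius_mu n * ln (real n))} \<Longrightarrow> A > 0 \<Longrightarrow>
      (\<lambda>N::nat. \<Sum>q | 1 \<le> q \<and> real q \<le> real N powr (1 - \<theta>) \<and> coprime N q.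
          \<bar>(\<Sum>n | n \<in> {1..<N} \<and> [n = N] (mod q). mangoldt n * g (N - n))
            - 1 / real (totient q) * (\<Sum>n\<in>{1..<N}. mangoldt n * g (N - n))\<bar>)
        \<in> O[at_top](\<lambda>N. real N / ln (real N) powr A)"
    and \<epsilon>: "\<epsilon> > 0"
  shows "\<forall>\<^sub>F N in at_top. even N \<longrightarrow> \<bar>goldbach_sum N - real N * singular_series N\<bar> \<le> \<epsilon> * (real N * singular_series N)"
proof -
  note psi = prime_number_theorem_from_level[OF \<theta>(1) C H1]
  define B where "B = 32 / ((1 - \<theta>) / 4) + 1"
  have B: "B > 0" unfolding B_def using \<theta> by (simp add: add_pos_pos)
  obtain C0 where C0: "C0 \<ge> 0" "\<forall>z\<ge>3. \<forall>e>0. \<forall>\<^sub>F N::nat in at_top.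
     \<bar>phi_sum ({p. prime p \<and> p \<le> z} \<union> prime_factors N) ln (real (primorial z) * real N powr \<theta>)
        - kap ({p. prime p \<and> p \<le> z} \<union> prime_factors N)\<bar>
      \<le> (e + C0 / sqrt (real z)) * kap ({p. prime p \<and> p \<le> z} \<union> prime_factors N)"
    using main_term_asymp[OF \<theta>(1) psi] by blast
  define e where "e = \<epsilon> / 16"
  have e: "e > 0" using \<epsilon> by (simp add: e_def)
  let ?\<tau> = "\<lambda>I::nat. (2 * real I ^ 2 + 10 * real I + 16) / 2 ^ I"
  have "((\<lambda>I::nat. 10 * B * ?\<tau> I) \<longlongrightarrow> 0) at_top"
    by (rule tendsto_mult_right_zero) real_asymp
  then have "\<forall>\<^sub>F I::nat in at_top. 10 * B * ?\<tau> I < e" using e by (rule order_tendstoD(2))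
  then obtain I where I: "10 * B * ?\<tau> I < e" by (auto simp: eventually_at_top_linorder)
  define D where "D = (\<Sum>i<I. real (i + 1) * 2 ^ (i + 1))"
  have "((\<lambda>z::nat. (320 + 80000 * B + C0) * (1 / sqrt (real z)) + D * (2 / ln (real z + 1) + 8 / sqrt (real z)) + 1 / (real z - 1)) \<longlongrightarrow> 0) at_top"
    by (intro tendsto_add_zero tendsto_mult_right_zero) real_asymp+
  then have "\<forall>\<^sub>F z::nat in at_top. (320 + 80000 * B + C0) * (1 / sqrt (real z)) + D * (2 / ln (real z + 1) + 8 / sqrt (real z)) + 1 / (real z - 1) < e"
    using e by (rule order_tendstoD(2))
  with eventually_ge_at_top[of 256] have "\<forall>\<^sub>F z::nat in at_top. z \<ge> 256 \<and>
      (320 + 80000 * B + C0) * (1 / sqrt (real z)) + D * (2 / ln (real z + 1) + 8 / sqrt (real z)) + 1 / (real z - 1) < e"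
    by (rule eventually_conj)
  then obtain z where z: "z \<ge> 256" and zs: "(320 + 80000 * B + C0) * (1 / sqrt (real z)) + D * (2 / ln (real z + 1) + 8 / sqrt (real z)) + 1 / (real z - 1) < e"
    by (auto simp: eventually_at_top_linorder)
  have z3: "z \<ge> 3" using z by simp
  let ?T = "\<lambda>N. {p. prime p \<and> p \<le> z} \<union> prime_factors N"
  let ?\<Phi> = "\<lambda>N. phi_sum (?T N) ln (real (primorial z) * real N powr \<theta>)"
  let ?X = "(320 + 80000 * B) / sqrt (real z) + D * (2 / ln (real z + 1) + 8 / sqrt (real z)) + 10 * B * ?\<tau> I + e"
  have ev1: "\<forall>\<^sub>F N in at_top. even N \<longrightarrow> \<bar>goldbach_sum N - real N * sieve_density N (primorial z) * ?\<Phi> N\<bar> \<le> ?X * (real N * kap (prime_factors N))"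
    unfolding B_def D_def
    by (rule goldbach_error_eventually[OF \<theta> C H1 H2 z dyadic_tail_le e])
  have ev2: "\<forall>\<^sub>F N::nat in at_top. \<bar>?\<Phi> N - kap (?T N)\<bar> \<le> (e + C0 / sqrt (real z)) * kap (?T N)"
    using C0(2) z3 e by blast
  show ?thesis using ev1 ev2 eventually_gt_at_top[of 0]
  proof eventually_elim
    case (elim N)
    show ?case
    proof
      assume ev: "even N"
      let ?\<kappa> = "kap (prime_factors N)" and ?r = "sieve_density N (primorial z)"
      have N: "even N" "N > 0" using ev elim by auto
      have k1: "?\<kappa> \<ge> 1" by (rule kap_ge_1) auto
      have r0: "?r \<ge> 0" using sieve_density_range[OF N] by simp
      have c: "e + C0 / sqrt (real z) \<ge> 0" using e C0(1) by simp
      have "\<bar>real N * ?r * ?\<Phi> N - real N * (?\<kappa> * twin_factor N z)\<bar> = real N * ?r * \<bar>?\<Phi> N - kap (?T N)\<bar>"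
        unfolding sieve_density_kap[OF N, symmetric] using r0 by (simp add: mult.assoc right_diff_distrib[symmetric] abs_mult)
      also have "\<dots> \<le> real N * ?r * ((e + C0 / sqrt (real z)) * kap (?T N))"
        using elim(2) r0 by (intro mult_left_mono) auto
      also have "\<dots> = (e + C0 / sqrt (real z)) * (real N * (?r * kap (?T N)))" by (simp only: mult_ac)
      also have "\<dots> \<le> (e + C0 / sqrt (real z)) * (real N * ?\<kappa>)"
        using sieve_density_kap_le[OF N, of z] c by (intro mult_left_mono) auto
      finally have 2: "\<bar>real N * ?r * ?\<Phi> N - real N * (?\<kappa> * twin_factor N z)\<bar> \<le> (e + C0 / sqrt (real z)) * (real N * ?\<kappa>)" .
      have "\<bar>real N * (?\<kappa> * twin_factor N z) - real N * singular_series N\<bar> = real N * \<bar>?\<kappa> * twin_factor N z - singular_series N\<bar>"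
        by (simp add: right_diff_distrib[symmetric] abs_mult)
      also have "\<dots> \<le> real N * (?\<kappa> * (1 / (real z - 1)))"
        by (intro mult_left_mono singular_series_approx[OF N z3]) simp
      finally have 3: "\<bar>real N * (?\<kappa> * twin_factor N z) - real N * singular_series N\<bar> \<le> (1 / (real z - 1)) * (real N * ?\<kappa>)"
        by (simp add: mult_ac)
      have 1: "\<bar>goldbach_sum N - real N * ?r * ?\<Phi> N\<bar> \<le> ?X * (real N * ?\<kappa>)" using elim(1) ev by blast
      have "\<bar>goldbach_sum N - real N * singular_series N\<bar> \<le> ?X * (real N * ?\<kappa>) + (e + C0 / sqrt (real z)) * (real N * ?\<kappa>) + (1 / (real z - 1)) * (real N * ?\<kappa>)"
        using 1 2 3 by linarith
      also have "\<dots> = (?X + (e + C0 / sqrt (real z)) + 1 / (real z - 1)) * (real N * ?\<kappa>)"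
        by (simp only: distrib_right)
      also have "\<dots> \<le> (4 * e) * (real N * ?\<kappa>)"
      proof (rule mult_right_mono)
        have "(320 + 80000 * B + C0) * (1 / sqrt (real z)) = (320 + 80000 * B) / sqrt (real z) + C0 / sqrt (real z)"
          by (simp add: add_divide_distrib)
        then show "?X + (e + C0 / sqrt (real z)) + 1 / (real z - 1) \<le> 4 * e" using zs I by linarith
      qed (use k1 in simp)
      also have "\<dots> \<le> (4 * e) * (real N * (8 / 3 * singular_series N))"
        using singular_series_ge[OF N] e by (intro mult_left_mono) auto
      also have "\<dots> \<le> \<epsilon> * (real N * singular_series N)"
        using singular_series_ge[OF N] k1 \<epsilon> by (simp add: e_def)
      finally show "\<bar>goldbach_sum N - real N * singular_series N\<bar> \<le> \<epsilon> * (real N * singular_series N)" .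
    qed
  qed
qed

text \<open>The statement on the Moebius sum appears once along even N and once along all N,
  covering both readings of o(N).\<close>

theorem theorem7:
  fixes \<theta> C :: real
  assumes "0 < \<theta>" and "\<theta> < 1" and "C > 0"
    and "\<And>A::real. A > 0 \<Longrightarrow>
      (\<lambda>N::nat. \<Sum>q | 1 \<le> q \<and> real q \<le> real N powr \<theta> * ln (real N) powr C \<and> coprime N q.
          \<bar>(\<Sum>n | n \<in> {1..<N} \<and> [n = N] (mod q). mangoldt n) - real N / real (totient q)\<bar>)
        \<in> O[at_top](\<lambda>N. real N / ln (real N) powr A)"
    and "\<And>(g :: nat \<Rightarrow> real) (A::real).
      g \<in> {moebius_mu, (\<lambda>n. moebius_mu n * ln (real n))} \<Longrightarrow> A > 0 \<Longrightarrow>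
      (\<lambda>N::nat. \<Sum>q | 1 \<le> q \<and> real q \<le> real N powr (1 - \<theta>) \<and> coprime N q.
          \<bar>(\<Sum>n | n \<in> {1..<N} \<and> [n = N] (mod q). mangoldt n * g (N - n))
            - 1 / real (totient q) * (\<Sum>n\<in>{1..<N}. mangoldt n * g (N - n))\<bar>)
        \<in> O[at_top](\<lambda>N. real N / ln (real N) powr A)"
  shows "(\<forall>A::real. A > 0 \<longrightarrow>
      (\<exists>E. E \<in> O[at_top](\<lambda>N::nat. real N / ln (real N) powr A) \<and>
        (\<forall>N. goldbach_sum N \<ge> real N * singular_series N * (1 - artin_product N) + E N)))
    \<and> (goldbach_sum \<sim>[even_at_top] (\<lambda>N. real N * singular_series N) \<longleftrightarrow>
      (\<lambda>N. \<Sum>n\<in>{1..<N}. mangoldt n * moebius_mu (N - n)) \<in> o[even_at_top](\<lambda>N. real N))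
    \<and> (goldbach_sum \<sim>[even_at_top] (\<lambda>N. real N * singular_series N) \<longleftrightarrow>
      (\<lambda>N. \<Sum>n\<in>{1..<N}. mangoldt n * moebius_mu (N - n)) \<in> o[at_top](\<lambda>N. real N))"
proof -
  note H1 = assms(4) and H2 = assms(5)
  note psi = prime_number_theorem_from_level[OF assms(1) assms(3) H1]
  have approx: "\<forall>\<^sub>F N in at_top. even N \<longrightarrow> \<bar>goldbach_sum N - real N * singular_series N\<bar> \<le> \<epsilon> * (real N * singular_series N)"
    if "\<epsilon> > 0" for \<epsilon>
    using goldbach_asymptotic[OF assms(1-3) H1 H2 that] .
  have S_pos: "singular_series N > 0" if "even N" "N > 0" for N
    using singular_series_ge[OF that] kap_ge_1[of "prime_factors N"] by fastforce
  have lower: "\<exists>E. E \<in> O[at_top](\<lambda>N::nat. real N / ln (real N) powr A) \<and>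
        (\<forall>N. goldbach_sum N \<ge> real N * singular_series N * (1 - artin_product N) + E N)" for A :: real
  proof (intro exI conjI allI)
    \<comment> \<open>The exact deficit. It is 0 for all large N, hence of any order of magnitude;
      at odd N the claim reduces to R(N) >= 0.\<close>
    let ?E = "\<lambda>N. min 0 (goldbach_sum N - real N * singular_series N * (1 - artin_product N))"
    show "goldbach_sum N \<ge> real N * singular_series N * (1 - artin_product N) + ?E N" for N by simp
    \<comment> \<open>A relative error of 3/8 gives R(N) >= 5/8 * N * S(N), and 1 -
      \<open>artin_product N\<close> is at most 5/8.\<close>
    have pos: "(0::real) < 3 / 8" by simp
    have "\<forall>\<^sub>F N in at_top. ?E N = 0"
      using approx[OF pos] eventually_gt_at_top[of 0]
    proof eventually_elim
      case (elim N)
      show ?case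
      proof (cases "even N")
        case True
        have "\<bar>goldbach_sum N - real N * singular_series N\<bar> \<le> 3 / 8 * (real N * singular_series N)"
          using elim True by blast
        then have "goldbach_sum N \<ge> real N * singular_series N - 3 / 8 * (real N * singular_series N)" by linarith
        then have "goldbach_sum N \<ge> real N * singular_series N * (1 - 3 / 8)"
          by (simp only: right_diff_distrib mult_1_right mult.commute[of _ "3 / 8"])
        moreover have "real N * singular_series N * (1 - artin_product N) \<le> real N * singular_series N * (1 - 3 / 8)"
          using S_pos[OF True elim(2)] artin_product_ge[OF True elim(2)] by (intro mult_left_mono) auto
        ultimately show ?thesis by simp
      next
        case False
        then show ?thesis by (simp add: singular_series_def goldbach_sum_def mangoldt_nonneg sum_nonneg)
      qed
    qed
    then show "?E \<in> O[at_top](\<lambda>N::nat. real N / ln (real N) powr A)"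
      by (rule landau_o.big.in_cong[THEN iffD2]) simp
  qed
  have ev_even: "\<forall>\<^sub>F N in even_at_top. P N" if "\<forall>\<^sub>F N in at_top. even N \<longrightarrow> P N" for P
    using that unfolding even_at_top_def eventually_inf_principal by (simp add: imp_conjL)
  have asymp: "goldbach_sum \<sim>[even_at_top] (\<lambda>N. real N * singular_series N)"
  proof (rule asymp_equivI')
    show "((\<lambda>N. goldbach_sum N / (real N * singular_series N)) \<longlongrightarrow> 1) even_at_top"
    proof (rule tendstoI)
      fix \<epsilon> :: real assume \<epsilon>: "\<epsilon> > 0"
      show "\<forall>\<^sub>F N in even_at_top. dist (goldbach_sum N / (real N * singular_series N)) 1 < \<epsilon>"
      proof (rule ev_even)
        show "\<forall>\<^sub>F N in at_top. even N \<longrightarrow> dist (goldbach_sum N / (real N * singular_series N)) 1 < \<epsilon>"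
          using approx[of "\<epsilon> / 2", OF half_gt_zero[OF \<epsilon>]] eventually_gt_at_top[of 0]
        proof eventually_elim
          case (elim N)
          show ?case
          proof
            assume ev: "even N"
            define M where "M = real N * singular_series N"
            have M: "M > 0" using S_pos[OF ev elim(2)] elim(2) by (simp add: M_def)
            have "dist (goldbach_sum N / M) 1 = \<bar>goldbach_sum N - M\<bar> / M"
            proof -
              have "goldbach_sum N / M - 1 = (goldbach_sum N - M) / M" using M by (simp add: diff_divide_distrib)
              then show ?thesis using M by (simp add: dist_real_def)
            qed
            also have "\<dots> \<le> \<epsilon> / 2" using elim(1) ev M by (simp add: M_def pos_divide_le_eq)
            also have "\<dots> < \<epsilon>" using \<epsilon> by simp
            finally show "dist (goldbach_sum N / (real N * singular_series N)) 1 < \<epsilon>" unfolding M_def .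
          qed
        qed
      qed
    qed
  qed
  have small: "(\<lambda>N. \<Sum>n\<in>{1..<N}. mangoldt n * moebius_mu (N - n)) \<in> o[at_top](\<lambda>N. real N)"
  proof (rule landau_o.smallI)
    fix c :: real assume c: "c > 0"
    have "\<forall>\<^sub>F N in at_top. \<bar>\<Sum>n\<in>{1..<N}. mangoldt n * moebius_mu (N - n)\<bar> \<le> real N / ln (real N) powr 1"
      by (rule total_sum_small[OF assms(2) _ moebius_mu_not_squarefree psi H2]) auto
    moreover have "\<forall>\<^sub>F N::nat in at_top. 1 / ln (real N) powr 1 \<le> c" using c by real_asymp
    ultimately show "\<forall>\<^sub>F N in at_top. norm (\<Sum>n\<in>{1..<N}. mangoldt n * moebius_mu (N - n)) \<le> c * norm (real N)"
    proof eventually_elim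
      case (elim N)
      have "real N / ln (real N) powr 1 \<le> c * real N" using mult_right_mono[OF elim(2), of "real N"] by simp
      then show ?case using elim(1) by simp
    qed
  qed
  have "even_at_top \<le> at_top" unfolding even_at_top_def by simp
  then have small_even: "(\<lambda>N. \<Sum>n\<in>{1..<N}. mangoldt n * moebius_mu (N - n)) \<in> o[even_at_top](\<lambda>N. real N)"
    using small by (rule landau_o.small.filter_mono)
  show ?thesis using lower asymp small small_even by blast
qed

end
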